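(* Suppose that $\mu$ satisfies the logarithmic Sobolev inequality, that $\sum_{n\in\mathbb Z}|a_n|^2<+\infty$, and that the spectral density $f$ belongs to $L^q(\mathbb T,d\theta)$ for some $2<q\le+\infty$ with $\frac{b_n}{\sqrt n}\,n^{1/q}\to 0$ as $n\to\infty$. Let $m\ge 0$ be an integer. Then the sequence of random vectors $$\left(\frac{1}{b_n\sqrt n}\sum_{k=1}^n\big(X_kX_{k+\ell}-\mathbb E X_kX_{k+\ell}\big)\right)_{0\le \ell\le m}$$ satisfies the moderate deviation principle on $\mathbb R^{m+1}$ with speed $b_n^2$ and rate function $$I(z)=\sup_{\lambda\in\mathbb R^{m+1}}\left\{\langle\lambda,z\rangle-\frac12\lambda^*\Sigma^2\lambda\right\},$$ where $\Sigma^2=(\Sigma^2_{k,\ell})_{0\le k,\ell\le m}$ and $$\Sigma^2_{k,\ell}=\frac1{2\pi}\int_{\mathbb T}\left(e^{i(k-\ell)\theta}+e^{i(k+\ell)\theta}\right)f^2(\theta)\,d\theta+\kappa_4\left(\frac1{2\pi}\int_{\mathbb T}f(\theta)e^{ik\theta}\,d\theta\right)\left(\frac1{2\pi}\int_{\mathbb T}f(\theta)e^{i\ell\theta}\,d\theta\right).$$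
   Context: Setting: $(\xi_n)_{n\in\mathbb Z}$ is a sequence of real-valued, centered, square integrable i.i.d. random variables with common law $\mu$ and $\mathbb E(\xi_0^2)>0$; $(a_n)_{n\in\mathbb Z}$ is a sequence of real numbers with $\sum_n|a_n|^2<\infty$; and $X_n:=\sum_{j\in\mathbb Z}a_j\xi_{n+j}$, $n\in\mathbb Z$ (moving average process). The torus $\mathbb T$ is identified with $[-\pi,\pi[$. Put $g(\theta):=\sum_{n\in\mathbb Z}a_ne^{in\theta}$ (series in $L^2(\mathbb T,d\theta)$); the spectral density of $(X_n)$ is $f(\theta):=\mathrm{Var}(\xi_0)|g(\theta)|^2$. Set $\kappa_4=\frac{\mathbb E(\xi_0^4)-3\mathbb E(\xi_0^2)^2}{\mathbb E(\xi_0^2)^2}$. Logarithmic Sobolev inequality for $\mu$: there exists $C>0$ such that $\mathrm{Ent}_\mu(h^2)\le 2C\,\mathbb E_\mu(|\nabla h|^2)$ for every smooth $h$ with $\mathbb E_\mu(h^2\log^+h^2)<\infty$, where $\mathrm{Ent}_\mu(h^2)=\mathbb E_\mu(h^2\log h^2)-\mathbb E_\mu(h^2)\log\mathbb E_\mu(h^2)$. $(b_n)$ is a sequence of positive real numbers with $1\ll b_n\ll\sqrt n$, i.e. $b_n\to\infty$ and $b_n/\sqrt n\to0$. If $q=+\infty$, then $1/q=0$. Moderate deviation principle (MDP) with speed $b_n^2$ and rate function $I$: the sequence $(Z_n)$ of random elements of a topological space $E$ satisfies the large deviation principle with speed $b_n^2$, i.e. $I:E\to[0,\infty]$ is lower semicontinuous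 and for every measurable $A\subset E$, $-\inf_{\mathrm{int}A}I\le\liminf_n b_n^{-2}\log\mathbb P(Z_n\in A)\le\limsup_n b_n^{-2}\log\mathbb P(Z_n\in A)\le-\inf_{\overline A}I$. *)

theory Defs
  imports "HOL-Probability.Probability" "HOL-Probability.Essential_Supremum"
begin

definition torus :: "real measure" where
  "torus = restrict_space lborel {-pi..<pi}"

(* The series of u over the integers converges in L^2(M) to S; S is determined
   only up to M-null sets. The squared L^2 distance is a nonnegative integral, so that it
   is infinite (rather than 0) if the difference is not square integrable. *)
definition has_L2_sum ::
  "'a measure \<Rightarrow> (int \<Rightarrow> 'a \<Rightarrow> 'b::{real_normed_vector, second_countable_topology})
     \<Rightarrow> ('a \<Rightarrow> 'b) \<Rightarrow> bool" where
  "has_L2_sum M u S \<longleftrightarrow>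
     S \<in> borel_measurable M \<and>
     integrable M (\<lambda>x. (norm (S x))\<^sup>2) \<and>
     (\<lambda>N::nat. \<integral>\<^sup>+ x. ennreal ((norm (S x - (\<Sum>j\<in>{- int N..int N}. u j x)))\<^sup>2) \<partial>M)
       \<longlonglongrightarrow> 0"

definition moving_average ::
  "'a measure \<Rightarrow> (int \<Rightarrow> real) \<Rightarrow> (int \<Rightarrow> 'a \<Rightarrow> real) \<Rightarrow> (int \<Rightarrow> 'a \<Rightarrow> real) \<Rightarrow> bool" where
  "moving_average M a \<xi> X \<longleftrightarrow>
     (\<forall>n. has_L2_sum M (\<lambda>j \<omega>. a j * \<xi> (n + j) \<omega>) (X n))"

definition fourier_series :: "(int \<Rightarrow> real) \<Rightarrow> (real \<Rightarrow> complex) \<Rightarrow> bool" where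
  "fourier_series a g \<longleftrightarrow>
     has_L2_sum torus (\<lambda>n \<theta>. complex_of_real (a n) * exp (\<i> * complex_of_real (of_int n * \<theta>))) g"

definition in_Lp :: "ereal \<Rightarrow> 'a measure \<Rightarrow> ('a \<Rightarrow> real) \<Rightarrow> bool" where
  "in_Lp q M f \<longleftrightarrow>
     f \<in> borel_measurable M \<and>
     (if q = \<infinity> then esssup M (\<lambda>x. ereal \<bar>f x\<bar>) < \<infinity>
      else integrable M (\<lambda>x. \<bar>f x\<bar> powr real_of_ereal q))"

definition smooth :: "(real \<Rightarrow> real) \<Rightarrow> bool" where
  "smooth h \<longleftrightarrow> (\<forall>k. (deriv ^^ k) h differentiable_on UNIV)"

(* The convention 0 log 0 = 0 is automatic. *)
definition entropy_functional :: "'a measure \<Rightarrow> ('a \<Rightarrow> real) \<Rightarrow> real" where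
  "entropy_functional M u = (\<integral>x. u x * ln (u x) \<partial>M) - (\<integral>x. u x \<partial>M) * ln (\<integral>x. u x \<partial>M)"

(* The energy on the right-hand side may be infinite. On the left-hand side ennreal loses
   nothing: the integrability premise makes the integrals finite, and the entropy is then
   nonnegative by Jensen's inequality. *)
definition log_sobolev :: "real measure \<Rightarrow> bool" where
  "log_sobolev \<mu> \<longleftrightarrow>
     (\<exists>C>0. \<forall>h. smooth h \<and> integrable \<mu> (\<lambda>x. (h x)\<^sup>2 * max 0 (ln ((h x)\<^sup>2))) \<longrightarrow>
        ennreal (entropy_functional \<mu> (\<lambda>x. (h x)\<^sup>2))
          \<le> ennreal (2 * C) * (\<integral>\<^sup>+ x. ennreal (\<bar>deriv h x\<bar>\<^sup>2) \<partial>\<mu>))"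

(* The logarithm of a probability, with log 0 = -\<infinity>. *)
definition elog :: "real \<Rightarrow> ereal" where
  "elog p = (if p = 0 then - \<infinity> else ereal (ln p))"

(* Lower semicontinuity is stated as closedness of the sublevel sets. *)
definition LDP ::
  "'a measure \<Rightarrow> (nat \<Rightarrow> 'a \<Rightarrow> 'e::topological_space) \<Rightarrow> (nat \<Rightarrow> real) \<Rightarrow> ('e \<Rightarrow> ereal) \<Rightarrow> bool"
  where
  "LDP M Z s I \<longleftrightarrow>
     (\<forall>n. Z n \<in> borel_measurable M) \<and>
     (\<forall>z. 0 \<le> I z) \<and>
     (\<forall>c. closed {z. I z \<le> c}) \<and>
     (\<forall>A\<in>sets borel.
        - (INF z\<in>interior A. I z)
          \<le> liminf (\<lambda>n. elog (measure M {\<omega> \<in> space M. Z n \<omega> \<in> A}) / ereal (s n)) \<and>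
        limsup (\<lambda>n. elog (measure M {\<omega> \<in> space M. Z n \<omega> \<in> A}) / ereal (s n))
          \<le> - (INF z\<in>closure A. I z))"

definition kurtosis_excess :: "'a measure \<Rightarrow> ('a \<Rightarrow> real) \<Rightarrow> real" where
  "kurtosis_excess M Y =
     ((\<integral>\<omega>. (Y \<omega>) ^ 4 \<partial>M) - 3 * (\<integral>\<omega>. (Y \<omega>)\<^sup>2 \<partial>M)\<^sup>2) / (\<integral>\<omega>. (Y \<omega>)\<^sup>2 \<partial>M)\<^sup>2"

definition Sigma2 :: "(real \<Rightarrow> real) \<Rightarrow> real \<Rightarrow> nat \<Rightarrow> nat \<Rightarrow> complex" where
  "Sigma2 f \<kappa> k l =
     1 / (2 * complex_of_real pi) *
       (\<integral>\<theta>. (exp (\<i> * complex_of_real ((real k - real l) * \<theta>))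
             + exp (\<i> * complex_of_real ((real k + real l) * \<theta>)))
             * complex_of_real ((f \<theta>)\<^sup>2) \<partial>torus)
     + complex_of_real \<kappa>
       * (1 / (2 * complex_of_real pi) *
           (\<integral>\<theta>. complex_of_real (f \<theta>) * exp (\<i> * complex_of_real (real k * \<theta>)) \<partial>torus))
       * (1 / (2 * complex_of_real pi) *
           (\<integral>\<theta>. complex_of_real (f \<theta>) * exp (\<i> * complex_of_real (real l * \<theta>)) \<partial>torus))"

(* The coordinates of the (m+1)-dimensional space, indexed by the type 'n, are numbered
   0..m by \<iota>. The entries of Sigma2 are real since the spectral density f is even (the
   coefficients of the moving average are real), so Re only changes the type. *)
definition Sigma2_matrix ::
  "(real \<Rightarrow> real) \<Rightarrow> real \<Rightarrow> ('n \<Rightarrow> nat) \<Rightarrow> real ^ 'n ^ 'n::finite" where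
  "Sigma2_matrix f \<kappa> \<iota> = (\<chi> i j. Re (Sigma2 f \<kappa> (\<iota> i) (\<iota> j)))"

definition gaussian_rate :: "real ^ 'n ^ 'n \<Rightarrow> real ^ 'n \<Rightarrow> ereal" where
  "gaussian_rate S z = (SUP v. ereal (v \<bullet> z - 1 / 2 * (v \<bullet> (S *v v))))"

end

(* Write t_n = b_n / sqrt n, and let Q_n be a fixed linear combination of the centered sums over
   k <= n of X_k X_{k+l}. It suffices to show that ln E exp(t_n Q_n) / b_n^2 tends to half the
   quadratic form of Sigma^2; the limit being quadratic, a direct Gaertner-Ellis argument (tilting
   for the lower bound) then yields the principle.

   The coefficients a are replaced by those of the Fejer mean P_M of g, and Q_n by a sum R_n of
   i.i.d. blocks of length p, separated by gaps so that they depend on disjoint sets of the xi_j.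
   A finite block has exponential moments, so ln E exp(t_n R_n) is governed by the block variance,
   which gives the form of Sigma^2 for the density v |P_M|^2 as p tends to infinity.

   The difference Q_n - R_n is a quadratic form in the noise. By Herbst's argument the logarithmic
   Sobolev inequality makes mu sub-Gaussian, so the Hanson-Wright inequality applies: as long as
   t_n times the operator norm is small, the logarithm of the exponential moment is at most
   C t_n^2 times the squared Hilbert-Schmidt norm. The operator norm is O(n^(1/q)) since f is in
   L^q, and this is where b_n n^(1/q) / sqrt n -> 0 enters; the squared Hilbert-Schmidt norm is at
   most epsilon n since g - P_M is small in L^4. Hoelder's inequality with exponents close to 1
   transfers the limit from R_n to Q_n. *)
theory Submission
  imports Defs "HOL-Computational_Algebra.Polynomial"
begin

section \<open>The Hanson-Wright inequality\<close>

text \<open>A quadratic form in sub-Gaussian noise has exponential moments near 0 only, on a range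
  governed by its operator norm. So the error form is measured in two ways: for the operator norm
  the sum of the norms of both forms is good enough, while the Hilbert-Schmidt norm is where the
  approximation has to be small. This needs g - P_M small in L^4; Fejer means provide it because
  their kernel is positive, so that Jensen's inequality bounds them in L^w for some w > 4, and
  interpolation with L^2 does the rest.

  Each X_k depends on infinitely many noise variables. The estimates are therefore uniform in a
  finite index set, and Fatou's lemma carries them to the limit. Of a block only the variance
  enters, because t_n tends to 0 while the block stays fixed.

  The parameters are chosen in the order Hoelder exponent, weight in the Hilbert-Schmidt estimate,
  Fejer order, block length; n tends to infinity with all of them fixed. The limit matrix may be
  singular; instead of inverting it on its range, the lower bound perturbs it by a multiple of the
  identity.\<close>

lemma nn_integral_gauss_quadratic:
  fixes \<alpha> \<beta> :: real
  assumes a: "\<alpha> < 1"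
  shows "(\<integral>\<^sup>+x. ennreal (exp (\<alpha> * x\<^sup>2 / 2 + \<beta> * x)) \<partial>std_normal_distribution)
    = ennreal (exp (\<beta>\<^sup>2 / (2 * (1 - \<alpha>))) / sqrt (1 - \<alpha>))"
proof -
  \<comment> \<open>Completing the square: the integrand becomes \<open>D\<close> times the normal
    density with mean \<open>m\<close> and standard deviation \<open>s\<close>.\<close>
  define s where "s = 1 / sqrt (1 - \<alpha>)"
  define m where "m = \<beta> / (1 - \<alpha>)"
  define D where "D = exp (\<beta>\<^sup>2 / (2 * (1 - \<alpha>))) / sqrt (1 - \<alpha>)"
  have s: "s > 0" "s\<^sup>2 = 1 / (1 - \<alpha>)" using a by (auto simp: s_def power_divide)
  have D: "D \<ge> 0" using a by (simp add: D_def)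
  have sq: "sqrt (2 * pi * s\<^sup>2) = sqrt (2 * pi) / sqrt (1 - \<alpha>)"
    using a by (simp add: s(2) real_sqrt_divide)
  have ex: "- x\<^sup>2 / 2 + (\<alpha> * x\<^sup>2 / 2 + \<beta> * x) = \<beta>\<^sup>2 / (2 * (1 - \<alpha>)) + - (x - m)\<^sup>2 / (2 * s\<^sup>2)" for x
  proof -
    define c where "c = 1 - \<alpha>"
    have c: "c > 0" "\<alpha> = 1 - c" using a by (auto simp: c_def)
    show ?thesis unfolding m_def s(2) c(2) using c(1) by (simp add: field_simps power2_eq_square)
  qed
  have eq: "std_normal_density x * exp (\<alpha> * x\<^sup>2 / 2 + \<beta> * x) = D * normal_density m s x" for x
  proof -
    have "std_normal_density x * exp (\<alpha> * x\<^sup>2 / 2 + \<beta> * x) = 1 / sqrt (2 * pi) * exp (- x\<^sup>2 / 2 + (\<alpha> * x\<^sup>2 / 2 + \<beta> * x))"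
      by (simp only: std_normal_density_def exp_add mult.assoc)
    also have "\<dots> = 1 / sqrt (2 * pi) * (exp (\<beta>\<^sup>2 / (2 * (1 - \<alpha>))) * exp (- (x - m)\<^sup>2 / (2 * s\<^sup>2)))"
      unfolding ex exp_add ..
    also have "\<dots> = D * normal_density m s x"
      unfolding normal_density_def D_def sq using a by simp
    finally show ?thesis .
  qed
  have "(\<integral>\<^sup>+x. ennreal (exp (\<alpha> * x\<^sup>2 / 2 + \<beta> * x)) \<partial>std_normal_distribution)
    = (\<integral>\<^sup>+x. ennreal (std_normal_density x) * ennreal (exp (\<alpha> * x\<^sup>2 / 2 + \<beta> * x)) \<partial>lborel)"
    by (subst nn_integral_density) auto
  also have "\<dots> = (\<integral>\<^sup>+x. ennreal D * ennreal (normal_density m s x) \<partial>lborel)"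
    using D by (simp add: ennreal_mult'[symmetric] eq)
  also have "\<dots> = ennreal D * (\<integral>\<^sup>+x. ennreal (normal_density m s x) \<partial>lborel)"
    by (rule nn_integral_cmult) auto
  also have "(\<integral>\<^sup>+x. ennreal (normal_density m s x) \<partial>lborel) = 1"
    using s(1) by (subst nn_integral_eq_integral) auto
  finally show ?thesis by (simp add: D_def)
qed

lemma prob_space_std_normal: "prob_space std_normal_distribution"
  by (rule prob_space_normal_density) simp

lemma sets_std_normal [measurable_cong]: "sets std_normal_distribution = sets borel"
  by simp

lemma product_sigma_finite_const: "prob_space \<mu> \<Longrightarrow> product_sigma_finite (\<lambda>_. \<mu>)"
  by (simp add: product_sigma_finite_def prob_space_imp_sigma_finite)

section \<open>Exponential moments of Gaussian quadratic forms\<close>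

definition qf :: "'i set \<Rightarrow> ('i \<Rightarrow> 'i \<Rightarrow> real) \<Rightarrow> ('i \<Rightarrow> real) \<Rightarrow> real" where
  "qf V B x = (\<Sum>i\<in>V. \<Sum>j\<in>V. B i j * x i * x j)"

lemma qf_insert:
  assumes V: "finite V" "k \<notin> V" and sym: "\<And>i j. B i j = B j i"
  shows "qf (insert k V) B (x(k := t)) = qf V B x + 2 * t * (\<Sum>i\<in>V. B i k * x i) + B k k * t\<^sup>2"
proof -
  let ?y = "x(k := t)"
  have y: "?y i = x i" if "i \<in> V" for i using that V by auto
  have 1: "(\<Sum>j\<in>insert k V. B i j * ?y i * ?y j) = B i k * ?y i * t + (\<Sum>j\<in>V. B i j * ?y i * x j)" for i
    using V y by simp
  have 2: "(\<Sum>i\<in>V. B i k * ?y i * t + (\<Sum>j\<in>V. B i j * ?y i * x j)) = t * (\<Sum>i\<in>V. B i k * x i) + qf V B x"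
    unfolding qf_def sum_distrib_left sum.distrib[symmetric] using y by (intro sum.cong) auto
  have 3: "(\<Sum>j\<in>V. B k j * ?y k * x j) = t * (\<Sum>i\<in>V. B i k * x i)"
    unfolding sum_distrib_left by (intro sum.cong) (auto simp: sym[of k])
  have "qf (insert k V) B ?y = (\<Sum>i\<in>insert k V. B i k * ?y i * t + (\<Sum>j\<in>V. B i j * ?y i * x j))"
    unfolding qf_def 1 ..
  also have "\<dots> = (B k k * t * t + t * (\<Sum>i\<in>V. B i k * x i)) + (t * (\<Sum>i\<in>V. B i k * x i) + qf V B x)"
    unfolding sum.insert[OF V] 2 3 by simp
  finally show ?thesis by (simp add: power2_eq_square algebra_simps)
qed

text \<open>This is the (k,k) entry of the matrix inequality B^2 \<le> \<rho> B. With s = 1/\<rho>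
  it follows from the identity B - s B^2 = (1 - s B) B (1 - s B) + s^2 B (\<rho> - B) B:
  \<open>psd\<close> is tested on e_k - s B e_k and \<open>up\<close> on the k-th column of B, so no
  square root of B is needed.\<close>

lemma psd_column_bound:
  assumes V: "finite V" "k \<notin> V" and sym: "\<And>i j. B i j = B j i" and rho: "0 < \<rho>"
    and psd: "\<And>x. 0 \<le> qf (insert k V) B x"
    and up: "\<And>x. qf (insert k V) B x \<le> \<rho> * (\<Sum>i\<in>insert k V. (x i)\<^sup>2)"
  shows "(\<Sum>i\<in>V. (B i k)\<^sup>2) \<le> B k k * (\<rho> - B k k)"
proof -
  define w where "w = (\<Sum>i\<in>V. (B i k)\<^sup>2)"
  define u where "u = B k k"
  define P where "P = qf V B (\<lambda>i. B i k)"
  have norm: "(\<Sum>i\<in>insert k V. ((x(k := t)) i)\<^sup>2) = t\<^sup>2 + (\<Sum>i\<in>V. (x i)\<^sup>2)" for x :: "'a \<Rightarrow> real" and t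
  proof -
    have "(\<Sum>i\<in>V. ((x(k := t)) i)\<^sup>2) = (\<Sum>i\<in>V. (x i)\<^sup>2)" using V by (intro sum.cong) auto
    then show ?thesis using V by simp
  qed
  have lin: "(\<Sum>i\<in>V. B i k * (c * B i k)) = c * w" for c
    unfolding w_def sum_distrib_left by (intro sum.cong) (auto simp: power2_eq_square)
  have scale: "qf V B (\<lambda>i. c * B i k) = c\<^sup>2 * P" for c
    unfolding P_def qf_def sum_distrib_left by (intro sum.cong) (auto simp: power2_eq_square)
  have q: "qf (insert k V) B ((\<lambda>i. c * B i k)(k := t)) = c\<^sup>2 * P + 2 * t * (c * w) + u * t\<^sup>2" for c t
    unfolding qf_insert[OF V sym] lin scale u_def ..
  define s where "s = 1 / \<rho>"
  have "1\<^sup>2 * P + 2 * u * (1 * w) + u * u\<^sup>2 \<le> \<rho> * (u\<^sup>2 + w)"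
    using up[of "(\<lambda>i. 1 * B i k)(k := u)"] unfolding q norm by (simp add: w_def)
  then have a: "s\<^sup>2 * (P + 2 * u * w + u * u\<^sup>2) \<le> s\<^sup>2 * (\<rho> * (u\<^sup>2 + w))"
    by (intro mult_left_mono) auto
  have b: "0 \<le> (-s)\<^sup>2 * P + 2 * (1 - s * u) * (- s * w) + u * (1 - s * u)\<^sup>2"
    using psd[of "(\<lambda>i. (-s) * B i k)(k := 1 - s * u)"] unfolding q .
  have c: "s\<^sup>2 * (\<rho> * (u\<^sup>2 + w)) = s * (u\<^sup>2 + w)"
    using rho by (simp add: s_def power2_eq_square)
  have "0 \<le> u - s * (w + u\<^sup>2)"
    using a b unfolding c by (simp add: power2_eq_square algebra_simps)
  then have "\<rho> * (s * (w + u\<^sup>2)) \<le> \<rho> * u"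
    using rho by (intro mult_left_mono) auto
  then have "w + u\<^sup>2 \<le> \<rho> * u" using rho by (simp add: s_def)
  then show ?thesis unfolding w_def[symmetric] u_def[symmetric] by (simp add: power2_eq_square algebra_simps)
qed

text \<open>The integral equals det(1 - B)^(-1/2). Instead of diagonalising B, the induction
  integrates out one variable. What remains is the form of \<open>B'\<close>, where 1 -
  \<open>B'\<close> is the Schur complement in 1 - B, and \<open>B'\<close> lies between 0 and the
  same \<rho>.\<close>

lemma gauss_qf_bound:
  assumes "finite V" "0 < \<rho>" "\<rho> < 1"
    and "\<And>i j. B i j = B j i"
    and "\<And>x. 0 \<le> qf V B x"
    and "\<And>x. qf V B x \<le> \<rho> * (\<Sum>i\<in>V. (x i)\<^sup>2)"
  shows "(\<integral>\<^sup>+x. ennreal (exp (qf V B x / 2)) \<partial>PiM V (\<lambda>_. std_normal_distribution))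
    \<le> ennreal (exp ((\<Sum>i\<in>V. B i i) / (2 * (1 - \<rho>))))"
  using assms(1,4-)
proof (induction V arbitrary: B rule: finite_induct)
  case empty
  interpret product_sigma_finite "\<lambda>_. std_normal_distribution"
    by (rule product_sigma_finite_const[OF prob_space_std_normal])
  show ?case by (subst nn_integral_empty) (auto simp: qf_def)
next
  case (insert k V)
  interpret product_sigma_finite "\<lambda>_. std_normal_distribution"
    by (rule product_sigma_finite_const[OF prob_space_std_normal])
  note V = insert.hyps and sym = insert.prems(1) and psd = insert.prems(2) and up = insert.prems(3)
  define u where "u = B k k"
  define w where "w = (\<Sum>i\<in>V. (B i k)\<^sup>2)"
  define S where "S = (\<Sum>i\<in>V. B i i)"
  define L where "L x = (\<Sum>i\<in>V. B i k * x i)" for x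
  define B' where "B' i j = B i j + B i k * B j k / (1 - u)" for i j
  have w: "w \<le> u * (\<rho> - u)"
    unfolding w_def u_def by (rule psd_column_bound[OF V sym assms(2) psd up])
  have norm: "(\<Sum>i\<in>insert k V. ((x(k := t)) i)\<^sup>2) = t\<^sup>2 + (\<Sum>i\<in>V. (x i)\<^sup>2)" for x :: "'a \<Rightarrow> real" and t
  proof -
    have "(\<Sum>i\<in>V. ((x(k := t)) i)\<^sup>2) = (\<Sum>i\<in>V. (x i)\<^sup>2)" using V by (intro sum.cong) auto
    then show ?thesis using V by simp
  qed
  have q: "qf (insert k V) B (x(k := t)) = qf V B x + 2 * t * L x + u * t\<^sup>2" for x t
    unfolding L_def u_def by (rule qf_insert[OF V sym])
  have u: "0 \<le> u" "u \<le> \<rho>"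
  proof -
    have "(\<lambda>i. 0)(k := 1) \<in> UNIV" by simp
    have z: "qf V B (\<lambda>i. 0) = 0" "L (\<lambda>i. 0) = 0" by (auto simp: qf_def L_def)
    show "0 \<le> u" using psd[of "(\<lambda>i. 0)(k := 1)"] unfolding q z by simp
    show "u \<le> \<rho>" using up[of "(\<lambda>i. 0)(k := 1)"] unfolding q z norm by simp
  qed
  have u1: "u < 1" using u assms by simp
  have qB': "qf V B' x = qf V B x + (L x)\<^sup>2 / (1 - u)" for x
  proof -
    have "(L x)\<^sup>2 / (1 - u) = (\<Sum>i\<in>V. \<Sum>j\<in>V. B i k * B j k / (1 - u) * x i * x j)"
      unfolding power2_eq_square L_def sum_product sum_divide_distrib by (intro sum.cong) auto
    then show ?thesis
      unfolding qf_def B'_def sum.distrib[symmetric] by (simp add: sum.distrib[symmetric] algebra_simps)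
  qed
  have psd': "0 \<le> qf V B' x" for x
  proof -
    have "qf (insert k V) B (x(k := 0)) = qf V B x" unfolding q by simp
    then have "0 \<le> qf V B x" using psd by metis
    then show ?thesis unfolding qB' using u1 by simp
  qed
  have up': "qf V B' x \<le> \<rho> * (\<Sum>i\<in>V. (x i)\<^sup>2)" for x
  proof -
    \<comment> \<open>This \<open>t\<close> maximises
      \<open>qf (insert k V) B (x(k := t)) - t\<^sup>2\<close>, and the maximum is
      \<open>qf V B' x\<close>. The bound \<open>up\<close> then costs \<rho> t^2, which is less
      than the subtracted t^2.\<close>
    define t where "t = L x / (1 - u)"
    have Lx: "L x = (1 - u) * t" using u1 by (simp add: t_def)
    have "(L x)\<^sup>2 / (1 - u) = (1 - u) * t\<^sup>2" unfolding Lx using u1 by (simp add: power2_eq_square)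
    then have "qf V B' x = qf (insert k V) B (x(k := t)) - t\<^sup>2"
      unfolding qB' q Lx by (simp add: power2_eq_square algebra_simps)
    also have "\<dots> \<le> \<rho> * (t\<^sup>2 + (\<Sum>i\<in>V. (x i)\<^sup>2)) - t\<^sup>2"
      using up[of "x(k := t)"] unfolding norm by linarith
    also have "\<dots> = \<rho> * (\<Sum>i\<in>V. (x i)\<^sup>2) - (1 - \<rho>) * t\<^sup>2" by (simp add: algebra_simps)
    also have "\<dots> \<le> \<rho> * (\<Sum>i\<in>V. (x i)\<^sup>2)" using assms by simp
    finally show ?thesis .
  qed
  have sym': "B' i j = B' j i" for i j unfolding B'_def by (simp add: sym[of i j])
  have tr: "(\<Sum>i\<in>V. B' i i) = S + w / (1 - u)"
    unfolding B'_def S_def w_def sum.distrib sum_divide_distrib by (simp add: power2_eq_square)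
  have inner: "(\<integral>\<^sup>+ t. ennreal (exp (qf (insert k V) B (x(k := t)) / 2)) \<partial>std_normal_distribution)
    = ennreal (1 / sqrt (1 - u)) * ennreal (exp (qf V B' x / 2))" for x
  proof -
    have "(\<integral>\<^sup>+ t. ennreal (exp (qf (insert k V) B (x(k := t)) / 2)) \<partial>std_normal_distribution)
      = (\<integral>\<^sup>+ t. ennreal (exp (qf V B x / 2)) * ennreal (exp (u * t\<^sup>2 / 2 + L x * t)) \<partial>std_normal_distribution)"
      unfolding q by (intro nn_integral_cong) (simp add: ennreal_mult'[symmetric] exp_add[symmetric] field_simps)
    also have "\<dots> = ennreal (exp (qf V B x / 2)) * ennreal (exp ((L x)\<^sup>2 / (2 * (1 - u))) / sqrt (1 - u))"
      by (subst nn_integral_cmult) (auto simp: nn_integral_gauss_quadratic[OF u1])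
    also have "\<dots> = ennreal (1 / sqrt (1 - u)) * ennreal (exp (qf V B' x / 2))"
    proof -
      have "exp (qf V B' x / 2) = exp (qf V B x / 2) * exp ((L x)\<^sup>2 / (2 * (1 - u)))"
        unfolding qB' exp_add[symmetric] using u1 by (simp add: field_simps)
      then show ?thesis using u1 by (simp add: ennreal_mult'[symmetric])
    qed
    finally show ?thesis .
  qed
  have meas[measurable]: "(\<lambda>x. qf V B x) \<in> borel_measurable (PiM V (\<lambda>_. std_normal_distribution))"
    for V :: "'a set" and B unfolding qf_def by measurable
  have "(\<integral>\<^sup>+x. ennreal (exp (qf (insert k V) B x / 2)) \<partial>PiM (insert k V) (\<lambda>_. std_normal_distribution))
     = (\<integral>\<^sup>+x. \<integral>\<^sup>+t. ennreal (exp (qf (insert k V) B (x(k := t)) / 2)) \<partial>std_normal_distribution \<partial>PiM V (\<lambda>_. std_normal_distribution))"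
    by (rule product_nn_integral_insert[OF V]) measurable
  also have "\<dots> = ennreal (1 / sqrt (1 - u)) * (\<integral>\<^sup>+x. ennreal (exp (qf V B' x / 2)) \<partial>PiM V (\<lambda>_. std_normal_distribution))"
    unfolding inner by (rule nn_integral_cmult) measurable
  also have "\<dots> \<le> ennreal (1 / sqrt (1 - u)) * ennreal (exp ((S + w / (1 - u)) / (2 * (1 - \<rho>))))"
    using insert.IH[of B', OF sym' psd' up'] unfolding tr by (intro mult_left_mono) auto
  \<comment> \<open>The factor 1/sqrt(1 - u) and the increase w/(1 - u) of the trace may together
    cost no more than u/(2 (1 - \<rho>)). The column bound w \<le> u (\<rho> - u) gives exactly
    this.\<close>
  also have "\<dots> \<le> ennreal (exp ((S + u) / (2 * (1 - \<rho>))))"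
  proof -
    have "1 / (1 - u) \<le> exp (1 / (1 - u) - 1)"
      using exp_ge_add_one_self[of "1 / (1 - u) - 1"] by simp
    moreover have "1 / (1 - u) - 1 = u / (1 - u)" using u1 by (simp add: field_simps)
    ultimately have "1 / (1 - u) \<le> exp (u / (1 - u))" by simp
    then have "sqrt (1 / (1 - u)) \<le> sqrt (exp (u / (1 - u)))" by (rule real_sqrt_le_mono)
    also have "sqrt (exp v) = exp (v / 2)" for v :: real
      by (rule real_sqrt_unique) (simp_all add: exp_double[symmetric])
    finally have 1: "1 / sqrt (1 - u) \<le> exp (u / (1 - u) / 2)" by (simp add: real_sqrt_divide)
    have 2: "u / (1 - u) / 2 + (S + w / (1 - u)) / (2 * (1 - \<rho>)) \<le> (S + u) / (2 * (1 - \<rho>))"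
    proof -
      have "u / (1 - u) * (1 - \<rho>) + w / (1 - u) \<le> u"
      proof -
        have "u * (1 - \<rho>) + w \<le> u * (1 - u)" using w by (simp add: algebra_simps)
        then have "(u * (1 - \<rho>) + w) / (1 - u) \<le> u" using u1 by (simp add: pos_divide_le_eq)
        then show ?thesis by (metis add_divide_distrib times_divide_eq_left)
      qed
      then have "(u / (1 - u) * (1 - \<rho>) + (S + w / (1 - u))) / (2 * (1 - \<rho>)) \<le> (S + u) / (2 * (1 - \<rho>))"
        using assms by (intro divide_right_mono) auto
      moreover have "(u / (1 - u) * (1 - \<rho>) + (S + w / (1 - u))) / (2 * (1 - \<rho>)) = u / (1 - u) / 2 + (S + w / (1 - u)) / (2 * (1 - \<rho>))"
      proof -
        have c: "a * (1 - \<rho>) / (2 * (1 - \<rho>)) = a / 2" for a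
          using assms by (intro nonzero_mult_divide_mult_cancel_right) simp
        show ?thesis unfolding add_divide_distrib[of _ _ "2 * (1 - \<rho>)"] c ..
      qed
      ultimately show ?thesis by simp
    qed
    have "1 / sqrt (1 - u) * exp ((S + w / (1 - u)) / (2 * (1 - \<rho>))) \<le> exp (u / (1 - u) / 2) * exp ((S + w / (1 - u)) / (2 * (1 - \<rho>)))"
      using 1 by (intro mult_right_mono) auto
    also have "\<dots> \<le> exp ((S + u) / (2 * (1 - \<rho>)))"
      using 2 by (simp add: exp_add[symmetric])
    finally show ?thesis using u1 by (simp add: ennreal_mult'[symmetric])
  qed
  also have "S + u = (\<Sum>i\<in>insert k V. B i i)" using V by (simp add: S_def u_def)
  finally show ?case .
qed

section \<open>Sub-Gaussian laws and decoupled bilinear forms\<close>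

definition subgaussian :: "real measure \<Rightarrow> real \<Rightarrow> bool" where
  "subgaussian \<mu> K \<longleftrightarrow> prob_space \<mu> \<and> sets \<mu> = sets borel \<and> 0 < K \<and>
     (\<forall>u. (\<integral>\<^sup>+x. ennreal (exp (u * x)) \<partial>\<mu>) \<le> ennreal (exp (K * u\<^sup>2 / 2)))"

lemma nn_integral_exp_sum_PiM:
  assumes "prob_space \<mu>" "finite J" and [measurable]: "\<And>j. j \<in> J \<Longrightarrow> h j \<in> borel_measurable \<mu>"
  shows "(\<integral>\<^sup>+y. ennreal (exp (\<Sum>j\<in>J. h j (y j))) \<partial>PiM J (\<lambda>_. \<mu>)) = (\<Prod>j\<in>J. \<integral>\<^sup>+x. ennreal (exp (h j x)) \<partial>\<mu>)"
proof -
  interpret product_sigma_finite "\<lambda>_. \<mu>" by (rule product_sigma_finite_const[OF assms(1)])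
  have "(\<integral>\<^sup>+y. ennreal (exp (\<Sum>j\<in>J. h j (y j))) \<partial>PiM J (\<lambda>_. \<mu>))
    = (\<integral>\<^sup>+y. (\<Prod>j\<in>J. ennreal (exp (h j (y j)))) \<partial>PiM J (\<lambda>_. \<mu>))"
    using assms(2) by (simp add: exp_sum prod_ennreal)
  also have "\<dots> = (\<Prod>j\<in>J. \<integral>\<^sup>+x. ennreal (exp (h j x)) \<partial>\<mu>)"
    by (rule product_nn_integral_prod[OF assms(2)]) measurable
  finally show ?thesis .
qed

lemma nn_integral_exp_sum_PiM_le:
  assumes "prob_space \<mu>" "finite J" "\<And>j. j \<in> J \<Longrightarrow> h j \<in> borel_measurable \<mu>"
    and "\<And>j. j \<in> J \<Longrightarrow> (\<integral>\<^sup>+x. ennreal (exp (h j x)) \<partial>\<mu>) \<le> ennreal (exp (c j))"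
  shows "(\<integral>\<^sup>+y. ennreal (exp (\<Sum>j\<in>J. h j (y j))) \<partial>PiM J (\<lambda>_. \<mu>)) \<le> ennreal (exp (\<Sum>j\<in>J. c j))"
proof -
  have "(\<Prod>j\<in>J. \<integral>\<^sup>+x. ennreal (exp (h j x)) \<partial>\<mu>) \<le> (\<Prod>j\<in>J. ennreal (exp (c j)))"
    using assms(2,4)
  proof (induction J rule: finite_induct)
    case (insert j J)
    then show ?case by (auto intro!: mult_mono)
  qed simp
  also have "(\<Prod>j\<in>J. ennreal (exp (c j))) = ennreal (exp (\<Sum>j\<in>J. c j))"
    using assms(2) by (simp add: exp_sum prod_ennreal)
  finally show ?thesis
    by (subst nn_integral_exp_sum_PiM[where h = h, OF assms(1,2)]) (use assms(3) in auto)
qed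

lemma subgaussian_linear:
  assumes "subgaussian \<mu> K" "finite J"
  shows "(\<integral>\<^sup>+y. ennreal (exp (\<Sum>j\<in>J. c j * y j)) \<partial>PiM J (\<lambda>_. \<mu>)) \<le> ennreal (exp (K / 2 * (\<Sum>j\<in>J. (c j)\<^sup>2)))"
proof -
  have [measurable_cong]: "sets \<mu> = sets borel" and p: "prob_space \<mu>" using assms by (auto simp: subgaussian_def)
  have "(\<integral>\<^sup>+x. ennreal (exp (c j * x)) \<partial>\<mu>) \<le> ennreal (exp (K / 2 * (c j)\<^sup>2))" for j
    using assms(1) by (simp add: subgaussian_def)
  then have "(\<integral>\<^sup>+y. ennreal (exp (\<Sum>j\<in>J. c j * y j)) \<partial>PiM J (\<lambda>_. \<mu>)) \<le> ennreal (exp (\<Sum>j\<in>J. K / 2 * (c j)\<^sup>2))"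
    by (intro nn_integral_exp_sum_PiM_le p assms(2)) measurable
  then show ?thesis by (simp add: sum_distrib_left)
qed

lemma gauss_linear:
  assumes "finite J"
  shows "(\<integral>\<^sup>+y. ennreal (exp (\<Sum>j\<in>J. c j * y j)) \<partial>PiM J (\<lambda>_. std_normal_distribution))
    = ennreal (exp (1 / 2 * (\<Sum>j\<in>J. (c j)\<^sup>2)))"
proof -
  have 1: "(\<integral>\<^sup>+x. ennreal (exp (c j * x)) \<partial>std_normal_distribution) = ennreal (exp ((c j)\<^sup>2 / 2))" for j
    using nn_integral_gauss_quadratic[of 0 "c j"] by simp
  show ?thesis
    by (subst nn_integral_exp_sum_PiM[OF prob_space_std_normal assms])
       (auto simp: 1 prod_ennreal sum_distrib_left exp_sum[OF assms])
qed

text \<open>Integrating over y leaves the exponential of a square in x. Writing it as a Gaussian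
  integral makes x enter linearly again, so the sub-Gaussian bound can be applied a second time;
  both laws are thereby replaced by Gaussian ones, and the Gaussian form has the matrix K^2 A^T
  A.\<close>

lemma subgaussian_bilinear:
  assumes sg: "subgaussian \<mu> K" and fin: "finite I" "finite J"
    and op: "\<And>x. (\<Sum>i\<in>I. (\<Sum>j\<in>J. A i j * x j)\<^sup>2) \<le> \<rho>\<^sup>2 * (\<Sum>j\<in>J. (x j)\<^sup>2)"
    and small: "K\<^sup>2 * \<rho>\<^sup>2 \<le> 1 / 2"
  shows "(\<integral>\<^sup>+x. \<integral>\<^sup>+y. ennreal (exp (\<Sum>i\<in>I. \<Sum>j\<in>J. A i j * x i * y j)) \<partial>PiM J (\<lambda>_. \<mu>) \<partial>PiM I (\<lambda>_. \<mu>))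
    \<le> ennreal (exp (K\<^sup>2 * (\<Sum>i\<in>I. \<Sum>j\<in>J. (A i j)\<^sup>2)))"
proof -
  have [measurable_cong]: "sets \<mu> = sets borel" and p: "prob_space \<mu>" and K: "K > 0"
    using sg by (auto simp: subgaussian_def)
  let ?g = "std_normal_distribution"
  interpret P: product_sigma_finite "\<lambda>_. \<mu>" by (rule product_sigma_finite_const[OF p])
  interpret G: product_sigma_finite "\<lambda>_. ?g" by (rule product_sigma_finite_const[OF prob_space_std_normal])
  interpret PG: pair_sigma_finite "PiM I (\<lambda>_. \<mu>)" "PiM J (\<lambda>_. ?g)"
    using P.sigma_finite[OF fin(1)] G.sigma_finite[OF fin(2)] by (rule pair_sigma_finite.intro)
  define B where "B j j' = K\<^sup>2 * (\<Sum>i\<in>I. A i j * A i j')" for j j'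
  have row: "(\<Sum>i\<in>I. \<Sum>j\<in>J. A i j * x i * y j) = (\<Sum>j\<in>J. (\<Sum>i\<in>I. A i j * x i) * y j)" for x y
    by (subst sum.swap) (simp add: sum_distrib_right)
  have row': "(\<Sum>j\<in>J. (sqrt K * (\<Sum>i\<in>I. A i j * x i)) * g j) = (\<Sum>i\<in>I. (sqrt K * (\<Sum>j\<in>J. A i j * g j)) * x i)" for x g
    unfolding sum_distrib_left sum_distrib_right by (subst sum.swap) (auto intro!: sum.cong)
  have qB: "qf J B g = K\<^sup>2 * (\<Sum>i\<in>I. (\<Sum>j\<in>J. A i j * g j)\<^sup>2)" for g
  proof -
    have "(\<Sum>i\<in>I. (\<Sum>j\<in>J. A i j * g j)\<^sup>2) = (\<Sum>i\<in>I. \<Sum>j\<in>J. \<Sum>j'\<in>J. A i j * A i j' * g j * g j')"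
      unfolding power2_eq_square sum_product by (intro sum.cong) auto
    also have "\<dots> = (\<Sum>j\<in>J. \<Sum>j'\<in>J. \<Sum>i\<in>I. A i j * A i j' * g j * g j')"
      by (subst sum.swap, intro sum.cong refl, rule sum.swap)
    finally show ?thesis unfolding qf_def B_def
      by (simp add: sum_distrib_left sum_distrib_right mult.assoc)
  qed
  have "(\<integral>\<^sup>+x. \<integral>\<^sup>+y. ennreal (exp (\<Sum>i\<in>I. \<Sum>j\<in>J. A i j * x i * y j)) \<partial>PiM J (\<lambda>_. \<mu>) \<partial>PiM I (\<lambda>_. \<mu>))
    \<le> (\<integral>\<^sup>+x. ennreal (exp (K / 2 * (\<Sum>j\<in>J. (\<Sum>i\<in>I. A i j * x i)\<^sup>2))) \<partial>PiM I (\<lambda>_. \<mu>))"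
    unfolding row by (intro nn_integral_mono subgaussian_linear[OF sg fin(2)])
  also have "\<dots> = (\<integral>\<^sup>+x. \<integral>\<^sup>+g. ennreal (exp (\<Sum>j\<in>J. (sqrt K * (\<Sum>i\<in>I. A i j * x i)) * g j)) \<partial>PiM J (\<lambda>_. ?g) \<partial>PiM I (\<lambda>_. \<mu>))"
    using K by (intro nn_integral_cong, subst gauss_linear[OF fin(2)])
      (simp add: power_mult_distrib sum_distrib_left[symmetric])
  also have "\<dots> = (\<integral>\<^sup>+g. \<integral>\<^sup>+x. ennreal (exp (\<Sum>j\<in>J. (sqrt K * (\<Sum>i\<in>I. A i j * x i)) * g j)) \<partial>PiM I (\<lambda>_. \<mu>) \<partial>PiM J (\<lambda>_. ?g))"
    by (rule PG.Fubini'[symmetric]) measurable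
  also have "\<dots> \<le> (\<integral>\<^sup>+g. ennreal (exp (K / 2 * (\<Sum>i\<in>I. (sqrt K * (\<Sum>j\<in>J. A i j * g j))\<^sup>2))) \<partial>PiM J (\<lambda>_. ?g))"
    unfolding row' by (intro nn_integral_mono subgaussian_linear[OF sg fin(1)])
  also have "\<dots> = (\<integral>\<^sup>+g. ennreal (exp (qf J B g / 2)) \<partial>PiM J (\<lambda>_. ?g))"
  proof -
    have "K / 2 * (\<Sum>i\<in>I. (sqrt K * (\<Sum>j\<in>J. A i j * g j))\<^sup>2) = qf J B g / 2" for g
    proof -
      have "(\<Sum>i\<in>I. (sqrt K * (\<Sum>j\<in>J. A i j * g j))\<^sup>2) = K * (\<Sum>i\<in>I. (\<Sum>j\<in>J. A i j * g j)\<^sup>2)"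
        using K by (simp add: power_mult_distrib sum_distrib_left[symmetric])
      then show ?thesis unfolding qB by (simp only:) (simp add: power2_eq_square)
    qed
    then show ?thesis by simp
  qed
  \<comment> \<open>By \<open>small\<close> the matrix \<open>B\<close> is bounded by K^2 \<rho>^2
    \<le> 1/2, so the Gaussian bound is used at 1/2; the trace of \<open>B\<close> is K^2 times the
    squared Hilbert-Schmidt norm of A.\<close>
  also have "\<dots> \<le> ennreal (exp ((\<Sum>j\<in>J. B j j) / (2 * (1 - 1 / 2))))"
  proof (rule gauss_qf_bound[OF fin(2)])
    show "B i j = B j i" for i j unfolding B_def by (simp add: mult.commute)
    show "0 \<le> qf J B x" for x unfolding qB by (intro mult_nonneg_nonneg sum_nonneg) auto
    show "qf J B x \<le> 1 / 2 * (\<Sum>i\<in>J. (x i)\<^sup>2)" for x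
    proof -
      have "qf J B x \<le> K\<^sup>2 * (\<rho>\<^sup>2 * (\<Sum>j\<in>J. (x j)\<^sup>2))" unfolding qB by (intro mult_left_mono op) auto
      also have "\<dots> \<le> 1 / 2 * (\<Sum>i\<in>J. (x i)\<^sup>2)"
        unfolding mult.assoc[symmetric] using small by (intro mult_right_mono sum_nonneg) auto
      finally show ?thesis .
    qed
  qed auto
  also have "(\<Sum>j\<in>J. B j j) = K\<^sup>2 * (\<Sum>i\<in>I. \<Sum>j\<in>J. (A i j)\<^sup>2)"
    unfolding B_def by (subst sum.swap) (simp add: sum_distrib_left power2_eq_square)
  finally show ?thesis by simp
qed

section \<open>Decoupling of the off-diagonal part\<close>

lemma card_separating_subsets:
  assumes "finite V" "i \<in> V" "j \<in> V" "i \<noteq> j"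
  shows "4 * card {I\<in>Pow V. i \<in> I \<and> j \<notin> I} = 2 ^ card V"
proof -
  have "{I\<in>Pow V. i \<in> I \<and> j \<notin> I} = insert i ` Pow (V - {i, j})"
  proof (intro equalityI subsetI)
    fix I assume "I \<in> {I\<in>Pow V. i \<in> I \<and> j \<notin> I}"
    then show "I \<in> insert i ` Pow (V - {i, j})" by (intro image_eqI[of _ _ "I - {i}"]) auto
  qed (use assms in auto)
  moreover have "inj_on (insert i) (Pow (V - {i, j}))"
    by (rule inj_onI) (metis Diff_iff PowD insertCI insert_ident subsetD)
  ultimately have "card {I\<in>Pow V. i \<in> I \<and> j \<notin> I} = 2 ^ card (V - {i, j})"
    by (simp add: card_image card_Pow assms(1))
  moreover have "card (V - {i, j}) = card V - 2"
    using assms by (subst card_Diff_subset) auto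
  moreover have "card V \<ge> 2"
    using card_mono[of V "{i, j}"] assms by auto
  ultimately show ?thesis
    by (metis le_add_diff_inverse power2_eq_square power_add mult_2 numeral_Bit0 one_add_one power_one_right semiring_norm(83))
qed

text \<open>A uniformly random subset I of V contains i and misses j with probability 1/4. Hence the
  off-diagonal form is the mean over I of four times its part with i in I and j outside, and
  Jensen's inequality for exp applies. In each term the two groups of variables are disjoint, hence
  independent under a product measure.\<close>

lemma exp_offdiag_le_decoupled:
  fixes A :: "'i \<Rightarrow> 'i \<Rightarrow> real"
  assumes "finite V"
  shows "exp (\<Sum>i\<in>V. \<Sum>j\<in>V-{i}. A i j * x i * x j)
    \<le> (\<Sum>I\<in>Pow V. (1 / 2 ^ card V) * exp (\<Sum>i\<in>I. \<Sum>j\<in>V-I. 4 * A i j * x i * x j))"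
proof -
  have inner: "(\<Sum>i\<in>I. \<Sum>j\<in>V-I. 4 * A i j * x i * x j)
     = (\<Sum>i\<in>V. \<Sum>j\<in>V-{i}. if i \<in> I \<and> j \<notin> I then 4 * A i j * x i * x j else 0)" if "I \<subseteq> V" for I
  proof -
    have "(\<Sum>i\<in>V. \<Sum>j\<in>V-{i}. if i \<in> I \<and> j \<notin> I then 4 * A i j * x i * x j else 0)
       = (\<Sum>i\<in>V. if i \<in> I then (\<Sum>j\<in>V-I. 4 * A i j * x i * x j) else 0)"
    proof (intro sum.cong refl)
      fix i
      show "(\<Sum>j\<in>V-{i}. if i \<in> I \<and> j \<notin> I then 4 * A i j * x i * x j else 0)
        = (if i \<in> I then (\<Sum>j\<in>V-I. 4 * A i j * x i * x j) else 0)"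
        using assms by (auto simp: sum.If_cases intro!: sum.cong)
    qed
    also have "\<dots> = (\<Sum>i\<in>I. \<Sum>j\<in>V-I. 4 * A i j * x i * x j)"
      using that assms by (simp add: sum.If_cases Int_absorb1)
    finally show ?thesis ..
  qed
  have "(\<Sum>I\<in>Pow V. (1 / 2 ^ card V) * (\<Sum>i\<in>I. \<Sum>j\<in>V-I. 4 * A i j * x i * x j))
     = (\<Sum>I\<in>Pow V. \<Sum>i\<in>V. \<Sum>j\<in>V-{i}. (1 / 2 ^ card V) * (if i \<in> I \<and> j \<notin> I then 4 * A i j * x i * x j else 0))"
    by (intro sum.cong refl) (simp add: inner sum_distrib_left)
  also have "\<dots> = (\<Sum>i\<in>V. \<Sum>j\<in>V-{i}. \<Sum>I\<in>Pow V. (1 / 2 ^ card V) * (if i \<in> I \<and> j \<notin> I then 4 * A i j * x i * x j else 0))"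
    by (subst sum.swap, intro sum.cong refl, rule sum.swap)
  also have "\<dots> = (\<Sum>i\<in>V. \<Sum>j\<in>V-{i}. A i j * x i * x j)"
  proof (intro sum.cong refl)
    fix i j assume ij: "i \<in> V" "j \<in> V - {i}"
    have "real (4 * card {I\<in>Pow V. i \<in> I \<and> j \<notin> I}) = 2 ^ card V"
      using card_separating_subsets[OF assms, of i j] ij by (metis DiffE insertI1 of_nat_numeral of_nat_power)
    then have c: "(1 / 2 ^ card V) * (real (card {I\<in>Pow V. i \<in> I \<and> j \<notin> I}) * (4 * A i j * x i * x j)) = A i j * x i * x j"
      by (simp add: field_simps)
    have "(\<Sum>I\<in>Pow V. (1 / 2 ^ card V) * (if i \<in> I \<and> j \<notin> I then 4 * A i j * x i * x j else 0))
      = (1 / 2 ^ card V) * (real (card {I\<in>Pow V. i \<in> I \<and> j \<notin> I}) * (4 * A i j * x i * x j))"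
      unfolding sum_distrib_left[symmetric] using assms
      by (subst sum.inter_filter[symmetric]) auto
    then show "(\<Sum>I\<in>Pow V. (1 / 2 ^ card V) * (if i \<in> I \<and> j \<notin> I then 4 * A i j * x i * x j else 0)) = A i j * x i * x j"
      using c by simp
  qed
  finally have eq: "(\<Sum>i\<in>V. \<Sum>j\<in>V-{i}. A i j * x i * x j)
     = (\<Sum>I\<in>Pow V. (1 / 2 ^ card V) * (\<Sum>i\<in>I. \<Sum>j\<in>V-I. 4 * A i j * x i * x j))" ..
  have "exp (\<Sum>I\<in>Pow V. (1 / 2 ^ card V) *\<^sub>R (\<Sum>i\<in>I. \<Sum>j\<in>V-I. 4 * A i j * x i * x j))
     \<le> (\<Sum>I\<in>Pow V. (1 / 2 ^ card V) * exp (\<Sum>i\<in>I. \<Sum>j\<in>V-I. 4 * A i j * x i * x j))"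
    by (rule convex_on_sum[OF _ _ exp_convex]) (use assms in \<open>auto simp: card_Pow\<close>)
  then show ?thesis unfolding eq by simp
qed

section \<open>Centered squares and the diagonal part\<close>

lemma subgaussian_exp_square:
  assumes sg: "subgaussian \<mu> K"
  shows "(\<integral>\<^sup>+x. ennreal (exp (x\<^sup>2 / (4 * K))) \<partial>\<mu>) \<le> ennreal (sqrt 2)"
proof -
  have [measurable_cong]: "sets \<mu> = sets borel" and p: "prob_space \<mu>" and K: "K > 0"
    using sg by (auto simp: subgaussian_def)
  let ?g = "std_normal_distribution"
  interpret PG: pair_sigma_finite \<mu> ?g
    by (intro pair_sigma_finite.intro prob_space_imp_sigma_finite p prob_space_std_normal)
  \<comment> \<open>Chosen so that exp(x^2/(4K)) is the Gaussian integral of exp(a x g). After the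
    exchange of integrals, the sub-Gaussian bound in x leaves exp(g^2/4), whose Gaussian integral is
    sqrt 2.\<close>
  define a where "a = 1 / sqrt (2 * K)"
  have a2: "a\<^sup>2 = 1 / (2 * K)" using K by (simp add: a_def power_divide)
  have "(\<integral>\<^sup>+x. ennreal (exp (x\<^sup>2 / (4 * K))) \<partial>\<mu>) = (\<integral>\<^sup>+x. \<integral>\<^sup>+g. ennreal (exp (a * x * g)) \<partial>?g \<partial>\<mu>)"
    using nn_integral_gauss_quadratic[of 0 "a * x" for x] a2
    by (intro nn_integral_cong) (simp add: power_mult_distrib)
  also have "\<dots> = (\<integral>\<^sup>+g. \<integral>\<^sup>+x. ennreal (exp (a * x * g)) \<partial>\<mu> \<partial>?g)"
    by (rule PG.Fubini'[symmetric]) measurable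
  also have "\<dots> \<le> (\<integral>\<^sup>+g. ennreal (exp (1/2 * g\<^sup>2 / 2 + 0 * g)) \<partial>?g)"
  proof (rule nn_integral_mono)
    fix g
    have "(\<integral>\<^sup>+x. ennreal (exp ((a * g) * x)) \<partial>\<mu>) \<le> ennreal (exp (K * (a * g)\<^sup>2 / 2))"
      using sg by (simp add: subgaussian_def)
    then show "(\<integral>\<^sup>+x. ennreal (exp (a * x * g)) \<partial>\<mu>) \<le> ennreal (exp (1/2 * g\<^sup>2 / 2 + 0 * g))"
      using K by (simp add: power_mult_distrib a2 mult.assoc mult.left_commute mult.commute[of g])
  qed
  also have "\<dots> = ennreal (sqrt 2)"
    by (subst nn_integral_gauss_quadratic) (auto simp: real_sqrt_divide)
  finally show ?thesis .
qed

lemma exp_le_quadratic: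
  fixes z :: real
  shows "exp z \<le> 1 + z + z\<^sup>2 * exp \<bar>z\<bar>"
proof (cases "z = 0")
  case False
  then obtain t where t: "\<bar>t\<bar> \<le> \<bar>z\<bar>" "exp z = (\<Sum>m<2. z ^ m / fact m) + exp t / fact 2 * z ^ 2"
    using Maclaurin_exp_le[of z 2] by auto
  have "exp t \<le> exp \<bar>z\<bar>" using t(1) by simp
  then have "exp t / 2 * z\<^sup>2 \<le> exp \<bar>z\<bar> * z\<^sup>2"
    using exp_gt_zero[of t] by (intro mult_right_mono zero_le_power2) linarith
  then show ?thesis using t(2) by (simp add: numeral_2_eq_2 mult.commute)
qed simp

text \<open>In exp z \<le> 1 + z + z^2 exp |z| with z = s (x^2 - v) the linear term has mean 0, and
  for small s the remainder is s^2 times a function dominated by exp(x^2/(4K)), which is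
  integrable.\<close>

lemma subgaussian_square:
  assumes sg: "subgaussian \<mu> K" and s2: "(\<integral>x. x\<^sup>2 \<partial>\<mu>) = v" and int: "integrable \<mu> (\<lambda>x. x\<^sup>2)"
  shows "\<exists>c>0. \<exists>D\<ge>0. \<forall>s. \<bar>s\<bar> \<le> c \<longrightarrow> (\<integral>\<^sup>+x. ennreal (exp (s * (x\<^sup>2 - v))) \<partial>\<mu>) \<le> ennreal (exp (D * s\<^sup>2))"
proof -
  have [measurable_cong]: "sets \<mu> = sets borel" and p: "prob_space \<mu>" and K: "K > 0"
    using sg by (auto simp: subgaussian_def)
  interpret prob_space \<mu> by fact
  have v: "v \<ge> 0" unfolding s2[symmetric] by simp
  \<comment> \<open>The available exponent 1/(4K) is 2c: one c absorbs the polynomial factor Y^2,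
    the other the factor exp |s Y|.\<close>
  define c where "c = 1 / (8 * K)"
  have c: "c > 0" "2 * c = 1 / (4 * K)" using K by (auto simp: c_def)
  define E where "E = 2 / c\<^sup>2 * exp (2 * c * v)"
  have E: "E \<ge> 0" by (simp add: E_def)
  define D where "D = E * sqrt 2"
  have pt: "exp (s * (x\<^sup>2 - v)) \<le> 1 + s * (x\<^sup>2 - v) + s\<^sup>2 * (E * exp (x\<^sup>2 / (4 * K)))" if s: "\<bar>s\<bar> \<le> c" for s x
  proof -
    define Y where "Y = x\<^sup>2 - v"
    have Y: "\<bar>Y\<bar> \<le> x\<^sup>2 + v" unfolding Y_def using v by (smt (verit) zero_le_power2)
    have "(c * \<bar>Y\<bar>)\<^sup>2 / 2 \<le> exp (c * \<bar>Y\<bar>)"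
      using exp_lower_Taylor_quadratic[of "c * \<bar>Y\<bar>"] c(1) by (smt (verit) mult_nonneg_nonneg abs_ge_zero)
    then have 1: "Y\<^sup>2 \<le> 2 / c\<^sup>2 * exp (c * \<bar>Y\<bar>)" using c(1) by (simp add: power_mult_distrib field_simps)
    have 2: "exp \<bar>s * Y\<bar> \<le> exp (c * \<bar>Y\<bar>)" using s by (simp add: abs_mult mult_right_mono)
    have "Y\<^sup>2 * exp \<bar>s * Y\<bar> \<le> (2 / c\<^sup>2 * exp (c * \<bar>Y\<bar>)) * exp (c * \<bar>Y\<bar>)"
      by (intro mult_mono 1 2) auto
    also have "\<dots> = 2 / c\<^sup>2 * exp (2 * c * \<bar>Y\<bar>)" by (simp add: mult_exp_exp)
    also have "\<dots> \<le> 2 / c\<^sup>2 * exp (2 * c * (x\<^sup>2 + v))" using Y c(1) by (intro mult_left_mono) auto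
    also have "\<dots> = E * exp (x\<^sup>2 / (4 * K))" unfolding E_def c(2) by (simp add: distrib_left exp_add add_divide_distrib)
    finally have "s\<^sup>2 * (Y\<^sup>2 * exp \<bar>s * Y\<bar>) \<le> s\<^sup>2 * (E * exp (x\<^sup>2 / (4 * K)))" by (intro mult_left_mono) auto
    then show ?thesis using exp_le_quadratic[of "s * Y"] unfolding Y_def by (simp add: power_mult_distrib mult.assoc)
  qed
  have fin: "integrable \<mu> (\<lambda>x. exp (x\<^sup>2 / (4 * K)))"
  proof (rule integrableI_nonneg)
    show "(\<integral>\<^sup>+x. ennreal (exp (x\<^sup>2 / (4 * K))) \<partial>\<mu>) < \<infinity>"
      using subgaussian_exp_square[OF sg] by (auto simp: top_unique less_top[symmetric])
  qed auto
  have le: "(\<integral>x. exp (x\<^sup>2 / (4 * K)) \<partial>\<mu>) \<le> sqrt 2"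
    using subgaussian_exp_square[OF sg] nn_integral_eq_integral[OF fin] by simp
  show ?thesis
  proof (rule exI[of _ c], intro conjI c(1), rule exI[of _ D], intro conjI allI impI)
    show "D \<ge> 0" using E by (simp add: D_def)
    fix s assume s: "\<bar>s\<bar> \<le> c"
    have i: "integrable \<mu> (\<lambda>x. 1 + s * (x\<^sup>2 - v) + s\<^sup>2 * (E * exp (x\<^sup>2 / (4 * K))))"
      using int fin by auto
    have "(\<integral>\<^sup>+x. ennreal (exp (s * (x\<^sup>2 - v))) \<partial>\<mu>) \<le> (\<integral>\<^sup>+x. ennreal (1 + s * (x\<^sup>2 - v) + s\<^sup>2 * (E * exp (x\<^sup>2 / (4 * K)))) \<partial>\<mu>)"
      using pt[OF s] by (intro nn_integral_mono ennreal_leI) auto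
    also have "\<dots> = ennreal (\<integral>x. 1 + s * (x\<^sup>2 - v) + s\<^sup>2 * (E * exp (x\<^sup>2 / (4 * K))) \<partial>\<mu>)"
      by (rule nn_integral_eq_integral[OF i]) (intro AE_I2 order_trans[OF exp_ge_zero pt[OF s]])
    also have "\<dots> \<le> ennreal (exp (D * s\<^sup>2))"
    proof (rule ennreal_leI)
    have "(\<integral>x. 1 + s * (x\<^sup>2 - v) + s\<^sup>2 * (E * exp (x\<^sup>2 / (4 * K))) \<partial>\<mu>) = 1 + s\<^sup>2 * (E * (\<integral>x. exp (x\<^sup>2 / (4 * K)) \<partial>\<mu>))"
      using int fin s2 by (simp add: prob_space)
    also have "\<dots> \<le> 1 + D * s\<^sup>2"
      unfolding D_def using mult_left_mono[OF mult_left_mono[OF le E], of "s\<^sup>2"] by (simp add: algebra_simps)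
    also have "\<dots> \<le> exp (D * s\<^sup>2)" by simp
    finally show "(\<integral>x. 1 + s * (x\<^sup>2 - v) + s\<^sup>2 * (E * exp (x\<^sup>2 / (4 * K))) \<partial>\<mu>) \<le> exp (D * s\<^sup>2)" .
    qed
    finally show "(\<integral>\<^sup>+x. ennreal (exp (s * (x\<^sup>2 - v))) \<partial>\<mu>) \<le> ennreal (exp (D * s\<^sup>2))" .
  qed
qed

lemma borel_measurable_bilinear:
  assumes "sets \<mu> = sets borel" "\<And>i. i \<in> I \<Longrightarrow> i \<in> V" "\<And>i j. i \<in> I \<Longrightarrow> j \<in> J i \<Longrightarrow> j \<in> V"
  shows "(\<lambda>x. ennreal (exp (\<Sum>i\<in>I. \<Sum>j\<in>J i. a i j * x i * x j))) \<in> borel_measurable (PiM V (\<lambda>_. \<mu>))"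
proof -
  have m: "(\<lambda>x. x i) \<in> borel_measurable (PiM V (\<lambda>_. \<mu>))" if "i \<in> V" for i
    using measurable_component_singleton[OF that, of "\<lambda>_. \<mu>"] assms(1) measurable_cong_sets by blast
  have "(\<lambda>x. \<Sum>i\<in>I. \<Sum>j\<in>J i. a i j * x i * x j) \<in> borel_measurable (PiM V (\<lambda>_. \<mu>))"
    using assms(2,3) by (intro borel_measurable_sum borel_measurable_times borel_measurable_const m) auto
  then show ?thesis by measurable
qed

text \<open>A block of A with rows in I and columns outside I has at most the operator norm and the
  Hilbert-Schmidt norm of A. So every subset I admits the same bound \<open>R\<close>, and averaging
  over I preserves it. The factor 4 of the decoupling becomes 16 after squaring.\<close>

lemma subgaussian_offdiag:
  fixes A :: "'i \<Rightarrow> 'i \<Rightarrow> real"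
  assumes sg: "subgaussian \<mu> K" and fin: "finite V"
    and op: "\<And>x. (\<Sum>i\<in>V. (\<Sum>j\<in>V. A i j * x j)\<^sup>2) \<le> \<rho>\<^sup>2 * (\<Sum>j\<in>V. (x j)\<^sup>2)"
    and small: "32 * K\<^sup>2 * \<rho>\<^sup>2 \<le> 1"
  shows "(\<integral>\<^sup>+x. ennreal (exp (\<Sum>i\<in>V. \<Sum>j\<in>V-{i}. A i j * x i * x j)) \<partial>PiM V (\<lambda>_. \<mu>))
    \<le> ennreal (exp (16 * K\<^sup>2 * (\<Sum>i\<in>V. \<Sum>j\<in>V. (A i j)\<^sup>2)))"
proof -
  have [measurable_cong]: "sets \<mu> = sets borel" and p: "prob_space \<mu>" and K: "K > 0"
    using sg by (auto simp: subgaussian_def)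
  interpret P: product_sigma_finite "\<lambda>_. \<mu>" by (rule product_sigma_finite_const[OF p])
  define R where "R = ennreal (exp (16 * K\<^sup>2 * (\<Sum>i\<in>V. \<Sum>j\<in>V. (A i j)\<^sup>2)))"
  have block: "(\<integral>\<^sup>+x. ennreal (exp (\<Sum>i\<in>I. \<Sum>j\<in>V-I. 4 * A i j * x i * x j)) \<partial>PiM V (\<lambda>_. \<mu>)) \<le> R"
    if I: "I \<in> Pow V" for I
  proof -
    have fI: "finite I" "finite (V - I)" "I \<inter> (V - I) = {}" "I \<union> (V - I) = V" using I fin finite_subset by auto
    have "(\<integral>\<^sup>+x. ennreal (exp (\<Sum>i\<in>I. \<Sum>j\<in>V-I. 4 * A i j * x i * x j)) \<partial>PiM V (\<lambda>_. \<mu>))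
      = (\<integral>\<^sup>+x. ennreal (exp (\<Sum>i\<in>I. \<Sum>j\<in>V-I. 4 * A i j * x i * x j)) \<partial>PiM (I \<union> (V - I)) (\<lambda>_. \<mu>))"
      using fI by simp
    also have "\<dots> = (\<integral>\<^sup>+x. \<integral>\<^sup>+y. ennreal (exp (\<Sum>i\<in>I. \<Sum>j\<in>V-I. 4 * A i j * merge I (V-I) (x, y) i * merge I (V-I) (x, y) j))
        \<partial>PiM (V - I) (\<lambda>_. \<mu>) \<partial>PiM I (\<lambda>_. \<mu>))"
      by (rule P.product_nn_integral_fold[OF fI(3,1,2)]) (intro borel_measurable_bilinear, use I \<open>sets \<mu> = sets borel\<close> in auto)
    also have "\<dots> = (\<integral>\<^sup>+x. \<integral>\<^sup>+y. ennreal (exp (\<Sum>i\<in>I. \<Sum>j\<in>V-I. 4 * A i j * x i * y j)) \<partial>PiM (V - I) (\<lambda>_. \<mu>) \<partial>PiM I (\<lambda>_. \<mu>))"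
      by (intro nn_integral_cong arg_cong[where f="\<lambda>z. ennreal (exp z)"] sum.cong) (auto simp: merge_def)
    also have "\<dots> \<le> ennreal (exp (K\<^sup>2 * (\<Sum>i\<in>I. \<Sum>j\<in>V-I. (4 * A i j)\<^sup>2)))"
    proof (rule subgaussian_bilinear[OF sg fI(1,2), where \<rho> = "4 * \<rho>"])
      fix x :: "'i \<Rightarrow> real"
      define y where "y j = (if j \<in> V - I then x j else 0)" for j
      have e: "(\<Sum>j\<in>V-I. 4 * A i j * x j) = 4 * (\<Sum>j\<in>V. A i j * y j)" for i
        unfolding sum_distrib_left using fin by (intro sum.mono_neutral_cong_left) (auto simp: y_def)
      have "(\<Sum>i\<in>I. (\<Sum>j\<in>V-I. 4 * A i j * x j)\<^sup>2) = 16 * (\<Sum>i\<in>I. (\<Sum>j\<in>V. A i j * y j)\<^sup>2)"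
        unfolding e by (simp add: power_mult_distrib sum_distrib_left[symmetric])
      also have "\<dots> \<le> 16 * (\<Sum>i\<in>V. (\<Sum>j\<in>V. A i j * y j)\<^sup>2)"
        using I fin by (intro mult_left_mono sum_mono2) auto
      also have "\<dots> \<le> 16 * (\<rho>\<^sup>2 * (\<Sum>j\<in>V. (y j)\<^sup>2))" using op[of y] by simp
      also have "(\<Sum>j\<in>V. (y j)\<^sup>2) = (\<Sum>j\<in>V-I. (x j)\<^sup>2)"
        using fin by (intro sum.mono_neutral_cong_right) (auto simp: y_def)
      finally show "(\<Sum>i\<in>I. (\<Sum>j\<in>V-I. 4 * A i j * x j)\<^sup>2) \<le> (4 * \<rho>)\<^sup>2 * (\<Sum>j\<in>V-I. (x j)\<^sup>2)"
        by (simp add: power_mult_distrib)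
    qed (use small in \<open>simp add: power_mult_distrib\<close>)
    also have "\<dots> \<le> R"
    proof -
      have "(\<Sum>i\<in>I. \<Sum>j\<in>V-I. (4 * A i j)\<^sup>2) = 16 * (\<Sum>i\<in>I. \<Sum>j\<in>V-I. (A i j)\<^sup>2)"
        by (simp add: power_mult_distrib sum_distrib_left)
      also have "(\<Sum>i\<in>I. \<Sum>j\<in>V-I. (A i j)\<^sup>2) \<le> (\<Sum>i\<in>V. \<Sum>j\<in>V-I. (A i j)\<^sup>2)"
        using I fin by (intro sum_mono2 sum_nonneg) auto
      also have "\<dots> \<le> (\<Sum>i\<in>V. \<Sum>j\<in>V. (A i j)\<^sup>2)"
        using I fin by (intro sum_mono sum_mono2) auto
      finally have "K\<^sup>2 * (\<Sum>i\<in>I. \<Sum>j\<in>V-I. (4 * A i j)\<^sup>2) \<le> K\<^sup>2 * (16 * (\<Sum>i\<in>V. \<Sum>j\<in>V. (A i j)\<^sup>2))"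
        by (intro mult_left_mono) auto
      then show ?thesis unfolding R_def by (intro ennreal_leI) (simp add: algebra_simps)
    qed
    finally show ?thesis .
  qed
  have "(\<integral>\<^sup>+x. ennreal (exp (\<Sum>i\<in>V. \<Sum>j\<in>V-{i}. A i j * x i * x j)) \<partial>PiM V (\<lambda>_. \<mu>))
    \<le> (\<integral>\<^sup>+x. (\<Sum>I\<in>Pow V. ennreal (1 / 2 ^ card V) * ennreal (exp (\<Sum>i\<in>I. \<Sum>j\<in>V-I. 4 * A i j * x i * x j))) \<partial>PiM V (\<lambda>_. \<mu>))"
    using exp_offdiag_le_decoupled[OF fin, of A]
    by (intro nn_integral_mono) (simp add: ennreal_mult'[symmetric] sum_ennreal ennreal_leI)
  also have "\<dots> = (\<Sum>I\<in>Pow V. ennreal (1 / 2 ^ card V) * (\<integral>\<^sup>+x. ennreal (exp (\<Sum>i\<in>I. \<Sum>j\<in>V-I. 4 * A i j * x i * x j)) \<partial>PiM V (\<lambda>_. \<mu>)))"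
  proof -
    have m: "(\<lambda>x. ennreal (exp (\<Sum>i\<in>I. \<Sum>j\<in>V-I. 4 * A i j * x i * x j))) \<in> borel_measurable (PiM V (\<lambda>_. \<mu>))"
      if "I \<in> Pow V" for I using that \<open>sets \<mu> = sets borel\<close> by (intro borel_measurable_bilinear) auto
    show ?thesis
      using m by (subst nn_integral_sum) (auto intro!: sum.cong nn_integral_cmult)
  qed
  also have "\<dots> \<le> (\<Sum>I\<in>Pow V. ennreal (1 / 2 ^ card V) * R)"
    by (intro sum_mono mult_left_mono block) auto
  also have "\<dots> = (\<Sum>I\<in>Pow V. ennreal (1 / 2 ^ card V)) * R" by (simp add: mult.assoc)
  also have "(\<Sum>I\<in>Pow V. ennreal (1 / 2 ^ card V)) = 1"
    using fin by (subst sum_ennreal) (auto simp: card_Pow)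
  finally show ?thesis by (simp add: R_def)
qed

text \<open>The centered form is the sum of its diagonal part \<open>X\<close>, a sum of independent
  terms, and its off-diagonal part \<open>Y\<close>. These depend on each other; Cauchy-Schwarz
  separates them at the price of replacing t by 2t. The constants do not depend on V, on A or on
  t.\<close>

theorem hanson_wright:
  assumes sg: "subgaussian \<mu> K" and s2: "(\<integral>x. x\<^sup>2 \<partial>\<mu>) = v" and int: "integrable \<mu> (\<lambda>x. x\<^sup>2)"
  obtains c C where "c > 0" "C > 0"
    "\<And>(V :: 'i set) A \<rho> t. \<lbrakk>finite V; \<And>x. (\<Sum>i\<in>V. (\<Sum>j\<in>V. A i j * x j)\<^sup>2) \<le> \<rho>\<^sup>2 * (\<Sum>j\<in>V. (x j)\<^sup>2); 0 \<le> \<rho>; \<bar>t\<bar> * \<rho> \<le> c\<rbrakk> \<Longrightarrow>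
      (\<integral>\<^sup>+x. ennreal (exp (t * (\<Sum>i\<in>V. \<Sum>j\<in>V. A i j * (x i * x j - (if i = j then v else 0))))) \<partial>PiM V (\<lambda>_. \<mu>))
       \<le> ennreal (exp (C * t\<^sup>2 * (\<Sum>i\<in>V. \<Sum>j\<in>V. (A i j)\<^sup>2)))"
proof -
  have [measurable_cong]: "sets \<mu> = sets borel" and p: "prob_space \<mu>" and K: "K > 0"
    using sg by (auto simp: subgaussian_def)
  obtain c0 D where cD: "c0 > 0" "D \<ge> 0" and
    diag: "\<And>s. \<bar>s\<bar> \<le> c0 \<Longrightarrow> (\<integral>\<^sup>+x. ennreal (exp (s * (x\<^sup>2 - v))) \<partial>\<mu>) \<le> ennreal (exp (D * s\<^sup>2))"
    using subgaussian_square[OF assms] by blast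
  \<comment> \<open>With t doubled, the diagonal part asks for 2 |t| \<rho> \<le> c0 and the
    off-diagonal part for 32 K^2 (2 |t| \<rho>)^2 \<le> 1; the second holds since 128/144 \<le>
    1.\<close>
  define c where "c = min (c0 / 2) (1 / (12 * K))"
  define C where "C = 2 * D + 32 * K\<^sup>2 + 1"
  have c: "c > 0" using cD K by (auto simp: c_def)
  have C: "C > 0" using cD zero_le_power2[of K] unfolding C_def by linarith
  show ?thesis
  proof (rule that[OF c C])
    fix V :: "'i set" and A \<rho> t
    assume fin: "finite V" and op: "\<And>x. (\<Sum>i\<in>V. (\<Sum>j\<in>V. A i j * x j)\<^sup>2) \<le> \<rho>\<^sup>2 * (\<Sum>j\<in>V. (x j)\<^sup>2)"
      and rho: "0 \<le> \<rho>" and small: "\<bar>t\<bar> * \<rho> \<le> c"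
    define h where "h = (\<Sum>i\<in>V. \<Sum>j\<in>V. (A i j)\<^sup>2)"
    define X where "X x = (\<Sum>i\<in>V. t * A i i * ((x i)\<^sup>2 - v))" for x
    define Y where "Y x = (\<Sum>i\<in>V. \<Sum>j\<in>V-{i}. t * A i j * x i * x j)" for x
    have split: "t * (\<Sum>i\<in>V. \<Sum>j\<in>V. A i j * (x i * x j - (if i = j then v else 0))) = X x + Y x" for x
    proof -
      have "(\<Sum>j\<in>V. A i j * (x i * x j - (if i = j then v else 0))) = A i i * ((x i)\<^sup>2 - v) + (\<Sum>j\<in>V-{i}. A i j * x i * x j)"
        if "i \<in> V" for i
        unfolding sum.remove[OF fin that] by (auto simp: power2_eq_square mult.assoc intro!: arg_cong2[where f="(+)"] sum.cong split: if_splits)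
      then have "(\<Sum>i\<in>V. \<Sum>j\<in>V. A i j * (x i * x j - (if i = j then v else 0)))
        = (\<Sum>i\<in>V. A i i * ((x i)\<^sup>2 - v)) + (\<Sum>i\<in>V. \<Sum>j\<in>V-{i}. A i j * x i * x j)"
        unfolding sum.distrib[symmetric] by (intro sum.cong refl) auto
      then show ?thesis
        unfolding X_def Y_def by (simp only: distrib_left sum_distrib_left mult.assoc)
    qed
    \<comment> \<open>The operator bound is tested on the i-th unit vector.\<close>
    have entry: "\<bar>A i i\<bar> \<le> \<rho>" if i: "i \<in> V" for i
    proof -
      have "(A i i)\<^sup>2 = (\<Sum>j\<in>V. A i j * (if j = i then 1 else 0))\<^sup>2" using i fin by (simp add: if_distrib cong: if_cong)
      also have "\<dots> \<le> (\<Sum>k\<in>V. (\<Sum>j\<in>V. A k j * (if j = i then 1 else 0))\<^sup>2)"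
        using i fin by (intro member_le_sum) auto
      also have "\<dots> \<le> \<rho>\<^sup>2 * (\<Sum>j\<in>V. (if j = i then 1 else 0)\<^sup>2)" by (rule op)
      also have "(\<Sum>j\<in>V. (if j = i then 1 else (0::real))\<^sup>2) = 1" using i fin by (simp add: if_distrib[of "\<lambda>x. x\<^sup>2"] cong: if_cong)
      finally show ?thesis using rho by (simp add: abs_le_square_iff[symmetric])
    qed
    have iX: "(\<integral>\<^sup>+x. ennreal (exp (2 * X x)) \<partial>PiM V (\<lambda>_. \<mu>)) \<le> ennreal (exp (4 * D * t\<^sup>2 * h))"
    proof -
      have "(\<integral>\<^sup>+x. ennreal (exp (\<Sum>i\<in>V. (2 * t * A i i) * ((x i)\<^sup>2 - v))) \<partial>PiM V (\<lambda>_. \<mu>))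
        \<le> ennreal (exp (\<Sum>i\<in>V. D * (2 * t * A i i)\<^sup>2))"
      proof (rule nn_integral_exp_sum_PiM_le[OF p fin])
        fix i assume i: "i \<in> V"
        have "\<bar>2 * t * A i i\<bar> \<le> 2 * (\<bar>t\<bar> * \<rho>)" using entry[OF i] by (simp add: abs_mult mult_left_mono)
        also have "\<dots> \<le> c0" using small by (simp add: c_def)
        finally show "(\<integral>\<^sup>+x. ennreal (exp (2 * t * A i i * (x\<^sup>2 - v))) \<partial>\<mu>) \<le> ennreal (exp (D * (2 * t * A i i)\<^sup>2))"
          by (rule diag)
      qed measurable
      also have "(\<Sum>i\<in>V. D * (2 * t * A i i)\<^sup>2) = 4 * D * t\<^sup>2 * (\<Sum>i\<in>V. (A i i)\<^sup>2)"
        by (simp add: power_mult_distrib sum_distrib_left algebra_simps)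
      also have "ennreal (exp \<dots>) \<le> ennreal (exp (4 * D * t\<^sup>2 * h))"
      proof -
        have "(\<Sum>i\<in>V. (A i i)\<^sup>2) \<le> h" unfolding h_def using fin by (intro sum_mono member_le_sum) auto
        then show ?thesis using cD by (intro ennreal_leI) (simp add: mult_left_mono)
      qed
      finally show ?thesis unfolding X_def by (simp add: sum_distrib_left mult.assoc)
    qed
    have iY: "(\<integral>\<^sup>+x. ennreal (exp (2 * Y x)) \<partial>PiM V (\<lambda>_. \<mu>)) \<le> ennreal (exp (64 * K\<^sup>2 * t\<^sup>2 * h))"
    proof -
      have "(\<integral>\<^sup>+x. ennreal (exp (\<Sum>i\<in>V. \<Sum>j\<in>V-{i}. (2 * t * A i j) * x i * x j)) \<partial>PiM V (\<lambda>_. \<mu>))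
        \<le> ennreal (exp (16 * K\<^sup>2 * (\<Sum>i\<in>V. \<Sum>j\<in>V. (2 * t * A i j)\<^sup>2)))"
      proof (rule subgaussian_offdiag[OF sg fin, where \<rho> = "2 * \<bar>t\<bar> * \<rho>"])
        fix x :: "'i \<Rightarrow> real"
        have "(\<Sum>i\<in>V. (\<Sum>j\<in>V. 2 * t * A i j * x j)\<^sup>2) = (2 * t)\<^sup>2 * (\<Sum>i\<in>V. (\<Sum>j\<in>V. A i j * x j)\<^sup>2)"
          unfolding sum_distrib_left power_mult_distrib[symmetric] by (simp add: mult.assoc)
        also have "\<dots> \<le> (2 * t)\<^sup>2 * (\<rho>\<^sup>2 * (\<Sum>j\<in>V. (x j)\<^sup>2))" by (intro mult_left_mono op) auto
        finally show "(\<Sum>i\<in>V. (\<Sum>j\<in>V. 2 * t * A i j * x j)\<^sup>2) \<le> (2 * \<bar>t\<bar> * \<rho>)\<^sup>2 * (\<Sum>j\<in>V. (x j)\<^sup>2)"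
          by (simp add: power_mult_distrib)
      next
        have "\<bar>t\<bar> * \<rho> \<le> 1 / (12 * K)" using small by (simp add: c_def)
        then have "(\<bar>t\<bar> * \<rho>)\<^sup>2 \<le> (1 / (12 * K))\<^sup>2" using rho by (intro power_mono) auto
        then have "K\<^sup>2 * (\<bar>t\<bar> * \<rho>)\<^sup>2 \<le> K\<^sup>2 * (1 / (12 * K))\<^sup>2" by (intro mult_left_mono) auto
        also have "\<dots> = 1 / 144" using K by (simp add: power_divide power_mult_distrib)
        finally show "32 * K\<^sup>2 * (2 * \<bar>t\<bar> * \<rho>)\<^sup>2 \<le> 1" by (simp add: power_mult_distrib)
      qed
      also have "16 * K\<^sup>2 * (\<Sum>i\<in>V. \<Sum>j\<in>V. (2 * t * A i j)\<^sup>2) = 64 * K\<^sup>2 * t\<^sup>2 * h"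
        unfolding h_def by (simp add: power_mult_distrib sum_distrib_left algebra_simps)
      finally show ?thesis unfolding Y_def by (simp add: sum_distrib_left mult.assoc)
    qed
    define P where "P = 4 * D * t\<^sup>2 * h"
    define Q where "Q = 64 * K\<^sup>2 * t\<^sup>2 * h"
    have m: "(\<lambda>x. x i) \<in> borel_measurable (PiM V (\<lambda>_. \<mu>))" if "i \<in> V" for i
      using that by measurable
    have mX[measurable]: "X \<in> borel_measurable (PiM V (\<lambda>_. \<mu>))" and mY[measurable]: "Y \<in> borel_measurable (PiM V (\<lambda>_. \<mu>))"
      unfolding X_def[abs_def] Y_def[abs_def]
      by (intro borel_measurable_sum borel_measurable_times borel_measurable_power borel_measurable_diff
          borel_measurable_const m; auto)+
    \<comment> \<open>Cauchy-Schwarz in the pointwise form ab \<le> (a^2 + b^2)/2. The factors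
      exp(-P/2) and exp(-Q/2) are chosen so that both squares have integral at most 1.\<close>
    have pt: "exp (X x + Y x) \<le> exp ((P + Q) / 2) / 2 * (exp (- P) * exp (2 * X x) + exp (- Q) * exp (2 * Y x))" for x
    proof -
      define a where "a = exp (X x - P / 2)"
      define b where "b = exp (Y x - Q / 2)"
      have "a * b \<le> (a\<^sup>2 + b\<^sup>2) / 2" using sum_squares_bound[of a b] by simp
      then have "exp ((P + Q) / 2) * (a * b) \<le> exp ((P + Q) / 2) * ((a\<^sup>2 + b\<^sup>2) / 2)" by simp
      moreover have "exp ((P + Q) / 2) * (a * b) = exp (X x + Y x)"
        unfolding a_def b_def mult_exp_exp by (simp add: field_simps)
      moreover have "a\<^sup>2 = exp (- P) * exp (2 * X x)" "b\<^sup>2 = exp (- Q) * exp (2 * Y x)"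
        unfolding a_def b_def mult_exp_exp exp_double[symmetric] by (simp_all add: algebra_simps)
      ultimately show ?thesis by simp
    qed
    have E: "ennreal c * (ennreal p * ennreal a + ennreal q * ennreal b) = ennreal (c * (p * a + q * b))"
      if "0 \<le> c" "0 \<le> p" "0 \<le> a" "0 \<le> q" "0 \<le> b" for a b c p q
      using that by (simp add: ennreal_mult ennreal_plus)
    have "(\<integral>\<^sup>+x. ennreal (exp (X x + Y x)) \<partial>PiM V (\<lambda>_. \<mu>))
      \<le> (\<integral>\<^sup>+x. ennreal (exp ((P + Q) / 2) / 2) * (ennreal (exp (- P)) * ennreal (exp (2 * X x)) + ennreal (exp (- Q)) * ennreal (exp (2 * Y x))) \<partial>PiM V (\<lambda>_. \<mu>))"
    proof (intro nn_integral_mono)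
      fix x
      have "ennreal (exp ((P + Q) / 2) / 2) * (ennreal (exp (- P)) * ennreal (exp (2 * X x)) + ennreal (exp (- Q)) * ennreal (exp (2 * Y x)))
        = ennreal (exp ((P + Q) / 2) / 2 * (exp (- P) * exp (2 * X x) + exp (- Q) * exp (2 * Y x)))"
        by (simp only: E exp_ge_zero divide_nonneg_nonneg zero_le_numeral)
      then show "ennreal (exp (X x + Y x)) \<le> ennreal (exp ((P + Q) / 2) / 2) * (ennreal (exp (- P)) * ennreal (exp (2 * X x)) + ennreal (exp (- Q)) * ennreal (exp (2 * Y x)))"
        by (simp only: ennreal_leI[OF pt])
    qed
    also have "\<dots> = ennreal (exp ((P + Q) / 2) / 2) * (ennreal (exp (- P)) * (\<integral>\<^sup>+x. ennreal (exp (2 * X x)) \<partial>PiM V (\<lambda>_. \<mu>))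
        + ennreal (exp (- Q)) * (\<integral>\<^sup>+x. ennreal (exp (2 * Y x)) \<partial>PiM V (\<lambda>_. \<mu>)))"
      by (simp add: nn_integral_cmult nn_integral_add)
    also have "\<dots> \<le> ennreal (exp ((P + Q) / 2) / 2) * (ennreal (exp (- P)) * ennreal (exp P) + ennreal (exp (- Q)) * ennreal (exp Q))"
      using iX iY unfolding P_def Q_def by (intro mult_left_mono add_mono) auto
    also have "\<dots> = ennreal (exp ((P + Q) / 2))"
    proof -
      have "ennreal (exp ((P + Q) / 2) / 2) * (ennreal (exp (- P)) * ennreal (exp P) + ennreal (exp (- Q)) * ennreal (exp Q))
        = ennreal (exp ((P + Q) / 2) / 2 * (exp (- P) * exp P + exp (- Q) * exp Q))"
        by (simp only: E exp_ge_zero divide_nonneg_nonneg zero_le_numeral)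
      also have "exp ((P + Q) / 2) / 2 * (exp (- P) * exp P + exp (- Q) * exp Q) = exp ((P + Q) / 2)"
        by (simp add: mult_exp_exp)
      finally show ?thesis .
    qed
    also have "\<dots> \<le> ennreal (exp (C * t\<^sup>2 * h))"
    proof -
      have h: "h \<ge> 0" unfolding h_def by (intro sum_nonneg) auto
      have "(P + Q) / 2 = (C - 1) * (t\<^sup>2 * h)" unfolding P_def Q_def C_def by (simp add: algebra_simps)
      also have "\<dots> \<le> C * (t\<^sup>2 * h)" using h by (intro mult_right_mono) auto
      finally show ?thesis by (intro ennreal_leI) (simp add: mult.assoc)
    qed
    finally show "(\<integral>\<^sup>+x. ennreal (exp (t * (\<Sum>i\<in>V. \<Sum>j\<in>V. A i j * (x i * x j - (if i = j then v else 0))))) \<partial>PiM V (\<lambda>_. \<mu>))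
       \<le> ennreal (exp (C * t\<^sup>2 * (\<Sum>i\<in>V. \<Sum>j\<in>V. (A i j)\<^sup>2)))"
      unfolding split h_def .
  qed
qed

section \<open>The Gaertner-Ellis theorem for a quadratic limit\<close>

lemma gaussian_rate_nonneg: "0 \<le> gaussian_rate S z"
  unfolding gaussian_rate_def by (rule SUP_upper2[of 0]) (auto simp: zero_ereal_def)

lemma closed_gaussian_rate: "closed {z. gaussian_rate S z \<le> c}"
proof -
  have "{z. gaussian_rate S z \<le> c} = (\<Inter>v. {z. ereal (v \<bullet> z - 1 / 2 * (v \<bullet> (S *v v))) \<le> c})"
    unfolding gaussian_rate_def by (auto simp: SUP_le_iff)
  moreover have "closed {z. ereal (v \<bullet> z - 1 / 2 * (v \<bullet> (S *v v))) \<le> c}" for v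
    by (intro closed_Collect_le continuous_on_ereal continuous_intros)
  ultimately show ?thesis by auto
qed

lemma elog_le_ereal:
  assumes "0 \<le> p" "p \<le> exp x" shows "elog p \<le> ereal x"
proof (cases "p = 0")
  case False
  then have "ln p \<le> ln (exp x)" using assms by (subst ln_le_cancel_iff) auto
  then show ?thesis using False by (simp add: elog_def)
qed (simp add: elog_def)

lemma elog_ge_ereal: "exp x \<le> p \<Longrightarrow> ereal x \<le> elog p"
  by (smt (verit) elog_def ereal_less_eq(3) exp_gt_zero ln_ge_iff)

lemma (in prob_space) expectation_exp_pos:
  assumes "integrable M (\<lambda>x. exp (h x :: real))"
  shows "0 < expectation (\<lambda>x. exp (h x))"
proof -
  have "expectation (\<lambda>x. exp (h x)) \<noteq> 0"
  proof
    assume "expectation (\<lambda>x. exp (h x)) = 0"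
    then have "AE x in M. exp (h x) = 0" using integral_nonneg_eq_0_iff_AE[OF assms] by simp
    then show False by simp
  qed
  then show ?thesis using integral_nonneg_AE[where M = M and f = "\<lambda>x. exp (h x)"] by (simp add: less_le)
qed

text \<open>Integrability is asked for large n only, with a threshold depending on v, since
  quadratic forms have exponential moments only near 0. It has to accompany \<open>cgf\<close>,
  because the expectation of a non-integrable function is 0 by default.\<close>

locale quadratic_cgf = prob_space M for M :: "'a measure" +
  fixes Z :: "nat \<Rightarrow> 'a \<Rightarrow> real^'n" and s :: "nat \<Rightarrow> real" and S :: "real^'n^'n"
  assumes Z_meas [measurable]: "\<And>n. Z n \<in> borel_measurable M"
    and s_lim: "filterlim s at_top sequentially"
    and int: "\<And>v. eventually (\<lambda>n. integrable M (\<lambda>\<omega>. exp (s n * (v \<bullet> Z n \<omega>)))) sequentially"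
    and cgf: "\<And>v. (\<lambda>n. ln (expectation (\<lambda>\<omega>. exp (s n * (v \<bullet> Z n \<omega>)))) / s n) \<longlonglongrightarrow> 1 / 2 * (v \<bullet> (S *v v))"
    and sym: "\<And>v w. v \<bullet> (S *v w) = w \<bullet> (S *v v)"
    and psd: "\<And>v. 0 \<le> v \<bullet> (S *v v)"
begin

lemma s_pos: "eventually (\<lambda>n. s n > 0) sequentially"
  using s_lim by (simp add: filterlim_at_top_dense)

lemma exp_moment_pos:
  assumes "integrable M (\<lambda>\<omega>. exp (s n * (v \<bullet> Z n \<omega>)))"
  shows "0 < expectation (\<lambda>\<omega>. exp (s n * (v \<bullet> Z n \<omega>)))"
  using assms by (rule expectation_exp_pos)

lemma exp_moment_bounds:
  assumes "\<epsilon> > 0"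
  shows "eventually (\<lambda>n. integrable M (\<lambda>\<omega>. exp (s n * (v \<bullet> Z n \<omega>))) \<and> s n > 0 \<and>
      expectation (\<lambda>\<omega>. exp (s n * (v \<bullet> Z n \<omega>))) \<le> exp (s n * (1 / 2 * (v \<bullet> (S *v v)) + \<epsilon>)) \<and>
      exp (s n * (1 / 2 * (v \<bullet> (S *v v)) - \<epsilon>)) \<le> expectation (\<lambda>\<omega>. exp (s n * (v \<bullet> Z n \<omega>)))) sequentially"
proof -
  have "eventually (\<lambda>n. dist (ln (expectation (\<lambda>\<omega>. exp (s n * (v \<bullet> Z n \<omega>)))) / s n) (1 / 2 * (v \<bullet> (S *v v))) < \<epsilon>) sequentially"
    using tendstoD[OF cgf assms] .
  then show ?thesis
    using int[of v] s_pos
  proof eventually_elim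
    case (elim n)
    define E where "E = expectation (\<lambda>\<omega>. exp (s n * (v \<bullet> Z n \<omega>)))"
    define q where "q = 1 / 2 * (v \<bullet> (S *v v))"
    have E: "E > 0" unfolding E_def by (rule exp_moment_pos[OF elim(2)])
    have "\<bar>ln E / s n - q\<bar> < \<epsilon>" using elim(1) by (simp add: E_def q_def dist_real_def)
    then have "q - \<epsilon> \<le> ln E / s n" "ln E / s n \<le> q + \<epsilon>" by linarith+
    then have "s n * (q - \<epsilon>) \<le> ln E" "ln E \<le> s n * (q + \<epsilon>)"
      using elim(3) by (simp_all add: field_simps)
    then have "exp (s n * (q - \<epsilon>)) \<le> E" "E \<le> exp (s n * (q + \<epsilon>))"
      using E by (metis exp_le_cancel_iff exp_ln)+
    then show ?case using elim unfolding E_def q_def by simp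
  qed
qed

text \<open>Exponential Chebyshev inequality under the law tilted by v: where w . Z \<ge> x, the
  factor exp(s r (w . Z - x)) is at least 1. The case v = 0, r = 1 serves the upper bound, the
  general case shows that the tilted law concentrates.\<close>

lemma tilted_half_space:
  assumes "\<epsilon> > 0" "r \<ge> 0"
  shows "eventually (\<lambda>n. expectation (\<lambda>\<omega>. exp (s n * (v \<bullet> Z n \<omega>)) * indicator {x..} (w \<bullet> Z n \<omega>))
      \<le> exp (s n * (1 / 2 * ((v + r *\<^sub>R w) \<bullet> (S *v (v + r *\<^sub>R w))) - r * x + \<epsilon>))) sequentially"
  using exp_moment_bounds[OF assms(1), of "v + r *\<^sub>R w"] exp_moment_bounds[OF assms(1), of v]
proof eventually_elim
  case (elim n)
  have i: "integrable M (\<lambda>\<omega>. exp (s n * (v \<bullet> Z n \<omega>)) * indicator {x..} (w \<bullet> Z n \<omega>))"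
    by (rule Bochner_Integration.integrable_bound[of M "\<lambda>\<omega>. exp (s n * (v \<bullet> Z n \<omega>))"])
      (use elim in \<open>auto simp: indicator_def\<close>)
  have "expectation (\<lambda>\<omega>. exp (s n * (v \<bullet> Z n \<omega>)) * indicator {x..} (w \<bullet> Z n \<omega>))
      \<le> expectation (\<lambda>\<omega>. exp (- (s n * (r * x))) * exp (s n * ((v + r *\<^sub>R w) \<bullet> Z n \<omega>)))"
  proof (rule integral_mono[OF i])
    fix \<omega>
    show "exp (s n * (v \<bullet> Z n \<omega>)) * indicator {x..} (w \<bullet> Z n \<omega>)
      \<le> exp (- (s n * (r * x))) * exp (s n * ((v + r *\<^sub>R w) \<bullet> Z n \<omega>))"
    proof (cases "x \<le> w \<bullet> Z n \<omega>")
      case True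
      then have "s n * (r * x) \<le> s n * (r * (w \<bullet> Z n \<omega>))" using assms elim by (intro mult_left_mono) auto
      then show ?thesis using True by (simp add: mult_exp_exp inner_add_left algebra_simps)
    qed simp
  qed (use elim in auto)
  also have "\<dots> \<le> exp (- (s n * (r * x))) * exp (s n * (1 / 2 * ((v + r *\<^sub>R w) \<bullet> (S *v (v + r *\<^sub>R w))) + \<epsilon>))"
    using elim by simp
  also have "\<dots> = exp (s n * (1 / 2 * ((v + r *\<^sub>R w) \<bullet> (S *v (v + r *\<^sub>R w))) - r * x + \<epsilon>))"
    by (simp add: mult_exp_exp algebra_simps)
  finally show ?case .
qed

lemma half_space_prob:
  assumes "\<epsilon> > 0"
  shows "eventually (\<lambda>n. prob {\<omega>\<in>space M. x \<le> w \<bullet> Z n \<omega>} \<le> exp (s n * (1 / 2 * (w \<bullet> (S *v w)) - x + \<epsilon>))) sequentially"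
proof -
  have "expectation (\<lambda>\<omega>. indicator {x..} (w \<bullet> Z n \<omega>)) = prob {\<omega>\<in>space M. x \<le> w \<bullet> Z n \<omega>}" for n
  proof -
    have "expectation (\<lambda>\<omega>. indicator {x..} (w \<bullet> Z n \<omega>) :: real) = expectation (indicator {\<omega>\<in>space M. x \<le> w \<bullet> Z n \<omega>})"
      by (intro Bochner_Integration.integral_cong) (auto simp: indicator_def)
    then show ?thesis by simp
  qed
  then show ?thesis
    using tilted_half_space[OF assms, of 1 0 x w] by simp
qed

text \<open>For c below the infimum of the rate on the closure, A is covered by finitely many
  half-spaces each of which has exponential rate at least c. Compactness is needed only inside a
  cube, since coordinate half-spaces cover the outside.\<close>

lemma upper_bound:
  assumes A: "A \<in> sets borel"
  shows "limsup (\<lambda>n. elog (measure M {\<omega> \<in> space M. Z n \<omega> \<in> A}) / ereal (s n)) \<le> - (INF z\<in>closure A. gaussian_rate S z)"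
proof -
  have main: "limsup (\<lambda>n. elog (measure M {\<omega> \<in> space M. Z n \<omega> \<in> A}) / ereal (s n)) \<le> ereal (- c)"
    if c: "ereal c < (INF z\<in>closure A. gaussian_rate S z)" for c
  proof -
    \<comment> \<open>\<open>P\<close> collects the half-spaces whose Chebyshev bound decays at rate
      at least c. By definition of the rate as a supremum, every point of rate above c lies in one
      of them.\<close>
    define H where "H p = {z. snd p < fst p \<bullet> z}" for p :: "(real^'n) \<times> real"
    define P where "P = {p. c \<le> snd p - 1 / 2 * (fst p \<bullet> (S *v fst p))}"
    have openH: "open (H p)" for p unfolding H_def by (intro open_Collect_less continuous_intros)
    \<comment> \<open>R is so large that each half-space on which some coordinate exceeds R in
      absolute value belongs to \<open>P\<close>; these form \<open>P0\<close>.\<close>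
    define R where "R = 1 + \<bar>c\<bar> + (\<Sum>i\<in>Basis. 1 / 2 * (i \<bullet> (S *v i)))"
    define P0 where "P0 = (\<lambda>i. (i, R)) ` (Basis :: (real^'n) set) \<union> (\<lambda>i. (- i, R)) ` Basis"
    have Ri: "c \<le> R - 1 / 2 * (i \<bullet> (S *v i))" if "i \<in> Basis" for i
    proof -
      have "1 / 2 * (i \<bullet> (S *v i)) \<le> (\<Sum>i\<in>Basis. 1 / 2 * (i \<bullet> (S *v i)))"
        using that psd by (intro member_le_sum) auto
      then show ?thesis by (simp add: R_def)
    qed
    have neg: "S *v (- i) = - (S *v i)" for i
      using matrix_vector_mult_scaleR[of S "-1" i] by simp
    have P0: "P0 \<subseteq> P" "finite P0"
      using Ri by (auto simp: P0_def P_def neg)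
    define F where "F = closure A \<inter> cbox (- R *\<^sub>R One) (R *\<^sub>R One)"
    have "compact F" unfolding F_def by (intro closed_Int_compact) auto
    moreover have "F \<subseteq> (\<Union>p\<in>P. H p)"
    proof
      fix z assume "z \<in> F"
      then have "(INF z\<in>closure A. gaussian_rate S z) \<le> gaussian_rate S z" by (intro INF_lower) (auto simp: F_def)
      with c have "ereal c < gaussian_rate S z" by (rule less_le_trans)
      then obtain v where "c < v \<bullet> z - 1 / 2 * (v \<bullet> (S *v v))"
        unfolding gaussian_rate_def by (auto simp: less_SUP_iff)
      then have "(v, c + 1 / 2 * (v \<bullet> (S *v v))) \<in> P" "z \<in> H (v, c + 1 / 2 * (v \<bullet> (S *v v)))"
        by (auto simp: P_def H_def)
      then show "z \<in> (\<Union>p\<in>P. H p)" by blast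
    qed
    ultimately obtain P1 where P1: "P1 \<subseteq> P" "finite P1" "F \<subseteq> (\<Union>p\<in>P1. H p)"
      using compactE_image[of F P H] openH by metis
    define Q where "Q = P0 \<union> P1"
    have Q: "finite Q" "Q \<subseteq> P" using P0 P1 by (auto simp: Q_def)
    have cover: "A \<subseteq> (\<Union>p\<in>Q. H p)"
    proof
      fix z assume z: "z \<in> A"
      show "z \<in> (\<Union>p\<in>Q. H p)"
      proof (cases "z \<in> F")
        case True then show ?thesis using P1 by (auto simp: Q_def)
      next
        case False
        then have "z \<notin> cbox (- R *\<^sub>R One) (R *\<^sub>R One)" using z closure_subset by (auto simp: F_def)
        then obtain i where i: "i \<in> Basis" "\<not> (- R \<le> z \<bullet> i \<and> z \<bullet> i \<le> R)"
          by (auto simp: mem_box inner_sum_left_Basis)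
        then have "z \<in> H (i, R) \<or> z \<in> H (- i, R)"
          by (auto simp: H_def inner_commute)
        then show ?thesis using i(1) by (auto simp: Q_def P0_def)
      qed
    qed
    \<comment> \<open>The union bound costs a factor N, which half of e absorbs because s n tends to
      infinity.\<close>
    define N where "N = real (card Q) + 1"
    have N: "N > 0" by (simp add: N_def)
    show ?thesis
    proof (rule ereal_le_epsilon2)
      fix e :: real assume e: "0 < e"
      have "eventually (\<lambda>n. \<forall>p\<in>Q. prob {\<omega>\<in>space M. snd p \<le> fst p \<bullet> Z n \<omega>} \<le> exp (s n * (1 / 2 * (fst p \<bullet> (S *v fst p)) - snd p + e / 2))) sequentially"
        using Q e by (intro eventually_ball_finite ballI half_space_prob) auto
      moreover have "eventually (\<lambda>n. s n \<ge> 2 * ln N / e) sequentially"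
        using s_lim by (simp add: filterlim_at_top)
      ultimately have "eventually (\<lambda>n. elog (measure M {\<omega> \<in> space M. Z n \<omega> \<in> A}) / ereal (s n) \<le> ereal (- c + e)) sequentially"
        using s_pos
      proof eventually_elim
        case (elim n)
        have "prob {\<omega> \<in> space M. Z n \<omega> \<in> A} \<le> prob (\<Union>p\<in>Q. {\<omega>\<in>space M. snd p \<le> fst p \<bullet> Z n \<omega>})"
        proof (rule finite_measure_mono)
          show "{\<omega> \<in> space M. Z n \<omega> \<in> A} \<subseteq> (\<Union>p\<in>Q. {\<omega>\<in>space M. snd p \<le> fst p \<bullet> Z n \<omega>})"
            using cover by (force simp: H_def)
          show "(\<Union>p\<in>Q. {\<omega>\<in>space M. snd p \<le> fst p \<bullet> Z n \<omega>}) \<in> events"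
            using Q by (intro sets.finite_UN) auto
        qed
        also have "\<dots> \<le> (\<Sum>p\<in>Q. prob {\<omega>\<in>space M. snd p \<le> fst p \<bullet> Z n \<omega>})"
          using Q by (intro finite_measure_subadditive_finite) auto
        also have "\<dots> \<le> (\<Sum>p\<in>Q. exp (s n * (- c + e / 2)))"
        proof (intro sum_mono)
          fix p assume p: "p \<in> Q"
          then have "1 / 2 * (fst p \<bullet> (S *v fst p)) - snd p + e / 2 \<le> - c + e / 2"
            using Q by (auto simp: P_def)
          then have "s n * (1 / 2 * (fst p \<bullet> (S *v fst p)) - snd p + e / 2) \<le> s n * (- c + e / 2)"
            using elim by (intro mult_left_mono) auto
          then show "prob {\<omega>\<in>space M. snd p \<le> fst p \<bullet> Z n \<omega>} \<le> exp (s n * (- c + e / 2))"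
            using elim(1) p by (meson exp_le_cancel_iff order_trans)
        qed
        also have "\<dots> \<le> N * exp (s n * (- c + e / 2))" by (simp add: N_def)
        also have "\<dots> = exp (ln N + s n * (- c + e / 2))" using N by (simp add: exp_add)
        also have "\<dots> \<le> exp (s n * (- c + e))"
        proof -
          have "ln N \<le> s n * (e / 2)" using elim(2) e by (simp add: field_simps)
          then show ?thesis by (simp add: algebra_simps)
        qed
        finally have "elog (prob {\<omega> \<in> space M. Z n \<omega> \<in> A}) \<le> ereal (s n * (- c + e))"
          by (intro elog_le_ereal) auto
        then have "elog (prob {\<omega> \<in> space M. Z n \<omega> \<in> A}) / ereal (s n) \<le> ereal (s n * (- c + e)) / ereal (s n)"
          using elim by (intro ereal_divide_right_mono) auto
        then show ?case using elim by simp
      qed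
      then have "limsup (\<lambda>n. elog (measure M {\<omega> \<in> space M. Z n \<omega> \<in> A}) / ereal (s n)) \<le> ereal (- c + e)"
        by (rule Limsup_bounded)
      then show "limsup (\<lambda>n. elog (measure M {\<omega> \<in> space M. Z n \<omega> \<in> A}) / ereal (s n)) \<le> ereal (- c) + ereal e"
        by simp
    qed
  qed
  show ?thesis
  \<comment> \<open>Comparison with real upper bounds y treats a finite and an infinite infimum at
    once.\<close>
  proof (rule ereal_le_real)
    fix y assume "- (INF z\<in>closure A. gaussian_rate S z) \<le> ereal y"
    show "limsup (\<lambda>n. elog (measure M {\<omega> \<in> space M. Z n \<omega> \<in> A}) / ereal (s n)) \<le> ereal y"
    proof (rule ereal_le_epsilon2)
      fix e :: real assume e: "0 < e"
      have "- ereal y \<le> (INF z\<in>closure A. gaussian_rate S z)"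
        using \<open>- (INF z\<in>closure A. gaussian_rate S z) \<le> ereal y\<close> by (subst ereal_uminus_le_reorder)
      then have "ereal (- y - e) < (INF z\<in>closure A. gaussian_rate S z)"
        using e by (auto intro: order.strict_trans2[of "ereal (- y - e)" "- ereal y"])
      from main[OF this] show "limsup (\<lambda>n. elog (measure M {\<omega> \<in> space M. Z n \<omega> \<in> A}) / ereal (s n)) \<le> ereal y + ereal e"
        by (simp add: add.commute)
    qed
  qed
qed

text \<open>Under the law tilted by v, \<open>Z n\<close> concentrates at S v, the gradient of the
  quadratic limit at v: each of the finitely many half-spaces that bound a small cube around S v has
  exponentially small tilted mass. Near S v the density of the tilt is at most
  exp(\<open>c\<close>)/\<open>E\<close>, which turns tilted mass into probability.\<close>

lemma lower_bound_at:
  assumes A: "A \<in> sets borel" and v: "S *v v = z'" and d: "\<delta> > 0" "ball z' \<delta> \<subseteq> A" and e: "e > 0"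
  shows "ereal (- (1 / 2 * (v \<bullet> (S *v v))) - e) \<le> liminf (\<lambda>n. elog (measure M {\<omega> \<in> space M. Z n \<omega> \<in> A}) / ereal (s n))"
proof -
  define q where "q = 1 / 2 * (v \<bullet> (S *v v))"
  \<comment> \<open>Coordinates within h of those of S v force a distance below \<eta>, because D h
    < \<eta>. The number \<kappa> bounds w . S w for the unit directions w in \<open>W\<close>. The
    loss e is shared by |v| \<eta>, \<epsilon> and (ln 2)/s n, each at most e/3.\<close>
  define \<eta> where "\<eta> = min \<delta> (min 1 (e / (3 * (1 + norm v))))"
  define D where "D = real DIM(real^'n)"
  define h where "h = \<eta> / (D + 1)"
  define \<kappa> where "\<kappa> = 1 + (\<Sum>i\<in>Basis. i \<bullet> (S *v i))"
  define \<epsilon> where "\<epsilon> = h\<^sup>2 / (8 * \<kappa>)"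
  define W :: "(real^'n) set" where "W = Basis \<union> uminus ` Basis"
  have D: "D \<ge> 0" by (simp add: D_def)
  have nv: "1 + norm v > 0" using norm_ge_zero[of v] by linarith
  have \<eta>: "\<eta> > 0" "\<eta> \<le> \<delta>" "\<eta> \<le> 1" "\<eta> \<le> e / (3 * (1 + norm v))" using d e nv by (auto simp: \<eta>_def)
  have \<eta>v: "norm v * \<eta> \<le> e / 3" "\<eta> \<le> e / 3"
  proof -
    have "(1 + norm v) * \<eta> \<le> (1 + norm v) * (e / (3 * (1 + norm v)))" using \<eta>(4) nv by (intro mult_left_mono) auto
    also have "\<dots> = e / 3" using nv by (simp add: field_simps)
    finally have *: "\<eta> + norm v * \<eta> \<le> e / 3" by (simp add: algebra_simps)
    moreover have "0 \<le> norm v * \<eta>" using \<eta> by simp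
    ultimately show "norm v * \<eta> \<le> e / 3" "\<eta> \<le> e / 3" using \<eta>(1) by linarith+
  qed
  have h: "h > 0" "h \<le> \<eta>" "D * h < \<eta>" using \<eta> D by (auto simp: h_def field_simps)
  have neg: "S *v (- i) = - (S *v i)" for i
    using matrix_vector_mult_scaleR[of S "-1" i] by simp
  have \<kappa>: "\<kappa> \<ge> 1" unfolding \<kappa>_def using psd by (simp add: sum_nonneg)
  have W\<kappa>: "w \<bullet> (S *v w) \<le> \<kappa>" if "w \<in> W" for w
  proof -
    obtain i where i: "i \<in> Basis" "w = i \<or> w = - i" using \<open>w \<in> W\<close> by (auto simp: W_def)
    have "i \<bullet> (S *v i) \<le> (\<Sum>i\<in>Basis. i \<bullet> (S *v i))" using i psd by (intro member_le_sum) auto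
    then show ?thesis using i by (auto simp: \<kappa>_def neg)
  qed
  have \<epsilon>: "\<epsilon> > 0" "\<epsilon> \<le> e / 3"
  proof -
    show "\<epsilon> > 0" using h \<kappa> by (simp add: \<epsilon>_def)
    have "\<epsilon> \<le> h\<^sup>2 / 1" unfolding \<epsilon>_def using \<kappa> h by (intro divide_left_mono) auto
    also have "\<dots> \<le> h" using h \<eta> by (simp add: power2_eq_square mult_left_le)
    finally show "\<epsilon> \<le> e / 3" using h \<eta>v by linarith
  qed
  have finW: "finite W" by (simp add: W_def)
  \<comment> \<open>This r minimises r^2 \<kappa>/2 - r h; the minimum is -h^2/(2 \<kappa>) = -4
    \<epsilon>. Hence each half-space has tilted moment at most exp(s (q - 3 \<epsilon>)), against a
    total of at least exp(s (q - \<epsilon>)).\<close>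
  define r where "r = h / \<kappa>"
  have r: "r \<ge> 0" using h \<kappa> by (simp add: r_def)
  have expo: "1 / 2 * ((v + r *\<^sub>R w) \<bullet> (S *v (v + r *\<^sub>R w))) - r * (w \<bullet> z' + h) + \<epsilon> \<le> q - 3 * \<epsilon>" if "w \<in> W" for w
  proof -
    have "(v + r *\<^sub>R w) \<bullet> (S *v (v + r *\<^sub>R w)) = v \<bullet> (S *v v) + 2 * r * (w \<bullet> z') + r\<^sup>2 * (w \<bullet> (S *v w))"
      using sym[of v w] by (simp add: matrix_vector_right_distrib matrix_vector_mult_scaleR inner_add_left inner_add_right v[symmetric] power2_eq_square algebra_simps)
    then have "1 / 2 * ((v + r *\<^sub>R w) \<bullet> (S *v (v + r *\<^sub>R w))) - r * (w \<bullet> z' + h) + \<epsilon> = q + r\<^sup>2 * (w \<bullet> (S *v w)) / 2 - r * h + \<epsilon>"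
      by (simp add: q_def algebra_simps)
    also have "r\<^sup>2 * (w \<bullet> (S *v w)) \<le> r\<^sup>2 * \<kappa>" using W\<kappa>[OF that] by (intro mult_left_mono) auto
    also have "q + r\<^sup>2 * \<kappa> / 2 - r * h + \<epsilon> = q - 3 * \<epsilon>"
      unfolding r_def \<epsilon>_def using \<kappa> by (simp add: field_simps power2_eq_square)
    finally show ?thesis by simp
  qed
  have "eventually (\<lambda>n. \<forall>w\<in>W. expectation (\<lambda>\<omega>. exp (s n * (v \<bullet> Z n \<omega>)) * indicator {w \<bullet> z' + h..} (w \<bullet> Z n \<omega>))
      \<le> exp (s n * (1 / 2 * ((v + r *\<^sub>R w) \<bullet> (S *v (v + r *\<^sub>R w))) - r * (w \<bullet> z' + h) + \<epsilon>))) sequentially"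
    using finW by (intro eventually_ball_finite ballI tilted_half_space \<epsilon> r)
  moreover have "eventually (\<lambda>n. s n \<ge> ln (2 * (2 * D + 1)) / (2 * \<epsilon>)) sequentially"
    "eventually (\<lambda>n. s n \<ge> ln 2 / (e / 3)) sequentially"
    using s_lim by (auto simp: filterlim_at_top)
  ultimately have "eventually (\<lambda>n. ereal (- q - e) \<le> elog (measure M {\<omega> \<in> space M. Z n \<omega> \<in> A}) / ereal (s n)) sequentially"
    using exp_moment_bounds[OF \<epsilon>(1), of v]
  proof eventually_elim
    case (elim n)
    define E where "E = expectation (\<lambda>\<omega>. exp (s n * (v \<bullet> Z n \<omega>)))"
    define G where "G w \<omega> = exp (s n * (v \<bullet> Z n \<omega>)) * (indicator {w \<bullet> z' + h..} (w \<bullet> Z n \<omega>) :: real)" for w \<omega>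
    have sn: "s n > 0" and iE: "integrable M (\<lambda>\<omega>. exp (s n * (v \<bullet> Z n \<omega>)))" using elim by auto
    have El: "exp (s n * (q - \<epsilon>)) \<le> E" using elim by (simp add: E_def q_def)
    have Gm[measurable]: "G w \<in> borel_measurable M" for w unfolding G_def by measurable
    have iG: "integrable M (G w)" for w
      by (rule Bochner_Integration.integrable_bound[OF iE]) (auto simp: G_def indicator_def)
    have Gle: "expectation (G w) \<le> exp (s n * (q - 3 * \<epsilon>))" if "w \<in> W" for w
    proof -
      have "s n * (1 / 2 * ((v + r *\<^sub>R w) \<bullet> (S *v (v + r *\<^sub>R w))) - r * (w \<bullet> z' + h) + \<epsilon>) \<le> s n * (q - 3 * \<epsilon>)"
        using expo[OF that] sn by (intro mult_left_mono) auto
      then show ?thesis using elim(1) that unfolding G_def by (meson exp_le_cancel_iff order_trans)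
    qed
    have cardW: "real (card W) \<le> 2 * D"
    proof -
      have "card W \<le> card (Basis :: (real^'n) set) + card (uminus ` (Basis :: (real^'n) set))" unfolding W_def by (rule card_Un_le)
      also have "\<dots> \<le> DIM(real^'n) + DIM(real^'n)" by (intro add_mono card_image_le) auto
      finally show ?thesis unfolding D_def by linarith
    qed
    have "(\<Sum>w\<in>W. expectation (G w)) \<le> (\<Sum>w\<in>W. exp (s n * (q - 3 * \<epsilon>)))" by (intro sum_mono Gle)
    also have "\<dots> \<le> (2 * D + 1) * exp (s n * (q - 3 * \<epsilon>))" using cardW by (simp add: mult_right_mono)
    also have "\<dots> \<le> E / 2"
    proof -
      have "ln (2 * (2 * D + 1)) \<le> s n * (2 * \<epsilon>)" using elim(2) \<epsilon> by (simp add: field_simps)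
      then have "exp (ln (2 * (2 * D + 1))) \<le> exp (s n * (2 * \<epsilon>))" by (simp only: exp_le_cancel_iff)
      then have "2 * (2 * D + 1) \<le> exp (s n * (2 * \<epsilon>))" using D by (subst (asm) exp_ln) auto
      then have "2 * (2 * D + 1) * exp (s n * (q - 3 * \<epsilon>)) \<le> exp (s n * (2 * \<epsilon>)) * exp (s n * (q - 3 * \<epsilon>))"
        by (intro mult_right_mono) auto
      also have "\<dots> = exp (s n * (q - \<epsilon>))" by (simp add: mult_exp_exp algebra_simps)
      finally show ?thesis using El by (simp add: algebra_simps)
    qed
    finally have half: "(\<Sum>w\<in>W. expectation (G w)) \<le> E / 2" .
    define B where "B = {\<omega> \<in> space M. Z n \<omega> \<in> A}"
    have B[measurable]: "B \<in> events" unfolding B_def using A by measurable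
    \<comment> \<open>On the ball around S v, the inner product v . Z is at most v . S v + |v|
      \<eta>, and v . S v = 2q.\<close>
    define c where "c = s n * (2 * q + norm v * \<eta>)"
    have pt: "exp (s n * (v \<bullet> Z n \<omega>)) \<le> exp c * indicator B \<omega> + (\<Sum>w\<in>W. G w \<omega>)" if \<omega>: "\<omega> \<in> space M" for \<omega>
    proof (cases "\<exists>w\<in>W. w \<bullet> z' + h \<le> w \<bullet> Z n \<omega>")
      case True
      then obtain w where w: "w \<in> W" "w \<bullet> z' + h \<le> w \<bullet> Z n \<omega>" by blast
      have "exp (s n * (v \<bullet> Z n \<omega>)) = G w \<omega>" using w by (simp add: G_def)
      also have "\<dots> \<le> (\<Sum>w\<in>W. G w \<omega>)" using w finW by (intro member_le_sum) (auto simp: G_def)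
      also have "\<dots> \<le> exp c * indicator B \<omega> + (\<Sum>w\<in>W. G w \<omega>)" by simp
      finally show ?thesis .
    next
      case False
      have "\<bar>(Z n \<omega> - z') \<bullet> i\<bar> \<le> h" if "i \<in> Basis" for i
      proof -
        have "i \<in> W" "- i \<in> W" using that by (auto simp: W_def)
        then have "i \<bullet> Z n \<omega> < i \<bullet> z' + h" "(- i) \<bullet> Z n \<omega> < (- i) \<bullet> z' + h" using False by force+
        then show ?thesis by (simp add: inner_diff_right inner_commute[of _ i] abs_le_iff)
      qed
      then have "(\<Sum>i\<in>Basis. \<bar>(Z n \<omega> - z') \<bullet> i\<bar>) \<le> (\<Sum>i\<in>(Basis :: (real^'n) set). h)" by (rule sum_mono)
      then have "norm (Z n \<omega> - z') \<le> D * h" using norm_le_l1[of "Z n \<omega> - z'"] by (simp add: D_def)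
      then have close: "norm (Z n \<omega> - z') < \<eta>" using h by linarith
      then have "Z n \<omega> \<in> ball z' \<delta>" using \<eta> by (simp add: dist_norm norm_minus_commute)
      then have "\<omega> \<in> B" using d \<omega> by (auto simp: B_def)
      moreover have "v \<bullet> Z n \<omega> \<le> 2 * q + norm v * \<eta>"
      proof -
        have "v \<bullet> (Z n \<omega> - z') \<le> norm v * norm (Z n \<omega> - z')" by (rule norm_cauchy_schwarz)
        also have "\<dots> \<le> norm v * \<eta>" using close by (intro mult_left_mono) auto
        finally show ?thesis unfolding q_def v by (simp add: inner_diff_right)
      qed
      then have "exp (s n * (v \<bullet> Z n \<omega>)) \<le> exp c" unfolding c_def using sn by (simp add: mult_left_mono)
      moreover have "0 \<le> (\<Sum>w\<in>W. G w \<omega>)" by (intro sum_nonneg) (auto simp: G_def)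
      ultimately show ?thesis by (simp del: exp_le_cancel_iff)
    qed
    have iB: "integrable M (indicat_real B)" by (rule integrable_real_indicator[OF B]) (simp add: less_top[symmetric])
    have "E \<le> expectation (\<lambda>\<omega>. exp c * indicator B \<omega> + (\<Sum>w\<in>W. G w \<omega>))"
      unfolding E_def using iE iG pt iB
      by (intro integral_mono Bochner_Integration.integrable_add Bochner_Integration.integrable_sum integrable_mult_right) auto
    also have "\<dots> = exp c * prob B + (\<Sum>w\<in>W. expectation (G w))"
      using iG iB by (subst Bochner_Integration.integral_add) (auto intro!: Bochner_Integration.integrable_sum Bochner_Integration.integral_sum)
    finally have "E / 2 \<le> exp c * prob B" using half by linarith
    then have "exp (s n * (q - \<epsilon>)) / 2 \<le> exp c * prob B" using El by linarith
    then have "exp (- c) * (exp (s n * (q - \<epsilon>)) / 2) \<le> exp (- c) * (exp c * prob B)" by (intro mult_left_mono) auto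
    also have "\<dots> = prob B" by (simp add: mult.assoc[symmetric] mult_exp_exp)
    also have "exp (- c) * (exp (s n * (q - \<epsilon>)) / 2) = exp (- c + s n * (q - \<epsilon>) - ln 2)"
    proof -
      have "exp (- ln 2) = (1 / 2 :: real)" by (simp add: exp_minus)
      then show ?thesis by (simp only: exp_add diff_conv_add_uminus)
    qed
    finally have pB: "exp (- c + s n * (q - \<epsilon>) - ln 2) \<le> prob B" .
    have "s n * (- q - e) \<le> - c + s n * (q - \<epsilon>) - ln 2"
    proof -
      have l2: "ln 2 \<le> s n * (e / 3)" using elim(3) e by (simp add: field_simps)
      have "s n * (norm v * \<eta> + \<epsilon>) \<le> s n * (e / 3 + e / 3)" using \<eta>v \<epsilon> sn by (intro mult_left_mono) auto
      then show ?thesis using l2 unfolding c_def by (simp add: algebra_simps)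
    qed
    then have "exp (s n * (- q - e)) \<le> prob B" using pB by (meson exp_le_cancel_iff order_trans)
    then have "ereal (s n * (- q - e)) \<le> elog (prob B)" by (rule elog_ge_ereal)
    then have "ereal (s n * (- q - e)) / ereal (s n) \<le> elog (prob B) / ereal (s n)"
      using sn by (intro ereal_divide_right_mono) auto
    then show ?case using sn by (simp add: B_def)
  qed
  then show ?thesis unfolding q_def by (intro Liminf_bounded)
qed

text \<open>S may be singular, so instead of S v = z the equation (S + d) v = z is solved; S + d is
  injective because S is positive semidefinite. The finite rate of z bounds d |v|^2, so S v is as
  close to z as desired when d is small, and its rate is no larger.\<close>

lemma lower_bound:
  assumes A: "A \<in> sets borel"
  shows "- (INF z\<in>interior A. gaussian_rate S z) \<le> liminf (\<lambda>n. elog (measure M {\<omega> \<in> space M. Z n \<omega> \<in> A}) / ereal (s n))"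
proof -
  define L where "L = liminf (\<lambda>n. elog (measure M {\<omega> \<in> space M. Z n \<omega> \<in> A}) / ereal (s n))"
  have "- gaussian_rate S z \<le> L" if z: "z \<in> interior A" for z
  proof (cases "gaussian_rate S z")
    case (real r)
    have r: "v \<bullet> z - 1 / 2 * (v \<bullet> (S *v v)) \<le> r" for v
    proof -
      have "ereal (v \<bullet> z - 1 / 2 * (v \<bullet> (S *v v))) \<le> gaussian_rate S z"
        unfolding gaussian_rate_def by (rule SUP_upper) simp
      then show ?thesis using real by simp
    qed
    have r0: "r \<ge> 0" using r[of 0] by simp
    obtain \<delta> where \<delta>: "\<delta> > 0" "ball z \<delta> \<subseteq> A" using z by (auto simp: mem_interior)
    \<comment> \<open>Since d |v|^2 \<le> r, the distance of z from S v satisfies (d |v|)^2 \<le> d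
      r < (\<delta>/2)^2. The summand 1 keeps the denominator positive when r = 0.\<close>
    define d where "d = (\<delta> / 2)\<^sup>2 / (2 * r + 1)"
    have d: "d > 0" using \<delta> r0 by (simp add: d_def)
    have "inj (\<lambda>v. S *v v + d *\<^sub>R v)"
    proof -
      have lin: "linear (\<lambda>v. S *v v + d *\<^sub>R v)"
        by (intro linear_compose_add linear_scale_self matrix_vector_mul_linear) 
      have "v = 0" if "S *v v + d *\<^sub>R v = 0" for v
      proof -
        have "v \<bullet> (S *v v + d *\<^sub>R v) = 0" using that by simp
        then have "v \<bullet> (S *v v) + d * (v \<bullet> v) = 0" by (simp add: inner_add_right)
        moreover have "0 \<le> d * (v \<bullet> v)" using d by simp
        ultimately have "d * (v \<bullet> v) = 0" using psd[of v] by linarith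
        then show "v = 0" using d by simp
      qed
      then show ?thesis using linear_injective_0[OF lin] by blast
    qed
    moreover have lin: "linear (\<lambda>v. S *v v + d *\<^sub>R v)"
      by (intro linear_compose_add linear_scale_self matrix_vector_mul_linear)
    ultimately have "surj (\<lambda>v. S *v v + d *\<^sub>R v)" using linear_injective_imp_surjective by blast
    then obtain v where v: "z = S *v v + d *\<^sub>R v" by (meson surjD)
    have "v \<bullet> z = v \<bullet> (S *v v) + d * (norm v)\<^sup>2"
      unfolding v by (simp add: inner_add_right power2_norm_eq_inner)
    then have *: "1 / 2 * (v \<bullet> (S *v v)) + d * (norm v)\<^sup>2 \<le> r" using r[of v] by simp
    then have "d * (norm v)\<^sup>2 \<le> r" using psd[of v] by linarith
    then have "d * (d * (norm v)\<^sup>2) \<le> d * r" using d by (intro mult_left_mono) auto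
    also have "\<dots> < (\<delta> / 2)\<^sup>2"
    proof -
      have "r / (2 * r + 1) < 1" using r0 by simp
      then have "(\<delta> / 2)\<^sup>2 * (r / (2 * r + 1)) < (\<delta> / 2)\<^sup>2 * 1" using \<delta> by (intro mult_strict_left_mono) auto
      then show ?thesis by (simp add: d_def)
    qed
    finally have "(d * norm v)\<^sup>2 < (\<delta> / 2)\<^sup>2" by (simp add: power2_eq_square algebra_simps)
    then have dv: "d * norm v < \<delta> / 2" using \<delta> by (intro power_less_imp_less_base[of "d * norm v" 2]) auto
    have b: "ball (S *v v) (\<delta> / 2) \<subseteq> A"
    proof
      fix y assume "y \<in> ball (S *v v) (\<delta> / 2)"
      moreover have "dist z (S *v v) < \<delta> / 2" unfolding v using dv d by (simp add: dist_norm)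
      ultimately have "dist z y < \<delta>" using dist_triangle[of z y "S *v v"] by simp
      then show "y \<in> A" using \<delta> by auto
    qed
    have q: "1 / 2 * (v \<bullet> (S *v v)) \<le> r" using * d by (smt (verit) mult_nonneg_nonneg zero_le_power2)
    have "ereal (- r) \<le> L"
    proof (rule ereal_le_epsilon2)
      fix e :: real assume e: "e > 0"
      have "ereal (- (1 / 2 * (v \<bullet> (S *v v))) - e) \<le> L"
        unfolding L_def by (rule lower_bound_at[OF A refl _ b e]) (use \<delta> in simp)
      moreover have "ereal (- r - e) \<le> ereal (- (1 / 2 * (v \<bullet> (S *v v))) - e)" using q by simp
      ultimately have "ereal (- r - e) \<le> L" by (rule order_trans[rotated])
      then have "ereal (- r - e) + ereal e \<le> L + ereal e" by (rule add_right_mono)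
      then show "ereal (- r) \<le> L + ereal e" by simp
    qed
    then show ?thesis using real by simp
  next
    case MInf
    then show ?thesis using gaussian_rate_nonneg[of S z] by simp
  qed simp
  then have "- L \<le> gaussian_rate S z" if "z \<in> interior A" for z
    using that by (subst ereal_uminus_le_reorder)
  then have "- L \<le> (INF z\<in>interior A. gaussian_rate S z)" by (intro INF_greatest)
  then show ?thesis unfolding L_def[symmetric] by (subst ereal_uminus_le_reorder)
qed

theorem LDP_gaussian_rate: "LDP M Z s (gaussian_rate S)"
  unfolding LDP_def
  by (intro conjI allI ballI Z_meas gaussian_rate_nonneg closed_gaussian_rate upper_bound lower_bound)

end

section \<open>Herbst's argument\<close>

text \<open>Functions p(tanh) exp(c tanh) with a polynomial p are closed under differentiation,
  because the derivative of tanh is 1 - tanh^2; \<open>D\<close> is the induced map on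
  polynomials.\<close>

lemma smooth_exp_tanh:
  assumes "R \<noteq> 0" shows "smooth (\<lambda>x. exp (c * tanh (x / R)))"
proof -
  define F where "F p x = poly p (tanh (x / R)) * exp (c * tanh (x / R))" for p :: "real poly" and x
  define D where "D p = (pderiv p + smult c p) * [:1 / R, 0, - 1 / R:]" for p
  have der: "(F p has_field_derivative F (D p) x) (at x)" for p x
    unfolding F_def[abs_def] D_def using assms
    by (auto intro!: derivative_eq_intros simp: algebra_simps power2_eq_square add_divide_distrib diff_divide_distrib)
  have dF: "deriv (F p) = F (D p)" for p
    by (rule ext) (rule DERIV_imp_deriv[OF der])
  have "(deriv ^^ k) (F p) = F ((D ^^ k) p)" for k p
    by (induction k) (auto simp: dF)
  moreover have "F p differentiable_on UNIV" for p
    using der by (auto simp: differentiable_on_def real_differentiable_def)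
  ultimately have "smooth (F p)" for p by (simp add: smooth_def)
  from this[of 1] show ?thesis by (simp add: F_def[abs_def])
qed

lemma exp_diff_le:
  fixes a b :: real
  assumes "\<bar>a\<bar> \<le> m" "\<bar>b\<bar> \<le> m"
  shows "\<bar>exp a - exp b\<bar> \<le> \<bar>a - b\<bar> * exp m"
proof -
  have *: "exp a - exp b \<le> \<bar>a - b\<bar> * exp m" if "\<bar>a\<bar> \<le> m" for a b :: real
  proof -
    have "exp a * (1 + (b - a)) \<le> exp a * exp (b - a)" by (intro mult_left_mono) auto
    also have "\<dots> = exp b" by (simp add: mult_exp_exp)
    finally have "exp a - exp b \<le> (a - b) * exp a" by (simp add: algebra_simps)
    also have "\<dots> \<le> \<bar>a - b\<bar> * exp m" using that by (intro mult_mono) auto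
    finally show ?thesis .
  qed
  show ?thesis using *[of a b] *[of b a] assms by (auto simp: abs_if split: if_splits)
qed

lemma (in prob_space) bounded_mgf_has_derivative:
  fixes \<phi> :: "'a \<Rightarrow> real"
  assumes [measurable]: "\<phi> \<in> borel_measurable M" and b: "\<And>x. \<bar>\<phi> x\<bar> \<le> R"
  shows "((\<lambda>u. expectation (\<lambda>x. exp (u * \<phi> x))) has_field_derivative expectation (\<lambda>x. \<phi> x * exp (u * \<phi> x))) (at u)"
  unfolding has_field_derivative_iff tendsto_at_iff_sequentially
proof (intro allI impI)
  fix X :: "nat \<Rightarrow> real" assume X: "\<forall>i. X i \<in> UNIV - {u}" "X \<longlonglongrightarrow> u"
  have R: "R \<ge> 0" using abs_ge_zero[of "\<phi> undefined"] b[of undefined] by linarith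
  obtain B0 where B0: "\<And>i. norm (X i) \<le> B0" using X(2) by (metis convergentI convergent_imp_Bseq BseqE)
  define B where "B = max B0 \<bar>u\<bar>"
  have B: "\<bar>X i\<bar> \<le> B" "\<bar>u\<bar> \<le> B" for i using B0[of i] by (auto simp: B_def)
  have bb: "\<bar>v * \<phi> x\<bar> \<le> B * R" if "\<bar>v\<bar> \<le> B" for v x
    unfolding abs_mult using that b[of x] by (intro mult_mono) auto
  have int: "integrable M (\<lambda>x. exp (v * \<phi> x))" if "\<bar>v\<bar> \<le> B" for v
    by (rule integrable_const_bound[of _ "exp (B * R)"]) (use bb[OF that] in \<open>auto simp: abs_le_iff\<close>)
  have eq: "((\<lambda>v. (expectation (\<lambda>x. exp (v * \<phi> x)) - expectation (\<lambda>x. exp (u * \<phi> x))) / (v - u)) \<circ> X)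
    = (\<lambda>i. expectation (\<lambda>x. (exp (X i * \<phi> x) - exp (u * \<phi> x)) / (X i - u)))"
    using int B by (auto simp: o_def)
  show "((\<lambda>v. (expectation (\<lambda>x. exp (v * \<phi> x)) - expectation (\<lambda>x. exp (u * \<phi> x))) / (v - u)) \<circ> X)
    \<longlonglongrightarrow> expectation (\<lambda>x. \<phi> x * exp (u * \<phi> x))"
    unfolding eq
  proof (rule integral_dominated_convergence[where w = "\<lambda>_. R * exp (B * R)"])
    show "AE x in M. (\<lambda>i. (exp (X i * \<phi> x) - exp (u * \<phi> x)) / (X i - u)) \<longlonglongrightarrow> \<phi> x * exp (u * \<phi> x)"
    proof (rule AE_I2)
      fix x
      have "((\<lambda>v. exp (v * \<phi> x)) has_field_derivative \<phi> x * exp (u * \<phi> x)) (at u)"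
        by (auto intro!: derivative_eq_intros)
      then show "(\<lambda>i. (exp (X i * \<phi> x) - exp (u * \<phi> x)) / (X i - u)) \<longlonglongrightarrow> \<phi> x * exp (u * \<phi> x)"
        unfolding has_field_derivative_iff tendsto_at_iff_sequentially using X by (auto simp: o_def)
    qed
    show "AE x in M. norm ((exp (X i * \<phi> x) - exp (u * \<phi> x)) / (X i - u)) \<le> R * exp (B * R)" for i
    proof (rule AE_I2)
      fix x
      have ne: "X i - u \<noteq> 0" using X by auto
      have "\<bar>exp (X i * \<phi> x) - exp (u * \<phi> x)\<bar> \<le> \<bar>X i * \<phi> x - u * \<phi> x\<bar> * exp (B * R)"
        by (intro exp_diff_le bb B)
      also have "\<bar>X i * \<phi> x - u * \<phi> x\<bar> = \<bar>X i - u\<bar> * \<bar>\<phi> x\<bar>" by (simp add: abs_mult[symmetric] left_diff_distrib)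
      also have "\<bar>X i - u\<bar> * \<bar>\<phi> x\<bar> * exp (B * R) \<le> \<bar>X i - u\<bar> * R * exp (B * R)"
        using b[of x] by (intro mult_right_mono mult_left_mono) auto
      finally show "norm ((exp (X i * \<phi> x) - exp (u * \<phi> x)) / (X i - u)) \<le> R * exp (B * R)"
        using ne by (simp add: field_simps)
    qed
  qed auto
qed

text \<open>Divided by u^2 H(u), the entropy bound \<open>ent\<close> says that ln H(u)/u has
  derivative at most C/2. At 0 this quotient tends to the mean of \<phi>, the derivative of ln H
  there, and integration from 0 gives the claim.\<close>

lemma (in prob_space) herbst_bounded:
  fixes \<phi> :: "'a \<Rightarrow> real"
  assumes m[measurable]: "\<phi> \<in> borel_measurable M" and b: "\<And>x. \<bar>\<phi> x\<bar> \<le> R"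
    and ent: "\<And>u. expectation (\<lambda>x. u * \<phi> x * exp (u * \<phi> x)) - expectation (\<lambda>x. exp (u * \<phi> x)) * ln (expectation (\<lambda>x. exp (u * \<phi> x)))
      \<le> C / 2 * u\<^sup>2 * expectation (\<lambda>x. exp (u * \<phi> x))"
  shows "expectation (\<lambda>x. exp (u * \<phi> x)) \<le> exp (u * expectation \<phi> + C * u\<^sup>2 / 2)"
proof -
  define H where "H u = expectation (\<lambda>x. exp (u * \<phi> x))" for u
  define H' where "H' u = expectation (\<lambda>x. \<phi> x * exp (u * \<phi> x))" for u
  have R: "R \<ge> 0" using abs_ge_zero[of "\<phi> undefined"] b[of undefined] by linarith
  have der: "(H has_field_derivative H' u) (at u)" for u
    unfolding H_def[abs_def] H'_def by (rule bounded_mgf_has_derivative[OF m b])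
  have bb: "\<bar>u * \<phi> x\<bar> \<le> \<bar>u\<bar> * R" for u x
    unfolding abs_mult using b[of x] by (intro mult_left_mono) auto
  have Hpos: "H u > 0" for u
  proof -
    have "expectation (\<lambda>x. exp (- (\<bar>u\<bar> * R))) \<le> H u"
      unfolding H_def
    proof (rule integral_mono)
      show "integrable M (\<lambda>x. exp (u * \<phi> x))"
        by (rule integrable_const_bound[of _ "exp (\<bar>u\<bar> * R)"]) (use bb[of u] in \<open>auto simp: abs_le_iff\<close>)
      show "exp (- (\<bar>u\<bar> * R)) \<le> exp (u * \<phi> x)" for x using bb[of u x] by (auto simp: abs_le_iff)
    qed simp
    then show ?thesis by (simp add: prob_space) (meson exp_gt_zero less_le_trans)
  qed
  have H0: "H 0 = 1" "H' 0 = expectation \<phi>" by (auto simp: H_def H'_def prob_space)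
  have ent': "u * H' u - H u * ln (H u) \<le> C / 2 * u\<^sup>2 * H u" for u
  proof -
    have "expectation (\<lambda>x. u * \<phi> x * exp (u * \<phi> x)) = u * H' u" unfolding H'_def by (simp add: mult.assoc)
    then show ?thesis using ent[of u] by (simp add: H_def)
  qed
  \<comment> \<open>Nonincreasing on each open half-line with limit E \<phi> at 0. So g is at most E
    \<phi> on the right and at least E \<phi> on the left; multiplying by a negative u brings the
    second case to the same bound.\<close>
  define g where "g u = ln (H u) / u - C / 2 * u" for u
  have dg: "\<exists>y. DERIV g u :> y \<and> y \<le> 0" if "u \<noteq> 0" for u
  proof (intro exI conjI)
    show "DERIV g u :> (H' u / H u * u - ln (H u)) / u\<^sup>2 - C / 2"
      unfolding g_def[abs_def] using that Hpos[of u]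
      by (auto intro!: derivative_eq_intros der simp: power2_eq_square)
    have "(u * H' u - H u * ln (H u)) / (u\<^sup>2 * H u) \<le> C / 2"
      using ent'[of u] that Hpos[of u] by (simp add: divide_le_eq algebra_simps)
    moreover have "(u * H' u - H u * ln (H u)) / (u\<^sup>2 * H u) = (H' u / H u * u - ln (H u)) / u\<^sup>2"
      using Hpos[of u] that by (simp add: field_simps)
    ultimately show "(H' u / H u * u - ln (H u)) / u\<^sup>2 - C / 2 \<le> 0" by simp
  qed
  have mono: "g b \<le> g a" if "a \<le> b" "0 < a \<or> b < 0" for a b
    using that by (intro DERIV_nonpos_imp_nonincreasing[of a b g] dg) auto
  have lim: "(g \<longlongrightarrow> expectation \<phi>) (at 0)"
  proof -
    have "((\<lambda>u. ln (H u)) has_field_derivative (H' 0 / H 0)) (at 0)"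
      using Hpos[of 0] by (auto intro!: derivative_eq_intros der)
    then have "((\<lambda>u. ln (H u) / u) \<longlongrightarrow> expectation \<phi>) (at 0)"
      by (simp add: has_field_derivative_iff H0)
    then have "((\<lambda>u. ln (H u) / u - C / 2 * u) \<longlongrightarrow> expectation \<phi> - C / 2 * 0) (at 0)"
      by (intro tendsto_intros)
    then show ?thesis by (simp add: g_def[abs_def])
  qed
  have "ln (H u) \<le> u * expectation \<phi> + C * u\<^sup>2 / 2"
  proof (cases "u = 0")
    case False
    then consider "u > 0" | "u < 0" by linarith
    then show ?thesis
    proof cases
      case 1
      have "(g \<longlongrightarrow> expectation \<phi>) (at_right 0)" using lim by (simp add: filterlim_at_split)
      moreover have "eventually (\<lambda>s. g u \<le> g s) (at_right 0)"
        using eventually_at_right_real[OF 1] by eventually_elim (auto intro!: mono)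
      ultimately have "g u \<le> expectation \<phi>" by (rule tendsto_lowerbound) simp
      then show ?thesis using 1 by (simp add: g_def field_simps power2_eq_square)
    next
      case 2
      have "(g \<longlongrightarrow> expectation \<phi>) (at_left 0)" using lim by (simp add: filterlim_at_split)
      moreover have "eventually (\<lambda>s. g s \<le> g u) (at_left 0)"
        using eventually_at_left_real[OF 2] by eventually_elim (auto intro!: mono)
      ultimately have "expectation \<phi> \<le> g u" by (rule tendsto_upperbound) simp
      then have "g u * u \<le> expectation \<phi> * u" using 2 by (intro mult_right_mono_neg) auto
      moreover have "g u * u = ln (H u) - C * u\<^sup>2 / 2"
        using 2 by (simp add: g_def left_diff_distrib power2_eq_square)
      ultimately show ?thesis by (simp add: mult.commute)
    qed
  qed (simp add: H0)
  then have "exp (ln (H u)) \<le> exp (u * expectation \<phi> + C * u\<^sup>2 / 2)" by simp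
  then have "H u \<le> exp (u * expectation \<phi> + C * u\<^sup>2 / 2)" by (simp only: exp_ln[OF Hpos])
  then show ?thesis by (simp only: H_def)
qed

lemma abs_tanh_le: "\<bar>tanh (x::real)\<bar> \<le> \<bar>x\<bar>"
proof -
  have *: "tanh x \<le> x" if "x \<ge> 0" for x :: real
  proof -
    have "(\<lambda>x. tanh x - x) x \<le> (\<lambda>x. tanh x - x) 0"
      by (rule DERIV_nonpos_imp_nonincreasing[OF that])
        (auto intro!: exI derivative_eq_intros simp: tanh_real_altdef[symmetric])
    then show ?thesis by simp
  qed
  show ?thesis using *[of x] *[of "-x"] by (cases "x \<ge> 0") auto
qed

lemma tendsto_scaled_tanh: "(\<lambda>n. real (Suc n) * tanh (x / real (Suc n))) \<longlonglongrightarrow> x"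
proof (cases "x = 0")
  case False
  have "(tanh has_field_derivative 1) (at (0::real))" by (auto intro!: derivative_eq_intros)
  then have "((\<lambda>y. tanh y / y) \<longlongrightarrow> 1) (at (0::real))" by (simp add: has_field_derivative_iff)
  moreover have "filterlim (\<lambda>n. x / real (Suc n)) (at 0) sequentially"
    unfolding filterlim_at
  proof
    have "filterlim (\<lambda>n. real (Suc n)) at_top sequentially"
      by (rule filterlim_compose[OF filterlim_real_sequentially filterlim_Suc])
    then show "(\<lambda>n. x / real (Suc n)) \<longlonglongrightarrow> 0"
      by (rule tendsto_divide_0[OF tendsto_const filterlim_at_top_imp_at_infinity])
  qed (use False in auto)
  ultimately have "(\<lambda>n. tanh (x / real (Suc n)) / (x / real (Suc n))) \<longlonglongrightarrow> 1"
    by (rule filterlim_compose)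
  then have "(\<lambda>n. x * (tanh (x / real (Suc n)) / (x / real (Suc n)))) \<longlonglongrightarrow> x * 1" by (intro tendsto_intros)
  moreover have "x * (tanh (x / real (Suc n)) / (x / real (Suc n))) = real (Suc n) * tanh (x / real (Suc n))" for n
    using False by (simp del: of_nat_Suc)
  ultimately show ?thesis by (simp only: mult_1_right)
qed simp

text \<open>The logarithmic Sobolev inequality is applied to exp(u \<phi>/2) for \<phi> = R
  tanh(x/R), which is smooth, bounded by R and has slope at most 1. Boundedness makes the inequality
  and Herbst's differentiation legitimate; the limit in R is then taken by Fatou's lemma.\<close>

theorem log_sobolev_imp_subgaussian:
  assumes p: "prob_space \<mu>" and s: "sets \<mu> = sets borel" and ls: "log_sobolev \<mu>"
    and int: "integrable \<mu> (\<lambda>x. x)" and mean: "(\<integral>x. x \<partial>\<mu>) = 0"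
  shows "\<exists>K. subgaussian \<mu> K"
proof -
  interpret prob_space \<mu> by fact
  have [measurable_cong]: "sets \<mu> = sets borel" by fact
  obtain C where C: "C > 0" and ls': "\<And>h. smooth h \<Longrightarrow> integrable \<mu> (\<lambda>x. (h x)\<^sup>2 * max 0 (ln ((h x)\<^sup>2))) \<Longrightarrow>
        ennreal (entropy_functional \<mu> (\<lambda>x. (h x)\<^sup>2)) \<le> ennreal (2 * C) * (\<integral>\<^sup>+ x. ennreal (\<bar>deriv h x\<bar>\<^sup>2) \<partial>\<mu>)"
    using ls unfolding log_sobolev_def by blast
  define \<phi> where "\<phi> R x = R * tanh (x / R)" for R x :: real
  have \<phi>m[measurable]: "\<phi> R \<in> borel_measurable borel" for R
  proof -
    have "continuous_on UNIV (\<phi> R)" unfolding \<phi>_def[abs_def]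
      by (cases "R = 0") (auto intro!: continuous_intros)
    then show ?thesis by (rule borel_measurable_continuous_onI)
  qed
  have \<phi>b: "\<bar>\<phi> R x\<bar> \<le> R" if "R > 0" for R x
    using that tanh_real_bounds[of "x / R"] by (auto simp: \<phi>_def abs_mult abs_le_iff intro: mult_left_le)
  have \<phi>x: "\<bar>\<phi> R x\<bar> \<le> \<bar>x\<bar>" if "R > 0" for R x
    using mult_left_mono[OF abs_tanh_le[of "x / R"], of R] that by (simp add: \<phi>_def abs_mult)
  have key: "expectation (\<lambda>x. exp (u * \<phi> R x)) \<le> exp (u * expectation (\<phi> R) + C * u\<^sup>2 / 2)" if R: "R > 0" for u R
  proof (rule herbst_bounded[OF _ \<phi>b[OF R]])
    fix u :: real
    define h where "h x = exp (u * \<phi> R x / 2)" for x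
    have h: "h = (\<lambda>x. exp ((u * R / 2) * tanh (x / R)))" by (auto simp: h_def \<phi>_def)
    have h2: "(h x)\<^sup>2 = exp (u * \<phi> R x)" for x by (simp add: h_def exp_double[symmetric])
    have bb: "\<bar>u * \<phi> R x\<bar> \<le> \<bar>u\<bar> * R" for x
      unfolding abs_mult using \<phi>b[OF R, of x] by (intro mult_left_mono) auto
    have ebd: "exp (u * \<phi> R x) \<le> exp (\<bar>u\<bar> * R)" for x using bb[of x] by (auto simp: abs_le_iff)
    have i1: "integrable \<mu> (\<lambda>x. exp (u * \<phi> R x))"
      by (rule integrable_const_bound[of _ "exp (\<bar>u\<bar> * R)"]) (use ebd in auto)
    have "integrable \<mu> (\<lambda>x. (h x)\<^sup>2 * max 0 (ln ((h x)\<^sup>2)))"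
    proof (rule integrable_const_bound[of _ "exp (\<bar>u\<bar> * R) * (\<bar>u\<bar> * R)"])
      have "\<bar>exp (u * \<phi> R x) * max 0 (u * \<phi> R x)\<bar> \<le> exp (\<bar>u\<bar> * R) * (\<bar>u\<bar> * R)" for x
        unfolding abs_mult using ebd[of x] bb[of x] by (intro mult_mono) auto
      then show "AE x in \<mu>. norm ((h x)\<^sup>2 * max 0 (ln ((h x)\<^sup>2))) \<le> exp (\<bar>u\<bar> * R) * (\<bar>u\<bar> * R)"
        by (simp add: h2)
    qed (simp add: h2)
    moreover have "smooth h" unfolding h using R by (intro smooth_exp_tanh) simp
    ultimately have "ennreal (entropy_functional \<mu> (\<lambda>x. (h x)\<^sup>2)) \<le> ennreal (2 * C) * (\<integral>\<^sup>+ x. ennreal (\<bar>deriv h x\<bar>\<^sup>2) \<partial>\<mu>)"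
      by (intro ls')
    \<comment> \<open>The derivative of h is u/2 times h times the slope of \<phi>; the resulting
      u^2/4, times 2C, is the constant C/2 that Herbst's argument expects.\<close>
    also have "\<dots> \<le> ennreal (2 * C) * (\<integral>\<^sup>+ x. ennreal (u\<^sup>2 / 4 * exp (u * \<phi> R x)) \<partial>\<mu>)"
    proof (intro mult_left_mono nn_integral_mono ennreal_leI)
      fix x
      have "(h has_field_derivative (h x * (u / 2 * (1 - (tanh (x / R))\<^sup>2)))) (at x)"
        unfolding h using R by (auto intro!: derivative_eq_intros)
      then have "deriv h x = h x * (u / 2 * (1 - (tanh (x / R))\<^sup>2))" by (rule DERIV_imp_deriv)
      then have "\<bar>deriv h x\<bar>\<^sup>2 = exp (u * \<phi> R x) * (u\<^sup>2 / 4 * (1 - (tanh (x / R))\<^sup>2)\<^sup>2)"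
        by (simp only: power2_abs power_mult_distrib h2 power_divide) simp
      also have "\<dots> \<le> exp (u * \<phi> R x) * (u\<^sup>2 / 4 * 1)"
      proof (intro mult_left_mono)
        have "(tanh (x / R))\<^sup>2 \<le> 1" using tanh_real_bounds[of "x / R"] by (subst abs_square_le_1) (auto simp: abs_le_iff)
        then show "(1 - (tanh (x / R))\<^sup>2)\<^sup>2 \<le> 1" by (intro power_le_one) auto
      qed auto
      finally show "\<bar>deriv h x\<bar>\<^sup>2 \<le> u\<^sup>2 / 4 * exp (u * \<phi> R x)" by (simp add: mult.commute)
    qed simp
    also have "\<dots> = ennreal (2 * C * (u\<^sup>2 / 4 * expectation (\<lambda>x. exp (u * \<phi> R x))))"
    proof -
      have "(\<integral>\<^sup>+ x. ennreal (u\<^sup>2 / 4 * exp (u * \<phi> R x)) \<partial>\<mu>) = ennreal (u\<^sup>2 / 4 * expectation (\<lambda>x. exp (u * \<phi> R x)))"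
        using i1 by (subst nn_integral_eq_integral) auto
      moreover have "ennreal (2 * C) * ennreal x = ennreal (2 * C * x)" for x
        using C by (intro ennreal_mult'[symmetric]) simp
      ultimately show ?thesis by (simp only:)
    qed
    finally have "entropy_functional \<mu> (\<lambda>x. (h x)\<^sup>2) \<le> 2 * C * (u\<^sup>2 / 4 * expectation (\<lambda>x. exp (u * \<phi> R x)))"
      using C by (subst (asm) ennreal_le_iff) auto
    then show "expectation (\<lambda>x. u * \<phi> R x * exp (u * \<phi> R x)) - expectation (\<lambda>x. exp (u * \<phi> R x)) * ln (expectation (\<lambda>x. exp (u * \<phi> R x)))
      \<le> C / 2 * u\<^sup>2 * expectation (\<lambda>x. exp (u * \<phi> R x))"
      by (simp add: entropy_functional_def h2 mult.commute mult.left_commute)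
  qed measurable
  have "(\<integral>\<^sup>+x. ennreal (exp (u * x)) \<partial>\<mu>) \<le> ennreal (exp (C * u\<^sup>2 / 2))" for u
  proof -
    define T where "T n = \<phi> (real (Suc n))" for n
    have Tlim: "(\<lambda>n. T n x) \<longlonglongrightarrow> x" for x unfolding T_def \<phi>_def by (rule tendsto_scaled_tanh)
    have [measurable]: "T n \<in> borel_measurable borel" for n unfolding T_def by (rule \<phi>m)
    \<comment> \<open>The truncated variables need not be centered; their means vanish in the limit
      by dominated convergence.\<close>
    have ET: "(\<lambda>n. expectation (T n)) \<longlonglongrightarrow> 0"
      unfolding mean[symmetric]
    proof (rule integral_dominated_convergence[where w = "\<lambda>x. \<bar>x\<bar>"])
      show "integrable \<mu> (\<lambda>x. \<bar>x\<bar>)" using int by (rule integrable_abs)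
      show "AE x in \<mu>. (\<lambda>n. T n x) \<longlonglongrightarrow> x" by (intro AE_I2 Tlim)
      show "AE x in \<mu>. norm (T n x) \<le> \<bar>x\<bar>" for n
        unfolding T_def real_norm_def by (intro AE_I2 \<phi>x) simp
    qed measurable
    have "(\<integral>\<^sup>+x. ennreal (exp (u * x)) \<partial>\<mu>) = (\<integral>\<^sup>+x. liminf (\<lambda>n. ennreal (exp (u * T n x))) \<partial>\<mu>)"
    proof (intro nn_integral_cong)
      fix x
      have "(\<lambda>n. ennreal (exp (u * T n x))) \<longlonglongrightarrow> ennreal (exp (u * x))" by (intro tendsto_intros Tlim)
      then show "ennreal (exp (u * x)) = liminf (\<lambda>n. ennreal (exp (u * T n x)))"
        using lim_imp_Liminf sequentially_bot by metis
    qed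
    also have "\<dots> \<le> liminf (\<lambda>n. \<integral>\<^sup>+x. ennreal (exp (u * T n x)) \<partial>\<mu>)"
      by (rule nn_integral_liminf) measurable
    also have "\<dots> \<le> liminf (\<lambda>n. ennreal (exp (u * expectation (T n) + C * u\<^sup>2 / 2)))"
    proof (intro Liminf_mono always_eventually allI)
      fix n
      have "integrable \<mu> (\<lambda>x. exp (u * T n x))"
      proof (rule integrable_const_bound[of _ "exp (\<bar>u\<bar> * real (Suc n))"])
        have "u * T n x \<le> \<bar>u\<bar> * real (Suc n)" for x
        proof -
          have "\<bar>u * T n x\<bar> \<le> \<bar>u\<bar> * real (Suc n)"
            unfolding abs_mult T_def by (intro mult_left_mono \<phi>b) auto
          then show ?thesis by linarith
        qed
        then show "AE x in \<mu>. norm (exp (u * T n x)) \<le> exp (\<bar>u\<bar> * real (Suc n))" by simp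
      qed measurable
      then have "(\<integral>\<^sup>+x. ennreal (exp (u * T n x)) \<partial>\<mu>) = ennreal (expectation (\<lambda>x. exp (u * T n x)))"
        by (rule nn_integral_eq_integral) auto
      also have "\<dots> \<le> ennreal (exp (u * expectation (T n) + C * u\<^sup>2 / 2))"
        unfolding T_def by (intro ennreal_leI key) auto
      finally show "(\<integral>\<^sup>+x. ennreal (exp (u * T n x)) \<partial>\<mu>) \<le> \<dots>" .
    qed
    also have "\<dots> = ennreal (exp (C * u\<^sup>2 / 2))"
    proof -
      have "(\<lambda>n. ennreal (exp (u * expectation (T n) + C * u\<^sup>2 / 2))) \<longlonglongrightarrow> ennreal (exp (u * 0 + C * u\<^sup>2 / 2))"
        by (intro tendsto_intros ET)
      then show ?thesis using lim_imp_Liminf sequentially_bot by fastforce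
    qed
    finally show ?thesis .
  qed
  then show ?thesis using p s C unfolding subgaussian_def by auto
qed

section \<open>Fourier series and Toeplitz-type bounds\<close>

definition E :: "int \<Rightarrow> real \<Rightarrow> complex" where
  "E j w = exp (\<i> * complex_of_real (of_int j * w))"

lemma norm_E [simp]: "cmod (E j w) = 1"
  unfolding E_def by (simp add: norm_exp_i_times)

lemma E_0 [simp]: "E 0 w = 1"
  by (simp add: E_def)

lemma E_add: "E (j + k) w = E j w * E k w"
  unfolding E_def exp_add[symmetric] by (simp add: algebra_simps)

lemma cnj_E: "cnj (E j w) = E (- j) w"
  unfolding E_def by (simp add: exp_cnj)

lemma E_mult_cnj: "E j w * cnj (E k w) = E (j - k) w"
  unfolding cnj_E E_add[symmetric] by simp

lemma space_torus: "space torus = {-pi..<pi}"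
  by (simp add: torus_def space_restrict_space)

lemma measurable_torus_borel [measurable (raw)]: "f \<in> borel_measurable borel \<Longrightarrow> f \<in> borel_measurable torus"
  unfolding torus_def by (rule measurable_restrict_space1) simp

lemma E_measurable [measurable]: "E j \<in> borel_measurable torus"
proof (rule measurable_torus_borel)
  have "continuous_on UNIV (E j)" unfolding E_def[abs_def] by (intro continuous_intros)
  then show "E j \<in> borel_measurable borel" by (rule borel_measurable_continuous_onI)
qed

lemma emeasure_torus: "emeasure torus (space torus) = ennreal (2 * pi)"
  unfolding space_torus unfolding torus_def by (subst emeasure_restrict_space) auto

interpretation torus: finite_measure torus
  by standard (simp add: emeasure_torus)

lemma measure_torus [simp]: "measure torus (space torus) = 2 * pi"
  by (simp add: measure_def emeasure_torus)

lemma integrable_torus_bounded: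
  fixes h :: "real \<Rightarrow> 'b::{banach, second_countable_topology}"
  assumes "h \<in> borel_measurable torus" "\<And>x. norm (h x) \<le> B"
  shows "integrable torus h"
  by (rule torus.integrable_const_bound[of _ B]) (use assms in auto)

lemma integral_E: "(\<integral>w. E j w \<partial>torus) = (if j = 0 then of_real (2 * pi) else 0)"
proof (cases "j = 0")
  case False
  have c: "continuous_on UNIV (E j)" unfolding E_def[abs_def] by (intro continuous_intros)
  have [measurable]: "E j \<in> borel_measurable borel" using c by (rule borel_measurable_continuous_onI)
  define F where "F w = E j w / (\<i> * of_int j)" for w
  have d: "(F has_vector_derivative E j x) (at x within {-pi..pi})" for x
  proof -
    have "((\<lambda>z. exp (\<i> * (of_int j * z)) / (\<i> * of_int j)) has_field_derivative exp (\<i> * (of_int j * of_real x))) (at (complex_of_real x))"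
    proof -
      have "\<i> * (z * \<i>) = - z" for z by (simp add: mult.commute[of z])
      then show ?thesis using False by (auto intro!: derivative_eq_intros)
    qed
    then have "((\<lambda>x. exp (\<i> * (of_int j * complex_of_real x)) / (\<i> * of_int j)) has_vector_derivative exp (\<i> * (of_int j * of_real x))) (at x within {-pi..pi})"
      by (rule has_vector_derivative_real_field)
    then show ?thesis by (simp add: F_def[abs_def] E_def)
  qed
  have "(\<integral>w. E j w \<partial>torus) = (\<integral>w. indicator {-pi..<pi} w *\<^sub>R E j w \<partial>lborel)"
    unfolding torus_def by (subst integral_restrict_space) auto
  also have "\<dots> = (\<integral>w. indicator {-pi..pi} w *\<^sub>R E j w \<partial>lborel)"
  proof (rule integral_cong_AE)
    have "AE w in lborel. w \<noteq> pi" by (rule AE_lborel_singleton)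
    then show "AE w in lborel. indicator {-pi..<pi} w *\<^sub>R E j w = indicator {-pi..pi} w *\<^sub>R E j w"
      by eventually_elim (auto simp: indicator_def)
  qed auto
  also have "\<dots> = F pi - F (- pi)"
    by (rule integral_FTC_Icc[OF _ d]) (use continuous_on_subset[OF c] in auto)
  also have "\<dots> = 0"
  proof -
    have "E j pi = E j (- pi) * E (2 * j) pi"
      unfolding E_def exp_add[symmetric] by (simp add: algebra_simps)
    also have "E (2 * j) pi = 1"
      unfolding E_def using exp_integer_2pi[of "of_int j"] by (simp add: algebra_simps)
    finally show ?thesis by (simp add: F_def)
  qed
  finally show ?thesis using False by simp
qed (simp add: scaleR_conv_of_real)

definition trig :: "int set \<Rightarrow> (int \<Rightarrow> complex) \<Rightarrow> real \<Rightarrow> complex" where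
  "trig K y w = (\<Sum>k\<in>K. y k * E k w)"

lemma trig_measurable [measurable]: "trig K y \<in> borel_measurable torus"
  unfolding trig_def[abs_def] by measurable

lemma norm_trig_le: "cmod (trig K y w) \<le> (\<Sum>k\<in>K. cmod (y k))"
  unfolding trig_def by (rule order_trans[OF norm_sum]) (simp add: norm_mult)

lemma norm_square_complex: "complex_of_real ((cmod z)\<^sup>2) = z * cnj z"
  by (simp add: complex_norm_square[symmetric])

lemma integral_norm_trig:
  assumes "finite K"
  shows "(\<integral>w. (cmod (trig K y w))\<^sup>2 \<partial>torus) = 2 * pi * (\<Sum>k\<in>K. (cmod (y k))\<^sup>2)"
proof -
  have "complex_of_real (\<integral>w. (cmod (trig K y w))\<^sup>2 \<partial>torus) = (\<integral>w. complex_of_real ((cmod (trig K y w))\<^sup>2) \<partial>torus)"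
    by (rule integral_complex_of_real[symmetric])
  also have "\<dots> = (\<integral>w. (\<Sum>j\<in>K. \<Sum>k\<in>K. (y j * cnj (y k)) * E (j - k) w) \<partial>torus)"
    unfolding norm_square_complex trig_def
    by (intro Bochner_Integration.integral_cong refl)
       (simp add: sum_product E_mult_cnj[symmetric] mult_ac)
  also have "\<dots> = (\<Sum>j\<in>K. \<Sum>k\<in>K. (y j * cnj (y k)) * (if j - k = 0 then of_real (2 * pi) else 0))"
  proof -
    have i: "integrable torus (\<lambda>w. (y j * cnj (y k)) * E (j - k) w)" for j k
      by (rule integrable_torus_bounded[of _ "cmod (y j * cnj (y k))"]) (auto simp: norm_mult)
    show ?thesis
      by (simp add: i integral_E)
  qed
  also have "\<dots> = (\<Sum>j\<in>K. y j * cnj (y j) * of_real (2 * pi))"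
  proof (intro sum.cong refl)
    fix j assume "j \<in> K"
    have "(\<Sum>k\<in>K. (y j * cnj (y k)) * (if j - k = 0 then of_real (2 * pi) else 0))
      = (\<Sum>k\<in>K. if k = j then y j * cnj (y j) * of_real (2 * pi) else 0)"
      by (intro sum.cong) auto
    then show "(\<Sum>k\<in>K. (y j * cnj (y k)) * (if j - k = 0 then of_real (2 * pi) else 0)) = y j * cnj (y j) * of_real (2 * pi)"
      using assms \<open>j \<in> K\<close> by simp
  qed
  also have "\<dots> = complex_of_real (2 * pi * (\<Sum>k\<in>K. (cmod (y k))\<^sup>2))"
    by (simp only: norm_square_complex[symmetric] of_real_mult[symmetric] of_real_sum[symmetric] sum_distrib_left mult.commute)
  finally show ?thesis by (simp only: of_real_eq_iff)
qed

section \<open>Bessel's inequality and Fourier coefficients of L^2 series\<close>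

lemma bessel:
  assumes J: "finite J" and m[measurable]: "h \<in> borel_measurable torus" and int: "integrable torus (\<lambda>w. (cmod (h w))\<^sup>2)"
  shows "(\<Sum>j\<in>J. (cmod (\<integral>w. h w * E (- j) w \<partial>torus))\<^sup>2) \<le> 2 * pi * (\<integral>w. (cmod (h w))\<^sup>2 \<partial>torus)"
proof -
  define c where "c j = (\<integral>w. h w * E (- j) w \<partial>torus)" for j
  \<comment> \<open>The orthogonal projection of h; expanding the nonnegative integral of |h - p|^2
    gives the inequality. The coefficients \<open>c\<close> are not normalised, whence the factors 2
    pi.\<close>
  define p where "p = trig J (\<lambda>j. c j / of_real (2 * pi))"
  have h1: "integrable torus h"
  proof (rule Bochner_Integration.integrable_bound)
    show "integrable torus (\<lambda>w. 1 + (cmod (h w))\<^sup>2)" using int by auto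
    have "cmod (h w) \<le> 1 + (cmod (h w))\<^sup>2" for w
    proof -
      have "2 * cmod (h w) \<le> (cmod (h w))\<^sup>2 + 1" using sum_squares_bound[of "cmod (h w)" 1] by simp
      then show ?thesis using zero_le_power2[of "cmod (h w)"] by linarith
    qed
    then show "AE x in torus. norm (h x) \<le> norm (1 + (cmod (h x))\<^sup>2)" by simp
  qed measurable
  have hE: "integrable torus (\<lambda>w. h w * E k w)" for k
    by (rule Bochner_Integration.integrable_bound[OF h1]) (auto simp: norm_mult)
  have pm[measurable]: "p \<in> borel_measurable torus" unfolding p_def by measurable
  have pb: "cmod (p w) \<le> (\<Sum>k\<in>J. cmod (c k / of_real (2 * pi)))" for w unfolding p_def by (rule norm_trig_le)
  have ip: "integrable torus (\<lambda>w. (cmod (p w))\<^sup>2)"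
    by (rule integrable_torus_bounded[of _ "(\<Sum>k\<in>J. cmod (c k / of_real (2 * pi)))\<^sup>2"]) (use pb in \<open>auto intro!: power_mono\<close>)
  have hp: "(\<lambda>w. h w * cnj (p w)) = (\<lambda>w. \<Sum>j\<in>J. cnj (c j / of_real (2 * pi)) * (h w * E (- j) w))"
    unfolding p_def trig_def by (simp add: sum_distrib_left cnj_E mult_ac)
  have ihp: "integrable torus (\<lambda>w. h w * cnj (p w))" unfolding hp using hE by auto
  define S where "S = (\<Sum>j\<in>J. (cmod (c j))\<^sup>2)"
  have Ihp: "(\<integral>w. h w * cnj (p w) \<partial>torus) = of_real (S / (2 * pi))"
  proof -
    have "(\<integral>w. h w * cnj (p w) \<partial>torus) = (\<Sum>j\<in>J. cnj (c j / of_real (2 * pi)) * c j)"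
      unfolding hp c_def using hE by (subst Bochner_Integration.integral_sum) auto
    also have "\<dots> = (\<Sum>j\<in>J. of_real ((cmod (c j))\<^sup>2 / (2 * pi)))"
      by (intro sum.cong refl) (simp add: norm_square_complex[simplified] mult.commute)
    finally show ?thesis by (simp add: S_def sum_divide_distrib)
  qed
  have Ip: "(\<integral>w. (cmod (p w))\<^sup>2 \<partial>torus) = S / (2 * pi)"
    unfolding p_def integral_norm_trig[OF J] S_def
    by (simp add: norm_divide power_divide sum_divide_distrib[symmetric] power2_eq_square)
  define q where "q w = Re (h w * cnj (p w))" for w
  have iq: "integrable torus q" "(\<integral>w. q w \<partial>torus) = S / (2 * pi)"
    unfolding q_def[abs_def] using integrable_Re[OF ihp] integral_Re[OF ihp] Ihp by auto
  have pt: "(cmod (h w - p w))\<^sup>2 = (cmod (h w))\<^sup>2 - 2 * q w + (cmod (p w))\<^sup>2" for w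
    unfolding cmod_power2 q_def by (simp add: power2_eq_square algebra_simps)
  have "0 \<le> (\<integral>w. (cmod (h w - p w))\<^sup>2 \<partial>torus)" by simp
  also have "\<dots> = (\<integral>w. (cmod (h w))\<^sup>2 \<partial>torus) - 2 * (\<integral>w. q w \<partial>torus) + (\<integral>w. (cmod (p w))\<^sup>2 \<partial>torus)"
    unfolding pt using int iq(1) ip by simp
  finally have "S / (2 * pi) \<le> (\<integral>w. (cmod (h w))\<^sup>2 \<partial>torus)" unfolding iq Ip by simp
  then show ?thesis unfolding S_def c_def by (simp add: divide_le_eq mult.commute)
qed

lemma (in finite_measure) L1_le_L2:
  fixes f :: "'a \<Rightarrow> real"
  assumes [measurable]: "f \<in> borel_measurable M" and int: "integrable M (\<lambda>x. (f x)\<^sup>2)"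
  shows "integrable M f" "(\<integral>x. \<bar>f x\<bar> \<partial>M)\<^sup>2 \<le> measure M (space M) * (\<integral>x. (f x)\<^sup>2 \<partial>M)"
proof -
  show i: "integrable M f"
  proof (rule Bochner_Integration.integrable_bound)
    show "integrable M (\<lambda>x. 1 + (f x)\<^sup>2)" using int by auto
    have "\<bar>t\<bar> \<le> 1 + t\<^sup>2" for t :: real
    proof -
      have "2 * \<bar>t\<bar> \<le> t\<^sup>2 + 1" using sum_squares_bound[of "\<bar>t\<bar>" 1] by simp
      then show ?thesis using zero_le_power2[of t] by linarith
    qed
    then show "AE x in M. norm (f x) \<le> norm (1 + (f x)\<^sup>2)" by simp
  qed measurable
  define m where "m = measure M (space M)"
  define I where "I = (\<integral>x. \<bar>f x\<bar> \<partial>M)"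
  define J where "J = (\<integral>x. (f x)\<^sup>2 \<partial>M)"
  have m: "m \<ge> 0" by (simp add: m_def)
  \<comment> \<open>Expanding the square yields Cauchy-Schwarz multiplied by m, so total mass 0 is
    treated apart.\<close>
  have "0 \<le> (\<integral>x. (m * \<bar>f x\<bar> - I)\<^sup>2 \<partial>M)" by simp
  also have "\<dots> = (\<integral>x. m\<^sup>2 * (f x)\<^sup>2 - 2 * m * I * \<bar>f x\<bar> + I\<^sup>2 \<partial>M)"
    by (intro Bochner_Integration.integral_cong refl) (simp add: power2_eq_square algebra_simps)
  also have "\<dots> = m\<^sup>2 * J - 2 * m * I * I + I\<^sup>2 * m"
    using int i by (simp add: I_def J_def m_def)
  finally have *: "0 \<le> m * (m * J - I\<^sup>2)" by (simp add: power2_eq_square algebra_simps)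
  have "I\<^sup>2 \<le> m * J"
  proof (cases "m = 0")
    case True
    then have "emeasure M (space M) = 0" by (simp add: m_def emeasure_eq_measure)
    then have "AE x in M. False" by (intro AE_I[of _ _ "space M"]) auto
    then have "I = 0" unfolding I_def by (intro integral_eq_zero_AE) auto
    then show ?thesis using True by simp
  next
    case False
    then show ?thesis using * m by (simp add: zero_le_mult_iff)
  qed
  then show "(\<integral>x. \<bar>f x\<bar> \<partial>M)\<^sup>2 \<le> measure M (space M) * (\<integral>x. (f x)\<^sup>2 \<partial>M)"
    unfolding I_def J_def m_def .
qed

lemma norm_add_square_le: "(norm (x + y))\<^sup>2 \<le> 2 * (norm x)\<^sup>2 + 2 * (norm y)\<^sup>2" for x y :: "'b::real_normed_vector"
proof -
  have "(norm (x + y))\<^sup>2 \<le> (norm x + norm y)\<^sup>2" by (intro power_mono norm_triangle_ineq) auto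
  also have "\<dots> \<le> 2 * (norm x)\<^sup>2 + 2 * (norm y)\<^sup>2" using sum_squares_bound[of "norm x" "norm y"] by (simp add: power2_sum)
  finally show ?thesis .
qed

lemma has_L2_sum_real:
  assumes L: "has_L2_sum M u S" and [measurable]: "\<And>j. u j \<in> borel_measurable M"
    and int: "\<And>j. integrable M (\<lambda>x. (norm (u j x))\<^sup>2)"
  shows "integrable M (\<lambda>x. (norm (S x - (\<Sum>j\<in>{- int N..int N}. u j x)))\<^sup>2)"
    "(\<lambda>N. \<integral>x. (norm (S x - (\<Sum>j\<in>{- int N..int N}. u j x)))\<^sup>2 \<partial>M) \<longlonglongrightarrow> 0"
proof -
  have Sm[measurable]: "S \<in> borel_measurable M" and iS: "integrable M (\<lambda>x. (norm (S x))\<^sup>2)"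
    and lim: "(\<lambda>N::nat. \<integral>\<^sup>+ x. ennreal ((norm (S x - (\<Sum>j\<in>{- int N..int N}. u j x)))\<^sup>2) \<partial>M) \<longlonglongrightarrow> 0"
    using L by (auto simp: has_L2_sum_def)
  have isum: "integrable M (\<lambda>x. (norm (\<Sum>j\<in>J. u j x))\<^sup>2)" if "finite J" for J
    using that
  proof (induction J rule: finite_induct)
    case (insert j J)
    have "integrable M (\<lambda>x. 2 * (norm (u j x))\<^sup>2 + 2 * (norm (\<Sum>j\<in>J. u j x))\<^sup>2)" using int insert by auto
    then show ?case
      by (rule Bochner_Integration.integrable_bound) (use insert norm_add_square_le in auto)
  qed simp
  have i: "integrable M (\<lambda>x. (norm (S x - (\<Sum>j\<in>{- int N..int N}. u j x)))\<^sup>2)" for N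
  proof -
    have "integrable M (\<lambda>x. 2 * (norm (S x))\<^sup>2 + 2 * (norm (\<Sum>j\<in>{- int N..int N}. u j x))\<^sup>2)" using iS isum by auto
    then show ?thesis
      by (rule Bochner_Integration.integrable_bound) (use norm_add_square_le[of _ "- _"] in auto)
  qed
  then show "integrable M (\<lambda>x. (norm (S x - (\<Sum>j\<in>{- int N..int N}. u j x)))\<^sup>2)" .
  have "(\<lambda>N. ennreal (\<integral>x. (norm (S x - (\<Sum>j\<in>{- int N..int N}. u j x)))\<^sup>2 \<partial>M)) \<longlonglongrightarrow> ennreal 0"
    using lim i by (simp add: nn_integral_eq_integral)
  then show "(\<lambda>N. \<integral>x. (norm (S x - (\<Sum>j\<in>{- int N..int N}. u j x)))\<^sup>2 \<partial>M) \<longlonglongrightarrow> 0"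
    by (subst (asm) tendsto_ennreal_iff) auto
qed

lemma fourier_series_trig:
  assumes "fourier_series a g"
  shows "g \<in> borel_measurable torus" "integrable torus (\<lambda>w. (cmod (g w))\<^sup>2)"
    "integrable torus (\<lambda>w. (cmod (g w - trig {- int N..int N} (\<lambda>j. of_real (a j)) w))\<^sup>2)"
    "(\<lambda>N. \<integral>w. (cmod (g w - trig {- int N..int N} (\<lambda>j. of_real (a j)) w))\<^sup>2 \<partial>torus) \<longlonglongrightarrow> 0"
proof -
  have L: "has_L2_sum torus (\<lambda>n w. complex_of_real (a n) * E n w) g"
    using assms unfolding fourier_series_def E_def .
  then show "g \<in> borel_measurable torus" "integrable torus (\<lambda>w. (cmod (g w))\<^sup>2)" by (auto simp: has_L2_sum_def)
  have i: "integrable torus (\<lambda>x. (norm (complex_of_real (a j) * E j x))\<^sup>2)" for j by (simp add: norm_mult)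
  show "integrable torus (\<lambda>w. (cmod (g w - trig {- int N..int N} (\<lambda>j. of_real (a j)) w))\<^sup>2)"
    "(\<lambda>N. \<integral>w. (cmod (g w - trig {- int N..int N} (\<lambda>j. of_real (a j)) w))\<^sup>2 \<partial>torus) \<longlonglongrightarrow> 0"
    using has_L2_sum_real[OF L _ i] unfolding trig_def by auto
qed

text \<open>The j-th coefficient of the partial sums is constant once N \<ge> |j|, and on a space of
  finite measure L^2 convergence implies convergence of coefficients.\<close>

lemma fourier_coefficient:
  assumes F: "fourier_series a g"
  shows "integrable torus (\<lambda>w. g w * E k w)" "(\<integral>w. g w * E (- j) w \<partial>torus) = 2 * pi * a j"
proof -
  note [measurable] = fourier_series_trig(1)[OF F]
  define T where "T N = trig {- int N..int N} (\<lambda>j. complex_of_real (a j))" for N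
  have [measurable]: "T N \<in> borel_measurable torus" for N unfolding T_def by measurable
  have g1: "integrable torus g"
    using torus.L1_le_L2(1)[of "\<lambda>w. cmod (g w)"] fourier_series_trig(2)[OF F] by (simp add: integrable_norm_iff)
  show gE: "integrable torus (\<lambda>w. g w * E k w)" for k
    by (rule Bochner_Integration.integrable_bound[OF g1]) (auto simp: norm_mult)
  have iT: "integrable torus (T N)" for N
    unfolding T_def by (rule integrable_torus_bounded[OF _ norm_trig_le]) measurable
  have TE: "integrable torus (\<lambda>w. T N w * E k w)" for k N
    by (rule Bochner_Integration.integrable_bound[OF iT[of N]]) (auto simp: norm_mult)
  define d where "d N = (\<integral>w. (cmod (g w - T N w))\<^sup>2 \<partial>torus)" for N
  have d: "d \<longlonglongrightarrow> 0" unfolding d_def T_def by (rule fourier_series_trig(4)[OF F])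
  have bound: "cmod ((\<integral>w. g w * E (- j) w \<partial>torus) - (\<integral>w. T N w * E (- j) w \<partial>torus)) \<le> sqrt (2 * pi * d N)" for N
  proof -
    have "cmod ((\<integral>w. g w * E (- j) w \<partial>torus) - (\<integral>w. T N w * E (- j) w \<partial>torus)) = cmod (\<integral>w. (g w - T N w) * E (- j) w \<partial>torus)"
      using gE TE by (simp add: left_diff_distrib)
    also have "\<dots> \<le> (\<integral>w. cmod ((g w - T N w) * E (- j) w) \<partial>torus)" by (rule integral_norm_bound)
    also have "\<dots> = (\<integral>w. \<bar>cmod (g w - T N w)\<bar> \<partial>torus)" by (simp add: norm_mult)
    also have "\<dots> \<le> sqrt (2 * pi * d N)"
      using torus.L1_le_L2(2)[of "\<lambda>w. cmod (g w - T N w)"] fourier_series_trig(3)[OF F, of N]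
      by (intro real_le_rsqrt) (simp add: d_def T_def)
    finally show ?thesis .
  qed
  have ev: "(\<integral>w. T N w * E (- j) w \<partial>torus) = 2 * pi * a j" if "N \<ge> nat \<bar>j\<bar>" for N
  proof -
    have "(\<lambda>w. T N w * E (- j) w) = (\<lambda>w. \<Sum>k\<in>{- int N..int N}. of_real (a k) * E (k - j) w)"
      unfolding T_def trig_def by (simp add: sum_distrib_right E_add[symmetric] mult.assoc)
    moreover have "integrable torus (\<lambda>w. complex_of_real (a k) * E (k - j) w)" for k
      by (rule integrable_torus_bounded[of _ "\<bar>a k\<bar>"]) (auto simp: norm_mult)
    ultimately have "(\<integral>w. T N w * E (- j) w \<partial>torus) = (\<Sum>k\<in>{- int N..int N}. of_real (a k) * (if k = j then of_real (2 * pi) else 0))"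
      by (simp add: integral_E)
    also have "\<dots> = (\<Sum>k\<in>{- int N..int N}. if k = j then of_real (a j) * of_real (2 * pi) else 0)" by (intro sum.cong) auto
    also have "\<dots> = 2 * pi * a j" using that by (simp add: mult.commute) linarith
    finally show ?thesis .
  qed
  have "(\<lambda>N. sqrt (2 * pi * d N)) \<longlonglongrightarrow> sqrt (2 * pi * 0)" by (intro tendsto_intros d)
  then have lim: "(\<lambda>N. sqrt (2 * pi * d N)) \<longlonglongrightarrow> 0" by simp
  have "(\<lambda>N. (\<integral>w. g w * E (- j) w \<partial>torus) - (\<integral>w. T N w * E (- j) w \<partial>torus)) \<longlonglongrightarrow> 0"
    by (rule Lim_null_comparison[OF _ lim]) (use bound in auto)
  moreover have "eventually (\<lambda>N. (\<integral>w. g w * E (- j) w \<partial>torus) - (\<integral>w. T N w * E (- j) w \<partial>torus) = (\<integral>w. g w * E (- j) w \<partial>torus) - 2 * pi * a j) sequentially"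
    using eventually_ge_at_top[of "nat \<bar>j\<bar>"] by eventually_elim (simp only: ev)
  ultimately have "(\<lambda>N. (\<integral>w. g w * E (- j) w \<partial>torus) - 2 * pi * a j) \<longlonglongrightarrow> 0"
    by (rule Lim_transform_eventually)
  then show "(\<integral>w. g w * E (- j) w \<partial>torus) = 2 * pi * a j"
    by (simp add: LIMSEQ_const_iff)
qed

section \<open>Operator and Hilbert-Schmidt norms of convolution matrices\<close>

lemma adjoint_bound:
  assumes F: "fourier_series a g" and K: "finite K" and V: "finite V"
  shows "(\<Sum>i\<in>V. (cmod (\<Sum>k\<in>K. of_real (a (i - k)) * y k))\<^sup>2)
    \<le> 1 / (2 * pi) * (\<integral>w. (cmod (g w))\<^sup>2 * (cmod (trig K y w))\<^sup>2 \<partial>torus)"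
    "integrable torus (\<lambda>w. (cmod (g w))\<^sup>2 * (cmod (trig K y w))\<^sup>2)"
proof -
  note [measurable] = fourier_series_trig(1)[OF F]
  define h where "h w = g w * trig K y w" for w
  have [measurable]: "h \<in> borel_measurable torus" unfolding h_def[abs_def] by measurable
  have h2: "(cmod (h w))\<^sup>2 = (cmod (g w))\<^sup>2 * (cmod (trig K y w))\<^sup>2" for w
    by (simp add: h_def norm_mult power_mult_distrib)
  define B where "B = (\<Sum>k\<in>K. cmod (y k))\<^sup>2"
  have tb: "(cmod (trig K y w))\<^sup>2 \<le> B" for w
    unfolding B_def by (intro power_mono norm_trig_le) auto
  show int: "integrable torus (\<lambda>w. (cmod (g w))\<^sup>2 * (cmod (trig K y w))\<^sup>2)"
  proof (rule Bochner_Integration.integrable_bound)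
    show "integrable torus (\<lambda>w. (cmod (g w))\<^sup>2 * B)" using fourier_series_trig(2)[OF F] by auto
    have "0 \<le> B" by (simp add: B_def)
    then show "AE w in torus. norm ((cmod (g w))\<^sup>2 * (cmod (trig K y w))\<^sup>2) \<le> norm ((cmod (g w))\<^sup>2 * B)"
      using tb by (intro AE_I2) (auto simp: abs_mult intro!: mult_left_mono)
  qed measurable
  \<comment> \<open>The convolution of a with the finite sequence y is the coefficient sequence of
    the product \<open>h\<close>, so Bessel's inequality bounds its square sum over any finite V by
    the integral of |h|^2.\<close>
  have c: "(\<integral>w. h w * E (- i) w \<partial>torus) = 2 * pi * (\<Sum>k\<in>K. of_real (a (i - k)) * y k)" for i
  proof -
    have "(\<lambda>w. h w * E (- i) w) = (\<lambda>w. \<Sum>k\<in>K. y k * (g w * E (- (i - k)) w))"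
      unfolding h_def trig_def by (simp add: sum_distrib_left sum_distrib_right E_add[symmetric] mult_ac)
    then have "(\<integral>w. h w * E (- i) w \<partial>torus) = (\<Sum>k\<in>K. y k * (\<integral>w. g w * E (- (i - k)) w \<partial>torus))"
      using fourier_coefficient(1)[OF F] by simp
    then show ?thesis unfolding fourier_coefficient(2)[OF F] by (simp add: sum_distrib_left mult_ac)
  qed
  have "(\<Sum>i\<in>V. (cmod (\<integral>w. h w * E (- i) w \<partial>torus))\<^sup>2) \<le> 2 * pi * (\<integral>w. (cmod (h w))\<^sup>2 \<partial>torus)"
    by (rule bessel[OF V]) (use int in \<open>auto simp: h2\<close>)
  also have "(\<Sum>i\<in>V. (cmod (\<integral>w. h w * E (- i) w \<partial>torus))\<^sup>2) = (2 * pi)\<^sup>2 * (\<Sum>i\<in>V. (cmod (\<Sum>k\<in>K. of_real (a (i - k)) * y k))\<^sup>2)"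
    unfolding c norm_mult power_mult_distrib sum_distrib_left[symmetric] by simp
  finally show "(\<Sum>i\<in>V. (cmod (\<Sum>k\<in>K. of_real (a (i - k)) * y k))\<^sup>2)
    \<le> 1 / (2 * pi) * (\<integral>w. (cmod (g w))\<^sup>2 * (cmod (trig K y w))\<^sup>2 \<partial>torus)"
    unfolding h2 by (simp add: power2_eq_square field_simps)
qed

lemma op_bound_bounded:
  assumes F: "fourier_series a g" and K: "finite K" and V: "finite V"
    and b: "AE t in torus. (cmod (g t))\<^sup>2 \<le> R"
  shows "(\<Sum>i\<in>V. (\<Sum>k\<in>K. a (i - k) * y k)\<^sup>2) \<le> R * (\<Sum>k\<in>K. (y k)\<^sup>2)"
proof -
  note [measurable] = fourier_series_trig(1)[OF F]
  define Y where "Y k = complex_of_real (y k)" for k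
  have c: "(cmod (\<Sum>k\<in>K. of_real (a (i - k)) * Y k))\<^sup>2 = (\<Sum>k\<in>K. a (i - k) * y k)\<^sup>2" for i
    unfolding Y_def by (simp only: of_real_mult[symmetric] of_real_sum[symmetric] norm_of_real power2_abs)
  have it: "integrable torus (\<lambda>t. (cmod (trig K Y t))\<^sup>2)"
    by (rule integrable_torus_bounded[of _ "(\<Sum>k\<in>K. cmod (Y k))\<^sup>2"]) (auto intro!: power_mono norm_trig_le)
  have "(\<Sum>i\<in>V. (\<Sum>k\<in>K. a (i - k) * y k)\<^sup>2) \<le> 1 / (2 * pi) * (\<integral>t. (cmod (g t))\<^sup>2 * (cmod (trig K Y t))\<^sup>2 \<partial>torus)"
    using adjoint_bound(1)[OF F K V, of Y] unfolding c .
  also have "\<dots> \<le> 1 / (2 * pi) * (\<integral>t. R * (cmod (trig K Y t))\<^sup>2 \<partial>torus)"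
  proof (intro mult_left_mono integral_mono_AE adjoint_bound(2)[OF F K V])
    show "AE t in torus. (cmod (g t))\<^sup>2 * (cmod (trig K Y t))\<^sup>2 \<le> R * (cmod (trig K Y t))\<^sup>2"
      using b by eventually_elim (auto intro: mult_right_mono)
  qed (use it in auto)
  also have "\<dots> = R * (\<Sum>k\<in>K. (y k)\<^sup>2)"
    by (simp add: integral_norm_trig[OF K] Y_def)
  finally show ?thesis .
qed

text \<open>A truncation at level R: above R the factor u^(1-r) is at most R^(1-r), as the exponent
  is negative.\<close>

lemma le_add_powr:
  fixes u R r :: real
  assumes "0 \<le> u" "0 < R" "1 < r"
  shows "u \<le> R + u powr r * R powr (1 - r)"
proof (cases "u \<le> R")
  case False
  then have "u > 0" "R < u" using assms by auto
  have "u = u powr r * u powr (1 - r)" using \<open>u > 0\<close> by (simp add: powr_add[symmetric])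
  also have "\<dots> \<le> u powr r * R powr (1 - r)"
    using \<open>R < u\<close> assms by (intro mult_left_mono powr_mono2') auto
  finally show ?thesis using assms by simp
qed (simp add: add_increasing2)

lemma in_Lp_infinity_bound:
  assumes "v > 0" and "in_Lp \<infinity> torus (\<lambda>t. v * (cmod (g t))\<^sup>2)"
  shows "\<exists>B\<ge>0. AE t in torus. (cmod (g t))\<^sup>2 \<le> B"
proof -
  have "esssup torus (\<lambda>x. ereal \<bar>v * (cmod (g x))\<^sup>2\<bar>) < \<infinity>" using assms(2) by (simp add: in_Lp_def)
  then obtain R where R: "esssup torus (\<lambda>x. ereal \<bar>v * (cmod (g x))\<^sup>2\<bar>) \<le> ereal R"
    by (cases "esssup torus (\<lambda>x. ereal \<bar>v * (cmod (g x))\<^sup>2\<bar>)") auto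
  have "(\<lambda>x. v * (cmod (g x))\<^sup>2) \<in> borel_measurable torus" using assms(2) by (simp add: in_Lp_def)
  then have "AE x in torus. ereal \<bar>v * (cmod (g x))\<^sup>2\<bar> \<le> esssup torus (\<lambda>x. ereal \<bar>v * (cmod (g x))\<^sup>2\<bar>)"
    by (intro esssup_AE) measurable
  then have "AE x in torus. (cmod (g x))\<^sup>2 \<le> max 0 (R / v)"
  proof eventually_elim
    case (elim x)
    then have "ereal \<bar>v * (cmod (g x))\<^sup>2\<bar> \<le> ereal R" using R by (rule order_trans)
    then have "v * (cmod (g x))\<^sup>2 \<le> R" using assms(1) by simp
    then show ?case using assms(1) by (simp add: field_simps le_max_iff_disj)
  qed
  then show ?thesis by (intro exI[of _ "max 0 (R / v)"]) simp
qed

text \<open>For unbounded f the density is truncated at a level R. Below R Parseval applies; above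
  R, |f|^r is integrable and the trigonometric polynomial is bounded uniformly by n times the square
  sum of y, since it has at most n terms. The rate n^(1/q) is for the square of the norm of the
  filter; the quadratic form contains two filters, so its norm is of this order too.\<close>

lemma op_bound:
  assumes F: "fourier_series a g" and v: "v > 0" and q: "2 < q" and L: "in_Lp q torus (\<lambda>t. v * (cmod (g t))\<^sup>2)"
  shows "\<exists>C\<ge>0. \<forall>n K V y. 1 \<le> n \<longrightarrow> finite K \<longrightarrow> card K \<le> n \<longrightarrow> finite V \<longrightarrow>
    (\<Sum>i\<in>V. (\<Sum>k\<in>K. a (i - k) * y k)\<^sup>2) \<le> C * real n powr real_of_ereal (1 / q) * (\<Sum>k\<in>K. (y k)\<^sup>2)"
proof (cases "q = \<infinity>")
  case True
  note [measurable] = fourier_series_trig(1)[OF F]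
  obtain B where B: "B \<ge> 0" "AE t in torus. (cmod (g t))\<^sup>2 \<le> B"
    using in_Lp_infinity_bound[OF v] L True by blast
  \<comment> \<open>Here 1/q = 0 and \<open>real n powr 0 = 1\<close>, because n \<ge> 1.\<close>
  show ?thesis
    by (rule exI[of _ B]) (auto simp: True B(1) intro!: op_bound_bounded[OF F _ _ B(2)])
next
  case False
  note [measurable] = fourier_series_trig(1)[OF F]
  obtain r where r: "q = ereal r" "r > 2" using q False by (cases q) auto
  have rq: "real_of_ereal (1 / q) = 1 / r" using r by (simp add: one_ereal_def)
  define u where "u t = (cmod (g t))\<^sup>2" for t
  have u0: "u t \<ge> 0" for t by (simp add: u_def)
  have [measurable]: "u \<in> borel_measurable torus" unfolding u_def[abs_def] by measurable
  have iu: "integrable torus (\<lambda>t. u t powr r)"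
  proof -
    have "integrable torus (\<lambda>t. \<bar>v * u t\<bar> powr r)" using L False r by (simp add: in_Lp_def u_def)
    then have "integrable torus (\<lambda>t. v powr r * u t powr r)" using v u0 by (simp add: powr_mult)
    then show ?thesis using v by simp
  qed
  define B where "B = (\<integral>t. u t powr r \<partial>torus)"
  have B: "B \<ge> 0" by (simp add: B_def)
  show ?thesis
  proof (intro exI[of _ "1 + B / (2 * pi)"] conjI allI impI)
    fix n :: nat and K V :: "int set" and y :: "int \<Rightarrow> real"
    assume n: "1 \<le> n" and K: "finite K" "card K \<le> n" and V: "finite V"
    define Y where "Y k = complex_of_real (y k)" for k
    define s where "s = (\<Sum>k\<in>K. (y k)\<^sup>2)"
    have s: "s \<ge> 0" unfolding s_def by (intro sum_nonneg) auto
    \<comment> \<open>The level at which both parts balance: it solves n R^(1-r) = R.\<close>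
    define R where "R = real n powr (1 / r)"
    have R: "R > 0" using n by (simp add: R_def)
    have nR: "real n * R powr (1 - r) = R"
    proof -
      have "R powr (1 - r) = real n powr ((1 - r) / r)" unfolding R_def by (simp add: powr_powr)
      then have "real n * R powr (1 - r) = real n powr (1 + (1 - r) / r)" using n by (simp add: powr_add)
      also have "1 + (1 - r) / r = 1 / r" using r by (simp add: field_simps)
      finally show ?thesis by (simp add: R_def)
    qed
    have c: "(cmod (\<Sum>k\<in>K. of_real (a (i - k)) * Y k))\<^sup>2 = (\<Sum>k\<in>K. a (i - k) * y k)\<^sup>2" for i
      unfolding Y_def by (simp only: of_real_mult[symmetric] of_real_sum[symmetric] norm_of_real power2_abs)
    define P where "P t = (cmod (trig K Y t))\<^sup>2" for t
    have [measurable]: "P \<in> borel_measurable torus" unfolding P_def[abs_def] by measurable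
    have P0: "P t \<ge> 0" for t by (simp add: P_def)
    have Pn: "P t \<le> real n * s" for t
    proof -
      have "P t \<le> (\<Sum>k\<in>K. \<bar>y k\<bar>)\<^sup>2" unfolding P_def using norm_trig_le[of K Y t] by (intro power_mono) (auto simp: Y_def)
      also have "\<dots> \<le> (\<Sum>k\<in>K. (1::real)\<^sup>2) * (\<Sum>k\<in>K. \<bar>y k\<bar>\<^sup>2)"
        using Cauchy_Schwarz_ineq_sum[of "\<lambda>_. 1" "\<lambda>k. \<bar>y k\<bar>" K] by simp
      also have "\<dots> \<le> real n * s" using K s by (auto simp: s_def intro!: mult_right_mono)
      finally show ?thesis .
    qed
    have iP: "integrable torus P" by (rule integrable_torus_bounded[of _ "real n * s"]) (use Pn P0 in auto)
    have IP: "(\<integral>t. P t \<partial>torus) = 2 * pi * s"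
      unfolding P_def integral_norm_trig[OF K(1)] by (simp add: Y_def s_def)
    have "(\<Sum>i\<in>V. (\<Sum>k\<in>K. a (i - k) * y k)\<^sup>2) \<le> 1 / (2 * pi) * (\<integral>t. u t * P t \<partial>torus)"
      using adjoint_bound(1)[OF F K(1) V, of Y] unfolding c u_def P_def .
    also have "\<dots> \<le> 1 / (2 * pi) * (\<integral>t. R * P t + (R powr (1 - r) * (real n * s)) * u t powr r \<partial>torus)"
    proof (intro mult_left_mono integral_mono)
      show "integrable torus (\<lambda>t. u t * P t)" unfolding u_def P_def by (rule adjoint_bound(2)[OF F K(1) V])
      show "integrable torus (\<lambda>t. R * P t + (R powr (1 - r) * (real n * s)) * u t powr r)" using iP iu by auto
      fix t
      have "u t * P t \<le> (R + u t powr r * R powr (1 - r)) * P t"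
        using le_add_powr[OF u0 R, of r t] r P0 by (intro mult_right_mono) auto
      also have "\<dots> = R * P t + (u t powr r * R powr (1 - r)) * P t" by (simp add: distrib_right)
      also have "\<dots> \<le> R * P t + (u t powr r * R powr (1 - r)) * (real n * s)"
        using Pn by (intro add_left_mono mult_left_mono) auto
      finally show "u t * P t \<le> R * P t + (R powr (1 - r) * (real n * s)) * u t powr r" by (simp add: mult_ac)
    qed auto
    also have "\<dots> = 1 / (2 * pi) * (R * (2 * pi * s) + (real n * R powr (1 - r)) * s * B)"
      using iP iu by (simp add: IP B_def mult_ac)
    also have "\<dots> = (1 + B / (2 * pi)) * real n powr real_of_ereal (1 / q) * s"
      unfolding nR rq R_def[symmetric] by (simp add: field_simps)
    finally show "(\<Sum>i\<in>V. (\<Sum>k\<in>K. a (i - k) * y k)\<^sup>2) \<le> (1 + B / (2 * pi)) * real n powr real_of_ereal (1 / q) * (\<Sum>k\<in>K. (y k)\<^sup>2)"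
      unfolding s_def .
  qed (use B in simp)
qed

lemma torus_pair_sigma_finite: "pair_sigma_finite torus torus"
  by (intro pair_sigma_finite.intro torus.sigma_finite_measure_axioms)

lemma nn_integral_norm_trig:
  assumes "finite K"
  shows "(\<integral>\<^sup>+t. ennreal ((cmod (trig K y t))\<^sup>2) \<partial>torus) = ennreal (2 * pi * (\<Sum>k\<in>K. (cmod (y k))\<^sup>2))"
proof -
  have "integrable torus (\<lambda>t. (cmod (trig K y t))\<^sup>2)"
    by (rule integrable_torus_bounded[of _ "(\<Sum>k\<in>K. cmod (y k))\<^sup>2"]) (auto intro!: power_mono norm_trig_le)
  then show ?thesis by (subst nn_integral_eq_integral) (auto simp: integral_norm_trig[OF assms])
qed

text \<open>Bessel's inequality in i and then in j bounds the square sum by a double integral of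
  |gc(t)|^2 |ga(\<phi>)|^2 times the kernel \<open>D\<close>, the squared modulus of the sum over k
  in K of exp(ik(t + \<phi>)). In each variable separately the kernel has integral 2 pi card K, so a
  pointwise splitting of the product of the two densities leaves only fourth powers.\<close>

lemma hs_bound:
  assumes Fc: "fourier_series c gc" and Fa: "fourier_series a ga"
    and ic: "integrable torus (\<lambda>t. (cmod (gc t)) ^ 4)" and ia: "integrable torus (\<lambda>t. (cmod (ga t)) ^ 4)"
    and K: "finite K" and V: "finite V" and W: "finite W" and \<tau>: "\<tau> > 0"
  shows "(\<Sum>i\<in>V. \<Sum>j\<in>W. (\<Sum>k\<in>K. c (i - k) * a (j - k))\<^sup>2)
    \<le> real (card K) / (4 * pi) * (\<tau> * (\<integral>t. (cmod (gc t)) ^ 4 \<partial>torus) + 1 / \<tau> * (\<integral>t. (cmod (ga t)) ^ 4 \<partial>torus))"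
proof -
  note [measurable] = fourier_series_trig(1)[OF Fc] fourier_series_trig(1)[OF Fa]
  interpret TT: pair_sigma_finite torus torus by (rule torus_pair_sigma_finite)
  define D where "D t \<phi> = (cmod (trig K (\<lambda>k. E k t) \<phi>))\<^sup>2" for t \<phi>
  have Dsym: "D t \<phi> = D \<phi> t" for t \<phi> by (simp add: D_def trig_def mult.commute)
  have D0: "D t \<phi> \<ge> 0" for t \<phi> by (simp add: D_def)
  have [measurable]: "(\<lambda>x. D (fst x) (snd x)) \<in> borel_measurable (torus \<Otimes>\<^sub>M torus)"
    unfolding D_def trig_def by measurable
  have Dm1[measurable]: "(\<lambda>x. D t x) \<in> borel_measurable torus" for t unfolding D_def by measurable
  have Dm2[measurable]: "(\<lambda>x. D x t) \<in> borel_measurable torus" for t unfolding D_def trig_def by measurable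
  have ID: "(\<integral>\<^sup>+\<phi>. ennreal (D t \<phi>) \<partial>torus) = ennreal (2 * pi * real (card K))" for t
    unfolding D_def nn_integral_norm_trig[OF K] by simp
  have ID': "(\<integral>\<^sup>+t. ennreal (D t \<phi>) \<partial>torus) = ennreal (2 * pi * real (card K))" for \<phi>
  proof -
    have "(\<lambda>t. ennreal (D t \<phi>)) = (\<lambda>t. ennreal (D \<phi> t))" by (rule ext, subst Dsym, rule refl)
    then show ?thesis by (simp only: ID)
  qed
  have en: "ennreal (x * z + y * z) = ennreal x * ennreal z + ennreal y * ennreal z" if "0 \<le> x" "0 \<le> y" "0 \<le> z" for x y z
    using that by (simp add: ennreal_plus ennreal_mult)
  define u where "u t = (cmod (gc t))\<^sup>2" for t
  define w where "w t = (cmod (ga t))\<^sup>2" for t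
  have u2: "(u t)\<^sup>2 = cmod (gc t) ^ 4" and w2: "(w t)\<^sup>2 = cmod (ga t) ^ 4" for t
    by (simp_all add: u_def w_def)
  have u0: "u t \<ge> 0" and w0: "w t \<ge> 0" for t by (simp_all add: u_def w_def)
  have [measurable]: "u \<in> borel_measurable torus" "w \<in> borel_measurable torus" unfolding u_def[abs_def] w_def[abs_def] by measurable
  define Y where "Y j k = complex_of_real (a (j - k))" for j k
  have c1: "(\<Sum>i\<in>V. (\<Sum>k\<in>K. c (i - k) * a (j - k))\<^sup>2) \<le> 1 / (2 * pi) * (\<integral>t. u t * (cmod (trig K (Y j) t))\<^sup>2 \<partial>torus)" for j
  proof -
    have "(cmod (\<Sum>k\<in>K. of_real (c (i - k)) * Y j k))\<^sup>2 = (\<Sum>k\<in>K. c (i - k) * a (j - k))\<^sup>2" for i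
      unfolding Y_def by (simp only: of_real_mult[symmetric] of_real_sum[symmetric] norm_of_real power2_abs)
    then show ?thesis using adjoint_bound(1)[OF Fc K V, of "Y j"] by (simp add: u_def)
  qed
  have iY: "integrable torus (\<lambda>t. u t * (cmod (trig K (Y j) t))\<^sup>2)" for j
    unfolding u_def by (rule adjoint_bound(2)[OF Fc K V])
  define \<Psi> where "\<Psi> t = (\<integral>\<phi>. w \<phi> * D t \<phi> \<partial>torus)" for t
  have c2: "(\<Sum>j\<in>W. (cmod (trig K (Y j) t))\<^sup>2) \<le> 1 / (2 * pi) * \<Psi> t" for t
    using adjoint_bound(1)[OF Fa K W, of "\<lambda>k. E k t"] by (simp add: \<Psi>_def w_def D_def trig_def Y_def)
  have i\<Psi>: "integrable torus (\<lambda>\<phi>. w \<phi> * D t \<phi>)" for t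
    unfolding w_def D_def by (rule adjoint_bound(2)[OF Fa K W])
  define Ic where "Ic = (\<integral>t. (cmod (gc t)) ^ 4 \<partial>torus)"
  define Ia where "Ia = (\<integral>t. (cmod (ga t)) ^ 4 \<partial>torus)"
  have I0: "Ic \<ge> 0" "Ia \<ge> 0" by (auto simp: Ic_def Ia_def)
  define S where "S = (\<Sum>i\<in>V. \<Sum>j\<in>W. (\<Sum>k\<in>K. c (i - k) * a (j - k))\<^sup>2)"
  have S1: "S \<le> 1 / (2 * pi) * (\<integral>t. u t * (\<Sum>j\<in>W. (cmod (trig K (Y j) t))\<^sup>2) \<partial>torus)"
  proof -
    have "S = (\<Sum>j\<in>W. \<Sum>i\<in>V. (\<Sum>k\<in>K. c (i - k) * a (j - k))\<^sup>2)" unfolding S_def by (rule sum.swap)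
    also have "\<dots> \<le> (\<Sum>j\<in>W. 1 / (2 * pi) * (\<integral>t. u t * (cmod (trig K (Y j) t))\<^sup>2 \<partial>torus))" by (intro sum_mono c1)
    also have "\<dots> = 1 / (2 * pi) * (\<integral>t. (\<Sum>j\<in>W. u t * (cmod (trig K (Y j) t))\<^sup>2) \<partial>torus)"
      using iY by (simp add: sum_distrib_left)
    finally show ?thesis by (simp add: sum_distrib_left)
  qed
  have "ennreal ((2 * pi) * ((2 * pi) * S)) \<le> (\<integral>\<^sup>+t. \<integral>\<^sup>+\<phi>. ennreal (u t * w \<phi> * D t \<phi>) \<partial>torus \<partial>torus)"
  proof -
    have isum: "integrable torus (\<lambda>t. u t * (\<Sum>j\<in>W. (cmod (trig K (Y j) t))\<^sup>2))"
      unfolding sum_distrib_left using iY by (intro Bochner_Integration.integrable_sum) auto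
    have "(2 * pi) * S \<le> (\<integral>t. u t * (\<Sum>j\<in>W. (cmod (trig K (Y j) t))\<^sup>2) \<partial>torus)"
      using S1 by (simp add: field_simps)
    then have "ennreal ((2 * pi) * ((2 * pi) * S)) \<le> ennreal ((2 * pi) * (\<integral>t. u t * (\<Sum>j\<in>W. (cmod (trig K (Y j) t))\<^sup>2) \<partial>torus))"
      by (intro ennreal_leI mult_left_mono) auto
    also have "\<dots> = ennreal (\<integral>t. (2 * pi) * (u t * (\<Sum>j\<in>W. (cmod (trig K (Y j) t))\<^sup>2)) \<partial>torus)" by simp
    also have "\<dots> = (\<integral>\<^sup>+t. ennreal ((2 * pi) * (u t * (\<Sum>j\<in>W. (cmod (trig K (Y j) t))\<^sup>2))) \<partial>torus)"
      using isum u0 by (intro nn_integral_eq_integral[symmetric]) (auto intro!: sum_nonneg mult_nonneg_nonneg)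
    also have "\<dots> \<le> (\<integral>\<^sup>+t. ennreal (u t * \<Psi> t) \<partial>torus)"
    proof (intro nn_integral_mono ennreal_leI)
      fix t
      have "u t * (2 * pi * (\<Sum>j\<in>W. (cmod (trig K (Y j) t))\<^sup>2)) \<le> u t * \<Psi> t"
        using c2[of t] u0 by (intro mult_left_mono) (auto simp: field_simps)
      then show "(2 * pi) * (u t * (\<Sum>j\<in>W. (cmod (trig K (Y j) t))\<^sup>2)) \<le> u t * \<Psi> t" by (simp add: mult_ac)
    qed
    also have "\<dots> = (\<integral>\<^sup>+t. \<integral>\<^sup>+\<phi>. ennreal (u t * w \<phi> * D t \<phi>) \<partial>torus \<partial>torus)"
    proof (intro nn_integral_cong)
      fix t
      have "ennreal (u t * \<Psi> t) = ennreal (\<integral>\<phi>. u t * (w \<phi> * D t \<phi>) \<partial>torus)" by (simp add: \<Psi>_def)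
      also have "\<dots> = (\<integral>\<^sup>+\<phi>. ennreal (u t * (w \<phi> * D t \<phi>)) \<partial>torus)"
        using i\<Psi>[of t] u0 w0 D0 by (intro nn_integral_eq_integral[symmetric]) auto
      finally show "ennreal (u t * \<Psi> t) = (\<integral>\<^sup>+\<phi>. ennreal (u t * w \<phi> * D t \<phi>) \<partial>torus)" by (simp add: mult.assoc)
    qed
    finally show ?thesis .
  qed
  \<comment> \<open>The inequality of the means with a free weight: if one fourth norm is bounded
    and the other can be made small, a large \<tau> tames the bounded one, and the small one is
    chosen afterwards.\<close>
  also have "\<dots> \<le> (\<integral>\<^sup>+t. \<integral>\<^sup>+\<phi>. ennreal (\<tau> / 2 * (u t)\<^sup>2) * ennreal (D t \<phi>) + ennreal (1 / (2 * \<tau>) * (w \<phi>)\<^sup>2) * ennreal (D t \<phi>) \<partial>torus \<partial>torus)"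
  proof (intro nn_integral_mono)
    fix t \<phi>
    have "u t * w \<phi> \<le> \<tau> / 2 * (u t)\<^sup>2 + 1 / (2 * \<tau>) * (w \<phi>)\<^sup>2"
    proof -
      have "0 \<le> (\<tau> * u t - w \<phi>)\<^sup>2" by simp
      then have "2 * \<tau> * (u t * w \<phi>) \<le> \<tau>\<^sup>2 * (u t)\<^sup>2 + (w \<phi>)\<^sup>2" by (simp add: power2_eq_square algebra_simps)
      then show ?thesis using \<tau> by (simp add: field_simps power2_eq_square)
    qed
    then have "u t * w \<phi> * D t \<phi> \<le> (\<tau> / 2 * (u t)\<^sup>2 + 1 / (2 * \<tau>) * (w \<phi>)\<^sup>2) * D t \<phi>" by (intro mult_right_mono D0)
    also have "\<dots> = \<tau> / 2 * (u t)\<^sup>2 * D t \<phi> + 1 / (2 * \<tau>) * (w \<phi>)\<^sup>2 * D t \<phi>" by (rule distrib_right)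
    finally have "ennreal (u t * w \<phi> * D t \<phi>) \<le> ennreal (\<tau> / 2 * (u t)\<^sup>2 * D t \<phi> + 1 / (2 * \<tau>) * (w \<phi>)\<^sup>2 * D t \<phi>)"
      by (rule ennreal_leI)
    also have "\<dots> = ennreal (\<tau> / 2 * (u t)\<^sup>2) * ennreal (D t \<phi>) + ennreal (1 / (2 * \<tau>) * (w \<phi>)\<^sup>2) * ennreal (D t \<phi>)"
      using D0[of t \<phi>] \<tau> by (intro en) auto
    finally show "ennreal (u t * w \<phi> * D t \<phi>) \<le> \<dots>" .
  qed
  also have "\<dots> = (\<integral>\<^sup>+t. ennreal (\<tau> / 2 * (u t)\<^sup>2) * ennreal (2 * pi * real (card K)) \<partial>torus)
     + (\<integral>\<^sup>+t. \<integral>\<^sup>+\<phi>. ennreal (1 / (2 * \<tau>) * (w \<phi>)\<^sup>2) * ennreal (D t \<phi>) \<partial>torus \<partial>torus)"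
    by (subst nn_integral_add[symmetric]) (auto simp: nn_integral_add nn_integral_cmult ID intro!: nn_integral_cong)
  also have "(\<integral>\<^sup>+t. \<integral>\<^sup>+\<phi>. ennreal (1 / (2 * \<tau>) * (w \<phi>)\<^sup>2) * ennreal (D t \<phi>) \<partial>torus \<partial>torus)
     = (\<integral>\<^sup>+\<phi>. \<integral>\<^sup>+t. ennreal (1 / (2 * \<tau>) * (w \<phi>)\<^sup>2) * ennreal (D t \<phi>) \<partial>torus \<partial>torus)"
    by (rule TT.Fubini'[symmetric]) measurable
  also have "\<dots> = (\<integral>\<^sup>+\<phi>. ennreal (1 / (2 * \<tau>) * (w \<phi>)\<^sup>2) * ennreal (2 * pi * real (card K)) \<partial>torus)"
    by (intro nn_integral_cong) (simp add: nn_integral_cmult ID' del: ennreal_mult'')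
  also have "(\<integral>\<^sup>+t. ennreal (\<tau> / 2 * (u t)\<^sup>2) * ennreal (2 * pi * real (card K)) \<partial>torus) = ennreal (\<tau> / 2 * Ic * (2 * pi * real (card K)))"
  proof -
    have "(\<integral>\<^sup>+t. ennreal (\<tau> / 2 * (u t)\<^sup>2) \<partial>torus) = ennreal (\<tau> / 2 * Ic)"
      unfolding u2 Ic_def using ic \<tau> by (subst nn_integral_eq_integral) auto
    moreover have "(\<integral>\<^sup>+t. ennreal (\<tau> / 2 * (u t)\<^sup>2) * ennreal (2 * pi * real (card K)) \<partial>torus)
      = (\<integral>\<^sup>+t. ennreal (\<tau> / 2 * (u t)\<^sup>2) \<partial>torus) * ennreal (2 * pi * real (card K))"
      by (rule nn_integral_multc) measurable
    moreover have "ennreal (\<tau> / 2 * Ic) * ennreal (2 * pi * real (card K)) = ennreal (\<tau> / 2 * Ic * (2 * pi * real (card K)))"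
      using I0 \<tau> by (intro ennreal_mult'[symmetric]) auto
    ultimately show ?thesis by (simp only:)
  qed
  also have "(\<integral>\<^sup>+t. ennreal (1 / (2 * \<tau>) * (w t)\<^sup>2) * ennreal (2 * pi * real (card K)) \<partial>torus) = ennreal (1 / (2 * \<tau>) * Ia * (2 * pi * real (card K)))"
  proof -
    have "(\<integral>\<^sup>+t. ennreal (1 / (2 * \<tau>) * (w t)\<^sup>2) \<partial>torus) = ennreal (1 / (2 * \<tau>) * Ia)"
      unfolding w2 Ia_def using ia \<tau> by (subst nn_integral_eq_integral) auto
    moreover have "(\<integral>\<^sup>+t. ennreal (1 / (2 * \<tau>) * (w t)\<^sup>2) * ennreal (2 * pi * real (card K)) \<partial>torus)
      = (\<integral>\<^sup>+t. ennreal (1 / (2 * \<tau>) * (w t)\<^sup>2) \<partial>torus) * ennreal (2 * pi * real (card K))"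
      by (rule nn_integral_multc) measurable
    moreover have "ennreal (1 / (2 * \<tau>) * Ia) * ennreal (2 * pi * real (card K)) = ennreal (1 / (2 * \<tau>) * Ia * (2 * pi * real (card K)))"
      using I0 \<tau> by (intro ennreal_mult'[symmetric]) auto
    ultimately show ?thesis by (simp only:)
  qed
  also have "ennreal (\<tau> / 2 * Ic * (2 * pi * real (card K))) + ennreal (1 / (2 * \<tau>) * Ia * (2 * pi * real (card K)))
    = ennreal (\<tau> / 2 * Ic * (2 * pi * real (card K)) + 1 / (2 * \<tau>) * Ia * (2 * pi * real (card K)))"
    using I0 \<tau> by (intro ennreal_plus[symmetric]) auto
  finally have "(2 * pi) * ((2 * pi) * S) \<le> \<tau> / 2 * Ic * (2 * pi * real (card K)) + 1 / (2 * \<tau>) * Ia * (2 * pi * real (card K))"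
    using I0 \<tau> by (subst (asm) ennreal_le_iff) auto
  also have "\<dots> = (2 * pi) * (real (card K) / 2 * (\<tau> * Ic + 1 / \<tau> * Ia))"
    using \<tau> by (simp add: field_simps)
  finally have "(2 * pi) * S \<le> real (card K) / 2 * (\<tau> * Ic + 1 / \<tau> * Ia)" by simp
  then have "S \<le> real (card K) / (4 * pi) * (\<tau> * Ic + 1 / \<tau> * Ia)"
    by (simp add: field_simps)
  then show ?thesis unfolding S_def Ic_def Ia_def .
qed

section \<open>Fejer means in $L^4$\<close>

text \<open>This is the maximum of 0 and 1 - |j|/M. The count is the form in which the weight arises
  when a double sum over k and l is sorted by the difference j, both in the Fejer kernel and in the
  variance of a block.\<close>

definition fejer_weight :: "nat \<Rightarrow> int \<Rightarrow> real" where
  "fejer_weight M j = real (card {k\<in>{0..<int M}. k - j \<in> {0..<int M}}) / real M"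

definition fejer_mean :: "(int \<Rightarrow> real) \<Rightarrow> nat \<Rightarrow> int \<Rightarrow> real" where
  "fejer_mean a M j = fejer_weight M j * a j"

lemma card_shifted_interval: "card {k\<in>{0..<int M}. k - j \<in> {0..<int M}} = nat (int M - \<bar>j\<bar>)"
proof -
  have "{k\<in>{0..<int M}. k - j \<in> {0..<int M}} = {max 0 j..<min (int M) (int M + j)}" by auto
  then show ?thesis by simp
qed

lemma fejer_weight_bounds:
  assumes "M > 0"
  shows "0 \<le> fejer_weight M j" "fejer_weight M j \<le> 1" "1 - fejer_weight M j \<le> real_of_int \<bar>j\<bar> / real M"
proof -
  show "0 \<le> fejer_weight M j" by (simp add: fejer_weight_def)
  have 1: "real (nat (int M - \<bar>j\<bar>)) \<le> real M" by simp
  then show "fejer_weight M j \<le> 1" using assms unfolding fejer_weight_def card_shifted_interval by simp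
  have "real M - real_of_int \<bar>j\<bar> \<le> real (nat (int M - \<bar>j\<bar>))" by simp
  then have "(real M - real_of_int \<bar>j\<bar>) / real M \<le> fejer_weight M j"
    unfolding fejer_weight_def card_shifted_interval by (intro divide_right_mono) auto
  then show "1 - fejer_weight M j \<le> real_of_int \<bar>j\<bar> / real M" using assms by (simp add: diff_divide_distrib)
qed

lemma fejer_mean_eq_0: "\<bar>j\<bar> \<ge> int M \<Longrightarrow> fejer_mean a M j = 0"
  unfolding fejer_mean_def fejer_weight_def card_shifted_interval by simp

text \<open>M times the Fejer kernel at t - s. It is written with both variables so that its
  symmetry and its joint measurability are at hand for Fubini's theorem.\<close>

definition dirichlet_sq :: "nat \<Rightarrow> real \<Rightarrow> real \<Rightarrow> real" where
  "dirichlet_sq M t s = (cmod (\<Sum>k\<in>{0..<int M}. E k t * E (- k) s))\<^sup>2"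

lemma dirichlet_sq_eq:
  "complex_of_real (dirichlet_sq M t s) = (\<Sum>k\<in>{0..<int M}. \<Sum>l\<in>{0..<int M}. E (k - l) t * E (- (k - l)) s)"
  unfolding dirichlet_sq_def norm_square_complex
proof -
  have h: "E k t * E (- k) s * cnj (E l t * E (- l) s) = E (k - l) t * E (- (k - l)) s" for k l
  proof -
    have "E k t * E (- k) s * cnj (E l t * E (- l) s) = (E k t * E (- l) t) * (E (- k) s * E (- (- l)) s)"
      by (simp add: cnj_E mult_ac)
    then show ?thesis unfolding E_add[symmetric] by simp
  qed
  show "(\<Sum>k\<in>{0..<int M}. E k t * E (- k) s) * cnj (\<Sum>k\<in>{0..<int M}. E k t * E (- k) s)
    = (\<Sum>k\<in>{0..<int M}. \<Sum>l\<in>{0..<int M}. E (k - l) t * E (- (k - l)) s)"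
    by (simp only: cnj_sum sum_product h)
qed

lemma dirichlet_sq_sym: "dirichlet_sq M t s = dirichlet_sq M s t"
proof -
  have "cnj (\<Sum>k\<in>{0..<int M}. E k t * E (- k) s) = (\<Sum>k\<in>{0..<int M}. E k s * E (- k) t)"
    by (simp add: cnj_E mult.commute)
  then show ?thesis unfolding dirichlet_sq_def by (metis complex_mod_cnj)
qed

lemma dirichlet_sq_bounds: "0 \<le> dirichlet_sq M t s" "dirichlet_sq M t s \<le> (real M)\<^sup>2"
proof -
  have "cmod (\<Sum>k\<in>{0..<int M}. E k t * E (- k) s) \<le> (\<Sum>k\<in>{0..<int M}. 1)"
    by (rule order_trans[OF norm_sum]) (simp add: norm_mult)
  then show "dirichlet_sq M t s \<le> (real M)\<^sup>2" unfolding dirichlet_sq_def by (intro power_mono) auto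
qed (simp add: dirichlet_sq_def)

lemma dirichlet_sq_measurable [measurable]:
  "(\<lambda>x. dirichlet_sq M (fst x) (snd x)) \<in> borel_measurable (torus \<Otimes>\<^sub>M torus)"
  "(\<lambda>s. dirichlet_sq M t s) \<in> borel_measurable torus" "(\<lambda>t. dirichlet_sq M t s) \<in> borel_measurable torus"
  unfolding dirichlet_sq_def by measurable

lemma nn_integral_dirichlet_sq: "(\<integral>\<^sup>+t. ennreal (dirichlet_sq M t s) \<partial>torus) = ennreal (2 * pi * real M)"
proof -
  have "dirichlet_sq M t s = (cmod (trig {0..<int M} (\<lambda>k. E (- k) s) t))\<^sup>2" for t
    by (simp add: dirichlet_sq_def trig_def mult.commute)
  then show ?thesis by (simp only: nn_integral_norm_trig[OF finite_atLeastLessThan_int]) simp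
qed

text \<open>Expanding the squared sum gives the coefficients a (k - l), and the number of pairs with
  k - l = j is M times the Fejer weight of j.\<close>

lemma fejer_convolution:
  fixes g :: "real \<Rightarrow> complex"
  assumes F: "fourier_series a g" and M: "M > 0"
  shows "integrable torus (\<lambda>s. complex_of_real (dirichlet_sq M t s) * g s)"
    "trig {- int M..int M} (\<lambda>j. of_real (fejer_mean a M j)) t
      = 1 / (2 * pi * real M) * (\<integral>s. complex_of_real (dirichlet_sq M t s) * g s \<partial>torus)"
proof -
  define K where "K = {0..<int M}"
  have eq: "(\<lambda>s. complex_of_real (dirichlet_sq M t s) * g s) = (\<lambda>s. \<Sum>k\<in>K. \<Sum>l\<in>K. E (k - l) t * (g s * E (- (k - l)) s))"
    unfolding dirichlet_sq_eq K_def by (simp add: sum_distrib_left sum_distrib_right mult_ac)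
  note i = fourier_coefficient(1)[OF F]
  show "integrable torus (\<lambda>s. complex_of_real (dirichlet_sq M t s) * g s)"
    unfolding eq by (intro Bochner_Integration.integrable_sum integrable_mult_right i)
  have "(\<integral>s. complex_of_real (dirichlet_sq M t s) * g s \<partial>torus) = (\<Sum>k\<in>K. \<Sum>l\<in>K. E (k - l) t * (2 * pi * a (k - l)))"
  proof -
    have "(\<integral>s. g s * E (l - k) s \<partial>torus) = 2 * pi * a (k - l)" for k l
      using fourier_coefficient(2)[OF F, of "k - l"] by simp
    then show ?thesis unfolding eq using i by simp
  qed
  also have "\<dots> = (\<Sum>k\<in>K. \<Sum>j\<in>{- int M..int M}. if k - j \<in> K then E j t * (2 * pi * a j) else 0)"
  proof (rule sum.cong[OF refl])
    fix k assume k: "k \<in> K"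
    have "(\<Sum>l\<in>K. E (k - l) t * (2 * pi * a (k - l))) = (\<Sum>j\<in>{j\<in>{- int M..int M}. k - j \<in> K}. E j t * (2 * pi * a j))"
      by (rule sum.reindex_bij_witness[of _ "\<lambda>j. k - j" "\<lambda>l. k - l"]) (use k in \<open>auto simp: K_def\<close>)
    also have "\<dots> = (\<Sum>j\<in>{- int M..int M}. if k - j \<in> K then E j t * (2 * pi * a j) else 0)"
      by (rule sum.inter_filter) simp
    finally show "(\<Sum>l\<in>K. E (k - l) t * (2 * pi * a (k - l))) = \<dots>" .
  qed
  also have "\<dots> = (\<Sum>j\<in>{- int M..int M}. \<Sum>k\<in>K. if k - j \<in> K then E j t * (2 * pi * a j) else 0)"
    by (rule sum.swap)
  also have "\<dots> = (\<Sum>j\<in>{- int M..int M}. of_nat (card {k\<in>K. k - j \<in> K}) * (E j t * (2 * pi * a j)))"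
  proof (intro sum.cong refl)
    fix j
    have "(\<Sum>k\<in>K. if k - j \<in> K then E j t * (2 * pi * a j) else 0) = (\<Sum>k\<in>{k\<in>K. k - j \<in> K}. E j t * (2 * pi * a j))"
      by (rule sum.inter_filter[symmetric]) (simp add: K_def)
    then show "(\<Sum>k\<in>K. if k - j \<in> K then E j t * (2 * pi * a j) else 0) = of_nat (card {k\<in>K. k - j \<in> K}) * (E j t * (2 * pi * a j))"
      by simp
  qed
  also have "\<dots> = (\<Sum>j\<in>{- int M..int M}. (2 * pi * real M) * (of_real (fejer_mean a M j) * E j t))"
    using M by (intro sum.cong refl) (simp add: fejer_mean_def fejer_weight_def K_def)
  also have "\<dots> = (2 * pi * real M) * trig {- int M..int M} (\<lambda>j. of_real (fejer_mean a M j)) t"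
    unfolding trig_def sum_distrib_left ..
  finally show "trig {- int M..int M} (\<lambda>j. of_real (fejer_mean a M j)) t
      = 1 / (2 * pi * real M) * (\<integral>s. complex_of_real (dirichlet_sq M t s) * g s \<partial>torus)"
    using M by simp
qed

text \<open>The graph of x^w lies above its tangent at c. This is Young's inequality for x and
  c^(w-1) with the conjugate exponent w/(w-1).\<close>

lemma powr_tangent:
  fixes x c w :: real
  assumes "0 \<le> x" "0 \<le> c" "1 < w"
  shows "x * c powr (w - 1) \<le> x powr w / w + (w - 1) / w * c powr w"
proof -
  define q where "q = w / (w - 1)"
  have q: "q > 1" "1 / w + 1 / q = 1" using assms by (auto simp: q_def field_simps)
  have "x * c powr (w - 1) \<le> x powr w / w + (c powr (w - 1)) powr q / q"
    by (rule Youngs_inequality) (use assms q in auto)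
  also have "(c powr (w - 1)) powr q = c powr w" unfolding powr_powr q_def using assms by simp
  also have "c powr w / q = (w - 1) / w * c powr w" by (simp add: q_def)
  finally show ?thesis .
qed

text \<open>Jensen's inequality for the Fejer kernel, in the form of its tangent line.\<close>

lemma fejer_powr_bound:
  assumes F: "fourier_series a g" and w: "1 < w" and iw: "integrable torus (\<lambda>t. cmod (g t) powr w)" and M: "M > 0"
  shows "(\<integral>t. cmod (trig {- int M..int M} (\<lambda>j. of_real (fejer_mean a M j)) t) powr w \<partial>torus)
    \<le> (\<integral>t. cmod (g t) powr w \<partial>torus)"
proof -
  note [measurable] = fourier_series_trig(1)[OF F]
  interpret TT: pair_sigma_finite torus torus by (rule torus_pair_sigma_finite)
  define p where "p = trig {- int M..int M} (\<lambda>j. complex_of_real (fejer_mean a M j))"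
  define D where "D = dirichlet_sq M"
  define L where "L = 2 * pi * real M"
  have L: "L > 0" using M by (simp add: L_def)
  note D0 = dirichlet_sq_bounds(1)[of M, folded D_def] and D1 = dirichlet_sq_bounds(2)[of M, folded D_def]
  note [measurable] = dirichlet_sq_measurable[of M, folded D_def]
  have [measurable]: "p \<in> borel_measurable torus" unfolding p_def by measurable
  have ID: "(\<integral>s. D t s \<partial>torus) = L" for t
  proof -
    have "(\<integral>\<^sup>+s. ennreal (D t s) \<partial>torus) = ennreal L"
      unfolding D_def dirichlet_sq_sym[of M t] L_def by (rule nn_integral_dirichlet_sq)
    then show ?thesis using L D0 by (intro integral_eq_nn_integral[THEN trans]) auto
  qed
  have iD: "integrable torus (\<lambda>s. D t s)" for t
    by (rule integrable_torus_bounded[of _ "(real M)\<^sup>2"]) (use D0 D1 in auto)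
  have iDg: "integrable torus (\<lambda>s. D t s * cmod (g s))" for t
    using integrable_norm[OF fejer_convolution(1)[OF F M, of t]] D0 by (simp add: norm_mult D_def)
  have iDw: "integrable torus (\<lambda>s. D t s * cmod (g s) powr w)" for t
  proof (rule Bochner_Integration.integrable_bound)
    show "integrable torus (\<lambda>s. (real M)\<^sup>2 * cmod (g s) powr w)" using iw by auto
    show "AE s in torus. norm (D t s * cmod (g s) powr w) \<le> norm ((real M)\<^sup>2 * cmod (g s) powr w)"
      using D0 D1 by (intro AE_I2) (auto simp: abs_mult intro!: mult_right_mono)
  qed measurable
  have jensen: "cmod (p t) powr w \<le> (\<integral>s. D t s * cmod (g s) powr w \<partial>torus) / L" for t
  proof -
    define c where "c = (\<integral>s. D t s * cmod (g s) \<partial>torus) / L"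
    define J where "J = (\<integral>s. D t s * cmod (g s) powr w \<partial>torus) / L"
    have c0: "c \<ge> 0" unfolding c_def using L D0 by (intro divide_nonneg_nonneg integral_nonneg_AE) auto
    have "cmod (p t) \<le> c"
    proof -
      have "cmod (p t) = cmod (\<integral>s. of_real (D t s) * g s \<partial>torus) / L"
        unfolding p_def fejer_convolution(2)[OF F M] D_def L_def using M by (simp add: norm_mult norm_divide)
      also have "\<dots> \<le> (\<integral>s. cmod (of_real (D t s) * g s) \<partial>torus) / L"
        using L by (intro divide_right_mono integral_norm_bound) auto
      also have "\<dots> = c" unfolding c_def using D0 by (simp add: norm_mult)
      finally show ?thesis .
    qed
    then have "cmod (p t) powr w \<le> c powr w" using w by (intro powr_mono2) auto
    also have "c powr w \<le> J"
    proof -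
      have "(\<integral>s. D t s * cmod (g s) * c powr (w - 1) \<partial>torus) \<le> (\<integral>s. D t s * cmod (g s) powr w / w + (w - 1) / w * c powr w * D t s \<partial>torus)"
      proof (intro integral_mono)
        fix s
        have "D t s * (cmod (g s) * c powr (w - 1)) \<le> D t s * (cmod (g s) powr w / w + (w - 1) / w * c powr w)"
          using powr_tangent[of "cmod (g s)" c w] c0 w D0 by (intro mult_left_mono) auto
        then show "D t s * cmod (g s) * c powr (w - 1) \<le> D t s * cmod (g s) powr w / w + (w - 1) / w * c powr w * D t s"
          by (simp add: algebra_simps)
      qed (use iDg iDw iD in auto)
      also have "\<dots> = L * J / w + (w - 1) / w * c powr w * L"
        using iDw iD L by (simp add: ID J_def)
      also have "(\<integral>s. D t s * cmod (g s) * c powr (w - 1) \<partial>torus) = L * (c * c powr (w - 1))"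
        using L by (simp add: c_def)
      also have "c * c powr (w - 1) = c powr w"
        using c0 w by (cases "c = 0") (auto simp: powr_mult_base)
      finally have "L * c powr w \<le> L * (J / w + (w - 1) / w * c powr w)" by (simp add: algebra_simps)
      then have "c powr w \<le> J / w + (w - 1) / w * c powr w" using L by (simp only: mult_le_cancel_left_pos)
      then have "w * c powr w \<le> w * (J / w + (w - 1) / w * c powr w)" using w by (intro mult_left_mono) auto
      also have "\<dots> = J + (w - 1) * c powr w" using w by (simp add: distrib_left)
      finally show ?thesis by (simp add: algebra_simps)
    qed
    finally show ?thesis unfolding J_def .
  qed
  have "(\<integral>\<^sup>+t. ennreal (cmod (p t) powr w) \<partial>torus) \<le> (\<integral>\<^sup>+t. \<integral>\<^sup>+s. ennreal (D t s) * ennreal (cmod (g s) powr w / L) \<partial>torus \<partial>torus)"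
  proof (intro nn_integral_mono)
    fix t
    have "ennreal (cmod (p t) powr w) \<le> ennreal (\<integral>s. D t s * cmod (g s) powr w / L \<partial>torus)"
      using jensen[of t] by (intro ennreal_leI) simp
    also have "\<dots> = (\<integral>\<^sup>+s. ennreal (D t s * cmod (g s) powr w / L) \<partial>torus)"
      using iDw[of t] D0 L by (intro nn_integral_eq_integral[symmetric]) auto
    also have "\<dots> = (\<integral>\<^sup>+s. ennreal (D t s) * ennreal (cmod (g s) powr w / L) \<partial>torus)"
      using D0 L by (intro nn_integral_cong) (simp add: ennreal_mult[symmetric])
    finally show "ennreal (cmod (p t) powr w) \<le> (\<integral>\<^sup>+s. ennreal (D t s) * ennreal (cmod (g s) powr w / L) \<partial>torus)" .
  qed
  also have "\<dots> = (\<integral>\<^sup>+s. \<integral>\<^sup>+t. ennreal (D t s) * ennreal (cmod (g s) powr w / L) \<partial>torus \<partial>torus)"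
    by (rule TT.Fubini'[symmetric]) measurable
  also have "\<dots> = (\<integral>\<^sup>+s. ennreal L * ennreal (cmod (g s) powr w / L) \<partial>torus)"
    by (intro nn_integral_cong, subst nn_integral_multc) (auto simp: D_def L_def nn_integral_dirichlet_sq simp del: ennreal_mult'')
  also have "\<dots> = (\<integral>\<^sup>+s. ennreal (cmod (g s) powr w) \<partial>torus)"
    using L by (intro nn_integral_cong) (simp add: ennreal_mult[symmetric])
  also have "\<dots> = ennreal (\<integral>t. cmod (g t) powr w \<partial>torus)"
    using iw by (intro nn_integral_eq_integral) auto
  finally have le: "(\<integral>\<^sup>+t. ennreal (cmod (p t) powr w) \<partial>torus) \<le> ennreal (\<integral>t. cmod (g t) powr w \<partial>torus)" .
  have "(\<integral>t. cmod (p t) powr w \<partial>torus) = enn2real (\<integral>\<^sup>+t. ennreal (cmod (p t) powr w) \<partial>torus)"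
    by (rule integral_eq_nn_integral) auto
  also have "\<dots> \<le> (\<integral>t. cmod (g t) powr w \<partial>torus)"
    using le by (intro enn2real_leI) auto
  finally show ?thesis unfolding p_def .
qed

text \<open>The constant C may depend on \<eta>. This is what interpolation between a quantity that
  tends to 0 and a bounded one delivers.\<close>

lemma null_by_splitting:
  fixes x d :: "nat \<Rightarrow> real"
  assumes x: "\<And>n. 0 \<le> x n" and d: "d \<longlonglongrightarrow> 0"
    and split: "\<And>\<eta>. 0 < \<eta> \<Longrightarrow> \<exists>C. eventually (\<lambda>n. x n \<le> \<eta> + C * d n) sequentially"
  shows "x \<longlonglongrightarrow> 0"
proof (rule order_tendstoI)
  fix e :: real assume e: "0 < e"
  obtain C where C: "eventually (\<lambda>n. x n \<le> e / 2 + C * d n) sequentially" using split[of "e / 2"] e by auto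
  have "(\<lambda>n. C * d n) \<longlonglongrightarrow> C * 0" by (intro tendsto_intros d)
  then have "eventually (\<lambda>n. C * d n < e / 2) sequentially" using e by (intro order_tendstoD) auto
  then show "eventually (\<lambda>n. x n < e) sequentially" using C by eventually_elim linarith
next
  fix e :: real assume "e < 0"
  then have "e < x n" for n using x[of n] by linarith
  then show "eventually (\<lambda>n. e < x n) sequentially" by simp
qed

text \<open>By Parseval the error is a sum of (1 - weight)^2 a_j^2. Outside a finite set
  \<open>A\<close> it is controlled by the tail of the square sum, and on \<open>A\<close> the
  weights differ from 1 by at most R/M.\<close>

lemma fejer_L2:
  assumes F: "fourier_series a g" and s: "(\<lambda>n. \<bar>a n\<bar>\<^sup>2) summable_on UNIV"
  shows "(\<lambda>M. \<integral>t. (cmod (g t - trig {- int M..int M} (\<lambda>j. of_real (fejer_mean a M j)) t))\<^sup>2 \<partial>torus) \<longlonglongrightarrow> 0"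
    "integrable torus (\<lambda>t. (cmod (g t - trig {- int M..int M} (\<lambda>j. of_real (fejer_mean a M j)) t))\<^sup>2)"
proof -
  note [measurable] = fourier_series_trig(1)[OF F]
  define p where "p M = trig {- int M..int M} (\<lambda>j. complex_of_real (fejer_mean a M j))" for M
  define T where "T N = trig {- int N..int N} (\<lambda>j. complex_of_real (a j))" for N
  have [measurable]: "p M \<in> borel_measurable torus" "T M \<in> borel_measurable torus" for M unfolding p_def T_def by measurable
  define e where "e N = (\<integral>t. (cmod (g t - T N t))\<^sup>2 \<partial>torus)" for N
  have e: "e \<longlonglongrightarrow> 0" unfolding e_def T_def by (rule fourier_series_trig(4)[OF F])
  define x where "x M = (\<integral>t. (cmod (g t - p M t))\<^sup>2 \<partial>torus)" for M
  have Tp: "T N t - p M t = trig {- int N..int N} (\<lambda>j. complex_of_real (a j - fejer_mean a M j)) t" if "M \<le> N" for M N t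
  proof -
    have "p M t = trig {- int N..int N} (\<lambda>j. complex_of_real (fejer_mean a M j)) t"
      unfolding p_def trig_def using that fejer_mean_eq_0[of M _ a]
      by (intro sum.mono_neutral_left) (auto simp: not_le)
    then show ?thesis unfolding T_def by (simp add: trig_def sum_subtractf[symmetric] left_diff_distrib)
  qed
  have iTp: "integrable torus (\<lambda>t. (cmod (T N t - p M t))\<^sup>2)" for N M
  proof (rule integrable_torus_bounded)
    fix t
    have "cmod (T N t - p M t) \<le> (\<Sum>k\<in>{- int N..int N}. cmod (of_real (a k))) + (\<Sum>k\<in>{- int M..int M}. cmod (of_real (fejer_mean a M k)))"
      unfolding T_def p_def by (intro order_trans[OF norm_triangle_ineq4] add_mono norm_trig_le)
    then show "norm ((cmod (T N t - p M t))\<^sup>2) \<le> ((\<Sum>k\<in>{- int N..int N}. cmod (of_real (a k))) + (\<Sum>k\<in>{- int M..int M}. cmod (of_real (fejer_mean a M k))))\<^sup>2"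
      by (simp add: power_mono)
  qed measurable
  have pt: "(cmod (g t - p M t))\<^sup>2 \<le> 2 * (cmod (g t - T N t))\<^sup>2 + 2 * (cmod (T N t - p M t))\<^sup>2" for t M N
    using norm_add_square_le[of "g t - T N t" "T N t - p M t"] by simp
  have igT: "integrable torus (\<lambda>t. (cmod (g t - T N t))\<^sup>2)" for N
    unfolding T_def by (rule fourier_series_trig(3)[OF F])
  have ii: "integrable torus (\<lambda>t. 2 * (cmod (g t - T N t))\<^sup>2 + 2 * (cmod (T N t - p M t))\<^sup>2)" for M N
    using igT iTp by auto
  have igp: "integrable torus (\<lambda>t. (cmod (g t - p M t))\<^sup>2)" for M
    by (rule Bochner_Integration.integrable_bound[OF ii[of 0 M]]) (use pt in auto)
  then show "integrable torus (\<lambda>t. (cmod (g t - trig {- int M..int M} (\<lambda>j. of_real (fejer_mean a M j)) t))\<^sup>2)"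
    unfolding p_def .
  have xle: "x M \<le> 2 * e N + 4 * pi * (\<Sum>j\<in>{- int N..int N}. (a j - fejer_mean a M j)\<^sup>2)" if "M \<le> N" for M N
  proof -
    have "x M \<le> (\<integral>t. 2 * (cmod (g t - T N t))\<^sup>2 + 2 * (cmod (T N t - p M t))\<^sup>2 \<partial>torus)"
      unfolding x_def by (intro integral_mono igp ii pt)
    also have "\<dots> = 2 * e N + 2 * (\<integral>t. (cmod (T N t - p M t))\<^sup>2 \<partial>torus)"
      using igT iTp by (simp add: e_def)
    also have "(\<integral>t. (cmod (T N t - p M t))\<^sup>2 \<partial>torus) = 2 * pi * (\<Sum>j\<in>{- int N..int N}. (a j - fejer_mean a M j)\<^sup>2)"
      unfolding Tp[OF that] by (subst integral_norm_trig) (simp_all only: norm_of_real power2_abs finite_atLeastAtMost_int)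
    finally show ?thesis by simp
  qed
  have "x \<longlonglongrightarrow> 0"
  proof (rule null_by_splitting)
    show "0 \<le> x n" for n by (simp add: x_def)
    have "(\<lambda>M. 1 / real M) \<longlonglongrightarrow> 0" by (rule lim_1_over_n)
    then have "(\<lambda>M. (1 / real M)\<^sup>2) \<longlonglongrightarrow> 0\<^sup>2" by (intro tendsto_intros)
    then show "(\<lambda>M. (1 / real M)\<^sup>2) \<longlonglongrightarrow> 0" by simp
    fix \<eta> :: real assume \<eta>: "0 < \<eta>"
    define S where "S = (\<Sum>\<^sub>\<infinity>j. \<bar>a j\<bar>\<^sup>2)"
    define \<eta>' where "\<eta>' = \<eta> / (4 * pi)"
    have \<eta>': "\<eta>' > 0" using \<eta> by (simp add: \<eta>'_def)
    have le: "(\<Sum>j\<in>B. \<bar>a j\<bar>\<^sup>2) \<le> S" if "finite B" for B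
      unfolding S_def by (rule finite_sum_le_infsum[OF s that]) auto
    have "((\<lambda>j. \<bar>a j\<bar>\<^sup>2) has_sum S) UNIV" unfolding S_def using s by simp
    then have "eventually (\<lambda>A. dist (\<Sum>j\<in>A. \<bar>a j\<bar>\<^sup>2) S < \<eta>') (finite_subsets_at_top UNIV)"
      using \<eta>' by (auto simp: has_sum_def tendsto_iff)
    \<comment> \<open>A carries the square sum up to \<open>\<eta>'\<close>, where 4 pi
      \<open>\<eta>'\<close> = \<eta> because the bound \<open>xle\<close> contains the factor 4
      pi.\<close>
    then obtain A where A: "finite A" "dist (\<Sum>j\<in>A. \<bar>a j\<bar>\<^sup>2) S < \<eta>'"
      by (auto simp: eventually_finite_subsets_at_top)
    have tail: "(\<Sum>j\<in>B. \<bar>a j\<bar>\<^sup>2) \<le> \<eta>'" if B: "finite B" "B \<inter> A = {}" for B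
    proof -
      have "(\<Sum>j\<in>B. \<bar>a j\<bar>\<^sup>2) + (\<Sum>j\<in>A. \<bar>a j\<bar>\<^sup>2) \<le> S"
        using le[of "B \<union> A"] A B by (simp add: sum.union_disjoint)
      then show ?thesis using A(2) by (simp add: dist_real_def)
    qed
    define R where "R = (\<Sum>j\<in>A. real_of_int \<bar>j\<bar>)"
    have R: "real_of_int \<bar>j\<bar> \<le> R" if "j \<in> A" for j
      unfolding R_def using that A by (intro member_le_sum) auto
    have "x M \<le> \<eta> + (4 * pi * R\<^sup>2 * S) * (1 / real M)\<^sup>2" if M: "M > 0" for M
    proof -
      have sum: "(\<Sum>j\<in>{- int N..int N}. (a j - fejer_mean a M j)\<^sup>2) \<le> \<eta>' + R\<^sup>2 * S * (1 / real M)\<^sup>2" for N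
      proof -
        define B where "B = {- int N..int N}"
        have w: "(a j - fejer_mean a M j)\<^sup>2 = (1 - fejer_weight M j)\<^sup>2 * \<bar>a j\<bar>\<^sup>2" for j
          unfolding fejer_mean_def power2_abs power_mult_distrib[symmetric] by (simp add: left_diff_distrib)
        have "(\<Sum>j\<in>B. (a j - fejer_mean a M j)\<^sup>2) = (\<Sum>j\<in>B - A. (a j - fejer_mean a M j)\<^sup>2) + (\<Sum>j\<in>B \<inter> A. (a j - fejer_mean a M j)\<^sup>2)"
          using sum.Int_Diff[of B "\<lambda>j. (a j - fejer_mean a M j)\<^sup>2" A] by (simp add: B_def)
        also have "(\<Sum>j\<in>B - A. (a j - fejer_mean a M j)\<^sup>2) \<le> (\<Sum>j\<in>B - A. \<bar>a j\<bar>\<^sup>2)"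
          unfolding w using fejer_weight_bounds[OF M] by (intro sum_mono mult_left_le_one_le) (auto intro!: power_le_one)
        also have "(\<Sum>j\<in>B - A. \<bar>a j\<bar>\<^sup>2) \<le> \<eta>'" by (rule tail) (auto simp: B_def)
        also have "(\<Sum>j\<in>B \<inter> A. (a j - fejer_mean a M j)\<^sup>2) \<le> (\<Sum>j\<in>B \<inter> A. (R / real M)\<^sup>2 * \<bar>a j\<bar>\<^sup>2)"
        proof (rule sum_mono)
          fix j assume j: "j \<in> B \<inter> A"
          have "1 - fejer_weight M j \<le> R / real M"
            using fejer_weight_bounds(3)[OF M, of j] R[of j] j by (auto intro!: order_trans[OF fejer_weight_bounds(3)[OF M]] divide_right_mono)
          then have "(1 - fejer_weight M j)\<^sup>2 \<le> (R / real M)\<^sup>2" using fejer_weight_bounds[OF M] by (intro power_mono) auto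
          then show "(a j - fejer_mean a M j)\<^sup>2 \<le> (R / real M)\<^sup>2 * \<bar>a j\<bar>\<^sup>2" unfolding w by (intro mult_right_mono) auto
        qed
        also have "(\<Sum>j\<in>B \<inter> A. (R / real M)\<^sup>2 * \<bar>a j\<bar>\<^sup>2) \<le> (R / real M)\<^sup>2 * S"
          unfolding sum_distrib_left[symmetric] by (intro mult_left_mono le) (auto simp: B_def)
        finally show ?thesis by (simp add: B_def power_divide mult_ac)
      qed
      \<comment> \<open>N is an auxiliary cutoff through which Parseval is applied to a
        trigonometric polynomial. The bound on the sum is uniform in N, so letting N tend to
        infinity removes \<open>e N\<close>.\<close>
      have "x M \<le> 2 * e N + 4 * pi * (\<eta>' + R\<^sup>2 * S * (1 / real M)\<^sup>2)" if "M \<le> N" for N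
        by (rule order_trans[OF xle[OF that]]) (use sum[of N] in \<open>auto intro!: mult_left_mono\<close>)
      moreover have "(\<lambda>N. 2 * e N + 4 * pi * (\<eta>' + R\<^sup>2 * S * (1 / real M)\<^sup>2)) \<longlonglongrightarrow> 2 * 0 + 4 * pi * (\<eta>' + R\<^sup>2 * S * (1 / real M)\<^sup>2)"
        by (intro tendsto_intros e)
      ultimately have "x M \<le> 2 * 0 + 4 * pi * (\<eta>' + R\<^sup>2 * S * (1 / real M)\<^sup>2)"
        by (intro LIMSEQ_le_const) auto
      then show ?thesis by (simp add: \<eta>'_def distrib_left mult_ac)
    qed
    then show "\<exists>C. eventually (\<lambda>M. x M \<le> \<eta> + C * (1 / real M)\<^sup>2) sequentially"
      by (intro exI[of _ "4 * pi * R\<^sup>2 * S"] eventually_sequentiallyI[of 1]) auto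
  qed
  then show "(\<lambda>M. \<integral>t. (cmod (g t - trig {- int M..int M} (\<lambda>j. of_real (fejer_mean a M j)) t))\<^sup>2 \<partial>torus) \<longlonglongrightarrow> 0"
    unfolding x_def p_def .
qed

text \<open>Up to R two of the four factors are bounded by R; beyond R the exponent 4 - w is
  negative and h may be replaced by R there.\<close>

lemma power4_le_split:
  fixes h R w :: real
  assumes "0 \<le> h" "0 < R" "4 < w"
  shows "h ^ 4 \<le> R\<^sup>2 * h\<^sup>2 + R powr (4 - w) * h powr w"
proof (cases "h \<le> R")
  case True
  have "h ^ 4 = h\<^sup>2 * h\<^sup>2" by (simp add: power2_eq_square power4_eq_xxxx)
  also have "\<dots> \<le> R\<^sup>2 * h\<^sup>2" using True assms by (intro mult_right_mono power_mono) auto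
  finally show ?thesis by (simp add: add_increasing2)
next
  case False
  then have h: "h > 0" "R < h" using assms by auto
  have "h ^ 4 = h powr (4 - w) * h powr w" using h by (simp add: powr_add[symmetric])
  also have "\<dots> \<le> R powr (4 - w) * h powr w" using h assms by (intro mult_right_mono powr_mono2') auto
  finally show ?thesis by (simp add: add_increasing)
qed

lemma powr_add_le:
  fixes x y w :: real
  assumes "0 \<le> x" "0 \<le> y" "0 < w"
  shows "(x + y) powr w \<le> 2 powr w * (x powr w + y powr w)"
proof -
  have "(x + y) powr w \<le> (2 * max x y) powr w" using assms by (intro powr_mono2) auto
  also have "\<dots> = 2 powr w * max x y powr w" using assms by (simp add: powr_mult)
  also have "max x y powr w \<le> x powr w + y powr w" by (auto simp: max_def)
  finally show ?thesis by simp
qed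

text \<open>The error tends to 0 in L^2 and stays bounded in L^w with w > 4, the latter because
  Fejer means do not increase the L^w norm. Splitting at a level R interpolates between the
  two.\<close>

theorem fejer_L4:
  assumes F: "fourier_series a g" and s: "(\<lambda>n. \<bar>a n\<bar>\<^sup>2) summable_on UNIV"
    and w: "4 < w" and iw: "integrable torus (\<lambda>t. cmod (g t) powr w)"
  shows "(\<lambda>M. \<integral>t. cmod (g t - trig {- int M..int M} (\<lambda>j. of_real (fejer_mean a M j)) t) ^ 4 \<partial>torus) \<longlonglongrightarrow> 0"
    "integrable torus (\<lambda>t. cmod (g t - trig {- int M..int M} (\<lambda>j. of_real (fejer_mean a M j)) t) ^ 4)"
proof -
  note [measurable] = fourier_series_trig(1)[OF F]
  define p where "p M = trig {- int M..int M} (\<lambda>j. complex_of_real (fejer_mean a M j))" for M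
  have [measurable]: "p M \<in> borel_measurable torus" for M unfolding p_def by measurable
  note L2 = fejer_L2[OF F s, folded p_def]
  define x where "x M = (\<integral>t. cmod (g t - p M t) ^ 4 \<partial>torus)" for M
  define B where "B = (\<integral>t. cmod (g t) powr w \<partial>torus)"
  have B: "B \<ge> 0" by (simp add: B_def)
  have ipw: "integrable torus (\<lambda>t. cmod (p M t) powr w)" for M
  proof (rule integrable_torus_bounded)
    show "norm (cmod (p M t) powr w) \<le> (\<Sum>k\<in>{- int M..int M}. cmod (of_real (fejer_mean a M k))) powr w" for t
      using powr_mono2[OF _ _ norm_trig_le, of w "{- int M..int M}" "\<lambda>j. of_real (fejer_mean a M j)" t] w unfolding p_def by simp
  qed measurable
  have ihw: "integrable torus (\<lambda>t. cmod (g t - p M t) powr w)" 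
    and hw: "M > 0 \<Longrightarrow> (\<integral>t. cmod (g t - p M t) powr w \<partial>torus) \<le> 2 powr w * (2 * B)" for M
  proof -
    have pt: "cmod (g t - p M t) powr w \<le> 2 powr w * (cmod (g t) powr w + cmod (p M t) powr w)" for t
    proof -
      have "cmod (g t - p M t) powr w \<le> (cmod (g t) + cmod (p M t)) powr w"
        using w by (intro powr_mono2 norm_triangle_ineq4) auto
      also have "\<dots> \<le> 2 powr w * (cmod (g t) powr w + cmod (p M t) powr w)" using w by (intro powr_add_le) auto
      finally show ?thesis .
    qed
    have i: "integrable torus (\<lambda>t. 2 powr w * (cmod (g t) powr w + cmod (p M t) powr w))" using iw ipw by auto
    show j: "integrable torus (\<lambda>t. cmod (g t - p M t) powr w)"
      by (rule Bochner_Integration.integrable_bound[OF i]) (use pt in auto)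
    assume M: "M > 0"
    have "(\<integral>t. cmod (g t - p M t) powr w \<partial>torus) \<le> (\<integral>t. 2 powr w * (cmod (g t) powr w + cmod (p M t) powr w) \<partial>torus)"
      by (intro integral_mono i j pt)
    also have "\<dots> = 2 powr w * (B + (\<integral>t. cmod (p M t) powr w \<partial>torus))" using iw ipw by (simp add: B_def)
    also have "\<dots> \<le> 2 powr w * (B + B)"
      using fejer_powr_bound[OF F _ iw M] w unfolding p_def B_def by (intro mult_left_mono add_left_mono) auto
    finally show "(\<integral>t. cmod (g t - p M t) powr w \<partial>torus) \<le> 2 powr w * (2 * B)" by simp
  qed
  have i4: "integrable torus (\<lambda>t. R\<^sup>2 * (cmod (g t - p M t))\<^sup>2 + R powr (4 - w) * cmod (g t - p M t) powr w)" for R M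
    using L2(2) ihw by auto
  have ix: "integrable torus (\<lambda>t. cmod (g t - p M t) ^ 4)" for M
    by (rule Bochner_Integration.integrable_bound[OF i4[of 1 M]])
      (use power4_le_split[of "cmod (g _ - p M _)" 1 w] w in auto)
  then show "integrable torus (\<lambda>t. cmod (g t - trig {- int M..int M} (\<lambda>j. of_real (fejer_mean a M j)) t) ^ 4)"
    unfolding p_def .
  have "x \<longlonglongrightarrow> 0"
  proof (rule null_by_splitting[OF _ L2(1)])
    show "0 \<le> x n" for n by (simp add: x_def)
    fix \<eta> :: real assume \<eta>: "0 < \<eta>"
    define c where "c = 2 powr w * (2 * B) + 1"
    have c: "c > 0" unfolding c_def using B by (simp add: add_nonneg_pos)
    \<comment> \<open>The exponent is negative, so R is large for small \<eta>; it makes the part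
      above R, which is bounded by R^(4-w) c, equal to \<eta>.\<close>
    define R where "R = (\<eta> / c) powr (1 / (4 - w))"
    have R: "R > 0" "R powr (4 - w) * c = \<eta>" using \<eta> c w by (auto simp: R_def powr_powr)
    have "x M \<le> \<eta> + R\<^sup>2 * (\<integral>t. (cmod (g t - p M t))\<^sup>2 \<partial>torus)" if M: "M > 0" for M
    proof -
      have "x M \<le> (\<integral>t. R\<^sup>2 * (cmod (g t - p M t))\<^sup>2 + R powr (4 - w) * cmod (g t - p M t) powr w \<partial>torus)"
        unfolding x_def using power4_le_split R w by (intro integral_mono ix i4) auto
      also have "\<dots> = R\<^sup>2 * (\<integral>t. (cmod (g t - p M t))\<^sup>2 \<partial>torus) + R powr (4 - w) * (\<integral>t. cmod (g t - p M t) powr w \<partial>torus)"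
        using L2(2) ihw by simp
      also have "R powr (4 - w) * (\<integral>t. cmod (g t - p M t) powr w \<partial>torus) \<le> R powr (4 - w) * c"
        using hw[OF M] by (intro mult_left_mono) (auto simp: c_def)
      finally show ?thesis unfolding R(2) by simp
    qed
    then show "\<exists>C. eventually (\<lambda>M. x M \<le> \<eta> + C * (\<integral>t. (cmod (g t - p M t))\<^sup>2 \<partial>torus)) sequentially"
      by (intro exI[of _ "R\<^sup>2"] eventually_sequentiallyI[of 1]) auto
  qed
  then show "(\<lambda>M. \<integral>t. cmod (g t - trig {- int M..int M} (\<lambda>j. of_real (fejer_mean a M j)) t) ^ 4 \<partial>torus) \<longlonglongrightarrow> 0"
    unfolding x_def p_def .
qed

section \<open>L^1 convergence of the squared and fourth powers of the modulus\<close>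

lemma square_diff_le:
  fixes x y \<eta> :: real
  assumes \<eta>: "0 < \<eta>"
  shows "\<bar>y\<^sup>2 - x\<^sup>2\<bar> \<le> \<eta> * x\<^sup>2 + (1 + 1 / \<eta>) * (y - x)\<^sup>2"
proof -
  define h where "h = y - x"
  have "0 \<le> (\<eta> * \<bar>x\<bar> - \<bar>h\<bar>)\<^sup>2" by simp
  then have "2 * \<eta> * (\<bar>x\<bar> * \<bar>h\<bar>) \<le> \<eta> * (\<eta> * x\<^sup>2) + h\<^sup>2" by (simp add: power2_eq_square algebra_simps)
  then have "2 * (\<bar>x\<bar> * \<bar>h\<bar>) \<le> \<eta> * x\<^sup>2 + h\<^sup>2 / \<eta>" using \<eta> by (simp add: field_simps power2_eq_square)
  moreover have "\<bar>y\<^sup>2 - x\<^sup>2\<bar> \<le> 2 * (\<bar>x\<bar> * \<bar>h\<bar>) + h\<^sup>2"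
  proof -
    have "y\<^sup>2 - x\<^sup>2 = 2 * (x * h) + h\<^sup>2" by (simp add: h_def power2_eq_square algebra_simps)
    then show ?thesis using abs_triangle_ineq[of "2 * (x * h)" "h\<^sup>2"] by (simp add: abs_mult)
  qed
  ultimately show ?thesis unfolding h_def by (simp add: distrib_right)
qed

text \<open>\<open>square_diff_le\<close> is used twice, first for the squares of y and x and then
  for y and x themselves. Since \<eta> \<le> 1, one has (1 + 1/\<eta>) \<eta>^2 \<le> 2 \<eta>,
  which keeps the coefficient of x^4 linear in \<eta>.\<close>

lemma power4_diff_le:
  fixes x y h \<eta> :: real
  assumes \<eta>: "0 < \<eta>" "\<eta> \<le> 1" and h: "\<bar>y - x\<bar> \<le> h"
  shows "\<bar>y ^ 4 - x ^ 4\<bar> \<le> 5 * \<eta> * x ^ 4 + 2 * (1 + 1 / \<eta>) ^ 3 * h ^ 4"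
proof -
  define c where "c = 1 + 1 / \<eta>"
  have c: "c > 0" "c * \<eta>\<^sup>2 \<le> 2 * \<eta>"
    using \<eta> by (auto simp: c_def power2_eq_square distrib_right intro!: add_pos_pos mult_left_le)
  have h2: "(y - x)\<^sup>2 \<le> h\<^sup>2" using h by (metis abs_ge_zero power2_abs power_mono)
  have p4: "z ^ 4 = (z\<^sup>2)\<^sup>2" for z :: real by simp
  have 1: "\<bar>y\<^sup>2 - x\<^sup>2\<bar> \<le> \<eta> * x\<^sup>2 + c * h\<^sup>2"
    using square_diff_le[OF \<eta>(1), of y x] mult_left_mono[OF h2, of c] c unfolding c_def by linarith
  then have "(y\<^sup>2 - x\<^sup>2)\<^sup>2 \<le> (\<eta> * x\<^sup>2 + c * h\<^sup>2)\<^sup>2" by (metis abs_ge_zero power2_abs power_mono)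
  also have "\<dots> \<le> 2 * (\<eta> * x\<^sup>2)\<^sup>2 + 2 * (c * h\<^sup>2)\<^sup>2"
    using sum_squares_bound[of "\<eta> * x\<^sup>2" "c * h\<^sup>2"] by (simp add: power2_sum)
  also have "\<dots> = 2 * \<eta>\<^sup>2 * x ^ 4 + 2 * c\<^sup>2 * h ^ 4" by (simp add: power_mult_distrib)
  finally have 2: "c * (y\<^sup>2 - x\<^sup>2)\<^sup>2 \<le> c * (2 * \<eta>\<^sup>2 * x ^ 4 + 2 * c\<^sup>2 * h ^ 4)" using c by (intro mult_left_mono) auto
  have 3: "(c * \<eta>\<^sup>2) * (2 * x ^ 4) \<le> (2 * \<eta>) * (2 * x ^ 4)" using c by (intro mult_right_mono) auto
  have "\<bar>y ^ 4 - x ^ 4\<bar> \<le> \<eta> * x ^ 4 + c * (y\<^sup>2 - x\<^sup>2)\<^sup>2"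
    using square_diff_le[OF \<eta>(1), of "y\<^sup>2" "x\<^sup>2"] unfolding c_def p4[symmetric] .
  also have "\<dots> \<le> \<eta> * x ^ 4 + c * (2 * \<eta>\<^sup>2 * x ^ 4 + 2 * c\<^sup>2 * h ^ 4)" using 2 by simp
  also have "\<dots> = \<eta> * x ^ 4 + (c * \<eta>\<^sup>2) * (2 * x ^ 4) + 2 * c ^ 3 * h ^ 4"
    by (simp add: distrib_left power3_eq_cube power2_eq_square mult_ac)
  also have "\<dots> \<le> 5 * \<eta> * x ^ 4 + 2 * c ^ 3 * h ^ 4" using 3 by simp
  finally show ?thesis unfolding c_def .
qed

lemma (in finite_measure) L4_imp_L2:
  fixes f :: "'a \<Rightarrow> real"
  assumes [measurable]: "f \<in> borel_measurable M" and i: "integrable M (\<lambda>x. (f x) ^ 4)"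
  shows "integrable M (\<lambda>x. (f x)\<^sup>2)"
  using L1_le_L2(1)[of "\<lambda>x. (f x)\<^sup>2"] i by simp

lemma weighted_integral_tendsto:
  fixes e :: "real \<Rightarrow> complex" and F :: "nat \<Rightarrow> real \<Rightarrow> real"
  assumes [measurable]: "e \<in> borel_measurable torus" and e: "\<And>t. cmod (e t) \<le> B"
    and iF: "\<And>n. integrable torus (F n)" and iG: "integrable torus G"
    and lim: "(\<lambda>n. \<integral>t. \<bar>F n t - G t\<bar> \<partial>torus) \<longlonglongrightarrow> 0"
  shows "(\<lambda>n. \<integral>t. e t * of_real (F n t) \<partial>torus) \<longlonglongrightarrow> (\<integral>t. e t * of_real (G t) \<partial>torus)"
proof -
  have i: "integrable torus (\<lambda>t. e t * of_real (H t))" if H: "integrable torus H" for H :: "real \<Rightarrow> real"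
  proof (rule Bochner_Integration.integrable_bound)
    show "integrable torus (\<lambda>t. B * H t)" using H by auto
    show "(\<lambda>t. e t * complex_of_real (H t)) \<in> borel_measurable torus"
      using borel_measurable_integrable[OF H] by measurable
    show "AE t in torus. norm (e t * complex_of_real (H t)) \<le> norm (B * H t)"
      using e by (intro AE_I2) (auto simp: norm_mult abs_mult intro!: mult_right_mono order_trans[OF e abs_ge_self])
  qed
  have B: "B \<ge> 0" using order_trans[OF norm_ge_zero e] .
  have "(\<lambda>n. (\<integral>t. e t * of_real (F n t) \<partial>torus) - (\<integral>t. e t * of_real (G t) \<partial>torus)) \<longlonglongrightarrow> 0"
  proof (rule Lim_null_comparison)
    show "eventually (\<lambda>n. norm ((\<integral>t. e t * of_real (F n t) \<partial>torus) - (\<integral>t. e t * of_real (G t) \<partial>torus)) \<le> B * (\<integral>t. \<bar>F n t - G t\<bar> \<partial>torus)) sequentially"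
    proof (intro always_eventually allI)
      fix n
      have d: "integrable torus (\<lambda>t. F n t - G t)" using iF iG by auto
      have "(\<integral>t. e t * of_real (F n t) \<partial>torus) - (\<integral>t. e t * of_real (G t) \<partial>torus) = (\<integral>t. e t * of_real (F n t - G t) \<partial>torus)"
        using i[OF iF] i[OF iG] by (simp add: right_diff_distrib)
      also have "norm \<dots> \<le> (\<integral>t. norm (e t * of_real (F n t - G t)) \<partial>torus)" by (rule integral_norm_bound)
      also have "\<dots> \<le> (\<integral>t. B * \<bar>F n t - G t\<bar> \<partial>torus)"
      proof (rule integral_mono)
        show "integrable torus (\<lambda>t. norm (e t * complex_of_real (F n t - G t)))" using i[OF d] by (rule integrable_norm)
        show "integrable torus (\<lambda>t. B * \<bar>F n t - G t\<bar>)" using d by auto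
        show "norm (e t * complex_of_real (F n t - G t)) \<le> B * \<bar>F n t - G t\<bar>" for t
          unfolding norm_mult norm_of_real using e by (intro mult_right_mono) auto
      qed
      also have "\<dots> = B * (\<integral>t. \<bar>F n t - G t\<bar> \<partial>torus)" by simp
      finally show "norm ((\<integral>t. e t * of_real (F n t) \<partial>torus) - (\<integral>t. e t * of_real (G t) \<partial>torus)) \<le> B * (\<integral>t. \<bar>F n t - G t\<bar> \<partial>torus)" .
    qed
    show "(\<lambda>n. B * (\<integral>t. \<bar>F n t - G t\<bar> \<partial>torus)) \<longlonglongrightarrow> 0"
      using tendsto_mult_left[OF lim, of B] by simp
  qed
  then show ?thesis by (simp add: LIM_zero_iff)
qed

text \<open>Up to powers of v these are the L^1 convergences of the densities v |p|^2 and of their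
  squares, which is what convergence of the entries of \<open>Sigma2\<close> asks for.\<close>

lemma L4_limits:
  fixes g :: "real \<Rightarrow> complex" and p :: "nat \<Rightarrow> real \<Rightarrow> complex"
  assumes [measurable]: "g \<in> borel_measurable torus" "\<And>n. p n \<in> borel_measurable torus"
    and ig: "integrable torus (\<lambda>t. cmod (g t) ^ 4)"
    and id: "\<And>n. integrable torus (\<lambda>t. cmod (g t - p n t) ^ 4)"
    and lim: "(\<lambda>n. \<integral>t. cmod (g t - p n t) ^ 4 \<partial>torus) \<longlonglongrightarrow> 0"
  shows "integrable torus (\<lambda>t. cmod (p n t) ^ 4)"
    "(\<lambda>n. \<integral>t. \<bar>cmod (p n t) ^ 4 - cmod (g t) ^ 4\<bar> \<partial>torus) \<longlonglongrightarrow> 0"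
    "(\<lambda>n. \<integral>t. \<bar>(cmod (p n t))\<^sup>2 - (cmod (g t))\<^sup>2\<bar> \<partial>torus) \<longlonglongrightarrow> 0"
proof -
  have d: "\<bar>cmod (p n t) - cmod (g t)\<bar> \<le> cmod (g t - p n t)" for n t
    using norm_triangle_ineq3[of "p n t" "g t"] by (simp add: norm_minus_commute)
  have pt: "\<bar>cmod (p n t) ^ 4 - cmod (g t) ^ 4\<bar> \<le> 5 * \<eta> * cmod (g t) ^ 4 + 2 * (1 + 1 / \<eta>) ^ 3 * cmod (g t - p n t) ^ 4"
    if "0 < \<eta>" "\<eta> \<le> 1" for \<eta> n t by (rule power4_diff_le[OF that d])
  have iR: "integrable torus (\<lambda>t. 5 * \<eta> * cmod (g t) ^ 4 + 2 * (1 + 1 / \<eta>) ^ 3 * cmod (g t - p n t) ^ 4)" for \<eta> n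
    using ig id by auto
  have iD: "integrable torus (\<lambda>t. \<bar>cmod (p n t) ^ 4 - cmod (g t) ^ 4\<bar>)" for n
    by (rule Bochner_Integration.integrable_bound[OF iR[of 1 n]]) (use pt[of 1] in \<open>auto intro!: AE_I2 order_trans[OF _ abs_ge_self]\<close>)
  show ip: "integrable torus (\<lambda>t. cmod (p n t) ^ 4)" for n
  proof (rule Bochner_Integration.integrable_bound)
    show "integrable torus (\<lambda>t. \<bar>cmod (p n t) ^ 4 - cmod (g t) ^ 4\<bar> + cmod (g t) ^ 4)" using iD ig by auto
  qed auto
  define Bg where "Bg = (\<integral>t. cmod (g t) ^ 4 \<partial>torus)"
  have Bg: "Bg \<ge> 0" by (simp add: Bg_def)
  show "(\<lambda>n. \<integral>t. \<bar>cmod (p n t) ^ 4 - cmod (g t) ^ 4\<bar> \<partial>torus) \<longlonglongrightarrow> 0"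
  proof (rule null_by_splitting[OF _ lim])
    fix \<epsilon> :: real assume \<epsilon>: "0 < \<epsilon>"
    define \<eta> where "\<eta> = min 1 (\<epsilon> / (5 * Bg + 1))"
    have c: "5 * Bg + 1 > 0" using Bg by simp
    have "\<eta> \<le> \<epsilon> / (5 * Bg + 1)" by (simp add: \<eta>_def)
    then have "\<eta> * (5 * Bg + 1) \<le> \<epsilon>" using c by (simp only: pos_le_divide_eq)
    then have \<eta>: "0 < \<eta>" "\<eta> \<le> 1" "\<eta> * (5 * Bg + 1) \<le> \<epsilon>"
      using \<epsilon> c by (auto simp: \<eta>_def)
    have "(\<integral>t. \<bar>cmod (p n t) ^ 4 - cmod (g t) ^ 4\<bar> \<partial>torus) \<le> \<epsilon> + 2 * (1 + 1 / \<eta>) ^ 3 * (\<integral>t. cmod (g t - p n t) ^ 4 \<partial>torus)" for n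
    proof -
      have "(\<integral>t. \<bar>cmod (p n t) ^ 4 - cmod (g t) ^ 4\<bar> \<partial>torus) \<le> (\<integral>t. 5 * \<eta> * cmod (g t) ^ 4 + 2 * (1 + 1 / \<eta>) ^ 3 * cmod (g t - p n t) ^ 4 \<partial>torus)"
        by (intro integral_mono iD iR pt \<eta>)
      also have "\<dots> = 5 * \<eta> * Bg + 2 * (1 + 1 / \<eta>) ^ 3 * (\<integral>t. cmod (g t - p n t) ^ 4 \<partial>torus)"
        using ig id by (simp add: Bg_def)
      also have "5 * \<eta> * Bg \<le> \<epsilon>" using \<eta> by (simp add: algebra_simps)
      finally show ?thesis by simp
    qed
    then show "\<exists>C. eventually (\<lambda>n. (\<integral>t. \<bar>cmod (p n t) ^ 4 - cmod (g t) ^ 4\<bar> \<partial>torus) \<le> \<epsilon> + C * (\<integral>t. cmod (g t - p n t) ^ 4 \<partial>torus)) sequentially"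
      by (intro exI[of _ "2 * (1 + 1 / \<eta>) ^ 3"] always_eventually allI)
  qed auto
  have ig2: "integrable torus (\<lambda>t. (cmod (g t))\<^sup>2)" by (rule torus.L4_imp_L2[OF _ ig]) measurable
  have id2: "integrable torus (\<lambda>t. (cmod (g t - p n t))\<^sup>2)" for n by (rule torus.L4_imp_L2[OF _ id]) measurable
  have lim2: "(\<lambda>n. \<integral>t. (cmod (g t - p n t))\<^sup>2 \<partial>torus) \<longlonglongrightarrow> 0"
  proof (rule Lim_null_comparison)
    show "eventually (\<lambda>n. norm (\<integral>t. (cmod (g t - p n t))\<^sup>2 \<partial>torus) \<le> sqrt (2 * pi * (\<integral>t. cmod (g t - p n t) ^ 4 \<partial>torus))) sequentially"
    proof (intro always_eventually allI)
      fix n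
      have m: "(\<lambda>t. (cmod (g t - p n t))\<^sup>2) \<in> borel_measurable torus" by measurable
      show "norm (\<integral>t. (cmod (g t - p n t))\<^sup>2 \<partial>torus) \<le> sqrt (2 * pi * (\<integral>t. cmod (g t - p n t) ^ 4 \<partial>torus))"
        using torus.L1_le_L2(2)[OF m] id[of n] by (intro real_le_rsqrt) simp
    qed
    have "(\<lambda>n. sqrt (2 * pi * (\<integral>t. cmod (g t - p n t) ^ 4 \<partial>torus))) \<longlonglongrightarrow> sqrt (2 * pi * 0)" by (intro tendsto_intros lim)
    then show "(\<lambda>n. sqrt (2 * pi * (\<integral>t. cmod (g t - p n t) ^ 4 \<partial>torus))) \<longlonglongrightarrow> 0" by simp
  qed
  have pt2: "\<bar>(cmod (p n t))\<^sup>2 - (cmod (g t))\<^sup>2\<bar> \<le> \<eta> * (cmod (g t))\<^sup>2 + (1 + 1 / \<eta>) * (cmod (g t - p n t))\<^sup>2" if "0 < \<eta>" for \<eta> n t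
  proof -
    have "(cmod (p n t) - cmod (g t))\<^sup>2 \<le> (cmod (g t - p n t))\<^sup>2"
      using d[of n t] by (metis abs_ge_zero power2_abs power_mono)
    then have "(1 + 1 / \<eta>) * (cmod (p n t) - cmod (g t))\<^sup>2 \<le> (1 + 1 / \<eta>) * (cmod (g t - p n t))\<^sup>2"
      using that by (intro mult_left_mono) auto
    then show ?thesis using square_diff_le[OF that, of "cmod (p n t)" "cmod (g t)"] by linarith
  qed
  have iR2: "integrable torus (\<lambda>t. \<eta> * (cmod (g t))\<^sup>2 + (1 + 1 / \<eta>) * (cmod (g t - p n t))\<^sup>2)" for \<eta> n
    using ig2 id2 by auto
  have iD2: "integrable torus (\<lambda>t. \<bar>(cmod (p n t))\<^sup>2 - (cmod (g t))\<^sup>2\<bar>)" for n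
    by (rule Bochner_Integration.integrable_bound[OF iR2[of 1 n]]) (use pt2[of 1] in \<open>auto intro!: AE_I2 order_trans[OF _ abs_ge_self]\<close>)
  define Bg2 where "Bg2 = (\<integral>t. (cmod (g t))\<^sup>2 \<partial>torus)"
  have Bg2: "Bg2 \<ge> 0" by (simp add: Bg2_def)
  show "(\<lambda>n. \<integral>t. \<bar>(cmod (p n t))\<^sup>2 - (cmod (g t))\<^sup>2\<bar> \<partial>torus) \<longlonglongrightarrow> 0"
  proof (rule null_by_splitting[OF _ lim2])
    fix \<epsilon> :: real assume \<epsilon>: "0 < \<epsilon>"
    define \<eta> where "\<eta> = \<epsilon> / (Bg2 + 1)"
    have \<eta>: "0 < \<eta>" "\<eta> * Bg2 \<le> \<epsilon>"
      using \<epsilon> Bg2 by (auto simp: \<eta>_def field_simps)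
    have "(\<integral>t. \<bar>(cmod (p n t))\<^sup>2 - (cmod (g t))\<^sup>2\<bar> \<partial>torus) \<le> \<epsilon> + (1 + 1 / \<eta>) * (\<integral>t. (cmod (g t - p n t))\<^sup>2 \<partial>torus)" for n
    proof -
      have "(\<integral>t. \<bar>(cmod (p n t))\<^sup>2 - (cmod (g t))\<^sup>2\<bar> \<partial>torus) \<le> (\<integral>t. \<eta> * (cmod (g t))\<^sup>2 + (1 + 1 / \<eta>) * (cmod (g t - p n t))\<^sup>2 \<partial>torus)"
        by (intro integral_mono iD2 iR2 pt2 \<eta>)
      also have "\<dots> = \<eta> * Bg2 + (1 + 1 / \<eta>) * (\<integral>t. (cmod (g t - p n t))\<^sup>2 \<partial>torus)"
        using ig2 id2 by (simp add: Bg2_def)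
      finally show ?thesis using \<eta> by simp
    qed
    then show "\<exists>C. eventually (\<lambda>n. (\<integral>t. \<bar>(cmod (p n t))\<^sup>2 - (cmod (g t))\<^sup>2\<bar> \<partial>torus) \<le> \<epsilon> + C * (\<integral>t. (cmod (g t - p n t))\<^sup>2 \<partial>torus)) sequentially"
      by (intro exI[of _ "1 + 1 / \<eta>"] always_eventually allI)
  qed auto
qed

section \<open>Quadratic forms in independent noise\<close>

text \<open>For noise with mean 0 and variance v the subtraction on the diagonal makes every summand
  centered, so the whole form has mean 0.\<close>

definition QF :: "real \<Rightarrow> 'i set \<Rightarrow> ('i \<Rightarrow> 'i \<Rightarrow> real) \<Rightarrow> ('i \<Rightarrow> real) \<Rightarrow> real" where
  "QF v V A x = (\<Sum>i\<in>V. \<Sum>j\<in>V. A i j * (x i * x j - (if i = j then v else 0)))"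

locale noise =
  fixes \<mu> :: "real measure" and K v :: real
  assumes sg: "subgaussian \<mu> K" and mean: "(\<integral>x. x \<partial>\<mu>) = 0" and second: "(\<integral>x. x\<^sup>2 \<partial>\<mu>) = v"
begin

lemma prob: "prob_space \<mu>" and sets [measurable_cong]: "sets \<mu> = sets borel"
  using sg by (auto simp: subgaussian_def)

sublocale prob_space \<mu> by (rule prob)

sublocale P: product_sigma_finite "\<lambda>_::'i. \<mu>"
  by (rule product_sigma_finite_const[OF prob])

lemma prob_PiM: "prob_space (PiM V (\<lambda>_. \<mu>))"
  by (rule prob_space_PiM) (rule prob)

lemma integrable_exp: "integrable \<mu> (\<lambda>x. exp (u * x))"
proof (rule integrableI_nonneg)
  have "(\<integral>\<^sup>+x. ennreal (exp (u * x)) \<partial>\<mu>) \<le> ennreal (exp (K * u\<^sup>2 / 2))" using sg by (auto simp: subgaussian_def)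
  then show "(\<integral>\<^sup>+x. ennreal (exp (u * x)) \<partial>\<mu>) < \<infinity>" by (auto simp: top_unique less_top[symmetric])
qed auto

lemma power_le_exp: "\<bar>x::real\<bar> ^ n \<le> real n ^ n * exp \<bar>x\<bar>" if "n > 0"
proof -
  have "\<bar>x\<bar> / real n \<le> exp (\<bar>x\<bar> / real n)" using exp_ge_add_one_self[of "\<bar>x\<bar> / real n"] by linarith
  then have "(\<bar>x\<bar> / real n) ^ n \<le> exp (\<bar>x\<bar> / real n) ^ n" by (intro power_mono) auto
  also have "\<dots> = exp \<bar>x\<bar>" using that by (simp add: exp_of_nat_mult[symmetric])
  finally show ?thesis using that by (simp add: power_divide field_simps)
qed

lemma integrable_power: "integrable \<mu> (\<lambda>x. x ^ n)"
proof (cases "n = 0")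
  case False
  show ?thesis
  proof (rule Bochner_Integration.integrable_bound)
    show "integrable \<mu> (\<lambda>x. real n ^ n * (exp (1 * x) + exp ((-1) * x)))" using integrable_exp[of 1] integrable_exp[of "-1"] by auto
    have "\<bar>x ^ n\<bar> \<le> real n ^ n * (exp (1 * x) + exp ((-1) * x))" for x :: real
    proof -
      have "\<bar>x ^ n\<bar> \<le> real n ^ n * exp \<bar>x\<bar>" using power_le_exp[of n x] False by (simp add: power_abs)
      also have "exp \<bar>x\<bar> \<le> exp (1 * x) + exp ((-1) * x)" by (cases "x \<ge> 0") auto
      finally show ?thesis by (simp add: mult_left_mono)
    qed
    then show "AE x in \<mu>. norm (x ^ n) \<le> norm (real n ^ n * (exp (1 * x) + exp ((-1) * x)))" by (auto intro: order_trans[OF _ abs_ge_self])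
  qed measurable
qed simp

definition m4 where "m4 = (\<integral>x. x ^ 4 \<partial>\<mu>)"

text \<open>Turns a product of noise variables with possibly equal indices into a product over all
  coordinates of powers; in this shape the integral factorises under the product measure.\<close>

definition cnt :: "'i \<Rightarrow> 'i \<Rightarrow> nat" where "cnt r i = (if r = i then 1 else 0)"

lemma prod_power_cnt:
  assumes "finite V" "i \<in> V" shows "(\<Prod>r\<in>V. (x r :: real) ^ cnt r i) = x i"
proof -
  have "(\<Prod>r\<in>V. x r ^ cnt r i) = (\<Prod>r\<in>V. if r = i then x i else 1)" by (intro prod.cong) (auto simp: cnt_def)
  then show ?thesis using assms by simp
qed

lemma moment4_product:
  assumes V: "finite V" "i \<in> V" "j \<in> V" "k \<in> V" "l \<in> V"
  shows "integrable (PiM V (\<lambda>_. \<mu>)) (\<lambda>x. x i * x j * x k * x l)"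
    "(\<integral>x. x i * x j * x k * x l \<partial>PiM V (\<lambda>_. \<mu>)) = (\<Prod>r\<in>V. \<integral>y. y ^ (cnt r i + cnt r j + cnt r k + cnt r l) \<partial>\<mu>)"
proof -
  have eq: "(\<lambda>x. x i * x j * x k * x l) = (\<lambda>x::_ \<Rightarrow> real. \<Prod>r\<in>V. x r ^ (cnt r i + cnt r j + cnt r k + cnt r l))"
    using V by (simp add: power_add prod.distrib prod_power_cnt)
  show "integrable (PiM V (\<lambda>_. \<mu>)) (\<lambda>x. x i * x j * x k * x l)"
    unfolding eq by (rule P.product_integrable_prod[OF V(1)]) (rule integrable_power)
  show "(\<integral>x. x i * x j * x k * x l \<partial>PiM V (\<lambda>_. \<mu>)) = (\<Prod>r\<in>V. \<integral>y. y ^ (cnt r i + cnt r j + cnt r k + cnt r l) \<partial>\<mu>)"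
    unfolding eq by (rule P.product_integral_prod[OF V(1)]) (rule integrable_power)
qed

lemma moment2:
  assumes V: "finite V" "i \<in> V" "j \<in> V"
  shows "integrable (PiM V (\<lambda>_. \<mu>)) (\<lambda>x. x i * x j)"
    "(\<integral>x. x i * x j \<partial>PiM V (\<lambda>_. \<mu>)) = (if i = j then v else 0)"
proof -
  have eq: "(\<lambda>x. x i * x j) = (\<lambda>x::_ \<Rightarrow> real. \<Prod>r\<in>V. x r ^ (cnt r i + cnt r j))"
    using V by (simp add: power_add prod.distrib prod_power_cnt)
  show "integrable (PiM V (\<lambda>_. \<mu>)) (\<lambda>x. x i * x j)"
    unfolding eq by (rule P.product_integrable_prod[OF V(1)]) (rule integrable_power)
  have I: "(\<integral>x. x i * x j \<partial>PiM V (\<lambda>_. \<mu>)) = (\<Prod>r\<in>V. \<integral>y. y ^ (cnt r i + cnt r j) \<partial>\<mu>)"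
    unfolding eq by (rule P.product_integral_prod[OF V(1)]) (rule integrable_power)
  show "(\<integral>x. x i * x j \<partial>PiM V (\<lambda>_. \<mu>)) = (if i = j then v else 0)"
  proof (cases "i = j")
    case True
    have "(\<Prod>r\<in>V. \<integral>y. y ^ (cnt r i + cnt r j) \<partial>\<mu>) = (\<Prod>r\<in>V. if r = i then v else 1)"
      using True second by (intro prod.cong) (auto simp: cnt_def prob_space power2_eq_square)
    then show ?thesis using True I V by simp
  next
    case False
    have "(\<integral>y. y ^ (cnt i i + cnt i j) \<partial>\<mu>) = 0" using False mean by (simp add: cnt_def)
    then have "(\<Prod>r\<in>V. \<integral>y. y ^ (cnt r i + cnt r j) \<partial>\<mu>) = 0" using V by (intro prod_zero) auto
    then show ?thesis using False I by simp
  qed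
qed

text \<open>An index that occurs exactly once contributes a factor 0, so the indices must match in
  pairs. When all four coincide, the three pairings already give 3 v^2, and the fourth cumulant m4 -
  3 v^2 corrects this to m4.\<close>

lemma moment4:
  assumes V: "finite V" "i \<in> V" "j \<in> V" "k \<in> V" "l \<in> V"
  shows "(\<integral>x. x i * x j * x k * x l \<partial>PiM V (\<lambda>_. \<mu>)) =
    v\<^sup>2 * (of_bool (i = j \<and> k = l) + of_bool (i = k \<and> j = l) + of_bool (i = l \<and> j = k))
     + (m4 - 3 * v\<^sup>2) * of_bool (i = j \<and> j = k \<and> k = l)"
proof -
  define n where "n r = cnt r i + cnt r j + cnt r k + cnt r l" for r
  have I: "(\<integral>x. x i * x j * x k * x l \<partial>PiM V (\<lambda>_. \<mu>)) = (\<Prod>r\<in>V. \<integral>y. y ^ n r \<partial>\<mu>)"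
    unfolding n_def by (rule moment4_product(2)[OF V])
  have zero: "(\<integral>x. x i * x j * x k * x l \<partial>PiM V (\<lambda>_. \<mu>)) = 0" if "r \<in> V" "n r = 1" for r
    unfolding I using that V(1) mean by (intro prod_zero) (auto intro!: bexI[of _ r])
  have two: "(\<integral>x. x i * x j * x k * x l \<partial>PiM V (\<lambda>_. \<mu>)) = v\<^sup>2"
    if st: "s \<in> V" "t \<in> V" "s \<noteq> t" and n: "\<And>r. n r = (if r = s \<or> r = t then 2 else 0)" for s t
  proof -
    have "(\<Prod>r\<in>V. \<integral>y. y ^ n r \<partial>\<mu>) = (\<Prod>r\<in>V. if r \<in> {s, t} then v else 1)"
      unfolding n using second by (intro prod.cong) (auto simp: prob_space)
    also have "\<dots> = (\<Prod>r\<in>{s, t}. v)"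
      by (rule prod.mono_neutral_cong_right) (use V(1) st in auto)
    finally show ?thesis unfolding I using st by (simp add: power2_eq_square)
  qed
  have four: "(\<integral>x. x i * x j * x k * x l \<partial>PiM V (\<lambda>_. \<mu>)) = m4" if "i = j" "j = k" "k = l"
  proof -
    have "(\<Prod>r\<in>V. \<integral>y. y ^ n r \<partial>\<mu>) = (\<Prod>r\<in>V. if r = i then m4 else 1)"
      unfolding n_def using that by (intro prod.cong) (auto simp: cnt_def prob_space m4_def power4_eq_xxxx mult.assoc)
    then show ?thesis unfolding I using V by simp
  qed
  have ex: "\<exists>r\<in>V. n r = 1" if "\<not> (i = j \<and> k = l)" "\<not> (i = k \<and> j = l)" "\<not> (i = l \<and> j = k)"
  proof -
    have "n i = 1 \<or> n j = 1 \<or> n k = 1 \<or> n l = 1" using that unfolding n_def cnt_def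
      by (cases "i = j"; cases "i = k"; cases "i = l"; cases "j = k"; cases "j = l"; cases "k = l") simp_all
    then show ?thesis using V by blast
  qed
  consider "i = j" "j = k" "k = l" | "i = j" "k = l" "i \<noteq> k" | "i = k" "j = l" "i \<noteq> j" | "i = l" "j = k" "i \<noteq> j"
    | "\<exists>r\<in>V. n r = 1" "\<not> (i = j \<and> k = l)" "\<not> (i = k \<and> j = l)" "\<not> (i = l \<and> j = k)"
    using ex by blast
  then show ?thesis
  proof cases
    case 1
    then show ?thesis using four by simp
  next
    case 2
    then show ?thesis using two[of i k] V by (auto simp: n_def cnt_def)
  next
    case 3
    then show ?thesis using two[of i j] V by (auto simp: n_def cnt_def)
  next
    case 4
    then show ?thesis using two[of i j] V by (auto simp: n_def cnt_def)
  next
    case 5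
    then obtain r where "r \<in> V" "n r = 1" by blast
    then have z: "(\<integral>x. x i * x j * x k * x l \<partial>PiM V (\<lambda>_. \<mu>)) = 0" by (rule zero)
    have "\<not> (i = j \<and> j = k \<and> k = l)" using 5(2) by blast
    then show ?thesis unfolding z using 5(2-4) by (simp only: of_bool_eq simp_thms mult_zero_right add_0_left add_0_right)
  qed
qed

text \<open>The centering cancels the pairing i = j, k = l. The other two pairings give A_ij A_ij
  and A_ij A_ji, kept apart since A is not assumed symmetric, and the fourth cumulant sees the
  diagonal.\<close>

lemma QF_square:
  assumes V: "finite V"
  shows "integrable (PiM V (\<lambda>_. \<mu>)) (\<lambda>x. (QF v V A x)\<^sup>2)"
    "(\<integral>x. (QF v V A x)\<^sup>2 \<partial>PiM V (\<lambda>_. \<mu>)) =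
      v\<^sup>2 * (\<Sum>i\<in>V. \<Sum>j\<in>V. A i j * A i j + A i j * A j i) + (m4 - 3 * v\<^sup>2) * (\<Sum>i\<in>V. (A i i)\<^sup>2)"
proof -
  let ?P = "PiM V (\<lambda>_. \<mu>)"
  interpret PP: prob_space ?P by (rule prob_PiM)
  define q where "q i j x = x i * x j - (if i = j then v else 0)" for i j and x :: "'a \<Rightarrow> real"
  have sq: "(QF v V A x)\<^sup>2 = (\<Sum>i\<in>V. \<Sum>j\<in>V. \<Sum>k\<in>V. \<Sum>l\<in>V. (A i j * A k l) * (q i j x * q k l x))" for x
    unfolding QF_def q_def[symmetric] power2_eq_square sum_product
    by (rule sum.cong[OF refl], subst sum.swap, intro sum.cong refl) (simp add: mult_ac)
  have qq: "q i j x * q k l x = x i * x j * x k * x l - (if k = l then v else 0) * (x i * x j) - (if i = j then v else 0) * (x k * x l) + (if i = j then v else 0) * (if k = l then v else 0)"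
    for i j k l x unfolding q_def by (simp add: algebra_simps)
  have iq: "integrable ?P (\<lambda>x. q i j x * q k l x)" if "i \<in> V" "j \<in> V" "k \<in> V" "l \<in> V" for i j k l
    unfolding qq using moment4_product(1)[OF V that] moment2(1)[OF V that(1,2)] moment2(1)[OF V that(3,4)] by auto
  have Iq: "(\<integral>x. q i j x * q k l x \<partial>?P) = v\<^sup>2 * (of_bool (i = k \<and> j = l) + of_bool (i = l \<and> j = k)) + (m4 - 3 * v\<^sup>2) * of_bool (i = j \<and> j = k \<and> k = l)"
    if "i \<in> V" "j \<in> V" "k \<in> V" "l \<in> V" for i j k l
  proof -
    have "(\<integral>x. q i j x * q k l x \<partial>?P) = (\<integral>x. x i * x j * x k * x l \<partial>?P) - (if k = l then v else 0) * (\<integral>x. x i * x j \<partial>?P) - (if i = j then v else 0) * (\<integral>x. x k * x l \<partial>?P) + (if i = j then v else 0) * (if k = l then v else 0)"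
      unfolding qq using moment4_product(1)[OF V that] moment2(1)[OF V that(1,2)] moment2(1)[OF V that(3,4)]
      by (simp add: PP.prob_space)
    moreover define a where "a = (if i = j then v else 0)"
    moreover define b where "b = (if k = l then v else 0)"
    moreover have "v\<^sup>2 * of_bool (i = j \<and> k = l) = a * b"
      by (simp add: a_def b_def power2_eq_square)
    ultimately show ?thesis
      unfolding moment4[OF V that] moment2(2)[OF V that(1,2)] moment2(2)[OF V that(3,4)] distrib_left
        a_def[symmetric] b_def[symmetric] by simp
  qed
  show "integrable ?P (\<lambda>x. (QF v V A x)\<^sup>2)"
    unfolding sq using iq by (intro Bochner_Integration.integrable_sum integrable_mult_right)
  have "(\<integral>x. (QF v V A x)\<^sup>2 \<partial>?P) = (\<Sum>i\<in>V. \<Sum>j\<in>V. \<Sum>k\<in>V. \<Sum>l\<in>V. (A i j * A k l) * (\<integral>x. q i j x * q k l x \<partial>?P))"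
    unfolding sq using iq by (simp add: Bochner_Integration.integral_sum)
  also have "\<dots> = (\<Sum>i\<in>V. \<Sum>j\<in>V. v\<^sup>2 * (A i j * A i j + A i j * A j i) + (if j = i then (m4 - 3 * v\<^sup>2) * (A i i)\<^sup>2 else 0))"
  proof (intro sum.cong[OF refl])
    fix i j assume ij: "i \<in> V" "j \<in> V"
    have s1: "(\<Sum>k\<in>V. \<Sum>l\<in>V. c k l * of_bool (k = s \<and> l = t)) = c s t" if "s \<in> V" "t \<in> V" for s t and c :: "'a \<Rightarrow> 'a \<Rightarrow> real"
    proof -
      have "(\<Sum>l\<in>V. c k l * of_bool (k = s \<and> l = t)) = (if k = s then c s t else 0)" for k
        using V that by (auto simp: of_bool_def if_distrib[of "(*) _"] cong: if_cong)
      then show ?thesis using V that by simp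
    qed
    have "(\<Sum>k\<in>V. \<Sum>l\<in>V. (A i j * A k l) * (\<integral>x. q i j x * q k l x \<partial>?P))
      = (\<Sum>k\<in>V. \<Sum>l\<in>V. (v\<^sup>2 * (A i j * A k l)) * of_bool (k = i \<and> l = j) + (v\<^sup>2 * (A i j * A k l)) * of_bool (k = j \<and> l = i)
          + ((m4 - 3 * v\<^sup>2) * of_bool (i = j) * (A i j * A k l)) * of_bool (k = i \<and> l = i))"
    proof (intro sum.cong refl)
      fix k l assume kl: "k \<in> V" "l \<in> V"
      have p: "(of_bool (i = k \<and> j = l) :: real) = of_bool (k = i \<and> l = j)"
        and s: "(of_bool (i = l \<and> j = k) :: real) = of_bool (k = j \<and> l = i)"
        and t: "(of_bool (i = j \<and> j = k \<and> k = l) :: real) = of_bool (i = j) * of_bool (k = i \<and> l = i)"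
        by auto
      show "(A i j * A k l) * (\<integral>x. q i j x * q k l x \<partial>?P) = (v\<^sup>2 * (A i j * A k l)) * of_bool (k = i \<and> l = j) + (v\<^sup>2 * (A i j * A k l)) * of_bool (k = j \<and> l = i)
          + ((m4 - 3 * v\<^sup>2) * of_bool (i = j) * (A i j * A k l)) * of_bool (k = i \<and> l = i)"
        unfolding Iq[OF ij kl] p s t by (simp only: distrib_left mult_ac)
    qed
    also have "\<dots> = v\<^sup>2 * (A i j * A i j) + v\<^sup>2 * (A i j * A j i) + (m4 - 3 * v\<^sup>2) * of_bool (i = j) * (A i j * A i i)"
      unfolding sum.distrib using ij by (simp only: s1)
    finally show "(\<Sum>k\<in>V. \<Sum>l\<in>V. (A i j * A k l) * (\<integral>x. q i j x * q k l x \<partial>?P))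
       = v\<^sup>2 * (A i j * A i j + A i j * A j i) + (if j = i then (m4 - 3 * v\<^sup>2) * (A i i)\<^sup>2 else 0)"
      by (auto simp: distrib_left power2_eq_square)
  qed
  also have "\<dots> = v\<^sup>2 * (\<Sum>i\<in>V. \<Sum>j\<in>V. A i j * A i j + A i j * A j i) + (m4 - 3 * v\<^sup>2) * (\<Sum>i\<in>V. (A i i)\<^sup>2)"
  proof -
    define Z where "Z i j = A i j * A i j + A i j * A j i" for i j
    have "(\<Sum>i\<in>V. \<Sum>j\<in>V. v\<^sup>2 * Z i j + (if j = i then (m4 - 3 * v\<^sup>2) * (A i i)\<^sup>2 else 0))
      = (\<Sum>i\<in>V. v\<^sup>2 * (\<Sum>j\<in>V. Z i j) + (m4 - 3 * v\<^sup>2) * (A i i)\<^sup>2)"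
      using V by (intro sum.cong refl) (simp add: sum.distrib sum_distrib_left)
    also have "\<dots> = v\<^sup>2 * (\<Sum>i\<in>V. \<Sum>j\<in>V. Z i j) + (m4 - 3 * v\<^sup>2) * (\<Sum>i\<in>V. (A i i)\<^sup>2)"
      by (simp add: sum.distrib sum_distrib_left)
    finally show ?thesis unfolding Z_def .
  qed
  finally show "(\<integral>x. (QF v V A x)\<^sup>2 \<partial>?P) =
      v\<^sup>2 * (\<Sum>i\<in>V. \<Sum>j\<in>V. A i j * A i j + A i j * A j i) + (m4 - 3 * v\<^sup>2) * (\<Sum>i\<in>V. (A i i)\<^sup>2)" .
qed

lemma QF_mean:
  assumes V: "finite V"
  shows "integrable (PiM V (\<lambda>_. \<mu>)) (QF v V A)" "(\<integral>x. QF v V A x \<partial>PiM V (\<lambda>_. \<mu>)) = 0"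
proof -
  let ?P = "PiM V (\<lambda>_. \<mu>)"
  interpret PP: prob_space ?P by (rule prob_PiM)
  show "integrable ?P (QF v V A)" unfolding QF_def[abs_def]
    by (intro Bochner_Integration.integrable_sum integrable_mult_right Bochner_Integration.integrable_diff moment2(1) V) auto
  have "(\<integral>x. QF v V A x \<partial>?P) = (\<Sum>i\<in>V. \<Sum>j\<in>V. A i j * ((\<integral>x. x i * x j \<partial>?P) - (if i = j then v else 0)))"
    unfolding QF_def using moment2(1)[OF V] by (simp add: Bochner_Integration.integral_sum PP.prob_space)
  also have "\<dots> = 0" by (intro sum.neutral ballI) (simp add: moment2(2)[OF V])
  finally show "(\<integral>x. QF v V A x \<partial>?P) = 0" .
qed

end

section \<open>Autocorrelations and the covariance structure of a finite filter\<close>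

definition SZ :: "(int \<Rightarrow> real) \<Rightarrow> real" where "SZ f = infsum f UNIV"

lemma SZ_eq: "finite B \<Longrightarrow> (\<And>i. i \<notin> B \<Longrightarrow> f i = 0) \<Longrightarrow> SZ f = sum f B"
  unfolding SZ_def by (subst infsum_cong_neutral[of B UNIV f f]) auto

text \<open>Translations without boundary terms are the reason for summing over all integers,
  although the functions to be summed have finite support.\<close>

lemma SZ_shift: "SZ (\<lambda>i. f (i + s)) = SZ f"
proof -
  have "bij_betw (\<lambda>i. i + s) UNIV (UNIV :: int set)"
    by (rule bij_betwI[of _ _ _ "\<lambda>i. i - s"]) auto
  then show ?thesis unfolding SZ_def by (rule infsum_reindex_bij_betw)
qed

lemma SZ_shift': "SZ (\<lambda>i. f (i - s)) = SZ f"
  using SZ_shift[of f "- s"] by simp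

text \<open>For X k = (SUM i. c (i - k) * x i), the form QF v V (Kmat l \<iota> c K) x is the sum over r and over
  k in K of l r * (X k * X (k + \<iota> r) - E), where E is the expectation of the product.\<close>

definition Kmat :: "('n \<Rightarrow> real) \<Rightarrow> ('n \<Rightarrow> nat) \<Rightarrow> (int \<Rightarrow> real) \<Rightarrow> int set \<Rightarrow> int \<Rightarrow> int \<Rightarrow> real" where
  "Kmat l \<iota> c K i j = (\<Sum>r\<in>UNIV. l r * (\<Sum>k\<in>K. c (i - k) * c (j - k - int (\<iota> r))))"

definition autocorr :: "(int \<Rightarrow> real) \<Rightarrow> int \<Rightarrow> real" where
  "autocorr c h = SZ (\<lambda>i. c i * c (i + h))"

locale finite_filter =
  fixes c :: "int \<Rightarrow> real" and M :: nat
  assumes supp: "\<And>j. int M < \<bar>j\<bar> \<Longrightarrow> c j = 0"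
begin

abbreviation "\<gamma> \<equiv> autocorr c"

lemma autocorr_minus: "\<gamma> (- h) = \<gamma> h"
  using SZ_shift'[of "\<lambda>i. c i * c (i + h)" h] by (simp add: autocorr_def mult.commute)

lemma autocorr_zero: "2 * int M < \<bar>h\<bar> \<Longrightarrow> \<gamma> h = 0"
proof -
  assume h: "2 * int M < \<bar>h\<bar>"
  have z: "c i * c (i + h) = 0" for i
  proof (cases "int M < \<bar>i\<bar>")
    case False
    then have "int M < \<bar>i + h\<bar>" using h by linarith
    then show ?thesis using supp by simp
  qed (simp add: supp)
  then show ?thesis unfolding autocorr_def SZ_def z by simp
qed

text \<open>It is enough that V contains the window around k: outside it the first factor vanishes,
  wherever l lies.\<close>

lemma sum_shifted_product:
  assumes V: "finite V" and cov: "{k - int M..k + int M} \<subseteq> V"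
  shows "(\<Sum>i\<in>V. c (i - k) * c (i - l)) = \<gamma> (k - l)"
proof -
  have "(\<Sum>i\<in>V. c (i - k) * c (i - l)) = SZ (\<lambda>i. c (i - k) * c (i - l))"
    by (rule SZ_eq[symmetric, OF V]) (use cov supp in \<open>force simp: subset_eq\<close>)
  also have "\<dots> = SZ (\<lambda>i. (\<lambda>i. c i * c (i + (k - l))) (i - k))" by simp
  also have "\<dots> = SZ (\<lambda>i. c i * c (i + (k - l)))" by (rule SZ_shift'[of "\<lambda>i. c i * c (i + (k - l))"])
  finally show ?thesis unfolding autocorr_def .
qed

text \<open>Correlation at distance d of the lagged products c_i c_(i-s) and c_i c_(i-t). It arises
  from products of diagonal entries and carries the fourth cumulant of the noise.\<close>

definition quad :: "int \<Rightarrow> int \<Rightarrow> int \<Rightarrow> real" where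
  "quad s t d = SZ (\<lambda>i. c i * c (i - s) * c (i + d) * c (i + d - t))"

lemma sum_shifted_quad:
  assumes V: "finite V" and cov: "{k - int M..k + int M} \<subseteq> V"
  shows "(\<Sum>i\<in>V. c (i - k) * c (i - k - s) * c (i - l) * c (i - l - t)) = quad s t (k - l)"
proof -
  have "(\<Sum>i\<in>V. c (i - k) * c (i - k - s) * c (i - l) * c (i - l - t)) = SZ (\<lambda>i. c (i - k) * c (i - k - s) * c (i - l) * c (i - l - t))"
    by (rule SZ_eq[symmetric, OF V]) (use cov supp in \<open>force simp: subset_eq\<close>)
  also have "\<dots> = SZ (\<lambda>i. (\<lambda>i. c i * c (i - s) * c (i + (k - l)) * c (i + (k - l) - t)) (i - k))" by simp
  also have "\<dots> = SZ (\<lambda>i. c i * c (i - s) * c (i + (k - l)) * c (i + (k - l) - t))"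
    by (rule SZ_shift'[of "\<lambda>i. c i * c (i - s) * c (i + (k - l)) * c (i + (k - l) - t)"])
  finally show ?thesis unfolding quad_def .
qed

lemma quad_zero: "2 * int M < \<bar>d\<bar> \<Longrightarrow> quad s t d = 0"
proof -
  assume h: "2 * int M < \<bar>d\<bar>"
  have z: "c i * c (i - s) * c (i + d) * c (i + d - t) = 0" for i
  proof (cases "int M < \<bar>i\<bar>")
    case False
    then have "int M < \<bar>i + d\<bar>" using h by linarith
    then show ?thesis using supp by simp
  qed (simp add: supp)
  then show ?thesis unfolding quad_def SZ_def z by simp
qed

text \<open>Summation over d lets the two lagged products move independently, so the sum factorises.
  This is the origin of the product of two integrals in the kurtosis term of the limit.\<close>

lemma SZ_quad: "SZ (quad s t) = \<gamma> s * \<gamma> t"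
proof -
  define B where "B = {- 2 * int M..2 * int M}"
  define C where "C = {- int M..int M}"
  have fin: "finite B" "finite C" by (auto simp: B_def C_def)
  have "SZ (quad s t) = (\<Sum>d\<in>B. quad s t d)"
    by (rule SZ_eq[OF fin(1)]) (auto simp: B_def intro!: quad_zero)
  also have "\<dots> = (\<Sum>d\<in>B. \<Sum>i\<in>C. c i * c (i - s) * c (i + d) * c (i + d - t))"
    unfolding quad_def by (intro sum.cong refl SZ_eq fin) (auto simp: C_def intro!: supp)
  also have "\<dots> = (\<Sum>i\<in>C. c i * c (i - s) * (\<Sum>d\<in>B. c (i + d) * c (i + d - t)))"
    by (subst sum.swap) (simp add: sum_distrib_left mult.assoc)
  also have "\<dots> = (\<Sum>i\<in>C. c i * c (i - s) * \<gamma> t)"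
  proof (intro sum.cong refl arg_cong2[where f="(*)"])
    fix i assume i: "i \<in> C"
    have "(\<Sum>d\<in>B. c (i + d) * c (i + d - t)) = SZ (\<lambda>d. c (i + d) * c (i + d - t))"
      by (rule SZ_eq[symmetric, OF fin(1)]) (use i in \<open>auto simp: B_def C_def intro!: supp\<close>)
    also have "\<dots> = SZ (\<lambda>d. (\<lambda>d. c d * c (d + (- t))) (d + i))" by (simp add: add.commute)
    also have "\<dots> = \<gamma> (- t)" unfolding autocorr_def by (rule SZ_shift[of "\<lambda>d. c d * c (d + - t)"])
    finally show "(\<Sum>d\<in>B. c (i + d) * c (i + d - t)) = \<gamma> t" unfolding autocorr_minus .
  qed
  also have "\<dots> = (\<Sum>i\<in>C. c i * c (i + (- s))) * \<gamma> t" by (simp add: sum_distrib_right)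
  also have "(\<Sum>i\<in>C. c i * c (i + (- s))) = \<gamma> (- s)"
    unfolding autocorr_def by (rule SZ_eq[symmetric, OF fin(2)]) (auto simp: C_def intro!: supp)
  finally show ?thesis unfolding autocorr_minus .
qed

definition P :: "real \<Rightarrow> complex" where
  "P = trig {- int M..int M} (\<lambda>j. of_real (c j))"

text \<open>The product of \<open>P\<close> with its conjugate, sorted by the difference d of the
  indices: the autocorrelations are the Fourier coefficients of the spectral density.\<close>

lemma norm_P_square: "complex_of_real ((cmod (P u))\<^sup>2) = trig {- 2 * int M..2 * int M} (\<lambda>d. of_real (\<gamma> d)) u"
proof -
  define B where "B = {- 2 * int M..2 * int M}"
  define C where "C = {- int M..int M}"
  have fin: "finite B" "finite C" by (auto simp: B_def C_def)
  have "complex_of_real ((cmod (P u))\<^sup>2) = (\<Sum>j\<in>C. \<Sum>k\<in>C. of_real (c j) * of_real (c k) * E (j - k) u)"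
    unfolding norm_square_complex P_def trig_def C_def[symmetric]
    by (simp add: sum_product E_mult_cnj[symmetric] mult_ac)
  also have "\<dots> = (\<Sum>k\<in>C. \<Sum>j\<in>C. of_real (c j) * of_real (c k) * E (j - k) u)" by (rule sum.swap)
  also have "\<dots> = (\<Sum>k\<in>C. \<Sum>d\<in>B. of_real (c (k + d)) * of_real (c k) * E d u)"
  proof (rule sum.cong[OF refl])
    fix k assume k: "k \<in> C"
    have "(\<Sum>d\<in>B. of_real (c (k + d)) * of_real (c k) * E d u) = (\<Sum>d\<in>{d\<in>B. k + d \<in> C}. of_real (c (k + d)) * of_real (c k) * E d u)"
      using fin by (intro sum.mono_neutral_right) (auto simp: C_def intro!: supp)
    also have "\<dots> = (\<Sum>j\<in>C. of_real (c j) * of_real (c k) * E (j - k) u)"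
      by (rule sum.reindex_bij_witness[of _ "\<lambda>j. j - k" "\<lambda>d. k + d"]) (use k in \<open>auto simp: B_def C_def\<close>)
    finally show "(\<Sum>j\<in>C. of_real (c j) * of_real (c k) * E (j - k) u) = (\<Sum>d\<in>B. of_real (c (k + d)) * of_real (c k) * E d u)" ..
  qed
  also have "\<dots> = (\<Sum>d\<in>B. of_real (\<Sum>k\<in>C. c k * c (k + d)) * E d u)"
    by (subst sum.swap) (simp add: sum_distrib_right sum_distrib_left mult_ac)
  also have "\<dots> = (\<Sum>d\<in>B. of_real (\<gamma> d) * E d u)"
  proof (intro sum.cong refl)
    fix d
    have "\<gamma> d = (\<Sum>k\<in>C. c k * c (k + d))" unfolding autocorr_def by (rule SZ_eq[OF fin(2)]) (auto simp: C_def intro!: supp)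
    then show "of_real (\<Sum>k\<in>C. c k * c (k + d)) * E d u = of_real (\<gamma> d) * E d u" by simp
  qed
  finally show ?thesis unfolding trig_def B_def .
qed

lemma integral_P2: "(\<integral>u. of_real ((cmod (P u))\<^sup>2) * E s u \<partial>torus) = of_real (2 * pi * \<gamma> s)"
proof -
  define B where "B = {- 2 * int M..2 * int M}"
  have i: "integrable torus (\<lambda>u. complex_of_real (\<gamma> d) * E (d + s) u)" for d
    by (rule integrable_torus_bounded[of _ "\<bar>\<gamma> d\<bar>"]) (auto simp: norm_mult)
  have "(\<lambda>u. of_real ((cmod (P u))\<^sup>2) * E s u) = (\<lambda>u. \<Sum>d\<in>B. of_real (\<gamma> d) * E (d + s) u)"
    unfolding norm_P_square trig_def B_def by (simp add: sum_distrib_right E_add mult.assoc)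
  then have "(\<integral>u. of_real ((cmod (P u))\<^sup>2) * E s u \<partial>torus) = (\<Sum>d\<in>B. of_real (\<gamma> d) * (if d + s = 0 then of_real (2 * pi) else 0))"
    using i by (simp add: integral_E)
  also have "\<dots> = (\<Sum>d\<in>B. if d = - s then of_real (\<gamma> (- s) * (2 * pi)) else 0)" by (intro sum.cong) auto
  also have "\<dots> = of_real (2 * pi * \<gamma> (- s))"
    by (auto simp: B_def autocorr_zero)
  finally show ?thesis unfolding autocorr_minus .
qed

text \<open>One factor |P|^2 is expanded into autocorrelations and the other integrated against the
  shifted characters, which is Parseval's identity for |P|^2 and its translate in frequency.\<close>

lemma integral_P4: "(\<integral>u. of_real ((cmod (P u)) ^ 4) * E s u \<partial>torus) = of_real (2 * pi * SZ (\<lambda>d. \<gamma> d * \<gamma> (d + s)))"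
proof -
  define B where "B = {- 2 * int M..2 * int M}"
  have [measurable]: "P \<in> borel_measurable torus" unfolding P_def by measurable
  have i: "integrable torus (\<lambda>u. complex_of_real (\<gamma> d) * (of_real ((cmod (P u))\<^sup>2) * E (d + s) u))" for d
  proof (rule integrable_torus_bounded)
    fix u
    have "(cmod (P u))\<^sup>2 \<le> (\<Sum>k\<in>{- int M..int M}. cmod (of_real (c k)))\<^sup>2" unfolding P_def by (intro power_mono norm_trig_le) auto
    then show "norm (complex_of_real (\<gamma> d) * (of_real ((cmod (P u))\<^sup>2) * E (d + s) u)) \<le> \<bar>\<gamma> d\<bar> * (\<Sum>k\<in>{- int M..int M}. cmod (of_real (c k)))\<^sup>2"
      unfolding norm_mult norm_of_real norm_E by (simp add: mult_left_mono)
  qed measurable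
  have "of_real ((cmod (P u)) ^ 4) * E s u = (\<Sum>d\<in>B. of_real (\<gamma> d) * (of_real ((cmod (P u))\<^sup>2) * E (d + s) u))" for u
  proof -
    have "complex_of_real ((cmod (P u)) ^ 4) * E s u = of_real ((cmod (P u))\<^sup>2) * of_real ((cmod (P u))\<^sup>2) * E s u"
      by (simp add: power4_eq_xxxx power2_eq_square)
    also have "\<dots> = of_real ((cmod (P u))\<^sup>2) * (\<Sum>d\<in>B. of_real (\<gamma> d) * E d u) * E s u"
      by (subst (2) norm_P_square) (simp add: trig_def B_def)
    finally show ?thesis by (simp add: sum_distrib_left sum_distrib_right E_add mult_ac)
  qed
  then have "(\<integral>u. of_real ((cmod (P u)) ^ 4) * E s u \<partial>torus) = (\<Sum>d\<in>B. of_real (\<gamma> d) * (\<integral>u. of_real ((cmod (P u))\<^sup>2) * E (d + s) u \<partial>torus))"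
    using i by simp
  also have "\<dots> = of_real (2 * pi * (\<Sum>d\<in>B. \<gamma> d * \<gamma> (d + s)))"
    unfolding integral_P2 by (simp add: sum_distrib_left mult_ac)
  also have "(\<Sum>d\<in>B. \<gamma> d * \<gamma> (d + s)) = SZ (\<lambda>d. \<gamma> d * \<gamma> (d + s))"
    by (rule SZ_eq[symmetric]) (auto simp: B_def autocorr_zero)
  finally show ?thesis .
qed

text \<open>Covariance of X_k X_(k+s) and X_k' X_(k'+t) as a function of d = k - k', for the process
  X filtered by c from noise with variance v and fourth cumulant q.\<close>

definition H :: "real \<Rightarrow> real \<Rightarrow> int \<Rightarrow> int \<Rightarrow> int \<Rightarrow> real" where
  "H v q s t d = v\<^sup>2 * (\<gamma> d * \<gamma> (d + (s - t)) + \<gamma> (d - t) * \<gamma> (d + s)) + q * quad s t d"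

lemma H_zero: "2 * int M + \<bar>s\<bar> < \<bar>d\<bar> \<Longrightarrow> H v q s t d = 0"
  unfolding H_def using autocorr_zero[of d] quad_zero[of d s t] autocorr_zero[of "d + s"] by simp

lemma SZ_add:
  assumes "finite B" "\<And>i. i \<notin> B \<Longrightarrow> f i = 0" "\<And>i. i \<notin> B \<Longrightarrow> g i = 0"
  shows "SZ (\<lambda>i. x * f i + y * g i) = x * SZ f + y * SZ g"
  using assms SZ_eq[of B f] SZ_eq[of B g] SZ_eq[of B "\<lambda>i. x * f i + y * g i"]
  by (simp add: sum.distrib sum_distrib_left)

lemma SZ_H: "SZ (H v q s t) = v\<^sup>2 * (SZ (\<lambda>d. \<gamma> d * \<gamma> (d + (s - t))) + SZ (\<lambda>d. \<gamma> d * \<gamma> (d + (s + t)))) + q * (\<gamma> s * \<gamma> t)"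
proof -
  define B where "B = {- 2 * int M - \<bar>s\<bar>..2 * int M + \<bar>s\<bar>}"
  have B: "finite B" by (simp add: B_def)
  have a: "SZ (\<lambda>d. \<gamma> (d - t) * \<gamma> (d + s)) = SZ (\<lambda>d. \<gamma> d * \<gamma> (d + (s + t)))"
    using SZ_shift'[of "\<lambda>d. \<gamma> d * \<gamma> (d + (s + t))" t] by (simp add: algebra_simps)
  have z: "\<gamma> d * \<gamma> (d + (s - t)) = 0" "\<gamma> (d - t) * \<gamma> (d + s) = 0" "quad s t d = 0" if "d \<notin> B" for d
  proof -
    have "2 * int M + \<bar>s\<bar> < \<bar>d\<bar>" using that by (auto simp: B_def)
    then show "\<gamma> d * \<gamma> (d + (s - t)) = 0" "\<gamma> (d - t) * \<gamma> (d + s) = 0" "quad s t d = 0"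
      using autocorr_zero[of d] quad_zero[of d s t] autocorr_zero[of "d + s"] by simp_all
  qed
  have "SZ (H v q s t) = SZ (\<lambda>d. v\<^sup>2 * (1 * (\<gamma> d * \<gamma> (d + (s - t))) + 1 * (\<gamma> (d - t) * \<gamma> (d + s))) + q * quad s t d)"
    by (simp add: H_def[abs_def])
  also have "\<dots> = v\<^sup>2 * SZ (\<lambda>d. 1 * (\<gamma> d * \<gamma> (d + (s - t))) + 1 * (\<gamma> (d - t) * \<gamma> (d + s))) + q * SZ (quad s t)"
    by (rule SZ_add[OF B]) (auto simp: z)
  also have "SZ (\<lambda>d. 1 * (\<gamma> d * \<gamma> (d + (s - t))) + 1 * (\<gamma> (d - t) * \<gamma> (d + s)))
      = 1 * SZ (\<lambda>d. \<gamma> d * \<gamma> (d + (s - t))) + 1 * SZ (\<lambda>d. \<gamma> (d - t) * \<gamma> (d + s))"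
    by (rule SZ_add[OF B]) (auto simp: z)
  finally show ?thesis unfolding a SZ_quad by simp
qed

text \<open>The limiting covariance is the covariance \<open>H\<close> summed over all distances.
  The products of autocorrelations turn into integrals of |P|^4; in the kurtosis term the factor
  q/v^2 meets two densities that each contain one v.\<close>

lemma Sigma2_P:
  assumes v: "v > 0"
  shows "Sigma2 (\<lambda>u. v * (cmod (P u))\<^sup>2) (q / v\<^sup>2) s t = complex_of_real (SZ (H v q (int s) (int t)))"
proof -
  have e1: "exp (\<i> * complex_of_real ((real s - real t) * u)) = E (int s - int t) u" for u by (simp add: E_def)
  have e2: "exp (\<i> * complex_of_real ((real s + real t) * u)) = E (int s + int t) u" for u by (simp add: E_def)
  have e3: "exp (\<i> * complex_of_real (real k * u)) = E (int k) u" for u k by (simp add: E_def)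
  have [measurable]: "P \<in> borel_measurable torus" unfolding P_def by measurable
  have iP: "integrable torus (\<lambda>u. of_real (cmod (P u) ^ 4) * E k u)" for k
  proof (rule integrable_torus_bounded)
    fix u
    have "cmod (P u) ^ 4 \<le> (\<Sum>k\<in>{- int M..int M}. cmod (of_real (c k))) ^ 4" unfolding P_def by (intro power_mono norm_trig_le) auto
    then show "norm (complex_of_real (cmod (P u) ^ 4) * E k u) \<le> (\<Sum>k\<in>{- int M..int M}. cmod (of_real (c k))) ^ 4"
      unfolding norm_mult norm_of_real norm_E by simp
  qed measurable
  have 1: "(\<integral>u. (E (int s - int t) u + E (int s + int t) u) * complex_of_real ((v * (cmod (P u))\<^sup>2)\<^sup>2) \<partial>torus)
    = of_real (v\<^sup>2) * (of_real (2 * pi * SZ (\<lambda>d. \<gamma> d * \<gamma> (d + (int s - int t)))) + of_real (2 * pi * SZ (\<lambda>d. \<gamma> d * \<gamma> (d + (int s + int t)))))"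
  proof -
    have "(\<lambda>u. (E (int s - int t) u + E (int s + int t) u) * complex_of_real ((v * (cmod (P u))\<^sup>2)\<^sup>2))
      = (\<lambda>u. of_real (v\<^sup>2) * (of_real (cmod (P u) ^ 4) * E (int s - int t) u + of_real (cmod (P u) ^ 4) * E (int s + int t) u))"
      by (rule ext) (simp add: power_mult_distrib algebra_simps)
    then show ?thesis using iP by (simp only: integral_mult_right_zero Bochner_Integration.integral_add integral_P4)
  qed
  have 2: "(\<integral>u. complex_of_real (v * (cmod (P u))\<^sup>2) * E (int k) u \<partial>torus) = of_real v * of_real (2 * pi * \<gamma> (int k))" for k
  proof -
    have "(\<lambda>u. complex_of_real (v * (cmod (P u))\<^sup>2) * E (int k) u) = (\<lambda>u. of_real v * (of_real ((cmod (P u))\<^sup>2) * E (int k) u))"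
      by (rule ext) (simp add: mult.assoc)
    then show ?thesis by (simp only: integral_mult_right_zero integral_P2)
  qed
  show ?thesis
    unfolding Sigma2_def e1 e2 e3 1 2 SZ_H using v by (simp add: field_simps power2_eq_square)
qed

text \<open>The three sums \<open>S1\<close>, \<open>S2\<close>, \<open>S3\<close> correspond to the
  two pairings and to the fourth cumulant, hence to the three terms of \<open>H\<close>. The window
  in \<open>cov\<close> extends by m to the right because the second factor of each product sits at
  a lag up to m.\<close>

lemma QF_Kmat_variance:
  fixes \<iota> :: "'n::finite \<Rightarrow> nat"
  assumes "noise \<mu> K v" and V: "finite V" and T: "finite T"
    and cov: "\<And>k. k \<in> T \<Longrightarrow> {k - int M..k + int M + int m} \<subseteq> V" and m: "\<And>r. \<iota> r \<le> m"
  shows "(\<integral>x. (QF v V (Kmat l \<iota> c T) x)\<^sup>2 \<partial>PiM V (\<lambda>_. \<mu>))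
    = (\<Sum>r\<in>UNIV. \<Sum>s\<in>UNIV. l r * l s * (\<Sum>k\<in>T. \<Sum>k'\<in>T. H v (noise.m4 \<mu> - 3 * v\<^sup>2) (int (\<iota> r)) (int (\<iota> s)) (k - k')))"
proof -
  interpret noise \<mu> K v by fact
  define A where "A = Kmat l \<iota> c T"
  have cov1: "{k - int M..k + int M} \<subseteq> V" if "k \<in> T" for k using cov[OF that] by auto
  have cov2: "{k + int (\<iota> r) - int M..k + int (\<iota> r) + int M} \<subseteq> V" if "k \<in> T" for k r using cov[OF that] m[of r] by (auto simp: subset_eq)
  have prodA: "A i j * A i' j' = (\<Sum>r\<in>UNIV. \<Sum>s\<in>UNIV. l r * l s * (\<Sum>k\<in>T. \<Sum>k'\<in>T. c (i - k) * c (j - k - int (\<iota> r)) * (c (i' - k') * c (j' - k' - int (\<iota> s)))))" for i j i' j'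
  proof -
    define X where "X i j r = (\<Sum>k\<in>T. c (i - k) * c (j - k - int (\<iota> r)))" for i j r
    have "A i j * A i' j' = (\<Sum>r\<in>UNIV. \<Sum>s\<in>UNIV. (l r * X i j r) * (l s * X i' j' s))"
      unfolding A_def Kmat_def X_def[symmetric] by (rule sum_product)
    also have "\<dots> = (\<Sum>r\<in>UNIV. \<Sum>s\<in>UNIV. l r * l s * (X i j r * X i' j' s))" by (simp only: mult_ac)
    finally show ?thesis unfolding X_def sum_product[of _ T] .
  qed
  have swap4: "(\<Sum>i\<in>V. \<Sum>r\<in>UNIV. \<Sum>s\<in>UNIV. l r * l s * (\<Sum>k\<in>T. \<Sum>k'\<in>T. F i r s k k')) = (\<Sum>r\<in>UNIV. \<Sum>s\<in>UNIV. l r * l s * (\<Sum>k\<in>T. \<Sum>k'\<in>T. \<Sum>i\<in>V. F i r s k k'))"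
    for F :: "int \<Rightarrow> 'n \<Rightarrow> 'n \<Rightarrow> int \<Rightarrow> int \<Rightarrow> real"
  proof -
    have inner: "(\<Sum>i\<in>V. \<Sum>k\<in>T. \<Sum>k'\<in>T. F i r s k k') = (\<Sum>k\<in>T. \<Sum>k'\<in>T. \<Sum>i\<in>V. F i r s k k')" for r s
      by (subst sum.swap, rule sum.cong[OF refl], rule sum.swap)
    have "(\<Sum>i\<in>V. \<Sum>r\<in>UNIV. \<Sum>s\<in>UNIV. l r * l s * (\<Sum>k\<in>T. \<Sum>k'\<in>T. F i r s k k')) = (\<Sum>r\<in>UNIV. \<Sum>s\<in>UNIV. \<Sum>i\<in>V. l r * l s * (\<Sum>k\<in>T. \<Sum>k'\<in>T. F i r s k k'))"
      by (subst sum.swap, rule sum.cong[OF refl], rule sum.swap)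
    also have "\<dots> = (\<Sum>r\<in>UNIV. \<Sum>s\<in>UNIV. l r * l s * (\<Sum>i\<in>V. \<Sum>k\<in>T. \<Sum>k'\<in>T. F i r s k k'))" by (simp add: sum_distrib_left)
    finally show ?thesis unfolding inner .
  qed
  have S1: "(\<Sum>i\<in>V. \<Sum>j\<in>V. A i j * A i j) = (\<Sum>r\<in>UNIV. \<Sum>s\<in>UNIV. l r * l s * (\<Sum>k\<in>T. \<Sum>k'\<in>T. \<gamma> (k - k') * \<gamma> ((k - k') + (int (\<iota> r) - int (\<iota> s)))))"
    unfolding prodA swap4
  proof (intro sum.cong refl arg_cong2[where f="(*)"])
    fix r s k k' assume k: "k \<in> T" "k' \<in> T"
    have "(\<Sum>i\<in>V. \<Sum>j\<in>V. c (i - k) * c (j - k - int (\<iota> r)) * (c (i - k') * c (j - k' - int (\<iota> s))))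
      = (\<Sum>i\<in>V. c (i - k) * c (i - k')) * (\<Sum>j\<in>V. c (j - (k + int (\<iota> r))) * c (j - (k' + int (\<iota> s))))"
      unfolding sum_product by (intro sum.cong refl) (simp add: diff_diff_eq mult_ac)
    also have "\<dots> = \<gamma> (k - k') * \<gamma> ((k + int (\<iota> r)) - (k' + int (\<iota> s)))"
      by (simp only: sum_shifted_product[OF V cov1[OF k(1)]] sum_shifted_product[OF V cov2[OF k(1)]])
    finally show "(\<Sum>i\<in>V. \<Sum>j\<in>V. c (i - k) * c (j - k - int (\<iota> r)) * (c (i - k') * c (j - k' - int (\<iota> s))))
      = \<gamma> (k - k') * \<gamma> ((k - k') + (int (\<iota> r) - int (\<iota> s)))" by (simp add: algebra_simps)
  qed
  have S2: "(\<Sum>i\<in>V. \<Sum>j\<in>V. A i j * A j i) = (\<Sum>r\<in>UNIV. \<Sum>s\<in>UNIV. l r * l s * (\<Sum>k\<in>T. \<Sum>k'\<in>T. \<gamma> ((k - k') - int (\<iota> s)) * \<gamma> ((k - k') + int (\<iota> r))))"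
    unfolding prodA swap4
  proof (intro sum.cong refl arg_cong2[where f="(*)"])
    fix r s k k' assume k: "k \<in> T" "k' \<in> T"
    have "(\<Sum>i\<in>V. \<Sum>j\<in>V. c (i - k) * c (j - k - int (\<iota> r)) * (c (j - k') * c (i - k' - int (\<iota> s))))
      = (\<Sum>i\<in>V. c (i - k) * c (i - (k' + int (\<iota> s)))) * (\<Sum>j\<in>V. c (j - (k + int (\<iota> r))) * c (j - k'))"
      unfolding sum_product by (intro sum.cong refl) (simp add: diff_diff_eq mult_ac)
    also have "\<dots> = \<gamma> (k - (k' + int (\<iota> s))) * \<gamma> ((k + int (\<iota> r)) - k')"
      by (simp only: sum_shifted_product[OF V cov1[OF k(1)]] sum_shifted_product[OF V cov2[OF k(1)]])
    finally show "(\<Sum>i\<in>V. \<Sum>j\<in>V. c (i - k) * c (j - k - int (\<iota> r)) * (c (j - k') * c (i - k' - int (\<iota> s))))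
      = \<gamma> ((k - k') - int (\<iota> s)) * \<gamma> ((k - k') + int (\<iota> r))" by (simp add: algebra_simps)
  qed
  have S3: "(\<Sum>i\<in>V. (A i i)\<^sup>2) = (\<Sum>r\<in>UNIV. \<Sum>s\<in>UNIV. l r * l s * (\<Sum>k\<in>T. \<Sum>k'\<in>T. quad (int (\<iota> r)) (int (\<iota> s)) (k - k')))"
    unfolding power2_eq_square prodA swap4
  proof (intro sum.cong refl arg_cong2[where f="(*)"])
    fix r s k k' assume k: "k \<in> T" "k' \<in> T"
    show "(\<Sum>i\<in>V. c (i - k) * c (i - k - int (\<iota> r)) * (c (i - k') * c (i - k' - int (\<iota> s)))) = quad (int (\<iota> r)) (int (\<iota> s)) (k - k')"
      using sum_shifted_quad[OF V cov1[OF k(1)], of "int (\<iota> r)" k' "int (\<iota> s)"] by (simp add: mult.assoc)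
  qed
  have lin: "x * (\<Sum>r\<in>UNIV. \<Sum>s\<in>UNIV. l r * l s * (\<Sum>k\<in>T. \<Sum>k'\<in>T. F r s k k')) = (\<Sum>r\<in>UNIV. \<Sum>s\<in>UNIV. l r * l s * (\<Sum>k\<in>T. \<Sum>k'\<in>T. x * F r s k k'))"
    for x and F :: "'n \<Rightarrow> 'n \<Rightarrow> int \<Rightarrow> int \<Rightarrow> real"
    by (simp add: sum_distrib_left mult_ac)
  have add: "(\<Sum>r\<in>UNIV. \<Sum>s\<in>UNIV. l r * l s * (\<Sum>k\<in>T. \<Sum>k'\<in>T. F r s k k')) + (\<Sum>r\<in>UNIV. \<Sum>s\<in>UNIV. l r * l s * (\<Sum>k\<in>T. \<Sum>k'\<in>T. G r s k k'))
    = (\<Sum>r\<in>UNIV. \<Sum>s\<in>UNIV. l r * l s * (\<Sum>k\<in>T. \<Sum>k'\<in>T. F r s k k' + G r s k k'))"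
    for F G :: "'n \<Rightarrow> 'n \<Rightarrow> int \<Rightarrow> int \<Rightarrow> real"
    by (simp add: sum.distrib distrib_left)
  have D: "(\<Sum>i\<in>V. \<Sum>j\<in>V. A i j * A i j + A i j * A j i) = (\<Sum>i\<in>V. \<Sum>j\<in>V. A i j * A i j) + (\<Sum>i\<in>V. \<Sum>j\<in>V. A i j * A j i)"
    by (simp add: sum.distrib)
  show ?thesis
    unfolding QF_square(2)[OF V] A_def[symmetric] D S1 S2 S3 unfolding add lin H_def ..
qed

lemma double_sum_difference:
  fixes h :: "int \<Rightarrow> real"
  shows "(\<Sum>k\<in>{0..<int p}. \<Sum>l\<in>{0..<int p}. h (k - l)) = (\<Sum>j\<in>{- int p..int p}. real (card {k\<in>{0..<int p}. k - j \<in> {0..<int p}}) * h j)"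
proof -
  define K where "K = {0..<int p}"
  have "(\<Sum>k\<in>K. \<Sum>l\<in>K. h (k - l)) = (\<Sum>k\<in>K. \<Sum>j\<in>{- int p..int p}. if k - j \<in> K then h j else 0)"
  proof (rule sum.cong[OF refl])
    fix k assume k: "k \<in> K"
    have "(\<Sum>l\<in>K. h (k - l)) = (\<Sum>j\<in>{j\<in>{- int p..int p}. k - j \<in> K}. h j)"
      by (rule sum.reindex_bij_witness[of _ "\<lambda>j. k - j" "\<lambda>l. k - l"]) (use k in \<open>auto simp: K_def\<close>)
    also have "\<dots> = (\<Sum>j\<in>{- int p..int p}. if k - j \<in> K then h j else 0)"
      by (rule sum.inter_filter) simp
    finally show "(\<Sum>l\<in>K. h (k - l)) = \<dots>" .
  qed
  also have "\<dots> = (\<Sum>j\<in>{- int p..int p}. \<Sum>k\<in>K. if k - j \<in> K then h j else 0)" by (rule sum.swap)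
  also have "\<dots> = (\<Sum>j\<in>{- int p..int p}. real (card {k\<in>K. k - j \<in> K}) * h j)"
  proof (intro sum.cong refl)
    fix j
    have "(\<Sum>k\<in>K. if k - j \<in> K then h j else 0) = (\<Sum>k\<in>{k\<in>K. k - j \<in> K}. h j)"
      by (rule sum.inter_filter[symmetric]) (simp add: K_def)
    then show "(\<Sum>k\<in>K. if k - j \<in> K then h j else 0) = real (card {k\<in>K. k - j \<in> K}) * h j" by simp
  qed
  finally show ?thesis unfolding K_def .
qed

text \<open>Divided by p, the number of pairs with difference j is the Fejer weight of j. It tends
  to 1 for fixed j, and finitely many j matter.\<close>

lemma cesaro_difference:
  fixes h :: "int \<Rightarrow> real"
  assumes h: "\<And>d. int D < \<bar>d\<bar> \<Longrightarrow> h d = 0"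
  shows "(\<lambda>p. (\<Sum>k\<in>{0..<int p}. \<Sum>l\<in>{0..<int p}. h (k - l)) / real p) \<longlonglongrightarrow> SZ h"
proof -
  define B where "B = {- int D..int D}"
  have SB: "SZ h = sum h B" by (rule SZ_eq) (use h in \<open>auto simp: B_def\<close>)
  have w: "(\<lambda>p. fejer_weight p j) \<longlonglongrightarrow> 1" for j
  proof (rule LIM_zero_cancel, rule Lim_null_comparison)
    show "eventually (\<lambda>p. norm (fejer_weight p j - 1) \<le> real_of_int \<bar>j\<bar> * (1 / real p)) sequentially"
    proof (rule eventually_sequentiallyI[of 1])
      fix p :: nat assume "1 \<le> p"
      then have "p > 0" by simp
      then show "norm (fejer_weight p j - 1) \<le> real_of_int \<bar>j\<bar> * (1 / real p)"
        using fejer_weight_bounds[of p j] by simp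
    qed
    have "(\<lambda>p. real_of_int \<bar>j\<bar> * (1 / real p)) \<longlonglongrightarrow> real_of_int \<bar>j\<bar> * 0" by (intro tendsto_intros lim_1_over_n)
    then show "(\<lambda>p. real_of_int \<bar>j\<bar> * (1 / real p)) \<longlonglongrightarrow> 0" by simp
  qed
  have "(\<lambda>p. \<Sum>j\<in>B. fejer_weight p j * h j) \<longlonglongrightarrow> (\<Sum>j\<in>B. 1 * h j)" by (intro tendsto_intros w)
  moreover have "eventually (\<lambda>p. (\<Sum>j\<in>B. fejer_weight p j * h j) = (\<Sum>k\<in>{0..<int p}. \<Sum>l\<in>{0..<int p}. h (k - l)) / real p) sequentially"
  proof (rule eventually_sequentiallyI[of D])
    fix p :: nat assume p: "D \<le> p"
    have "(\<Sum>k\<in>{0..<int p}. \<Sum>l\<in>{0..<int p}. h (k - l)) / real p = (\<Sum>j\<in>{- int p..int p}. fejer_weight p j * h j)"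
      unfolding double_sum_difference sum_divide_distrib fejer_weight_def by simp
    also have "\<dots> = (\<Sum>j\<in>B. fejer_weight p j * h j)"
      using p h by (intro sum.mono_neutral_right) (auto simp: B_def)
    finally show "(\<Sum>j\<in>B. fejer_weight p j * h j) = (\<Sum>k\<in>{0..<int p}. \<Sum>l\<in>{0..<int p}. h (k - l)) / real p" ..
  qed
  ultimately show ?thesis unfolding SB by (auto intro: Lim_transform_eventually)
qed

text \<open>The variance of a block of p times is a double sum of a function of the difference of
  two times, so per unit of time it converges to the sum of the covariances over all distances. The
  index set reaches from -M to p + m + M so as to contain all noise variables involved.\<close>

lemma variance_limit:
  fixes \<iota> :: "'n::finite \<Rightarrow> nat"
  assumes N: "noise \<mu> K v" and v: "v > 0" and m: "\<And>r. \<iota> r \<le> m"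
  shows "(\<lambda>p. (\<integral>x. (QF v {- int M..int p + int m + int M} (Kmat l \<iota> c {0..<int p}) x)\<^sup>2 \<partial>PiM {- int M..int p + int m + int M} (\<lambda>_. \<mu>)) / real p)
    \<longlonglongrightarrow> (\<Sum>r\<in>UNIV. \<Sum>s\<in>UNIV. l r * l s * Re (Sigma2 (\<lambda>u. v * (cmod (P u))\<^sup>2) ((noise.m4 \<mu> - 3 * v\<^sup>2) / v\<^sup>2) (\<iota> r) (\<iota> s)))"
proof -
  have eq: "(\<integral>x. (QF v {- int M..int p + int m + int M} (Kmat l \<iota> c {0..<int p}) x)\<^sup>2 \<partial>PiM {- int M..int p + int m + int M} (\<lambda>_. \<mu>)) / real p
    = (\<Sum>r\<in>UNIV. \<Sum>s\<in>UNIV. l r * l s * ((\<Sum>k\<in>{0..<int p}. \<Sum>k'\<in>{0..<int p}. H v (noise.m4 \<mu> - 3 * v\<^sup>2) (int (\<iota> r)) (int (\<iota> s)) (k - k')) / real p))" for p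
    by (subst QF_Kmat_variance[OF N, where m = m]) (use m in \<open>auto simp: sum_divide_distrib[where A = "UNIV :: 'n set"]\<close>)
  show ?thesis
    unfolding eq Sigma2_P[OF v] Re_complex_of_real
  proof (intro tendsto_sum tendsto_mult tendsto_const)
    fix r s
    show "(\<lambda>p. (\<Sum>k\<in>{0..<int p}. \<Sum>k'\<in>{0..<int p}. H v (noise.m4 \<mu> - 3 * v\<^sup>2) (int (\<iota> r)) (int (\<iota> s)) (k - k')) / real p)
      \<longlonglongrightarrow> SZ (H v (noise.m4 \<mu> - 3 * v\<^sup>2) (int (\<iota> r)) (int (\<iota> s)))"
      by (rule cesaro_difference[of "2 * M + \<iota> r"]) (rule H_zero, simp)
  qed
qed

end

section \<open>Exponential moments of block sums\<close>

lemma exp_cubic_bound: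
  fixes z :: real
  shows "\<bar>exp z - 1 - z - z\<^sup>2 / 2\<bar> \<le> \<bar>z\<bar> ^ 3 * exp \<bar>z\<bar>"
proof -
  obtain t where t: "\<bar>t\<bar> \<le> \<bar>z\<bar>" "exp z = (\<Sum>m<3. z ^ m / fact m) + exp t / fact 3 * z ^ 3"
    using Maclaurin_exp_le[of z 3] by auto
  have "exp z - 1 - z - z\<^sup>2 / 2 = exp t / 6 * z ^ 3"
    using t(2) by (simp add: numeral_3_eq_3 numeral_2_eq_2 fact_numeral)
  then have "\<bar>exp z - 1 - z - z\<^sup>2 / 2\<bar> = exp t / 6 * \<bar>z\<bar> ^ 3" by (simp only:) (simp add: abs_mult power_abs)
  also have "\<dots> \<le> exp \<bar>z\<bar> * \<bar>z\<bar> ^ 3"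
  proof (intro mult_right_mono)
    have "exp t \<le> exp \<bar>z\<bar>" using t(1) by simp
    then show "exp t / 6 \<le> exp \<bar>z\<bar>" using exp_gt_zero[of t] by linarith
  qed auto
  finally show ?thesis by (simp add: mult.commute)
qed

text \<open>A second-order expansion of the moment generating function at 0, where the linear term
  vanishes with the mean. Dominated convergence gives R(t)/t^2, and R/(1 + R) \<le> ln(1 + R) \<le>
  R passes from R to the logarithm.\<close>

lemma (in prob_space) cgf_at_zero:
  fixes U :: "'a \<Rightarrow> real"
  assumes [measurable]: "U \<in> borel_measurable M" and a: "a > 0"
    and ip: "integrable M (\<lambda>x. exp (a * U x))" and im: "integrable M (\<lambda>x. exp (- a * U x))"
    and iU: "integrable M U" and EU: "expectation U = 0"
    and iU2: "integrable M (\<lambda>x. (U x)\<^sup>2)"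
  shows "((\<lambda>t. ln (expectation (\<lambda>x. exp (t * U x))) / t\<^sup>2) \<longlongrightarrow> expectation (\<lambda>x. (U x)\<^sup>2) / 2) (at 0)"
proof -
  define R where "R t = expectation (\<lambda>x. exp (t * U x)) - 1" for t
  define s where "s = expectation (\<lambda>x. (U x)\<^sup>2) / 2"
  \<comment> \<open>Of the available exponent a, one half absorbs the factor u^2 and the other half
    exp |t u|, so that \<open>w\<close> dominates for |t| \<le> b.\<close>
  define b where "b = a / 2"
  have b: "b > 0" using a by (simp add: b_def)
  have iexp: "integrable M (\<lambda>x. exp (t * U x))" if "\<bar>t\<bar> \<le> a" for t
  proof (rule Bochner_Integration.integrable_bound)
    show "integrable M (\<lambda>x. exp (a * U x) + exp (- a * U x))" using ip im by auto
    have "exp (t * u) \<le> exp (a * u) + exp (- a * u)" for u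
    proof (cases "u \<ge> 0")
      case True
      then have "t * u \<le> a * u" using that by (intro mult_right_mono) auto
      then show ?thesis by (simp add: add_increasing2)
    next
      case False
      then have "t * u \<le> - a * u" using that by (intro mult_right_mono_neg) auto
      then show ?thesis by (simp add: add_increasing)
    qed
    then show "AE x in M. norm (exp (t * U x)) \<le> norm (exp (a * U x) + exp (- a * U x))"
      by (intro AE_I2) (auto intro: order_trans[OF _ abs_ge_self])
  qed measurable
  define w where "w u = 2 / b\<^sup>2 * (exp (a * u) + exp (- a * u))" for u :: real
  have iw: "integrable M (\<lambda>x. w (U x))" unfolding w_def using ip im by auto
  have wb: "\<bar>(exp (t * u) - 1 - t * u) / t\<^sup>2\<bar> \<le> w u" if t: "\<bar>t\<bar> \<le> b" "t \<noteq> 0" for t u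
  proof -
    have "0 \<le> exp (t * u) - 1 - t * u" using exp_ge_add_one_self[of "t * u"] by linarith
    moreover have "exp (t * u) - 1 - t * u \<le> (t * u)\<^sup>2 * exp \<bar>t * u\<bar>" using exp_le_quadratic[of "t * u"] by linarith
    ultimately have "\<bar>(exp (t * u) - 1 - t * u) / t\<^sup>2\<bar> \<le> u\<^sup>2 * exp \<bar>t * u\<bar>"
      using t by (simp add: power_mult_distrib field_simps)
    also have "\<dots> \<le> (2 / b\<^sup>2 * exp (b * \<bar>u\<bar>)) * exp (b * \<bar>u\<bar>)"
    proof (intro mult_mono)
      have "(b * \<bar>u\<bar>)\<^sup>2 / 2 \<le> exp (b * \<bar>u\<bar>)"
      proof -
        have "0 \<le> b * \<bar>u\<bar>" using b by simp
        then show ?thesis using exp_lower_Taylor_quadratic[of "b * \<bar>u\<bar>"] by linarith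
      qed
      then show "u\<^sup>2 \<le> 2 / b\<^sup>2 * exp (b * \<bar>u\<bar>)" using b by (simp add: power_mult_distrib field_simps)
      show "exp \<bar>t * u\<bar> \<le> exp (b * \<bar>u\<bar>)" using t by (simp add: abs_mult mult_right_mono)
    qed auto
    also have "\<dots> = 2 / b\<^sup>2 * exp (a * \<bar>u\<bar>)" by (simp add: mult_exp_exp b_def)
    also have "\<dots> \<le> w u" unfolding w_def
      by (intro mult_left_mono) (cases "u \<ge> 0", auto)
    finally show ?thesis .
  qed
  have lim2: "((\<lambda>t. R t / t\<^sup>2) \<longlongrightarrow> s) (at 0)"
    unfolding tendsto_at_iff_sequentially
  proof (intro allI impI)
    fix X :: "nat \<Rightarrow> real" assume X: "\<forall>i. X i \<in> UNIV - {0}" "X \<longlonglongrightarrow> 0"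
    have ne: "X i \<noteq> 0" for i using X by auto
    have ev: "eventually (\<lambda>i. \<bar>X i\<bar> \<le> b) sequentially"
      using order_tendstoD(2)[OF tendsto_rabs_zero[OF X(2)] b] by (rule eventually_mono) simp
    then obtain N where N: "\<And>i. i \<ge> N \<Longrightarrow> \<bar>X i\<bar> \<le> b" by (auto simp: eventually_sequentially)
    \<comment> \<open>The domination has to hold at every index, so the initial segment with |X i| >
      b is cut off.\<close>
    define Y where "Y i = X (i + N)" for i
    have Y: "Y \<longlonglongrightarrow> 0" "\<And>i. Y i \<noteq> 0" "\<And>i. \<bar>Y i\<bar> \<le> b"
      unfolding Y_def[abs_def] using LIMSEQ_ignore_initial_segment[OF X(2), of N] ne N by auto
    have "(\<lambda>i. expectation (\<lambda>x. (exp (Y i * U x) - 1 - Y i * U x) / (Y i)\<^sup>2)) \<longlonglongrightarrow> expectation (\<lambda>x. (U x)\<^sup>2 / 2)"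
    proof (rule integral_dominated_convergence[where w = "\<lambda>x. w (U x)"])
      show "AE x in M. norm ((exp (Y i * U x) - 1 - Y i * U x) / (Y i)\<^sup>2) \<le> w (U x)" for i
        using wb[OF Y(3,2)] by (intro AE_I2) simp
      show "AE x in M. (\<lambda>i. (exp (Y i * U x) - 1 - Y i * U x) / (Y i)\<^sup>2) \<longlonglongrightarrow> (U x)\<^sup>2 / 2"
      proof (intro AE_I2)
        fix x
        define u where "u = U x"
        have "(\<lambda>i. (exp (Y i * u) - 1 - Y i * u) / (Y i)\<^sup>2 - u\<^sup>2 / 2) \<longlonglongrightarrow> 0"
        proof (rule Lim_null_comparison)
          show "eventually (\<lambda>i. norm ((exp (Y i * u) - 1 - Y i * u) / (Y i)\<^sup>2 - u\<^sup>2 / 2) \<le> \<bar>Y i\<bar> * (\<bar>u\<bar> ^ 3 * exp \<bar>Y i * u\<bar>)) sequentially"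
          proof (intro always_eventually allI)
            fix i
            have "(exp (Y i * u) - 1 - Y i * u) / (Y i)\<^sup>2 - u\<^sup>2 / 2 = (exp (Y i * u) - 1 - Y i * u - (Y i * u)\<^sup>2 / 2) / (Y i)\<^sup>2"
              using Y(2)[of i] by (simp add: diff_divide_distrib power_mult_distrib)
            also have "\<bar>\<dots>\<bar> \<le> \<bar>Y i * u\<bar> ^ 3 * exp \<bar>Y i * u\<bar> / (Y i)\<^sup>2"
              unfolding abs_divide using exp_cubic_bound[of "Y i * u"] by (simp add: divide_right_mono)
            also have "\<dots> = \<bar>Y i\<bar> * (\<bar>u\<bar> ^ 3 * exp \<bar>Y i * u\<bar>)"
            proof -
              have "\<bar>Y i\<bar> ^ 3 = \<bar>Y i\<bar> * (Y i)\<^sup>2" by (simp add: power3_eq_cube power2_eq_square)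
              then show ?thesis using Y(2)[of i] by (simp add: abs_mult power_mult_distrib)
            qed
            finally show "norm ((exp (Y i * u) - 1 - Y i * u) / (Y i)\<^sup>2 - u\<^sup>2 / 2) \<le> \<bar>Y i\<bar> * (\<bar>u\<bar> ^ 3 * exp \<bar>Y i * u\<bar>)" by simp
          qed
          have "(\<lambda>i. \<bar>Y i\<bar> * (\<bar>u\<bar> ^ 3 * exp \<bar>Y i * u\<bar>)) \<longlonglongrightarrow> \<bar>0\<bar> * (\<bar>u\<bar> ^ 3 * exp \<bar>0 * u\<bar>)" by (intro tendsto_intros Y)
          then show "(\<lambda>i. \<bar>Y i\<bar> * (\<bar>u\<bar> ^ 3 * exp \<bar>Y i * u\<bar>)) \<longlonglongrightarrow> 0" by simp
        qed
        then show "(\<lambda>i. (exp (Y i * U x) - 1 - Y i * U x) / (Y i)\<^sup>2) \<longlonglongrightarrow> (U x)\<^sup>2 / 2"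
          unfolding u_def by (rule LIM_zero_cancel)
      qed
    qed (use iw in measurable)
    moreover have "expectation (\<lambda>x. (exp (Y i * U x) - 1 - Y i * U x) / (Y i)\<^sup>2) = R (Y i) / (Y i)\<^sup>2" for i
    proof -
      have "\<bar>Y i\<bar> \<le> a" using Y(3)[of i] a by (simp add: b_def)
      from iexp[OF this] show ?thesis using iU EU by (simp add: R_def prob_space)
    qed
    ultimately have "(\<lambda>i. R (Y i) / (Y i)\<^sup>2) \<longlonglongrightarrow> expectation (\<lambda>x. (U x)\<^sup>2 / 2)" by (simp only:)
    then have "(\<lambda>i. R (Y i) / (Y i)\<^sup>2) \<longlonglongrightarrow> s" by (simp add: s_def)
    then have "(\<lambda>i. ((\<lambda>t. R t / t\<^sup>2) \<circ> X) (i + N)) \<longlonglongrightarrow> s" by (simp add: Y_def o_def)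
    then show "((\<lambda>t. R t / t\<^sup>2) \<circ> X) \<longlonglongrightarrow> s" by (rule LIMSEQ_offset)
  qed
  have limR: "(R \<longlongrightarrow> 0) (at 0)"
  proof -
    have "((\<lambda>t. t\<^sup>2 * (R t / t\<^sup>2)) \<longlongrightarrow> 0\<^sup>2 * s) (at 0)" by (intro tendsto_intros lim2)
    moreover have "eventually (\<lambda>t. t\<^sup>2 * (R t / t\<^sup>2) = R t) (at 0)"
      unfolding eventually_at_filter by (intro always_eventually) auto
    ultimately show ?thesis by (simp add: tendsto_cong)
  qed
  have ev: "eventually (\<lambda>t. R t > -1) (at 0)" using order_tendstoD(1)[OF limR, of "-1"] by simp
  have lo: "((\<lambda>t. R t / t\<^sup>2 / (1 + R t)) \<longlongrightarrow> s / (1 + 0)) (at 0)" by (intro tendsto_intros lim2 limR) simp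
  have "((\<lambda>t. ln (1 + R t) / t\<^sup>2) \<longlongrightarrow> s) (at 0)"
  proof (rule tendsto_sandwich[OF _ _ _ lim2])
    show "((\<lambda>t. R t / t\<^sup>2 / (1 + R t)) \<longlongrightarrow> s) (at 0)" using lo by simp
    show "eventually (\<lambda>t. ln (1 + R t) / t\<^sup>2 \<le> R t / t\<^sup>2) (at 0)"
      using ev by eventually_elim (intro divide_right_mono ln_add_one_self_le_self2, auto)
    show "eventually (\<lambda>t. R t / t\<^sup>2 / (1 + R t) \<le> ln (1 + R t) / t\<^sup>2) (at 0)"
      using ev
    proof eventually_elim
      case (elim t)
      then have p: "1 + R t > 0" by linarith
      have "ln (1 / (1 + R t)) \<le> 1 / (1 + R t) - 1" using p by (intro ln_le_minus_one) auto
      moreover have "ln (1 / (1 + R t)) = - ln (1 + R t)" using p by (simp add: ln_div)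
      moreover have "1 / (1 + R t) - 1 = - (R t / (1 + R t))" using p by (simp add: field_simps)
      ultimately have "R t / (1 + R t) \<le> ln (1 + R t)" by linarith
      then have "R t / (1 + R t) / t\<^sup>2 \<le> ln (1 + R t) / t\<^sup>2" by (intro divide_right_mono) auto
      then show ?case by (simp add: mult.commute)
    qed
  qed
  then show ?thesis by (simp add: R_def s_def)
qed

text \<open>Hoelder's inequality from the convexity of exp: once a and b are subtracted from the two
  exponents, both integrals are at most 1 and the weights 1/p and 1/q add up to 1.\<close>

lemma (in prob_space) exp_holder:
  fixes A B :: "'a \<Rightarrow> real"
  assumes [measurable]: "A \<in> borel_measurable M" "B \<in> borel_measurable M"
    and p: "p > 0" "q > 0" "1 / p + 1 / q = 1"
    and a: "(\<integral>\<^sup>+x. ennreal (exp (p * A x)) \<partial>M) \<le> ennreal (exp a)"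
    and b: "(\<integral>\<^sup>+x. ennreal (exp (q * B x)) \<partial>M) \<le> ennreal (exp b)"
  shows "(\<integral>\<^sup>+x. ennreal (exp (A x + B x)) \<partial>M) \<le> ennreal (exp (a / p + b / q))"
proof -
  define c where "c = exp (a / p + b / q)"
  have pt: "exp (x + y) \<le> c * (1 / p * exp (- a)) * exp (p * x) + c * (1 / q * exp (- b)) * exp (q * y)" for x y
  proof -
    have "exp ((1 / p) *\<^sub>R (p * x - a) + (1 / q) *\<^sub>R (q * y - b)) \<le> (1 / p) * exp (p * x - a) + (1 / q) * exp (q * y - b)"
    proof -
      have e: "1 - 1 / q = 1 / p" using p by simp
      have "0 < 1 / p" using p by simp
      then have "1 / q \<le> 1" using p(3) by linarith
      then show ?thesis
        using convex_onD[OF exp_convex, of "1 / q" "p * x - a" "q * y - b"] p unfolding e by simp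
    qed
    moreover have "(1 / p) *\<^sub>R (p * x - a) + (1 / q) *\<^sub>R (q * y - b) = x + y - (a / p + b / q)"
      using p by (simp add: right_diff_distrib)
    ultimately have "exp (x + y - (a / p + b / q)) \<le> (1 / p) * exp (p * x - a) + (1 / q) * exp (q * y - b)" by simp
    then have "c * exp (x + y - (a / p + b / q)) \<le> c * ((1 / p) * exp (p * x - a) + (1 / q) * exp (q * y - b))"
      unfolding c_def by (intro mult_left_mono) auto
    moreover have "c * exp (x + y - (a / p + b / q)) = exp (x + y)" unfolding c_def mult_exp_exp by simp
    moreover have "exp (p * x - a) = exp (- a) * exp (p * x)" "exp (q * y - b) = exp (- b) * exp (q * y)"
      by (simp_all add: mult_exp_exp)
    ultimately show ?thesis by (simp add: distrib_left mult.assoc)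
  qed
  define ca where "ca = c * (1 / p * exp (- a))"
  define cb where "cb = c * (1 / q * exp (- b))"
  have c0: "ca \<ge> 0" "cb \<ge> 0" using p by (auto simp: ca_def cb_def c_def)
  have en: "ennreal (x * z + y * w) = ennreal x * ennreal z + ennreal y * ennreal w" if "0 \<le> x" "0 \<le> y" "0 \<le> z" "0 \<le> w" for x y z w
    using that by (simp add: ennreal_plus ennreal_mult)
  have "(\<integral>\<^sup>+x. ennreal (exp (A x + B x)) \<partial>M) \<le> (\<integral>\<^sup>+x. ennreal ca * ennreal (exp (p * A x)) + ennreal cb * ennreal (exp (q * B x)) \<partial>M)"
  proof (intro nn_integral_mono)
    fix x
    have "ennreal (exp (A x + B x)) \<le> ennreal (ca * exp (p * A x) + cb * exp (q * B x))"
      using pt[of "A x" "B x"] unfolding ca_def cb_def by (rule ennreal_leI)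
    then show "ennreal (exp (A x + B x)) \<le> ennreal ca * ennreal (exp (p * A x)) + ennreal cb * ennreal (exp (q * B x))"
      by (simp only: en[OF c0 exp_ge_zero exp_ge_zero])
  qed
  also have "\<dots> = ennreal ca * (\<integral>\<^sup>+x. ennreal (exp (p * A x)) \<partial>M) + ennreal cb * (\<integral>\<^sup>+x. ennreal (exp (q * B x)) \<partial>M)"
    by (simp add: nn_integral_add nn_integral_cmult)
  also have "\<dots> \<le> ennreal ca * ennreal (exp a) + ennreal cb * ennreal (exp b)"
    by (intro add_mono mult_left_mono a b) auto
  also have "\<dots> = ennreal (ca * exp a + cb * exp b)" by (simp only: en[OF c0 exp_ge_zero exp_ge_zero])
  also have "ca * exp a + cb * exp b = c * (1 / p + 1 / q)"
    unfolding ca_def cb_def by (simp add: mult_exp_exp distrib_left mult.assoc)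
  finally show ?thesis using p by (simp add: c_def)
qed

section \<open>Shifted and independent blocks of noise\<close>

lemma QF_cong:
  "(\<And>i. i \<in> V \<Longrightarrow> x i = y i) \<Longrightarrow> QF v V A x = QF v V A y"
  unfolding QF_def by (intro sum.cong refl) auto

lemma Kmat_shift: "Kmat l \<iota> c T (i - s) (j - s) = Kmat l \<iota> c ((\<lambda>k. k + s) ` T) i j"
proof -
  have "(\<Sum>k\<in>T. c (i - s - k) * c (j - s - k - int (\<iota> r))) = (\<Sum>k\<in>(\<lambda>k. k + s) ` T. c (i - k) * c (j - k - int (\<iota> r)))" for r
    by (subst sum.reindex) (auto simp: inj_on_def algebra_simps)
  then show ?thesis unfolding Kmat_def by simp
qed

lemma QF_shift:
  "QF v V A (\<lambda>i. x (i + s)) = QF v ((\<lambda>i. i + s) ` V) (\<lambda>i j. A (i - s) (j - s)) x" for V :: "int set"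
proof -
  have inj: "inj_on (\<lambda>i. i + s) V" by (simp add: inj_on_def)
  show ?thesis unfolding QF_def sum.reindex[OF inj] by simp
qed

definition op_le :: "int set \<Rightarrow> (int \<Rightarrow> int \<Rightarrow> real) \<Rightarrow> real \<Rightarrow> bool" where
  "op_le V A \<rho> \<longleftrightarrow> 0 \<le> \<rho> \<and> (\<forall>x. (\<Sum>i\<in>V. (\<Sum>j\<in>V. A i j * x j)\<^sup>2) \<le> \<rho>\<^sup>2 * (\<Sum>j\<in>V. (x j)\<^sup>2))"

context noise
begin

lemma QF_measurable: "V \<subseteq> W \<Longrightarrow> QF v V A \<in> borel_measurable (PiM W (\<lambda>_. \<mu>))"
proof -
  assume VW: "V \<subseteq> W"
  have m: "(\<lambda>x. x i) \<in> borel_measurable (PiM W (\<lambda>_. \<mu>))" if "i \<in> V" for i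
  proof -
    have [measurable]: "i \<in> W" using that VW by auto
    show ?thesis by measurable
  qed
  show ?thesis unfolding QF_def[abs_def]
    by (intro borel_measurable_sum borel_measurable_times borel_measurable_diff borel_measurable_const m)
qed

text \<open>Stationarity: the coordinates are identically distributed, so reindexing by a shift
  carries one product measure into the other, and the kernel matrix follows the shift of the
  times.\<close>

lemma nn_integral_QF_shift:
  fixes V :: "int set"
  shows "(\<integral>\<^sup>+x. ennreal (exp (t * QF v ((\<lambda>i. i + s) ` V) (Kmat l \<iota> c ((\<lambda>k. k + s) ` T)) x)) \<partial>PiM ((\<lambda>i. i + s) ` V) (\<lambda>_. \<mu>))
    = (\<integral>\<^sup>+x. ennreal (exp (t * QF v V (Kmat l \<iota> c T) x)) \<partial>PiM V (\<lambda>_. \<mu>))"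
proof -
  define W where "W = (\<lambda>i. i + s) ` V"
  have d: "distr (PiM W (\<lambda>_. \<mu>)) (PiM V (\<lambda>_. \<mu>)) (\<lambda>\<omega>. \<lambda>n\<in>V. \<omega> (n + s)) = PiM V (\<lambda>_. \<mu>)"
    by (rule distr_PiM_reindex[of W "\<lambda>_. \<mu>" "\<lambda>i. i + s" V, OF prob]) (auto simp: W_def inj_on_def)
  have m: "(\<lambda>\<omega>. \<lambda>n\<in>V. \<omega> (n + s)) \<in> measurable (PiM W (\<lambda>_. \<mu>)) (PiM V (\<lambda>_. \<mu>))"
    by (rule measurable_restrict) (rule measurable_component_singleton, simp add: W_def)
  have mQ: "(\<lambda>x. ennreal (exp (t * QF v V (Kmat l \<iota> c T) x))) \<in> borel_measurable (PiM V (\<lambda>_. \<mu>))"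
    using QF_measurable[of V V] by measurable
  have "(\<integral>\<^sup>+x. ennreal (exp (t * QF v V (Kmat l \<iota> c T) x)) \<partial>PiM V (\<lambda>_. \<mu>))
    = (\<integral>\<^sup>+x. ennreal (exp (t * QF v V (Kmat l \<iota> c T) x)) \<partial>distr (PiM W (\<lambda>_. \<mu>)) (PiM V (\<lambda>_. \<mu>)) (\<lambda>\<omega>. \<lambda>n\<in>V. \<omega> (n + s)))"
    by (simp only: d)
  also have "\<dots> = (\<integral>\<^sup>+\<omega>. ennreal (exp (t * QF v V (Kmat l \<iota> c T) (\<lambda>n\<in>V. \<omega> (n + s)))) \<partial>PiM W (\<lambda>_. \<mu>))"
    by (rule nn_integral_distr[OF m]) (simp add: mQ)
  also have "\<dots> = (\<integral>\<^sup>+\<omega>. ennreal (exp (t * QF v W (Kmat l \<iota> c ((\<lambda>k. k + s) ` T)) \<omega>)) \<partial>PiM W (\<lambda>_. \<mu>))"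
  proof (intro nn_integral_cong)
    fix \<omega>
    have "QF v V (Kmat l \<iota> c T) (\<lambda>n\<in>V. \<omega> (n + s)) = QF v V (Kmat l \<iota> c T) (\<lambda>n. \<omega> (n + s))"
      by (rule QF_cong) simp
    also have "\<dots> = QF v W (Kmat l \<iota> c ((\<lambda>k. k + s) ` T)) \<omega>"
      unfolding QF_shift W_def Kmat_shift ..
    finally show "ennreal (exp (t * QF v V (Kmat l \<iota> c T) (\<lambda>n\<in>V. \<omega> (n + s)))) = ennreal (exp (t * QF v W (Kmat l \<iota> c ((\<lambda>k. k + s) ` T)) \<omega>))"
      by simp
  qed
  finally show ?thesis unfolding W_def ..
qed

text \<open>Independence of disjoint blocks, by splitting off the last one: on a merged point the
  earlier forms see only the first group of coordinates and the last form only the second.\<close>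

lemma nn_integral_QF_blocks:
  fixes W :: "nat \<Rightarrow> int set"
  assumes fin: "\<And>b. finite (W b)" and disj: "\<And>b b'. b \<noteq> b' \<Longrightarrow> W b \<inter> W b' = {}"
  shows "(\<integral>\<^sup>+x. ennreal (exp (t * (\<Sum>b<J. QF v (W b) (A b) x))) \<partial>PiM (\<Union>b<J. W b) (\<lambda>_. \<mu>))
    = (\<Prod>b<J. \<integral>\<^sup>+x. ennreal (exp (t * QF v (W b) (A b) x)) \<partial>PiM (W b) (\<lambda>_. \<mu>))"
proof (induction J)
  case 0
  show ?case using prob_space.emeasure_space_1[OF prob_PiM[of "{} :: int set"]] by simp
next
  case (Suc J)
  define Y where "Y = (\<Union>b<J. W b)"
  have "W b \<inter> W J = {}" if "b < J" for b using disj[of b J] that by simp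
  then have Y: "finite Y" "Y \<inter> W J = {}" unfolding Y_def using fin by (auto simp: disjoint_iff)
  have U: "(\<Union>b<Suc J. W b) = Y \<union> W J" unfolding Y_def by (auto simp: less_Suc_eq)
  have sub: "W b \<subseteq> Y" if "b < J" for b using that by (auto simp: Y_def)
  have m1: "(\<lambda>x. \<Sum>b<J. QF v (W b) (A b) x) \<in> borel_measurable (PiM Y (\<lambda>_. \<mu>))"
    by (intro borel_measurable_sum QF_measurable sub) auto
  have m: "(\<lambda>x. \<Sum>b<Suc J. QF v (W b) (A b) x) \<in> borel_measurable (PiM (Y \<union> W J) (\<lambda>_. \<mu>))"
    using sub by (intro borel_measurable_sum QF_measurable) (auto simp: less_Suc_eq)
  have mJ: "QF v (W J) (A J) \<in> borel_measurable (PiM (W J) (\<lambda>_. \<mu>))" by (rule QF_measurable) simp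
  note [measurable] = m m1 mJ
  have "(\<integral>\<^sup>+x. ennreal (exp (t * (\<Sum>b<Suc J. QF v (W b) (A b) x))) \<partial>PiM (\<Union>b<Suc J. W b) (\<lambda>_. \<mu>))
    = (\<integral>\<^sup>+x. \<integral>\<^sup>+y. ennreal (exp (t * (\<Sum>b<Suc J. QF v (W b) (A b) (merge Y (W J) (x, y))))) \<partial>PiM (W J) (\<lambda>_. \<mu>) \<partial>PiM Y (\<lambda>_. \<mu>))"
    unfolding U by (rule P.product_nn_integral_fold[OF Y(2,1) fin]) measurable
  also have "\<dots> = (\<integral>\<^sup>+x. \<integral>\<^sup>+y. ennreal (exp (t * (\<Sum>b<J. QF v (W b) (A b) x))) * ennreal (exp (t * QF v (W J) (A J) y)) \<partial>PiM (W J) (\<lambda>_. \<mu>) \<partial>PiM Y (\<lambda>_. \<mu>))"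
  proof (intro nn_integral_cong)
    fix x y
    have 1: "QF v (W b) (A b) (merge Y (W J) (x, y)) = QF v (W b) (A b) x" if "b < J" for b
      using sub[OF that] by (intro QF_cong) (auto simp: merge_def)
    have 2: "QF v (W J) (A J) (merge Y (W J) (x, y)) = QF v (W J) (A J) y"
      using Y by (intro QF_cong) (auto simp: merge_def)
    show "ennreal (exp (t * (\<Sum>b<Suc J. QF v (W b) (A b) (merge Y (W J) (x, y)))))
      = ennreal (exp (t * (\<Sum>b<J. QF v (W b) (A b) x))) * ennreal (exp (t * QF v (W J) (A J) y))"
      by (simp add: 1 2 distrib_left exp_add ennreal_mult')
  qed
  also have "\<dots> = (\<integral>\<^sup>+x. ennreal (exp (t * (\<Sum>b<J. QF v (W b) (A b) x))) \<partial>PiM Y (\<lambda>_. \<mu>)) * (\<integral>\<^sup>+y. ennreal (exp (t * QF v (W J) (A J) y)) \<partial>PiM (W J) (\<lambda>_. \<mu>))"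
    by (simp add: nn_integral_cmult nn_integral_multc)
  finally show ?case using Suc.IH by (simp add: Y_def)
qed

text \<open>Brought into a form in which c0 and C can be fixed before the index set, the matrix and
  t; they depend on the law of the noise alone.\<close>

lemma noise_hanson_wright: "\<exists>c0 C. c0 > 0 \<and> C > 0 \<and> (\<forall>V A \<rho> t. finite V \<longrightarrow> op_le V A \<rho> \<longrightarrow> \<bar>t\<bar> * \<rho> \<le> c0 \<longrightarrow>
      (\<integral>\<^sup>+x. ennreal (exp (t * QF v V A x)) \<partial>PiM V (\<lambda>_. \<mu>)) \<le> ennreal (exp (C * t\<^sup>2 * (\<Sum>i\<in>V. \<Sum>j\<in>V. (A i j)\<^sup>2))))"
proof (rule hanson_wright[where ?'i = int, OF sg second integrable_power])
  fix c C :: real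
  assume c: "c > 0" "C > 0" and *: "\<And>(V :: int set) A \<rho> t. \<lbrakk>finite V; \<And>x. (\<Sum>i\<in>V. (\<Sum>j\<in>V. A i j * x j)\<^sup>2) \<le> \<rho>\<^sup>2 * (\<Sum>j\<in>V. (x j)\<^sup>2); 0 \<le> \<rho>; \<bar>t\<bar> * \<rho> \<le> c\<rbrakk> \<Longrightarrow>
      (\<integral>\<^sup>+x. ennreal (exp (t * (\<Sum>i\<in>V. \<Sum>j\<in>V. A i j * (x i * x j - (if i = j then v else 0))))) \<partial>PiM V (\<lambda>_. \<mu>))
       \<le> ennreal (exp (C * t\<^sup>2 * (\<Sum>i\<in>V. \<Sum>j\<in>V. (A i j)\<^sup>2)))"
  show ?thesis
    unfolding QF_def op_le_def by (intro exI[of _ c] exI[of _ C] conjI allI impI c) (rule *; simp)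
qed

lemma frobenius_op:
  fixes V :: "int set"
  shows "(\<Sum>i\<in>V. (\<Sum>j\<in>V. A i j * x j)\<^sup>2) \<le> (sqrt (\<Sum>i\<in>V. \<Sum>j\<in>V. (A i j)\<^sup>2))\<^sup>2 * (\<Sum>j\<in>V. (x j)\<^sup>2)"
proof -
  have "(\<Sum>i\<in>V. (\<Sum>j\<in>V. A i j * x j)\<^sup>2) \<le> (\<Sum>i\<in>V. (\<Sum>j\<in>V. (A i j)\<^sup>2) * (\<Sum>j\<in>V. (x j)\<^sup>2))"
    by (intro sum_mono Cauchy_Schwarz_ineq_sum)
  also have "\<dots> = (\<Sum>i\<in>V. \<Sum>j\<in>V. (A i j)\<^sup>2) * (\<Sum>j\<in>V. (x j)\<^sup>2)" by (simp add: sum_distrib_right)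
  finally show ?thesis by (simp add: sum_nonneg)
qed

text \<open>The Hilbert-Schmidt norm dominates the operator norm, so the Hanson-Wright range
  contains a neighbourhood of 0 for any finite form. Dividing by \<rho> + 1 allows for the zero
  matrix.\<close>

lemma QF_exp_integrable:
  fixes V :: "int set"
  assumes V: "finite V"
  shows "\<exists>a>0. \<forall>t. \<bar>t\<bar> \<le> a \<longrightarrow> integrable (PiM V (\<lambda>_. \<mu>)) (\<lambda>x. exp (t * QF v V A x))"
proof -
  obtain c0 C where c0: "c0 > 0" and hw': "\<forall>V A \<rho> t. finite V \<longrightarrow> op_le V A \<rho> \<longrightarrow> \<bar>t\<bar> * \<rho> \<le> c0 \<longrightarrow>
      (\<integral>\<^sup>+x. ennreal (exp (t * QF v V A x)) \<partial>PiM V (\<lambda>_. \<mu>)) \<le> ennreal (exp (C * t\<^sup>2 * (\<Sum>i\<in>V. \<Sum>j\<in>V. (A i j)\<^sup>2)))"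
    using noise_hanson_wright by blast
  define \<rho> where "\<rho> = sqrt (\<Sum>i\<in>V. \<Sum>j\<in>V. (A i j)\<^sup>2)"
  have \<rho>: "\<rho> \<ge> 0" by (simp add: \<rho>_def sum_nonneg)
  show ?thesis
  proof (intro exI[of _ "c0 / (\<rho> + 1)"] conjI allI impI)
    show "c0 / (\<rho> + 1) > 0" using c0 \<rho> by simp
    fix t assume t: "\<bar>t\<bar> \<le> c0 / (\<rho> + 1)"
    have "\<bar>t\<bar> * (\<rho> + 1) \<le> c0" using t \<rho> by (simp add: pos_le_divide_eq)
    moreover have "\<bar>t\<bar> * \<rho> \<le> \<bar>t\<bar> * (\<rho> + 1)" by (intro mult_left_mono) auto
    ultimately have s: "\<bar>t\<bar> * \<rho> \<le> c0" by linarith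
    show "integrable (PiM V (\<lambda>_. \<mu>)) (\<lambda>x. exp (t * QF v V A x))"
    proof (rule integrableI_nonneg)
      show "(\<lambda>x. exp (t * QF v V A x)) \<in> borel_measurable (PiM V (\<lambda>_. \<mu>))"
        using QF_measurable[of V V] by measurable
      have "(\<integral>\<^sup>+x. ennreal (exp (t * QF v V A x)) \<partial>PiM V (\<lambda>_. \<mu>)) \<le> ennreal (exp (C * t\<^sup>2 * (\<Sum>i\<in>V. \<Sum>j\<in>V. (A i j)\<^sup>2)))"
      proof -
        have "op_le V A \<rho>" unfolding op_le_def using \<rho> frobenius_op[of A _ V] by (simp add: \<rho>_def)
        then show ?thesis using hw' V s by blast
      qed
      then show "(\<integral>\<^sup>+x. ennreal (exp (t * QF v V A x)) \<partial>PiM V (\<lambda>_. \<mu>)) < \<infinity>" by (auto simp: top_unique less_top[symmetric])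
    qed auto
  qed
qed

lemma QF_cgf_at_zero:
  fixes V :: "int set"
  assumes V: "finite V"
  shows "((\<lambda>t. ln (\<integral>x. exp (t * QF v V A x) \<partial>PiM V (\<lambda>_. \<mu>)) / t\<^sup>2) \<longlongrightarrow> (\<integral>x. (QF v V A x)\<^sup>2 \<partial>PiM V (\<lambda>_. \<mu>)) / 2) (at 0)"
proof -
  interpret PP: prob_space "PiM V (\<lambda>_. \<mu>)" by (rule prob_PiM)
  obtain a where a: "a > 0" "\<And>t. \<bar>t\<bar> \<le> a \<Longrightarrow> integrable (PiM V (\<lambda>_. \<mu>)) (\<lambda>x. exp (t * QF v V A x))"
    using QF_exp_integrable[OF V, of A] by blast
  show ?thesis
    by (rule PP.cgf_at_zero[OF QF_measurable[OF order_refl] a(1) a(2) a(2) QF_mean[OF V] QF_square(1)[OF V]]) (use a(1) in auto)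
qed

end

section \<open>Norms of the matrix of the approximation error\<close>

text \<open>\<rho> bounds the square of the operator norm of the convolution with x, restricted to
  inputs on T, uniformly over all finite output windows V.\<close>

definition filter_bound :: "(int \<Rightarrow> real) \<Rightarrow> int set \<Rightarrow> real \<Rightarrow> bool" where
  "filter_bound x T \<rho> \<longleftrightarrow> 0 \<le> \<rho> \<and>
     (\<forall>V w. finite V \<longrightarrow> (\<Sum>i\<in>V. (\<Sum>k\<in>T. x (i - k) * w k)\<^sup>2) \<le> \<rho> * (\<Sum>k\<in>T. (w k)\<^sup>2))"

text \<open>An operator and its transpose have the same norm: with w the transposed image of z,
  |w|^2 is the inner product of z with the filtered w, and Cauchy-Schwarz gives |w|^4 \<le> |z|^2
  \<rho> |w|^2. The shift s only moves the output window.\<close>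

lemma filter_bound_adjoint:
  assumes y: "filter_bound y T \<rho>" and V: "finite V"
  shows "(\<Sum>k\<in>T. (\<Sum>j\<in>V. y (j - k - s) * z j)\<^sup>2) \<le> \<rho> * (\<Sum>j\<in>V. (z j)\<^sup>2)"
proof -
  define w where "w k = (\<Sum>j\<in>V. y (j - k - s) * z j)" for k
  define u where "u j = (\<Sum>k\<in>T. y (j - s - k) * w k)" for j
  define S where "S = (\<Sum>k\<in>T. (w k)\<^sup>2)"
  define Z where "Z = (\<Sum>j\<in>V. (z j)\<^sup>2)"
  have nn: "S \<ge> 0" "Z \<ge> 0" "\<rho> \<ge> 0" using y by (auto simp: S_def Z_def filter_bound_def intro!: sum_nonneg)
  have "S = (\<Sum>k\<in>T. \<Sum>j\<in>V. y (j - k - s) * z j * w k)"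
    unfolding S_def power2_eq_square w_def[of _] by (simp add: sum_distrib_left sum_distrib_right mult_ac)
  also have "\<dots> = (\<Sum>j\<in>V. \<Sum>k\<in>T. y (j - k - s) * z j * w k)" by (rule sum.swap)
  also have "\<dots> = (\<Sum>j\<in>V. z j * u j)"
    unfolding u_def by (simp add: sum_distrib_left algebra_simps)
  finally have 1: "S\<^sup>2 \<le> Z * (\<Sum>j\<in>V. (u j)\<^sup>2)" unfolding Z_def by (simp only: Cauchy_Schwarz_ineq_sum)
  have "(\<Sum>j\<in>V. (u j)\<^sup>2) = (\<Sum>i\<in>(\<lambda>j. j - s) ` V. (\<Sum>k\<in>T. y (i - k) * w k)\<^sup>2)"
    by (subst sum.reindex) (auto simp: inj_on_def u_def)
  also have "\<dots> \<le> \<rho> * S" unfolding S_def using y V by (simp add: filter_bound_def)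
  finally have "Z * (\<Sum>j\<in>V. (u j)\<^sup>2) \<le> Z * (\<rho> * S)" using nn by (intro mult_left_mono)
  with 1 have "S * S \<le> (\<rho> * Z) * S" by (simp add: power2_eq_square mult_ac)
  then have "S \<le> \<rho> * Z" using nn by (cases "S = 0") auto
  then show ?thesis unfolding S_def Z_def w_def .
qed

text \<open>A filter times the transpose of a shifted filter. Two different filters are allowed
  because the difference of the matrices for a and c is expanded bilinearly.\<close>

definition lag_mat :: "(int \<Rightarrow> real) \<Rightarrow> (int \<Rightarrow> real) \<Rightarrow> int \<Rightarrow> int set \<Rightarrow> int \<Rightarrow> int \<Rightarrow> real" where
  "lag_mat x y s T i j = (\<Sum>k\<in>T. x (i - k) * y (j - k - s))"

lemma lag_mat_op:
  assumes x: "filter_bound x T \<rho>" and y: "filter_bound y T \<rho>'" and V: "finite V"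
  shows "(\<Sum>i\<in>V. (\<Sum>j\<in>V. lag_mat x y s T i j * z j)\<^sup>2) \<le> \<rho> * \<rho>' * (\<Sum>j\<in>V. (z j)\<^sup>2)"
proof -
  define w where "w k = (\<Sum>j\<in>V. y (j - k - s) * z j)" for k
  have "(\<Sum>j\<in>V. lag_mat x y s T i j * z j) = (\<Sum>k\<in>T. x (i - k) * w k)" for i
    unfolding lag_mat_def w_def sum_distrib_left sum_distrib_right
    by (subst sum.swap) (simp add: mult.assoc)
  then have "(\<Sum>i\<in>V. (\<Sum>j\<in>V. lag_mat x y s T i j * z j)\<^sup>2) \<le> \<rho> * (\<Sum>k\<in>T. (w k)\<^sup>2)"
    using x V by (simp add: filter_bound_def)
  also have "\<dots> \<le> \<rho> * (\<rho>' * (\<Sum>j\<in>V. (z j)\<^sup>2))"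
    unfolding w_def using x by (intro mult_left_mono filter_bound_adjoint[OF y V]) (auto simp: filter_bound_def)
  finally show ?thesis by (simp add: mult.assoc)
qed

lemma Kmat_lag: "Kmat l \<iota> c T i j = (\<Sum>r\<in>UNIV. l r * lag_mat c c (int (\<iota> r)) T i j)"
  by (simp add: Kmat_def lag_mat_def)

lemma Kmat_op:
  fixes \<iota> :: "'n::finite \<Rightarrow> nat"
  assumes x: "filter_bound c T \<rho>" and V: "finite V"
  shows "(\<Sum>i\<in>V. (\<Sum>j\<in>V. Kmat l \<iota> c T i j * z j)\<^sup>2) \<le> (\<Sum>r\<in>UNIV. (l r)\<^sup>2) * real CARD('n) * \<rho>\<^sup>2 * (\<Sum>j\<in>V. (z j)\<^sup>2)"
proof -
  define y where "y r i = (\<Sum>j\<in>V. lag_mat c c (int (\<iota> r)) T i j * z j)" for r i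
  define \<Lambda> where "\<Lambda> = (\<Sum>r\<in>UNIV. (l r)\<^sup>2)"
  have \<Lambda>: "\<Lambda> \<ge> 0" by (simp add: \<Lambda>_def sum_nonneg)
  have "(\<Sum>j\<in>V. Kmat l \<iota> c T i j * z j) = (\<Sum>r\<in>UNIV. l r * y r i)" for i
    unfolding Kmat_lag y_def sum_distrib_left sum_distrib_right by (subst sum.swap) (simp add: mult.assoc)
  then have "(\<Sum>i\<in>V. (\<Sum>j\<in>V. Kmat l \<iota> c T i j * z j)\<^sup>2) = (\<Sum>i\<in>V. (\<Sum>r\<in>UNIV. l r * y r i)\<^sup>2)" by simp
  also have "\<dots> \<le> (\<Sum>i\<in>V. \<Lambda> * (\<Sum>r\<in>UNIV. (y r i)\<^sup>2))"
    unfolding \<Lambda>_def by (intro sum_mono Cauchy_Schwarz_ineq_sum)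
  also have "\<dots> = \<Lambda> * (\<Sum>r\<in>UNIV. \<Sum>i\<in>V. (y r i)\<^sup>2)"
    unfolding sum_distrib_left[symmetric] by (subst sum.swap) simp
  also have "\<dots> \<le> \<Lambda> * (\<Sum>r\<in>(UNIV :: 'n set). \<rho> * \<rho> * (\<Sum>j\<in>V. (z j)\<^sup>2))"
    unfolding y_def using \<Lambda> by (intro mult_left_mono sum_mono lag_mat_op[OF x x V])
  also have "\<dots> = \<Lambda> * real CARD('n) * \<rho>\<^sup>2 * (\<Sum>j\<in>V. (z j)\<^sup>2)" by (simp add: power2_eq_square)
  finally show ?thesis unfolding \<Lambda>_def .
qed

text \<open>No cancellation between the two matrices is used: the sum of their norms is enough,
  since it is multiplied by t_n. The factor 2 comes from (x - y)^2 \<le> 2 x^2 + 2 y^2.\<close>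

lemma Kmat_diff_op:
  fixes \<iota> :: "'n::finite \<Rightarrow> nat"
  assumes a: "filter_bound a T \<rho>" and c: "filter_bound c T' \<rho>'" and V: "finite V"
  shows "op_le V (\<lambda>i j. Kmat l \<iota> a T i j - Kmat l \<iota> c T' i j) (sqrt (2 * (\<Sum>r\<in>UNIV. (l r)\<^sup>2) * real CARD('n)) * (\<rho> + \<rho>'))"
  unfolding op_le_def
proof (intro conjI allI)
  define \<Lambda> where "\<Lambda> = (\<Sum>r\<in>UNIV. (l r)\<^sup>2) * real CARD('n)"
  have \<Lambda>: "\<Lambda> \<ge> 0" by (simp add: \<Lambda>_def sum_nonneg)
  have \<rho>: "\<rho> \<ge> 0" "\<rho>' \<ge> 0" using a c by (auto simp: filter_bound_def)
  show "0 \<le> sqrt (2 * (\<Sum>r\<in>UNIV. (l r)\<^sup>2) * real CARD('n)) * (\<rho> + \<rho>')" using \<rho> by (simp add: sum_nonneg)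
  fix z :: "int \<Rightarrow> real"
  define Z where "Z = (\<Sum>j\<in>V. (z j)\<^sup>2)"
  have Z: "Z \<ge> 0" by (simp add: Z_def sum_nonneg)
  have sq: "(x - y)\<^sup>2 \<le> 2 * x\<^sup>2 + 2 * y\<^sup>2" for x y :: real
    using sum_squares_bound[of x "- y"] by (simp add: power2_diff)
  have "(\<Sum>i\<in>V. (\<Sum>j\<in>V. (Kmat l \<iota> a T i j - Kmat l \<iota> c T' i j) * z j)\<^sup>2)
    \<le> (\<Sum>i\<in>V. 2 * (\<Sum>j\<in>V. Kmat l \<iota> a T i j * z j)\<^sup>2 + 2 * (\<Sum>j\<in>V. Kmat l \<iota> c T' i j * z j)\<^sup>2)"
    unfolding left_diff_distrib sum_subtractf by (intro sum_mono sq)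
  also have "\<dots> = 2 * (\<Sum>i\<in>V. (\<Sum>j\<in>V. Kmat l \<iota> a T i j * z j)\<^sup>2) + 2 * (\<Sum>i\<in>V. (\<Sum>j\<in>V. Kmat l \<iota> c T' i j * z j)\<^sup>2)"
    by (simp add: sum.distrib sum_distrib_left)
  also have "\<dots> \<le> 2 * (\<Lambda> * \<rho>\<^sup>2 * Z) + 2 * (\<Lambda> * \<rho>'\<^sup>2 * Z)"
    using Kmat_op[OF a V] Kmat_op[OF c V] unfolding \<Lambda>_def Z_def by (intro add_mono mult_left_mono) auto
  also have "\<dots> = 2 * \<Lambda> * Z * (\<rho>\<^sup>2 + \<rho>'\<^sup>2)" by (simp add: algebra_simps)
  also have "\<dots> \<le> 2 * \<Lambda> * Z * (\<rho> + \<rho>')\<^sup>2"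
    using \<Lambda> Z \<rho> by (intro mult_left_mono) (auto simp: power2_sum)
  also have "\<dots> = (sqrt (2 * \<Lambda>) * (\<rho> + \<rho>'))\<^sup>2 * Z" using \<Lambda> by (simp add: power_mult_distrib)
  finally show "(\<Sum>i\<in>V. (\<Sum>j\<in>V. (Kmat l \<iota> a T i j - Kmat l \<iota> c T' i j) * z j)\<^sup>2)
    \<le> (sqrt (2 * (\<Sum>r\<in>UNIV. (l r)\<^sup>2) * real CARD('n)) * (\<rho> + \<rho>'))\<^sup>2 * (\<Sum>j\<in>V. (z j)\<^sup>2)"
    unfolding \<Lambda>_def Z_def by (simp add: mult.assoc)
qed

lemma lag_mat_hs:
  assumes Fc: "fourier_series c gc" and Fa: "fourier_series a ga"
    and ic: "integrable torus (\<lambda>t. (cmod (gc t)) ^ 4)" and ia: "integrable torus (\<lambda>t. (cmod (ga t)) ^ 4)"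
    and K: "finite K" and V: "finite V" and \<tau>: "\<tau> > 0"
  shows "(\<Sum>i\<in>V. \<Sum>j\<in>V. (lag_mat c a s K i j)\<^sup>2)
    \<le> real (card K) / (4 * pi) * (\<tau> * (\<integral>t. (cmod (gc t)) ^ 4 \<partial>torus) + 1 / \<tau> * (\<integral>t. (cmod (ga t)) ^ 4 \<partial>torus))"
proof -
  have "(\<Sum>j\<in>V. (lag_mat c a s K i j)\<^sup>2) = (\<Sum>j\<in>(\<lambda>j. j - s) ` V. (\<Sum>k\<in>K. c (i - k) * a (j - k))\<^sup>2)" for i
    by (subst sum.reindex) (auto simp: inj_on_def lag_mat_def algebra_simps)
  then show ?thesis
    using hs_bound[OF Fc Fa ic ia K V finite_imageI[OF V, of "\<lambda>j. j - s"] \<tau>] by simp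
qed

text \<open>For each lag the difference is the matrix of (e, a) plus that of (c, e), both over T,
  plus that of (c, c) over T - T', with e = a - c. The first two can be made small by a good
  approximation in L^4, the third by leaving out a small proportion of the times.\<close>

lemma Kmat_diff_hs:
  fixes \<iota> :: "'n::finite \<Rightarrow> nat"
  assumes Fa: "fourier_series a ga" and Fc: "fourier_series c gc" and Fe: "fourier_series (\<lambda>j. a j - c j) ge"
    and ia: "integrable torus (\<lambda>t. (cmod (ga t)) ^ 4)" and ic: "integrable torus (\<lambda>t. (cmod (gc t)) ^ 4)"
    and ie: "integrable torus (\<lambda>t. (cmod (ge t)) ^ 4)"
    and T: "finite T" and T': "T' \<subseteq> T" and V: "finite V" and \<tau>: "\<tau> > 0"
  shows "(\<Sum>i\<in>V. \<Sum>j\<in>V. (Kmat l \<iota> a T i j - Kmat l \<iota> c T' i j)\<^sup>2)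
    \<le> 3 * (\<Sum>r\<in>UNIV. (l r)\<^sup>2) * real CARD('n) / (4 * pi) *
      (real (card T) * (2 * \<tau> * (\<integral>t. (cmod (ge t)) ^ 4 \<partial>torus)
          + ((\<integral>t. (cmod (ga t)) ^ 4 \<partial>torus) + (\<integral>t. (cmod (gc t)) ^ 4 \<partial>torus)) / \<tau>)
        + real (card (T - T')) * (2 * (\<integral>t. (cmod (gc t)) ^ 4 \<partial>torus)))"
proof -
  define e where "e j = a j - c j" for j
  define Ia where "Ia = (\<integral>t. (cmod (ga t)) ^ 4 \<partial>torus)"
  define Ic where "Ic = (\<integral>t. (cmod (gc t)) ^ 4 \<partial>torus)"
  define Ie where "Ie = (\<integral>t. (cmod (ge t)) ^ 4 \<partial>torus)"
  note Fe' = Fe[folded e_def]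
  define \<Lambda> where "\<Lambda> = (\<Sum>r\<in>UNIV. (l r)\<^sup>2)"
  have \<Lambda>: "\<Lambda> \<ge> 0" by (simp add: \<Lambda>_def sum_nonneg)
  define s where "s r = int (\<iota> r)" for r
  define d1 where "d1 r i j = lag_mat e a (s r) T i j" for r i j
  define d2 where "d2 r i j = lag_mat c e (s r) T i j" for r i j
  define d3 where "d3 r i j = lag_mat c c (s r) (T - T') i j" for r i j
  have split: "lag_mat a a (s r) T i j - lag_mat c c (s r) T' i j = d1 r i j + d2 r i j + d3 r i j" for r i j
  proof -
    have "lag_mat c c (s r) T i j = lag_mat c c (s r) T' i j + d3 r i j"
      unfolding lag_mat_def d3_def using sum.subset_diff[OF T' T] by (simp add: add.commute)
    moreover have "lag_mat a a (s r) T i j = d1 r i j + d2 r i j + lag_mat c c (s r) T i j"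
      unfolding d1_def d2_def lag_mat_def e_def sum.distrib[symmetric] by (intro sum.cong refl) (simp add: algebra_simps)
    ultimately show ?thesis by simp
  qed
  have sq3: "(x + y + z)\<^sup>2 \<le> 3 * (x\<^sup>2 + y\<^sup>2 + z\<^sup>2)" for x y z :: real
    using sum_squares_bound[of x y] sum_squares_bound[of x z] sum_squares_bound[of y z]
    by (simp add: power2_eq_square algebra_simps)
  have pt: "(Kmat l \<iota> a T i j - Kmat l \<iota> c T' i j)\<^sup>2 \<le> \<Lambda> * (\<Sum>r\<in>UNIV. 3 * ((d1 r i j)\<^sup>2 + (d2 r i j)\<^sup>2 + (d3 r i j)\<^sup>2))" for i j
  proof -
    have "Kmat l \<iota> a T i j - Kmat l \<iota> c T' i j = (\<Sum>r\<in>UNIV. l r * (d1 r i j + d2 r i j + d3 r i j))"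
      unfolding Kmat_lag split[symmetric] s_def by (simp add: sum_subtractf right_diff_distrib)
    then have "(Kmat l \<iota> a T i j - Kmat l \<iota> c T' i j)\<^sup>2 \<le> \<Lambda> * (\<Sum>r\<in>UNIV. (d1 r i j + d2 r i j + d3 r i j)\<^sup>2)"
      unfolding \<Lambda>_def by (simp only: Cauchy_Schwarz_ineq_sum)
    also have "\<dots> \<le> \<Lambda> * (\<Sum>r\<in>UNIV. 3 * ((d1 r i j)\<^sup>2 + (d2 r i j)\<^sup>2 + (d3 r i j)\<^sup>2))"
      using \<Lambda> by (intro mult_left_mono sum_mono sq3)
    finally show ?thesis .
  qed
  have b1: "(\<Sum>i\<in>V. \<Sum>j\<in>V. (d1 r i j)\<^sup>2) \<le> real (card T) / (4 * pi) * (\<tau> * Ie + 1 / \<tau> * Ia)" for r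
    unfolding d1_def Ie_def Ia_def by (rule lag_mat_hs[OF Fe' Fa ie ia T V \<tau>])
  \<comment> \<open>Now the small filter e is the second argument, so the weight is inverted in
    order that \<tau> multiplies \<open>Ie\<close> again.\<close>
  have b2: "(\<Sum>i\<in>V. \<Sum>j\<in>V. (d2 r i j)\<^sup>2) \<le> real (card T) / (4 * pi) * (\<tau> * Ie + 1 / \<tau> * Ic)" for r
    using lag_mat_hs[OF Fc Fe' ic ie T V, of "1 / \<tau>" "s r"] \<tau> unfolding d2_def Ie_def Ic_def by (simp add: add.commute)
  have b3: "(\<Sum>i\<in>V. \<Sum>j\<in>V. (d3 r i j)\<^sup>2) \<le> real (card (T - T')) / (4 * pi) * (2 * Ic)" for r
    using lag_mat_hs[OF Fc Fc ic ic _ V, of "T - T'" 1 "s r"] T unfolding d3_def Ic_def by simp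
  have "(\<Sum>i\<in>V. \<Sum>j\<in>V. (Kmat l \<iota> a T i j - Kmat l \<iota> c T' i j)\<^sup>2)
    \<le> (\<Sum>i\<in>V. \<Sum>j\<in>V. \<Lambda> * (\<Sum>r\<in>UNIV. 3 * ((d1 r i j)\<^sup>2 + (d2 r i j)\<^sup>2 + (d3 r i j)\<^sup>2)))"
    by (intro sum_mono pt)
  also have "\<dots> = 3 * \<Lambda> * (\<Sum>r\<in>UNIV. (\<Sum>i\<in>V. \<Sum>j\<in>V. (d1 r i j)\<^sup>2) + (\<Sum>i\<in>V. \<Sum>j\<in>V. (d2 r i j)\<^sup>2) + (\<Sum>i\<in>V. \<Sum>j\<in>V. (d3 r i j)\<^sup>2))"
  proof -
    have "(\<Sum>i\<in>V. \<Sum>j\<in>V. \<Lambda> * (\<Sum>r\<in>UNIV. 3 * F r i j)) = 3 * \<Lambda> * (\<Sum>r\<in>UNIV. \<Sum>i\<in>V. \<Sum>j\<in>V. F r i j)" for F :: "'n \<Rightarrow> int \<Rightarrow> int \<Rightarrow> real"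
    proof -
      have "(\<Sum>i\<in>V. \<Sum>j\<in>V. \<Sum>r\<in>UNIV. F r i j) = (\<Sum>i\<in>V. \<Sum>r\<in>UNIV. \<Sum>j\<in>V. F r i j)"
        by (intro sum.cong refl, rule sum.swap)
      also have "\<dots> = (\<Sum>r\<in>UNIV. \<Sum>i\<in>V. \<Sum>j\<in>V. F r i j)" by (rule sum.swap)
      finally show ?thesis by (simp add: sum_distrib_left[symmetric])
    qed
    from this[of "\<lambda>r i j. (d1 r i j)\<^sup>2 + (d2 r i j)\<^sup>2 + (d3 r i j)\<^sup>2"] show ?thesis by (simp only: sum.distrib)
  qed
  also have "\<dots> \<le> 3 * \<Lambda> * (\<Sum>r\<in>(UNIV :: 'n set). real (card T) / (4 * pi) * (\<tau> * Ie + 1 / \<tau> * Ia)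
      + real (card T) / (4 * pi) * (\<tau> * Ie + 1 / \<tau> * Ic) + real (card (T - T')) / (4 * pi) * (2 * Ic))"
    using \<Lambda> by (intro mult_left_mono sum_mono add_mono b1 b2 b3) auto
  also have "\<dots> = 3 * \<Lambda> * real CARD('n) / (4 * pi) * (real (card T) * (2 * \<tau> * Ie + (Ia + Ic) / \<tau>) + real (card (T - T')) * (2 * Ic))"
    using \<tau> by (simp add: field_simps)
  finally show ?thesis unfolding \<Lambda>_def Ia_def Ic_def Ie_def .
qed

context finite_filter
begin

lemma fourier_series_P: "fourier_series c P"
proof -
  have [measurable]: "P \<in> borel_measurable torus" unfolding P_def by measurable
  have i: "integrable torus (\<lambda>x. (norm (P x))\<^sup>2)"
    by (rule integrable_torus_bounded[of _ "(\<Sum>k\<in>{- int M..int M}. cmod (of_real (c k)))\<^sup>2"])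
      (auto simp: P_def intro!: power_mono norm_trig_le[THEN order_trans])
  have eq: "(\<Sum>j\<in>{- int N..int N}. complex_of_real (c j) * E j x) = P x" if "N \<ge> M" for N x
    unfolding P_def trig_def using that supp by (intro sum.mono_neutral_right) (auto simp: not_le)
  have "has_L2_sum torus (\<lambda>n t. complex_of_real (c n) * E n t) P"
    unfolding has_L2_sum_def
  proof (intro conjI i)
    show "(\<lambda>N::nat. \<integral>\<^sup>+ x. ennreal ((norm (P x - (\<Sum>j\<in>{- int N..int N}. complex_of_real (c j) * E j x)))\<^sup>2) \<partial>torus) \<longlonglongrightarrow> 0"
      by (rule tendsto_eventually, rule eventually_sequentiallyI[of M]) (simp add: eq)
  qed measurable
  then show ?thesis unfolding fourier_series_def E_def .
qed

lemma fourier_series_diff: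
  assumes F: "fourier_series a g"
  shows "fourier_series (\<lambda>j. a j - c j) (\<lambda>t. g t - P t)"
proof -
  note [measurable] = fourier_series_trig(1)[OF F]
  have [measurable]: "P \<in> borel_measurable torus" unfolding P_def by measurable
  have iP: "integrable torus (\<lambda>x. (norm (P x))\<^sup>2)" using fourier_series_trig(2)[OF fourier_series_P] .
  have i: "integrable torus (\<lambda>x. (norm (g x - P x))\<^sup>2)"
  proof (rule Bochner_Integration.integrable_bound)
    show "integrable torus (\<lambda>x. 2 * (norm (g x))\<^sup>2 + 2 * (norm (P x))\<^sup>2)" using iP fourier_series_trig(2)[OF F] by auto
    have "(norm (g x - P x))\<^sup>2 \<le> 2 * (norm (g x))\<^sup>2 + 2 * (norm (P x))\<^sup>2" for x
      using norm_add_square_le[of "g x" "- P x"] by simp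
    then show "AE x in torus. norm ((norm (g x - P x))\<^sup>2) \<le> norm (2 * (norm (g x))\<^sup>2 + 2 * (norm (P x))\<^sup>2)" by simp
  qed measurable
  have eq: "(\<Sum>j\<in>{- int N..int N}. complex_of_real (a j - c j) * E j x) = trig {- int N..int N} (\<lambda>j. of_real (a j)) x - P x" if "N \<ge> M" for N x
  proof -
    have "(\<Sum>j\<in>{- int N..int N}. complex_of_real (c j) * E j x) = P x"
      unfolding P_def trig_def using that supp by (intro sum.mono_neutral_right) (auto simp: not_le)
    then show ?thesis by (simp add: trig_def left_diff_distrib sum_subtractf)
  qed
  have "has_L2_sum torus (\<lambda>n t. complex_of_real (a n - c n) * E n t) (\<lambda>t. g t - P t)"
    unfolding has_L2_sum_def
  proof (intro conjI i)
    have "(\<lambda>N::nat. \<integral>\<^sup>+ x. ennreal ((norm (g x - trig {- int N..int N} (\<lambda>j. of_real (a j)) x))\<^sup>2) \<partial>torus) \<longlonglongrightarrow> 0"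
      using F unfolding fourier_series_def has_L2_sum_def trig_def E_def by simp
    moreover have "eventually (\<lambda>N. (\<integral>\<^sup>+ x. ennreal ((norm (g x - trig {- int N..int N} (\<lambda>j. of_real (a j)) x))\<^sup>2) \<partial>torus)
      = (\<integral>\<^sup>+ x. ennreal ((norm (g x - P x - (\<Sum>j\<in>{- int N..int N}. complex_of_real (a j - c j) * E j x)))\<^sup>2) \<partial>torus)) sequentially"
      by (rule eventually_sequentiallyI[of M]) (simp only: eq, simp)
    ultimately show "(\<lambda>N::nat. \<integral>\<^sup>+ x. ennreal ((norm (g x - P x - (\<Sum>j\<in>{- int N..int N}. complex_of_real (a j - c j) * E j x)))\<^sup>2) \<partial>torus) \<longlonglongrightarrow> 0"
      by (rule Lim_transform_eventually)
  qed measurable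
  then show ?thesis unfolding fourier_series_def E_def .
qed

lemma norm_P_bounded: "(cmod (P t))\<^sup>2 \<le> (\<Sum>k\<in>{- int M..int M}. \<bar>c k\<bar>)\<^sup>2"
  using norm_trig_le[of "{- int M..int M}" "\<lambda>j. of_real (c j)" t] by (intro power_mono) (auto simp: P_def)

lemma filter_bound_P: "finite T \<Longrightarrow> filter_bound c T ((\<Sum>k\<in>{- int M..int M}. \<bar>c k\<bar>)\<^sup>2)"
  unfolding filter_bound_def
  by (intro conjI allI impI op_bound_bounded[OF fourier_series_P] AE_I2 norm_P_bounded) auto

end

section \<open>From finite quadratic forms to the moving average\<close>

lemma summable_on_symmetric_partial_sums:
  fixes f :: "int \<Rightarrow> real"
  assumes "f summable_on UNIV"
  shows "(\<lambda>L::nat. \<Sum>j\<in>{- int L..int L}. f j) \<longlonglongrightarrow> infsum f UNIV"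
proof -
  have "filterlim (\<lambda>L::nat. {- int L..int L}) (finite_subsets_at_top UNIV) sequentially"
    unfolding filterlim_finite_subsets_at_top
  proof (intro allI impI)
    fix X :: "int set" assume X: "finite X \<and> X \<subseteq> UNIV"
    then have L: "\<bar>x\<bar> \<le> Max (abs ` X)" if "x \<in> X" for x using that by simp
    show "\<forall>\<^sub>F y in sequentially. finite {- int y..int y} \<and> X \<subseteq> {- int y..int y} \<and> {- int y..int y} \<subseteq> UNIV"
      by (rule eventually_sequentiallyI[of "nat (Max (abs ` X))"]) (use L in force)
  qed
  then show ?thesis
    using has_sum_infsum[OF assms] unfolding has_sum_def by (rule filterlim_compose[rotated])
qed

lemma abs_mult_le_squares: "\<bar>x * y\<bar> \<le> x\<^sup>2 + y\<^sup>2" for x y :: real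
proof -
  have "2 * (\<bar>x\<bar> * \<bar>y\<bar>) \<le> x\<^sup>2 + y\<^sup>2" using sum_squares_bound[of "\<bar>x\<bar>" "\<bar>y\<bar>"] by simp
  moreover have "0 \<le> \<bar>x\<bar> * \<bar>y\<bar>" by simp
  ultimately show ?thesis unfolding abs_mult by linarith
qed

text \<open>The difference of the products is bilinear in the two errors. The weight s in the
  inequality of the means keeps the bounded second moments small while the errors carry the large
  factor 1 + 1/s.\<close>

lemma integral_product_tendsto:
  fixes Y W :: "'a \<Rightarrow> real" and Yn Wn :: "nat \<Rightarrow> 'a \<Rightarrow> real"
  assumes [measurable]: "Y \<in> borel_measurable M" "W \<in> borel_measurable M"
      "\<And>n. Yn n \<in> borel_measurable M" "\<And>n. Wn n \<in> borel_measurable M"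
    and iY: "integrable M (\<lambda>x. (Y x)\<^sup>2)" and iW: "integrable M (\<lambda>x. (W x)\<^sup>2)"
    and iYn: "\<And>n. integrable M (\<lambda>x. (Y x - Yn n x)\<^sup>2)" and iWn: "\<And>n. integrable M (\<lambda>x. (W x - Wn n x)\<^sup>2)"
    and lY: "(\<lambda>n. \<integral>x. (Y x - Yn n x)\<^sup>2 \<partial>M) \<longlonglongrightarrow> 0" and lW: "(\<lambda>n. \<integral>x. (W x - Wn n x)\<^sup>2 \<partial>M) \<longlonglongrightarrow> 0"
  shows "integrable M (\<lambda>x. Y x * W x - Yn n x * Wn n x)"
    "(\<lambda>n. \<integral>x. \<bar>Y x * W x - Yn n x * Wn n x\<bar> \<partial>M) \<longlonglongrightarrow> 0"
proof -
  define d where "d n = (\<integral>x. (Y x - Yn n x)\<^sup>2 \<partial>M) + (\<integral>x. (W x - Wn n x)\<^sup>2 \<partial>M)" for n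
  define c where "c = (\<integral>x. (Y x)\<^sup>2 \<partial>M) + (\<integral>x. (W x)\<^sup>2 \<partial>M)"
  have c: "c \<ge> 0" unfolding c_def by simp
  define H where "H s n x = s * ((Y x)\<^sup>2 + (W x)\<^sup>2) + (1 + 1 / s) * ((Y x - Yn n x)\<^sup>2 + (W x - Wn n x)\<^sup>2)" for s n x
  have pt: "\<bar>Y x * W x - Yn n x * Wn n x\<bar> \<le> H s n x" if s: "s > 0" for s n x
  proof -
    have ab: "\<bar>p * r\<bar> \<le> s * p\<^sup>2 + 1 / s * r\<^sup>2" for p r :: real
    proof -
      have "0 \<le> (s * \<bar>p\<bar> - \<bar>r\<bar>)\<^sup>2" by simp
      then have "2 * (s * \<bar>p * r\<bar>) \<le> s\<^sup>2 * p\<^sup>2 + r\<^sup>2" by (simp add: power2_diff power_mult_distrib abs_mult)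
      moreover have "0 \<le> s * \<bar>p * r\<bar>" using s by simp
      ultimately have "s * \<bar>p * r\<bar> \<le> s\<^sup>2 * p\<^sup>2 + r\<^sup>2" by linarith
      then have "s * \<bar>p * r\<bar> \<le> s * (s * p\<^sup>2 + 1 / s * r\<^sup>2)" using s by (simp add: power2_eq_square distrib_left)
      then show ?thesis using s by simp
    qed
    have "Y x * W x - Yn n x * Wn n x = W x * (Y x - Yn n x) + Y x * (W x - Wn n x) - (Y x - Yn n x) * (W x - Wn n x)"
      by (simp add: algebra_simps)
    also have "\<bar>\<dots>\<bar> \<le> \<bar>W x * (Y x - Yn n x)\<bar> + \<bar>Y x * (W x - Wn n x)\<bar> + \<bar>(Y x - Yn n x) * (W x - Wn n x)\<bar>" by linarith
    also have "\<dots> \<le> (s * (W x)\<^sup>2 + 1 / s * (Y x - Yn n x)\<^sup>2) + (s * (Y x)\<^sup>2 + 1 / s * (W x - Wn n x)\<^sup>2) + ((Y x - Yn n x)\<^sup>2 + (W x - Wn n x)\<^sup>2)"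
      by (intro add_mono ab abs_mult_le_squares)
    also have "\<dots> = H s n x" unfolding H_def by (simp add: algebra_simps)
    finally show ?thesis .
  qed
  have iH: "integrable M (H s n)" for s n unfolding H_def using iY iW iYn iWn by auto
  have EH: "(\<integral>x. H s n x \<partial>M) = s * c + (1 + 1 / s) * d n" for s n
    unfolding H_def c_def d_def using iY iW iYn iWn by simp
  show int: "integrable M (\<lambda>x. Y x * W x - Yn n x * Wn n x)" for n
    by (rule Bochner_Integration.integrable_bound[OF iH[of 1 n]]) (use pt[of 1] in \<open>auto intro: order_trans[OF _ abs_ge_self]\<close>)
  show "(\<lambda>n. \<integral>x. \<bar>Y x * W x - Yn n x * Wn n x\<bar> \<partial>M) \<longlonglongrightarrow> 0"
  proof (rule null_by_splitting)
    show "d \<longlonglongrightarrow> 0" unfolding d_def[abs_def] using tendsto_add[OF lY lW] by simp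
    fix \<eta> :: real assume \<eta>: "0 < \<eta>"
    define s where "s = \<eta> / (c + 1)"
    have s: "s > 0" "s * c \<le> \<eta>" using \<eta> c by (auto simp: s_def field_simps)
    have "(\<integral>x. \<bar>Y x * W x - Yn n x * Wn n x\<bar> \<partial>M) \<le> \<eta> + (1 + 1 / s) * d n" for n
    proof -
      have "(\<integral>x. \<bar>Y x * W x - Yn n x * Wn n x\<bar> \<partial>M) \<le> (\<integral>x. H s n x \<partial>M)"
        by (rule integral_mono) (use int iH pt s in auto)
      then show ?thesis using s by (simp add: EH)
    qed
    then show "\<exists>C. \<forall>\<^sub>F n in sequentially. (\<integral>x. \<bar>Y x * W x - Yn n x * Wn n x\<bar> \<partial>M) \<le> \<eta> + C * d n"
      by (intro exI[of _ "1 + 1 / s"] always_eventually allI)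
  qed simp
qed

text \<open>L^1 convergence gives almost sure convergence along a subsequence, and Fatou's lemma
  then carries an upper bound on exponential moments to the limit. No uniform integrability of the
  exponentials enters.\<close>

lemma nn_integral_exp_L1_limit:
  fixes F :: "nat \<Rightarrow> 'a \<Rightarrow> real"
  assumes [measurable]: "\<And>n. F n \<in> borel_measurable M" "G \<in> borel_measurable M"
    and i: "\<And>n. integrable M (F n)" "integrable M G"
    and l: "(\<lambda>n. \<integral>x. \<bar>F n x - G x\<bar> \<partial>M) \<longlonglongrightarrow> 0"
    and b: "eventually (\<lambda>n. (\<integral>\<^sup>+x. ennreal (exp (F n x)) \<partial>M) \<le> B) sequentially"
  shows "(\<integral>\<^sup>+x. ennreal (exp (G x)) \<partial>M) \<le> B"
proof -
  obtain N where N: "\<And>n. n \<ge> N \<Longrightarrow> (\<integral>\<^sup>+x. ennreal (exp (F n x)) \<partial>M) \<le> B" using b by (auto simp: eventually_sequentially)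
  have "(\<lambda>n. \<integral>x. norm (F n x - G x) \<partial>M) \<longlonglongrightarrow> 0" using l by simp
  then obtain r :: "nat \<Rightarrow> nat" where r: "strict_mono r" "AE x in M. (\<lambda>n. F (r n) x) \<longlonglongrightarrow> G x"
    using tendsto_L1_AE_subseq[of M "\<lambda>n x. F n x - G x"] i LIM_zero_iff[of "\<lambda>n. F n _"] by (auto simp: LIM_zero_iff)
  have "(\<integral>\<^sup>+x. ennreal (exp (G x)) \<partial>M) = (\<integral>\<^sup>+x. liminf (\<lambda>n. ennreal (exp (F (r n) x))) \<partial>M)"
  proof (rule nn_integral_cong_AE)
    show "AE x in M. ennreal (exp (G x)) = liminf (\<lambda>n. ennreal (exp (F (r n) x)))"
      using r(2)
    proof eventually_elim
      case (elim x)
      have "(\<lambda>n. ennreal (exp (F (r n) x))) \<longlonglongrightarrow> ennreal (exp (G x))" by (intro tendsto_ennrealI tendsto_exp elim)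
      from lim_imp_Liminf[OF _ this] show ?case by simp
    qed
  qed
  also have "\<dots> \<le> liminf (\<lambda>n. \<integral>\<^sup>+x. ennreal (exp (F (r n) x)) \<partial>M)" by (rule nn_integral_liminf) measurable
  also have "\<dots> \<le> limsup (\<lambda>n. \<integral>\<^sup>+x. ennreal (exp (F (r n) x)) \<partial>M)" by (rule Liminf_le_Limsup) simp
  also have "\<dots> \<le> B"
  proof (rule Limsup_bounded)
    show "\<forall>\<^sub>F n in sequentially. (\<integral>\<^sup>+x. ennreal (exp (F (r n) x)) \<partial>M) \<le> B"
      using eventually_ge_at_top[of N] by eventually_elim (use seq_suble[OF r(1)] N in \<open>meson order_trans\<close>)
  qed
  finally show ?thesis .
qed

section \<open>The moving average and its approximation by finite quadratic forms\<close>

locale linear_process = noise \<mu> K v for \<mu> :: "real measure" and K v :: real +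
  fixes M :: "'a measure" and a :: "int \<Rightarrow> real" and \<xi> X :: "int \<Rightarrow> 'a \<Rightarrow> real"
  assumes prob_M: "prob_space M"
    and indep: "prob_space.indep_vars M (\<lambda>_. borel) \<xi> UNIV"
    and dist: "\<And>n. distr M borel (\<xi> n) = \<mu>"
    and summable_squares: "(\<lambda>n. \<bar>a n\<bar>\<^sup>2) summable_on UNIV"
    and moving: "moving_average M a \<xi> X"
begin

sublocale M: prob_space M by (rule prob_M)

lemma rv_\<xi> [measurable]: "\<xi> i \<in> borel_measurable M"
  using indep unfolding M.indep_vars_def by auto

lemma rv_X [measurable]: "X i \<in> borel_measurable M"
  using moving unfolding moving_average_def has_L2_sum_def by auto

lemma X_square: "integrable M (\<lambda>w. (X i w)\<^sup>2)"
  using moving unfolding moving_average_def has_L2_sum_def by auto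

lemma noise_measurable: "(\<lambda>w. \<lambda>i\<in>V. \<xi> i w) \<in> measurable M (PiM V (\<lambda>_. \<mu>))"
  by (rule measurable_restrict) (use measurable_cong_sets[OF refl sets] in simp)

lemma noise_distr:
  assumes "V \<noteq> {}"
  shows "distr M (PiM V (\<lambda>_. \<mu>)) (\<lambda>w. \<lambda>i\<in>V. \<xi> i w) = PiM V (\<lambda>_. \<mu>)"
proof -
  have "M.indep_vars (\<lambda>_. borel) \<xi> V" using M.indep_vars_subset[OF indep] by simp
  then have "distr M (PiM V (\<lambda>_. borel)) (\<lambda>w. \<lambda>i\<in>V. \<xi> i w) = PiM V (\<lambda>_. \<mu>)"
    using M.indep_vars_iff_distr_eq_PiM[where I = V and M' = "\<lambda>_. borel" and X = \<xi>] assms dist by simp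
  moreover have "distr M (PiM V (\<lambda>_. \<mu>)) (\<lambda>w. \<lambda>i\<in>V. \<xi> i w) = distr M (PiM V (\<lambda>_. borel)) (\<lambda>w. \<lambda>i\<in>V. \<xi> i w)"
    by (rule distr_cong) (auto intro!: sets_PiM_cong simp: sets)
  ultimately show ?thesis by simp
qed

lemma nn_integral_QF_noise:
  assumes V: "V \<noteq> {}"
  shows "(\<integral>\<^sup>+w. ennreal (exp (t * QF v V A (\<lambda>i. \<xi> i w))) \<partial>M) = (\<integral>\<^sup>+x. ennreal (exp (t * QF v V A x)) \<partial>PiM V (\<lambda>_. \<mu>))"
proof -
  have mQ: "(\<lambda>x. ennreal (exp (t * QF v V A x))) \<in> borel_measurable (PiM V (\<lambda>_. \<mu>))"
    using QF_measurable[of V V] by measurable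
  have "(\<integral>\<^sup>+x. ennreal (exp (t * QF v V A x)) \<partial>PiM V (\<lambda>_. \<mu>))
    = (\<integral>\<^sup>+x. ennreal (exp (t * QF v V A x)) \<partial>distr M (PiM V (\<lambda>_. \<mu>)) (\<lambda>w. \<lambda>i\<in>V. \<xi> i w))"
    by (simp only: noise_distr[OF V])
  also have "\<dots> = (\<integral>\<^sup>+w. ennreal (exp (t * QF v V A (\<lambda>i\<in>V. \<xi> i w))) \<partial>M)"
    by (rule nn_integral_distr[OF noise_measurable]) (simp add: mQ)
  also have "\<dots> = (\<integral>\<^sup>+w. ennreal (exp (t * QF v V A (\<lambda>i. \<xi> i w))) \<partial>M)"
  proof (intro nn_integral_cong)
    fix w
    have "QF v V A (\<lambda>i\<in>V. \<xi> i w) = QF v V A (\<lambda>i. \<xi> i w)" by (rule QF_cong) simp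
    then show "ennreal (exp (t * QF v V A (\<lambda>i\<in>V. \<xi> i w))) = ennreal (exp (t * QF v V A (\<lambda>i. \<xi> i w)))" by simp
  qed
  finally show ?thesis ..
qed

lemma noise_covariance:
  "integrable M (\<lambda>w. \<xi> i w * \<xi> j w)" "(\<integral>w. \<xi> i w * \<xi> j w \<partial>M) = (if i = j then v else 0)"
proof -
  define V where "V = {i, j}"
  have V: "V \<noteq> {}" "finite V" "i \<in> V" "j \<in> V" by (auto simp: V_def)
  note m2 = moment2[OF V(2-4)]
  have mp: "(\<lambda>x. x i * x j) \<in> borel_measurable (PiM V (\<lambda>_. \<mu>))" using m2(1) by (rule borel_measurable_integrable)
  have "integrable (distr M (PiM V (\<lambda>_. \<mu>)) (\<lambda>w. \<lambda>i\<in>V. \<xi> i w)) (\<lambda>x. x i * x j)" using m2(1) by (simp only: noise_distr[OF V(1)])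
  then show "integrable M (\<lambda>w. \<xi> i w * \<xi> j w)"
    using V by (subst (asm) integrable_distr_eq[OF noise_measurable mp]) simp
  have "(\<integral>x. x i * x j \<partial>distr M (PiM V (\<lambda>_. \<mu>)) (\<lambda>w. \<lambda>i\<in>V. \<xi> i w)) = (if i = j then v else 0)"
    using m2(2) by (simp only: noise_distr[OF V(1)])
  then show "(\<integral>w. \<xi> i w * \<xi> j w \<partial>M) = (if i = j then v else 0)"
    using V by (subst (asm) integral_distr[OF noise_measurable mp]) simp
qed

lemma noise_products:
  assumes B: "finite B"
  shows "integrable M (\<lambda>w. (\<Sum>i\<in>B. x i * \<xi> i w) * (\<Sum>i\<in>B. y i * \<xi> i w))"
    "(\<integral>w. (\<Sum>i\<in>B. x i * \<xi> i w) * (\<Sum>i\<in>B. y i * \<xi> i w) \<partial>M) = v * (\<Sum>i\<in>B. x i * y i)"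
proof -
  have eq: "(\<Sum>i\<in>B. x i * \<xi> i w) * (\<Sum>i\<in>B. y i * \<xi> i w) = (\<Sum>i\<in>B. \<Sum>j\<in>B. x i * y j * (\<xi> i w * \<xi> j w))" for w
    unfolding sum_product by (simp add: mult_ac)
  show "integrable M (\<lambda>w. (\<Sum>i\<in>B. x i * \<xi> i w) * (\<Sum>i\<in>B. y i * \<xi> i w))"
    unfolding eq by (intro Bochner_Integration.integrable_sum integrable_mult_right noise_covariance)
  have "(\<integral>w. (\<Sum>i\<in>B. x i * \<xi> i w) * (\<Sum>i\<in>B. y i * \<xi> i w) \<partial>M) = (\<Sum>i\<in>B. \<Sum>j\<in>B. x i * y j * (if i = j then v else 0))"
    unfolding eq by (simp add: Bochner_Integration.integral_sum noise_covariance)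
  also have "\<dots> = (\<Sum>i\<in>B. x i * y i * v)"
  proof (intro sum.cong refl)
    fix i assume i: "i \<in> B"
    have "(\<Sum>j\<in>B. x i * y j * (if i = j then v else 0)) = (\<Sum>j\<in>B. if i = j then x i * y i * v else 0)"
      by (intro sum.cong) auto
    then show "(\<Sum>j\<in>B. x i * y j * (if i = j then v else 0)) = x i * y i * v" using B i by simp
  qed
  finally show "(\<integral>w. (\<Sum>i\<in>B. x i * \<xi> i w) * (\<Sum>i\<in>B. y i * \<xi> i w) \<partial>M) = v * (\<Sum>i\<in>B. x i * y i)"
    by (simp add: sum_distrib_left mult_ac)
qed

end

lemma QF_Kmat:
  fixes \<iota> :: "'n::finite \<Rightarrow> nat"
  shows "QF v V (Kmat l \<iota> c T) x = (\<Sum>r\<in>UNIV. l r * (\<Sum>k\<in>T.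
    (\<Sum>i\<in>V. c (i - k) * x i) * (\<Sum>i\<in>V. c (i - k - int (\<iota> r)) * x i) - v * (\<Sum>i\<in>V. c (i - k) * c (i - k - int (\<iota> r)))))"
proof -
  define G where "G r k i j = l r * (c (i - k) * c (j - k - int (\<iota> r)) * (x i * x j - (if i = j then v else 0)))" for r k i j
  have "QF v V (Kmat l \<iota> c T) x = (\<Sum>i\<in>V. \<Sum>j\<in>V. \<Sum>r\<in>UNIV. \<Sum>k\<in>T. G r k i j)"
    unfolding QF_def Kmat_def G_def by (simp add: sum_distrib_left sum_distrib_right mult_ac)
  also have "\<dots> = (\<Sum>i\<in>V. \<Sum>r\<in>UNIV. \<Sum>j\<in>V. \<Sum>k\<in>T. G r k i j)"
    by (rule sum.cong[OF refl], rule sum.swap)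
  also have "\<dots> = (\<Sum>r\<in>UNIV. \<Sum>i\<in>V. \<Sum>j\<in>V. \<Sum>k\<in>T. G r k i j)" by (rule sum.swap)
  also have "\<dots> = (\<Sum>r\<in>UNIV. \<Sum>i\<in>V. \<Sum>k\<in>T. \<Sum>j\<in>V. G r k i j)"
    by (rule sum.cong[OF refl], rule sum.cong[OF refl], rule sum.swap)
  also have "\<dots> = (\<Sum>r\<in>UNIV. \<Sum>k\<in>T. \<Sum>i\<in>V. \<Sum>j\<in>V. G r k i j)"
    by (rule sum.cong[OF refl], rule sum.swap)
  finally have 1: "QF v V (Kmat l \<iota> c T) x = (\<Sum>r\<in>UNIV. \<Sum>k\<in>T. \<Sum>i\<in>V. \<Sum>j\<in>V. G r k i j)" .
  have 2: "(\<Sum>i\<in>V. \<Sum>j\<in>V. G r k i j) = l r * ((\<Sum>i\<in>V. c (i - k) * x i) * (\<Sum>i\<in>V. c (i - k - int (\<iota> r)) * x i) - v * (\<Sum>i\<in>V. c (i - k) * c (i - k - int (\<iota> r))))" for r k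
  proof (cases "finite V")
    case True
    have "(\<Sum>j\<in>V. G r k i j) = l r * (c (i - k) * x i * (\<Sum>j\<in>V. c (j - k - int (\<iota> r)) * x j) - v * (c (i - k) * c (i - k - int (\<iota> r))))"
      if i: "i \<in> V" for i
    proof -
      have "G r k i j = l r * (c (i - k) * x i * (c (j - k - int (\<iota> r)) * x j)) - (if i = j then l r * v * (c (i - k) * c (i - k - int (\<iota> r))) else 0)" for j
        unfolding G_def by (simp add: algebra_simps)
      then show ?thesis using i True by (simp add: sum_subtractf sum_distrib_left right_diff_distrib mult_ac)
    qed
    then show ?thesis by (simp add: sum_distrib_left[symmetric] sum_distrib_right[symmetric] sum_subtractf)
  qed (simp add: G_def)
  show ?thesis unfolding 1 2 by (simp only: sum_distrib_left)
qed

lemma QF_Kmat_support: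
  fixes \<iota> :: "'n::finite \<Rightarrow> nat"
  assumes W: "finite W" "V \<subseteq> W"
    and z: "\<And>i k. i \<in> W - V \<Longrightarrow> k \<in> T \<Longrightarrow> c (i - k) = 0" "\<And>i k r. i \<in> W - V \<Longrightarrow> k \<in> T \<Longrightarrow> c (i - k - int (\<iota> r)) = 0"
  shows "QF v W (Kmat l \<iota> c T) x = QF v V (Kmat l \<iota> c T) x"
proof -
  have "(\<Sum>i\<in>W. c (i - k) * y i) = (\<Sum>i\<in>V. c (i - k) * y i)" if "k \<in> T" for k y
    using z that by (intro sum.mono_neutral_right W) auto
  moreover have "(\<Sum>i\<in>W. c (i - k - int (\<iota> r)) * y i) = (\<Sum>i\<in>V. c (i - k - int (\<iota> r)) * y i)" if "k \<in> T" for k r y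
    using z that by (intro sum.mono_neutral_right W) auto
  ultimately show ?thesis unfolding QF_Kmat by simp
qed

lemma QF_diff: "QF v V (\<lambda>i j. A i j - B i j) x = QF v V A x - QF v V B x"
  unfolding QF_def by (simp add: left_diff_distrib sum_subtractf)

context linear_process
begin

lemma v_nonneg: "0 \<le> v"
  using second by (metis integral_nonneg_AE AE_I2 zero_le_power2)

text \<open>The window {-N..N} refers to the noise index and is the same for every k, unlike the
  partial sums in \<open>moving_average\<close>, whose window is centered at k. This way the
  products for all k become forms in one finite set of noise variables.\<close>

definition XN :: "nat \<Rightarrow> int \<Rightarrow> 'a \<Rightarrow> real" where
  "XN N k w = (\<Sum>i\<in>{- int N..int N}. a (i - k) * \<xi> i w)"

lemma rv_XN [measurable]: "XN N k \<in> borel_measurable M"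
  unfolding XN_def[abs_def] by measurable

text \<open>The windows {-N..N} and {k - N..k + N} differ only at indices i with |i - k| > N - |k|.
  So the two truncations differ in mean square by at most v times a tail of the square sum of
  a.\<close>

lemma XN_L2:
  "integrable M (\<lambda>w. (X k w - XN N k w)\<^sup>2)" "(\<lambda>N. \<integral>w. (X k w - XN N k w)\<^sup>2 \<partial>M) \<longlonglongrightarrow> 0"
proof -
  define S where "S N w = (\<Sum>j\<in>{- int N..int N}. a j * \<xi> (k + j) w)" for N :: nat and w
  have [measurable]: "S N \<in> borel_measurable M" for N unfolding S_def[abs_def] by measurable
  have L: "has_L2_sum M (\<lambda>j w. a j * \<xi> (k + j) w) (X k)" using moving unfolding moving_average_def by simp
  have isq: "integrable M (\<lambda>w. (norm (a j * \<xi> (k + j) w))\<^sup>2)" for j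
  proof -
    have "(norm (a j * \<xi> (k + j) w))\<^sup>2 = (a j)\<^sup>2 * (\<xi> (k + j) w * \<xi> (k + j) w)" for w
      by (simp add: power_mult_distrib power2_eq_square[of "\<xi> _ _"])
    then show ?thesis using integrable_mult_right[OF noise_covariance(1)[of "k + j" "k + j"]] by simp
  qed
  have iS: "integrable M (\<lambda>w. (X k w - S N w)\<^sup>2)" for N
    using has_L2_sum_real(1)[OF L _ isq, of N] by (simp add: S_def)
  have lS: "(\<lambda>N. \<integral>w. (X k w - S N w)\<^sup>2 \<partial>M) \<longlonglongrightarrow> 0"
    using has_L2_sum_real(2)[OF L _ isq] by (simp add: S_def)
  define s where "s = nat \<bar>k\<bar>"
  define B where "B N = {- int N - int s..int N + int s}" for N :: nat
  \<comment> \<open>Takes the values -1, 0 and 1, and is 0 wherever both windows agree.\<close>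
  define \<epsilon> where "\<epsilon> N i = (of_bool (i \<in> {k - int N..k + int N}) - of_bool (i \<in> {- int N..int N}) :: real)" for N :: nat and i :: int
  have S: "S N w - XN N k w = (\<Sum>i\<in>B N. a (i - k) * \<epsilon> N i * \<xi> i w)" for N w
  proof -
    have "S N w = (\<Sum>i\<in>{k - int N..k + int N}. a (i - k) * \<xi> i w)"
      unfolding S_def by (rule sum.reindex_bij_witness[of _ "\<lambda>i. i - k" "\<lambda>j. k + j"]) auto
    also have "\<dots> = (\<Sum>i\<in>B N. of_bool (i \<in> {k - int N..k + int N}) * (a (i - k) * \<xi> i w))"
      by (rule sum.mono_neutral_cong_left) (auto simp: B_def s_def)
    finally have 1: "S N w = (\<Sum>i\<in>B N. of_bool (i \<in> {k - int N..k + int N}) * (a (i - k) * \<xi> i w))" .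
    have 2: "XN N k w = (\<Sum>i\<in>B N. of_bool (i \<in> {- int N..int N}) * (a (i - k) * \<xi> i w))"
      unfolding XN_def by (rule sum.mono_neutral_cong_left) (auto simp: B_def s_def)
    show ?thesis unfolding 1 2 \<epsilon>_def sum_subtractf[symmetric] by (intro sum.cong refl) (simp only: algebra_simps)
  qed
  have fB: "finite (B N)" for N by (simp add: B_def)
  have iD: "integrable M (\<lambda>w. (S N w - XN N k w)\<^sup>2)"
    and eD: "(\<integral>w. (S N w - XN N k w)\<^sup>2 \<partial>M) = v * (\<Sum>i\<in>B N. (a (i - k) * \<epsilon> N i)\<^sup>2)" for N
    unfolding S power2_eq_square using noise_products[OF fB] by auto
  define A where "A = infsum (\<lambda>n. \<bar>a n\<bar>\<^sup>2) UNIV"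
  have bD: "(\<Sum>i\<in>B N. (a (i - k) * \<epsilon> N i)\<^sup>2) \<le> A - (\<Sum>j\<in>{- int (N - s)..int (N - s)}. \<bar>a j\<bar>\<^sup>2)" if N: "N \<ge> s" for N
  proof -
    define G where "G = {- int (N - s)..int (N - s)}"
    define B' where "B' = (\<lambda>i. i - k) ` B N - G"
    have z: "\<epsilon> N i = 0" if "i - k \<in> G" for i
      using that N unfolding G_def \<epsilon>_def s_def by (auto simp: of_nat_diff)
    have "(\<Sum>i\<in>B N. (a (i - k) * \<epsilon> N i)\<^sup>2) \<le> (\<Sum>i\<in>B N. if i - k \<in> G then 0 else \<bar>a (i - k)\<bar>\<^sup>2)"
    proof (rule sum_mono)
      fix i
      have "(\<epsilon> N i)\<^sup>2 \<le> 1" unfolding \<epsilon>_def by (auto simp: of_bool_def)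
      then show "(a (i - k) * \<epsilon> N i)\<^sup>2 \<le> (if i - k \<in> G then 0 else \<bar>a (i - k)\<bar>\<^sup>2)"
        using z[of i] by (auto simp: power_mult_distrib mult_left_le)
    qed
    also have "\<dots> = (\<Sum>j\<in>(\<lambda>i. i - k) ` B N. if j \<in> G then 0 else \<bar>a j\<bar>\<^sup>2)"
      by (subst sum.reindex) (auto simp: inj_on_def)
    also have "\<dots> = (\<Sum>j\<in>B'. \<bar>a j\<bar>\<^sup>2)"
      unfolding B'_def by (rule sum.mono_neutral_cong_right) (auto simp: fB)
    finally have "(\<Sum>i\<in>B N. (a (i - k) * \<epsilon> N i)\<^sup>2) \<le> (\<Sum>j\<in>B'. \<bar>a j\<bar>\<^sup>2)" .
    moreover have "(\<Sum>j\<in>B'. \<bar>a j\<bar>\<^sup>2) + (\<Sum>j\<in>G. \<bar>a j\<bar>\<^sup>2) = (\<Sum>j\<in>B' \<union> G. \<bar>a j\<bar>\<^sup>2)"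
      by (rule sum.union_disjoint[symmetric]) (auto simp: B'_def G_def fB)
    moreover have "(\<Sum>j\<in>B' \<union> G. \<bar>a j\<bar>\<^sup>2) \<le> A"
      unfolding A_def by (rule finite_sum_le_infsum[OF summable_squares]) (auto simp: B'_def G_def fB)
    ultimately show ?thesis unfolding G_def by linarith
  qed
  have lD: "(\<lambda>N. \<integral>w. (S N w - XN N k w)\<^sup>2 \<partial>M) \<longlonglongrightarrow> 0"
  proof (rule tendsto_sandwich[of "\<lambda>_. 0"])
    show "\<forall>\<^sub>F N in sequentially. (\<integral>w. (S N w - XN N k w)\<^sup>2 \<partial>M) \<le> v * (A - (\<Sum>j\<in>{- int (N - s)..int (N - s)}. \<bar>a j\<bar>\<^sup>2))"
      using eventually_ge_at_top[of s] by eventually_elim (unfold eD, intro mult_left_mono bD v_nonneg)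
    have "(\<lambda>N. \<Sum>j\<in>{- int (N + s - s)..int (N + s - s)}. \<bar>a j\<bar>\<^sup>2) \<longlonglongrightarrow> A"
      using summable_on_symmetric_partial_sums[OF summable_squares] by (simp add: A_def)
    then have "(\<lambda>N. \<Sum>j\<in>{- int (N - s)..int (N - s)}. \<bar>a j\<bar>\<^sup>2) \<longlonglongrightarrow> A" by (rule LIMSEQ_offset)
    then have "(\<lambda>N. v * (A - (\<Sum>j\<in>{- int (N - s)..int (N - s)}. \<bar>a j\<bar>\<^sup>2))) \<longlonglongrightarrow> v * (A - A)" by (intro tendsto_intros)
    then show "(\<lambda>N. v * (A - (\<Sum>j\<in>{- int (N - s)..int (N - s)}. \<bar>a j\<bar>\<^sup>2))) \<longlonglongrightarrow> 0" by simp
  qed simp_all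
  have sq: "(X k w - XN N k w)\<^sup>2 \<le> 2 * (X k w - S N w)\<^sup>2 + 2 * (S N w - XN N k w)\<^sup>2" for N w
    using norm_add_square_le[of "X k w - S N w" "S N w - XN N k w"] by simp
  show i: "integrable M (\<lambda>w. (X k w - XN N k w)\<^sup>2)" for N
  proof (rule Bochner_Integration.integrable_bound)
    show "integrable M (\<lambda>w. 2 * (X k w - S N w)\<^sup>2 + 2 * (S N w - XN N k w)\<^sup>2)" using iS iD by auto
    show "AE w in M. norm ((X k w - XN N k w)\<^sup>2) \<le> norm (2 * (X k w - S N w)\<^sup>2 + 2 * (S N w - XN N k w)\<^sup>2)"
      using sq[of _ N] by (intro AE_I2) simp
  qed measurable
  show "(\<lambda>N. \<integral>w. (X k w - XN N k w)\<^sup>2 \<partial>M) \<longlonglongrightarrow> 0"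
  proof (rule tendsto_sandwich[of "\<lambda>_. 0"])
    show "\<forall>\<^sub>F N in sequentially. (\<integral>w. (X k w - XN N k w)\<^sup>2 \<partial>M) \<le> 2 * (\<integral>w. (X k w - S N w)\<^sup>2 \<partial>M) + 2 * (\<integral>w. (S N w - XN N k w)\<^sup>2 \<partial>M)"
    proof (intro always_eventually allI)
      fix N
      have "(\<integral>w. (X k w - XN N k w)\<^sup>2 \<partial>M) \<le> (\<integral>w. 2 * (X k w - S N w)\<^sup>2 + 2 * (S N w - XN N k w)\<^sup>2 \<partial>M)"
        by (rule integral_mono) (use i iS iD sq in auto)
      then show "(\<integral>w. (X k w - XN N k w)\<^sup>2 \<partial>M) \<le> 2 * (\<integral>w. (X k w - S N w)\<^sup>2 \<partial>M) + 2 * (\<integral>w. (S N w - XN N k w)\<^sup>2 \<partial>M)"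
        using iS[of N] iD[of N] by simp
    qed
    have "(\<lambda>N. 2 * (\<integral>w. (X k w - S N w)\<^sup>2 \<partial>M) + 2 * (\<integral>w. (S N w - XN N k w)\<^sup>2 \<partial>M)) \<longlonglongrightarrow> 2 * 0 + 2 * 0"
      by (intro tendsto_intros lS lD)
    then show "(\<lambda>N. 2 * (\<integral>w. (X k w - S N w)\<^sup>2 \<partial>M) + 2 * (\<integral>w. (S N w - XN N k w)\<^sup>2 \<partial>M)) \<longlonglongrightarrow> 0" by simp
  qed simp_all
qed

definition Q :: "('n::finite \<Rightarrow> real) \<Rightarrow> ('n \<Rightarrow> nat) \<Rightarrow> int set \<Rightarrow> 'a \<Rightarrow> real" where
  "Q l \<iota> T w = (\<Sum>r\<in>UNIV. l r * (\<Sum>k\<in>T. X k w * X (k + int (\<iota> r)) w - (\<integral>w. X k w * X (k + int (\<iota> r)) w \<partial>M)))"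

lemma rv_Q [measurable]: "Q l \<iota> T \<in> borel_measurable M"
  unfolding Q_def[abs_def] by measurable

lemma X_product: "integrable M (\<lambda>w. X i w * X j w)"
proof (rule Bochner_Integration.integrable_bound)
  show "integrable M (\<lambda>w. (X i w)\<^sup>2 + (X j w)\<^sup>2)" using X_square by auto
  show "AE w in M. norm (X i w * X j w) \<le> norm ((X i w)\<^sup>2 + (X j w)\<^sup>2)" using abs_mult_le_squares by (intro AE_I2) simp
qed measurable

lemma Q_mean: "integrable M (Q l \<iota> T)" "(\<integral>w. Q l \<iota> T w \<partial>M) = 0"
proof -
  show "integrable M (Q l \<iota> T)" unfolding Q_def[abs_def] using X_product
    by (intro Bochner_Integration.integrable_sum integrable_mult_right Bochner_Integration.integrable_diff) auto
  show "(\<integral>w. Q l \<iota> T w \<partial>M) = 0" unfolding Q_def using X_product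
    by (subst Bochner_Integration.integral_sum) (auto simp: M.prob_space)
qed

text \<open>The truncated variables converge in L^2, hence their products in L^1 together with the
  expectations. The centering by v inside \<open>QF\<close> is exactly the expectation of the
  truncated products, so both sides are centered in the same way.\<close>

lemma QF_tendsto_Q:
  "integrable M (\<lambda>w. QF v {- int N..int N} (Kmat l \<iota> a T) (\<lambda>i. \<xi> i w))"
  "(\<lambda>N. \<integral>w. \<bar>QF v {- int N..int N} (Kmat l \<iota> a T) (\<lambda>i. \<xi> i w) - Q l \<iota> T w\<bar> \<partial>M) \<longlonglongrightarrow> 0"
proof -
  define W where "W r k w = X k w * X (k + int (\<iota> r)) w" for r k w
  define Wn where "Wn N r k w = XN N k w * XN N (k + int (\<iota> r)) w" for N r k w
  have [measurable]: "W r k \<in> borel_measurable M" "Wn N r k \<in> borel_measurable M" for N r k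
    unfolding W_def[abs_def] Wn_def[abs_def] by measurable
  have iW: "integrable M (W r k)" for r k unfolding W_def[abs_def] by (rule X_product)
  have iWn: "integrable M (Wn N r k)" for N r k unfolding Wn_def[abs_def] XN_def by (rule noise_products) simp
  have EWn: "(\<integral>w. Wn N r k w \<partial>M) = v * (\<Sum>i\<in>{- int N..int N}. a (i - k) * a (i - k - int (\<iota> r)))" for N r k
    unfolding Wn_def XN_def by (subst noise_products) (auto simp: algebra_simps)
  have lW: "(\<lambda>N. \<integral>w. \<bar>W r k w - Wn N r k w\<bar> \<partial>M) \<longlonglongrightarrow> 0" for r k
    unfolding W_def Wn_def by (rule integral_product_tendsto(2)[OF _ _ _ _ X_square X_square XN_L2(1) XN_L2(1) XN_L2(2) XN_L2(2)]) measurable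
  have eq: "QF v {- int N..int N} (Kmat l \<iota> a T) (\<lambda>i. \<xi> i w) = (\<Sum>r\<in>UNIV. l r * (\<Sum>k\<in>T. Wn N r k w - (\<integral>w. Wn N r k w \<partial>M)))" for N w
    unfolding QF_Kmat EWn unfolding Wn_def XN_def by (simp add: algebra_simps)
  show i: "integrable M (\<lambda>w. QF v {- int N..int N} (Kmat l \<iota> a T) (\<lambda>i. \<xi> i w))" for N
    unfolding eq using iWn by (intro Bochner_Integration.integrable_sum integrable_mult_right Bochner_Integration.integrable_diff) auto
  define d where "d N r k = (\<integral>w. \<bar>W r k w - Wn N r k w\<bar> \<partial>M)" for N r k
  have iabs: "integrable M (\<lambda>w. \<bar>W r k w - Wn N r k w\<bar>)" for N r k using iW iWn by auto
  have pt: "\<bar>QF v {- int N..int N} (Kmat l \<iota> a T) (\<lambda>i. \<xi> i w) - Q l \<iota> T w\<bar> \<le> (\<Sum>r\<in>UNIV. \<bar>l r\<bar> * (\<Sum>k\<in>T. \<bar>W r k w - Wn N r k w\<bar> + d N r k))" for N w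
  proof -
    have "QF v {- int N..int N} (Kmat l \<iota> a T) (\<lambda>i. \<xi> i w) - Q l \<iota> T w
      = (\<Sum>r\<in>UNIV. l r * (\<Sum>k\<in>T. (Wn N r k w - (\<integral>w. Wn N r k w \<partial>M)) - (W r k w - (\<integral>w. W r k w \<partial>M))))"
      unfolding eq Q_def W_def[symmetric] by (simp only: sum_subtractf right_diff_distrib)
    also have "\<bar>\<dots>\<bar> \<le> (\<Sum>r\<in>UNIV. \<bar>l r\<bar> * (\<Sum>k\<in>T. \<bar>(Wn N r k w - (\<integral>w. Wn N r k w \<partial>M)) - (W r k w - (\<integral>w. W r k w \<partial>M))\<bar>))"
      by (rule order_trans[OF sum_abs]) (auto simp: abs_mult intro!: sum_mono mult_left_mono)
    also have "\<dots> \<le> (\<Sum>r\<in>UNIV. \<bar>l r\<bar> * (\<Sum>k\<in>T. \<bar>W r k w - Wn N r k w\<bar> + d N r k))"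
    proof (intro sum_mono mult_left_mono)
      fix r k
      have "\<bar>(\<integral>w. W r k w \<partial>M) - (\<integral>w. Wn N r k w \<partial>M)\<bar> \<le> d N r k"
        unfolding d_def Bochner_Integration.integral_diff[OF iW iWn, symmetric] by (rule integral_abs_bound)
      then show "\<bar>(Wn N r k w - (\<integral>w. Wn N r k w \<partial>M)) - (W r k w - (\<integral>w. W r k w \<partial>M))\<bar> \<le> \<bar>W r k w - Wn N r k w\<bar> + d N r k" by linarith
    qed auto
    finally show ?thesis .
  qed
  show "(\<lambda>N. \<integral>w. \<bar>QF v {- int N..int N} (Kmat l \<iota> a T) (\<lambda>i. \<xi> i w) - Q l \<iota> T w\<bar> \<partial>M) \<longlonglongrightarrow> 0"
  proof (rule tendsto_sandwich[of "\<lambda>_. 0"])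
    show "\<forall>\<^sub>F N in sequentially. (\<integral>w. \<bar>QF v {- int N..int N} (Kmat l \<iota> a T) (\<lambda>i. \<xi> i w) - Q l \<iota> T w\<bar> \<partial>M) \<le> (\<Sum>r\<in>UNIV. \<bar>l r\<bar> * (\<Sum>k\<in>T. d N r k + d N r k))"
    proof (intro always_eventually allI)
      fix N
      have iR: "integrable M (\<lambda>w. \<Sum>r\<in>UNIV. \<bar>l r\<bar> * (\<Sum>k\<in>T. \<bar>W r k w - Wn N r k w\<bar> + d N r k))"
        using iabs by (intro Bochner_Integration.integrable_sum integrable_mult_right Bochner_Integration.integrable_add) auto
      have "(\<integral>w. \<bar>QF v {- int N..int N} (Kmat l \<iota> a T) (\<lambda>i. \<xi> i w) - Q l \<iota> T w\<bar> \<partial>M) \<le> (\<integral>w. (\<Sum>r\<in>UNIV. \<bar>l r\<bar> * (\<Sum>k\<in>T. \<bar>W r k w - Wn N r k w\<bar> + d N r k)) \<partial>M)"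
        by (rule integral_mono[OF integrable_abs[OF Bochner_Integration.integrable_diff[OF i Q_mean(1)]] iR pt])
      also have "\<dots> = (\<Sum>r\<in>UNIV. \<bar>l r\<bar> * (\<Sum>k\<in>T. (\<integral>w. \<bar>W r k w - Wn N r k w\<bar> \<partial>M) + d N r k))"
        using iabs by (simp add: Bochner_Integration.integral_sum M.prob_space)
      finally show "(\<integral>w. \<bar>QF v {- int N..int N} (Kmat l \<iota> a T) (\<lambda>i. \<xi> i w) - Q l \<iota> T w\<bar> \<partial>M) \<le> (\<Sum>r\<in>UNIV. \<bar>l r\<bar> * (\<Sum>k\<in>T. d N r k + d N r k))"
        unfolding d_def .
    qed
    have "(\<lambda>N. \<Sum>r\<in>UNIV. \<bar>l r\<bar> * (\<Sum>k\<in>T. d N r k + d N r k)) \<longlonglongrightarrow> (\<Sum>r\<in>UNIV. \<bar>l r\<bar> * (\<Sum>k\<in>T. 0 + 0))"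
      unfolding d_def by (intro tendsto_intros lW)
    then show "(\<lambda>N. \<Sum>r\<in>UNIV. \<bar>l r\<bar> * (\<Sum>k\<in>T. d N r k + d N r k)) \<longlonglongrightarrow> 0" by simp
  qed simp_all
qed

text \<open>By \<open>stable\<close> the approximating form is the same on every window containing
  V, so on a large window the difference is a single form with the difference matrix. Its
  exponential moments are bounded uniformly in the window, and this bound survives the limit in the
  window.\<close>

lemma deviation_bound:
  assumes V: "finite V"
    and stable: "\<And>W x. finite W \<Longrightarrow> V \<subseteq> W \<Longrightarrow> QF v W (Kmat l \<iota> c T') x = QF v V (Kmat l \<iota> c T') x"
    and bound: "\<And>W. finite W \<Longrightarrow> (\<integral>\<^sup>+x. ennreal (exp (t * QF v W (\<lambda>i j. Kmat l \<iota> a T i j - Kmat l \<iota> c T' i j) x)) \<partial>PiM W (\<lambda>_. \<mu>)) \<le> B"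
  shows "(\<integral>\<^sup>+w. ennreal (exp (t * (Q l \<iota> T w - QF v V (Kmat l \<iota> c T') (\<lambda>i. \<xi> i w)))) \<partial>M) \<le> B"
proof -
  define R where "R w = QF v V (Kmat l \<iota> c T') (\<lambda>i. \<xi> i w)" for w
  define F where "F N w = QF v {- int N..int N} (Kmat l \<iota> a T) (\<lambda>i. \<xi> i w)" for N w
  have [measurable]: "R \<in> borel_measurable M" "F N \<in> borel_measurable M" for N
    unfolding R_def[abs_def] F_def[abs_def] QF_def by measurable
  have iR: "integrable M R" unfolding R_def[abs_def] QF_def
    by (intro Bochner_Integration.integrable_sum integrable_mult_right Bochner_Integration.integrable_diff noise_covariance) simp
  have iF: "integrable M (F N)" for N unfolding F_def[abs_def] by (rule QF_tendsto_Q)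
  show ?thesis
  proof (rule nn_integral_exp_L1_limit[where F = "\<lambda>N w. t * (F N w - R w)"])
    have "(\<lambda>N. \<bar>t\<bar> * (\<integral>w. \<bar>F N w - Q l \<iota> T w\<bar> \<partial>M)) \<longlonglongrightarrow> \<bar>t\<bar> * 0"
      unfolding F_def by (intro tendsto_intros QF_tendsto_Q)
    moreover have "\<bar>t * (F N w - R w) - t * (Q l \<iota> T w - QF v V (Kmat l \<iota> c T') (\<lambda>i. \<xi> i w))\<bar> = \<bar>t\<bar> * \<bar>F N w - Q l \<iota> T w\<bar>" for N w
      unfolding R_def abs_mult[symmetric] by (simp add: algebra_simps)
    ultimately show "(\<lambda>N. \<integral>w. \<bar>t * (F N w - R w) - t * (Q l \<iota> T w - QF v V (Kmat l \<iota> c T') (\<lambda>i. \<xi> i w))\<bar> \<partial>M) \<longlonglongrightarrow> 0" by simp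
    show "\<forall>\<^sub>F N in sequentially. (\<integral>\<^sup>+w. ennreal (exp (t * (F N w - R w))) \<partial>M) \<le> B"
    proof (rule eventually_sequentiallyI[of "nat (Max (insert 0 (abs ` V)))"])
      fix N assume N: "nat (Max (insert 0 (abs ` V))) \<le> N"
      have "V \<subseteq> {- int N..int N}"
      proof
        fix i assume "i \<in> V"
        then have "\<bar>i\<bar> \<le> Max (insert 0 (abs ` V))" using V by (intro Max_ge) auto
        then show "i \<in> {- int N..int N}" using N by auto
      qed
      then have "F N w - R w = QF v {- int N..int N} (\<lambda>i j. Kmat l \<iota> a T i j - Kmat l \<iota> c T' i j) (\<lambda>i. \<xi> i w)" for w
        unfolding F_def R_def QF_diff by (simp add: stable)
      then show "(\<integral>\<^sup>+w. ennreal (exp (t * (F N w - R w))) \<partial>M) \<le> B"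
        using bound[of "{- int N..int N}"] by (simp add: nn_integral_QF_noise)
    qed
  qed (use iF iR Bochner_Integration.integrable_diff[OF Q_mean(1) iR] in \<open>auto simp: R_def[symmetric]\<close>)
qed

end

section \<open>The limit of the cumulant generating functions\<close>

lemma QF_sum: "QF v V (\<lambda>i j. \<Sum>b\<in>B. A b i j) x = (\<Sum>b\<in>B. QF v V (A b) x)"
proof -
  have "QF v V (\<lambda>i j. \<Sum>b\<in>B. A b i j) x = (\<Sum>i\<in>V. \<Sum>j\<in>V. \<Sum>b\<in>B. A b i j * (x i * x j - (if i = j then v else 0)))"
    unfolding QF_def by (simp add: sum_distrib_right)
  also have "\<dots> = (\<Sum>i\<in>V. \<Sum>b\<in>B. \<Sum>j\<in>V. A b i j * (x i * x j - (if i = j then v else 0)))"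
    by (rule sum.cong[OF refl], rule sum.swap)
  also have "\<dots> = (\<Sum>b\<in>B. QF v V (A b) x)" unfolding QF_def by (rule sum.swap)
  finally show ?thesis .
qed

lemma Kmat_UN:
  assumes "finite B" "\<And>b. b \<in> B \<Longrightarrow> finite (T b)" "\<And>b b'. b \<noteq> b' \<Longrightarrow> T b \<inter> T b' = {}"
  shows "Kmat l \<iota> c (\<Union>b\<in>B. T b) i j = (\<Sum>b\<in>B. Kmat l \<iota> c (T b) i j)"
proof -
  have "(\<Sum>k\<in>(\<Union>b\<in>B. T b). F k) = (\<Sum>b\<in>B. \<Sum>k\<in>T b. F k)" for F :: "int \<Rightarrow> real"
    using assms by (intro sum.UNION_disjoint) auto
  then have "Kmat l \<iota> c (\<Union>b\<in>B. T b) i j = (\<Sum>r\<in>UNIV. \<Sum>b\<in>B. l r * (\<Sum>k\<in>T b. c (i - k) * c (j - k - int (\<iota> r))))"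
    unfolding Kmat_def by (simp add: sum_distrib_left)
  also have "\<dots> = (\<Sum>b\<in>B. Kmat l \<iota> c (T b) i j)" unfolding Kmat_def by (rule sum.swap)
  finally show ?thesis .
qed

lemma div_over_n_tendsto:
  assumes "L > 0" shows "(\<lambda>n. real (n div L) / real n) \<longlonglongrightarrow> 1 / real L"
proof (rule tendsto_sandwich)
  have b: "real n / real L - 1 \<le> real (n div L)" "real (n div L) \<le> real n / real L" for n
  proof -
    have "real n = real (n div L) * real L + real (n mod L)"
      unfolding of_nat_mult[symmetric] of_nat_add[symmetric] by simp
    moreover have "real (n mod L) < real L" using assms by simp
    ultimately show "real n / real L - 1 \<le> real (n div L)" "real (n div L) \<le> real n / real L"
      using assms by (simp_all add: field_simps)
  qed
  show "\<forall>\<^sub>F n in sequentially. 1 / real L - 1 / real n \<le> real (n div L) / real n"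
    using eventually_gt_at_top[of 0]
  proof eventually_elim
    case (elim n)
    have "(real n / real L - 1) / real n \<le> real (n div L) / real n" by (intro divide_right_mono b) simp
    then show ?case using elim by (simp add: diff_divide_distrib)
  qed
  show "\<forall>\<^sub>F n in sequentially. real (n div L) / real n \<le> 1 / real L"
    using eventually_gt_at_top[of 0]
  proof eventually_elim
    case (elim n)
    have "real (n div L) / real n \<le> (real n / real L) / real n" by (intro divide_right_mono b) simp
    then show ?case using elim by simp
  qed
  have "(\<lambda>n. 1 / real L - 1 / real n) \<longlonglongrightarrow> 1 / real L - 0" by (intro tendsto_intros lim_1_over_n)
  then show "(\<lambda>n. 1 / real L - 1 / real n) \<longlonglongrightarrow> 1 / real L" by simp
qed simp

text \<open>T b is the b-th block of p times and V b the set of noise indices that it involves; the period L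
  is the cardinality of V b, so that the sets V b are disjoint.\<close>

locale blocked_filter = finite_filter c H for c :: "int \<Rightarrow> real" and H :: nat +
  fixes m p :: nat
begin

definition L :: nat where "L = p + m + 2 * H + 1"
definition V0 :: "int set" where "V0 = {- int H..int p + int m + int H}"
text \<open>The summand 1 is there because the sums over k start at 1.\<close>

definition s :: "nat \<Rightarrow> int" where "s b = 1 + int b * int L"
definition V :: "nat \<Rightarrow> int set" where "V b = (\<lambda>i. i + s b) ` V0"
definition T :: "nat \<Rightarrow> int set" where "T b = (\<lambda>i. i + s b) ` {0..<int p}"
definition VV :: "nat \<Rightarrow> int set" where "VV J = (\<Union>b<J. V b)"
definition TT :: "nat \<Rightarrow> int set" where "TT J = (\<Union>b<J. T b)"

lemma L_pos: "0 < L" by (simp add: L_def)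

lemma V_eq: "V b = {s b - int H..s b + int p + int m + int H}"
  unfolding V_def V0_def by (simp add: image_add_atLeastAtMost' algebra_simps)

lemma T_eq: "T b = {s b..<s b + int p}"
  unfolding T_def by (simp add: image_add_atLeastLessThan' algebra_simps)

lemma finite_V [simp]: "finite (V b)" "finite (VV J)" by (auto simp: V_eq VV_def)
lemma finite_T [simp]: "finite (T b)" "finite (TT J)" by (auto simp: T_eq TT_def)

lemma s_gap: "b < b' \<Longrightarrow> s b + int L \<le> s b'"
proof -
  assume "b < b'"
  then have "int (Suc b) * int L \<le> int b' * int L" by (intro mult_right_mono) auto
  then show ?thesis by (simp add: s_def algebra_simps)
qed

lemma V_disjoint: "b \<noteq> b' \<Longrightarrow> V b \<inter> V b' = {}"
proof (induction b b' rule: linorder_wlog)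
  case (le b b')
  then have "s b + int L \<le> s b'" by (intro s_gap) auto
  then show ?case by (auto simp: V_eq L_def)
qed (auto simp: Int_commute)

lemma T_disjoint: "b \<noteq> b' \<Longrightarrow> T b \<inter> T b' = {}"
  using V_disjoint[of b b'] by (auto simp: V_eq T_eq)

text \<open>Only the times of the blocks have to lie in {1..n}; the noise windows \<open>V b\<close>
  may stick out. The last complete period ends at n at the latest, because
  \<open>s (n div L)\<close> is at most n + 1.\<close>

lemma TT_subset: "TT (n div L) \<subseteq> {1..int n}"
proof
  fix k assume "k \<in> TT (n div L)"
  then obtain b where b: "b < n div L" "s b \<le> k" "k < s b + int p" by (auto simp: TT_def T_eq)
  have "s b + int L \<le> s (n div L)" by (rule s_gap[OF b(1)])
  moreover have "int (n div L) * int L \<le> int n" unfolding of_nat_mult[symmetric] of_nat_le_iff by (rule div_times_less_eq_dividend)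
  moreover have "s (n div L) = 1 + int (n div L) * int L" "1 \<le> s b" "int p \<le> int L" by (simp_all add: s_def L_def)
  ultimately show "k \<in> {1..int n}" using b(2,3) by simp
qed

lemma card_rest: "real (card ({1..int n} - TT (n div L))) = real n - real (n div L) * real p"
proof -
  have "card (TT J) = J * p" for J
    unfolding TT_def by (subst card_UN_disjoint) (use T_disjoint in \<open>auto simp: T_eq\<close>)
  then have "card ({1..int n} - TT (n div L)) = n - n div L * p"
    using TT_subset by (subst card_Diff_subset) auto
  moreover have "n div L * p \<le> n"
  proof -
    have "n div L * p \<le> n div L * L" by (intro mult_le_mono) (simp_all add: L_def)
    also have "\<dots> \<le> n" by (rule div_times_less_eq_dividend)
    finally show ?thesis .
  qed
  ultimately show ?thesis by (simp add: of_nat_diff)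
qed

lemma QF_TT:
  fixes \<iota> :: "'n::finite \<Rightarrow> nat"
  assumes \<iota>: "\<And>r. \<iota> r \<le> m" and W: "finite W" "VV J \<subseteq> W"
  shows "QF v W (Kmat l \<iota> c (TT J)) x = (\<Sum>b<J. QF v (V b) (Kmat l \<iota> c (T b)) x)"
proof -
  have "QF v W (Kmat l \<iota> c (TT J)) x = (\<Sum>b<J. QF v W (Kmat l \<iota> c (T b)) x)"
  proof -
    have "Kmat l \<iota> c (TT J) = (\<lambda>i j. \<Sum>b<J. Kmat l \<iota> c (T b) i j)"
      unfolding TT_def using T_disjoint by (intro ext Kmat_UN) auto
    then show ?thesis by (simp add: QF_sum)
  qed
  also have "\<dots> = (\<Sum>b<J. QF v (V b) (Kmat l \<iota> c (T b)) x)"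
  proof (intro sum.cong refl)
    fix b assume "b \<in> {..<J}"
    then have sub: "V b \<subseteq> W" using W by (auto simp: VV_def)
    show "QF v W (Kmat l \<iota> c (T b)) x = QF v (V b) (Kmat l \<iota> c (T b)) x"
    proof (rule QF_Kmat_support[OF W(1) sub])
      show "c (i - k) = 0" if "i \<in> W - V b" "k \<in> T b" for i k
        using that by (intro supp) (auto simp: V_eq T_eq)
      show "c (i - k - int (\<iota> r)) = 0" if "i \<in> W - V b" "k \<in> T b" for i k r
        using that \<iota>[of r] by (intro supp) (auto simp: V_eq T_eq)
    qed
  qed
  finally show ?thesis .
qed

end

section \<open>Cumulants of the block sums and comparison with the process\<close>

locale blocked_process =
  linear_process \<mu> K v \<Omega> a \<xi> X + blocked_filter c H m p
  for \<mu> :: "real measure" and K v :: real and \<Omega> :: "'a measure" and a :: "int \<Rightarrow> real" and \<xi> X :: "int \<Rightarrow> 'a \<Rightarrow> real"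
    and c :: "int \<Rightarrow> real" and H m p :: nat +
  fixes l :: "'n::finite \<Rightarrow> real" and \<iota> :: "'n \<Rightarrow> nat"
  assumes lag_le: "\<And>r. \<iota> r \<le> m"
begin

definition U :: "(int \<Rightarrow> real) \<Rightarrow> real" where "U = QF v V0 (Kmat l \<iota> c {0..<int p})"

definition R :: "nat \<Rightarrow> 'a \<Rightarrow> real" where
  "R n \<omega> = QF v (VV (n div L)) (Kmat l \<iota> c (TT (n div L))) (\<lambda>i. \<xi> i \<omega>)"

lemma rv_R [measurable]: "R n \<in> borel_measurable \<Omega>"
  unfolding R_def[abs_def] QF_def by measurable

text \<open>Disjoint noise windows make the blocks independent and the shift makes them identically
  distributed. The condition L \<le> n provides at least one block, so that the set of noise indices
  is not empty.\<close>

lemma block_mgf: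
  assumes n: "L \<le> n"
  shows "(\<integral>\<^sup>+\<omega>. ennreal (exp (t * R n \<omega>)) \<partial>\<Omega>) = (\<integral>\<^sup>+x. ennreal (exp (t * U x)) \<partial>PiM V0 (\<lambda>_. \<mu>)) ^ (n div L)"
proof -
  define J where "J = n div L"
  have J: "0 < J" unfolding J_def using n L_pos by (simp add: div_greater_zero_iff)
  have "V 0 \<subseteq> VV J" using J by (auto simp: VV_def)
  moreover have "V 0 \<noteq> {}" by (auto simp: V_eq)
  ultimately have ne: "VV J \<noteq> {}" by auto
  have "(\<integral>\<^sup>+\<omega>. ennreal (exp (t * R n \<omega>)) \<partial>\<Omega>) = (\<integral>\<^sup>+x. ennreal (exp (t * QF v (VV J) (Kmat l \<iota> c (TT J)) x)) \<partial>PiM (VV J) (\<lambda>_. \<mu>))"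
    unfolding R_def J_def[symmetric] by (rule nn_integral_QF_noise[OF ne])
  also have "\<dots> = (\<integral>\<^sup>+x. ennreal (exp (t * (\<Sum>b<J. QF v (V b) (Kmat l \<iota> c (T b)) x))) \<partial>PiM (\<Union>b<J. V b) (\<lambda>_. \<mu>))"
    unfolding VV_def[symmetric] by (simp only: QF_TT[OF lag_le finite_V(2) order_refl])
  also have "\<dots> = (\<Prod>b<J. \<integral>\<^sup>+x. ennreal (exp (t * QF v (V b) (Kmat l \<iota> c (T b)) x)) \<partial>PiM (V b) (\<lambda>_. \<mu>))"
    by (rule nn_integral_QF_blocks) (simp_all add: V_disjoint)
  also have "\<dots> = (\<integral>\<^sup>+x. ennreal (exp (t * U x)) \<partial>PiM V0 (\<lambda>_. \<mu>)) ^ J"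
    unfolding V_def T_def nn_integral_QF_shift U_def by simp
  finally show ?thesis unfolding J_def .
qed

text \<open>Each block contributes the cumulant function of one fixed variable at \<tau> t_n, which
  tends to 0, and the number of blocks is asymptotically n/L. The factor \<tau> will be a Hoelder
  exponent or its inverse.\<close>

lemma main_term:
  fixes t :: "nat \<Rightarrow> real"
  assumes t: "t \<longlonglongrightarrow> 0" "\<And>n. n \<ge> 1 \<Longrightarrow> t n > 0" and \<tau>: "\<tau> > 0"
  shows "\<exists>G. (\<forall>\<^sub>F n in sequentially. (\<integral>\<^sup>+\<omega>. ennreal (exp (\<tau> * t n * R n \<omega>)) \<partial>\<Omega>) = ennreal (exp (G n))) \<and>
    (\<lambda>n. G n / (real n * (t n)\<^sup>2)) \<longlonglongrightarrow> \<tau>\<^sup>2 * ((\<integral>x. (U x)\<^sup>2 \<partial>PiM V0 (\<lambda>_. \<mu>)) / (2 * real L))"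
proof -
  interpret PP: prob_space "PiM V0 (\<lambda>_. \<mu>)" by (rule prob_PiM)
  have fV: "finite V0" by (simp add: V0_def)
  define \<Lambda> where "\<Lambda> u = ln (\<integral>x. exp (u * U x) \<partial>PiM V0 (\<lambda>_. \<mu>))" for u
  define S where "S = (\<integral>x. (U x)\<^sup>2 \<partial>PiM V0 (\<lambda>_. \<mu>))"
  define G where "G n = real (n div L) * \<Lambda> (\<tau> * t n)" for n
  obtain d where d: "d > 0" "\<And>u. \<bar>u\<bar> \<le> d \<Longrightarrow> integrable (PiM V0 (\<lambda>_. \<mu>)) (\<lambda>x. exp (u * U x))"
    unfolding U_def using QF_exp_integrable[OF fV, of "Kmat l \<iota> c {0..<int p}"] by blast
  have lt: "(\<lambda>n. \<tau> * t n) \<longlonglongrightarrow> 0" using tendsto_mult_right_zero[OF t(1)] .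
  have ev: "\<forall>\<^sub>F n in sequentially. \<bar>\<tau> * t n\<bar> \<le> d"
    using order_tendstoD(2)[OF tendsto_rabs_zero[OF lt] d(1)] by (rule eventually_mono) simp
  have "\<forall>\<^sub>F n in sequentially. (\<integral>\<^sup>+\<omega>. ennreal (exp (\<tau> * t n * R n \<omega>)) \<partial>\<Omega>) = ennreal (exp (G n))"
    using ev eventually_ge_at_top[of L]
  proof eventually_elim
    case (elim n)
    define I where "I = (\<integral>x. exp (\<tau> * t n * U x) \<partial>PiM V0 (\<lambda>_. \<mu>))"
    have I: "I > 0" unfolding I_def by (rule PP.expectation_exp_pos[OF d(2)[OF elim(1)]])
    have "(\<integral>\<^sup>+x. ennreal (exp (\<tau> * t n * U x)) \<partial>PiM V0 (\<lambda>_. \<mu>)) = ennreal I"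
      unfolding I_def by (rule nn_integral_eq_integral[OF d(2)[OF elim(1)]]) simp
    moreover have "I ^ (n div L) = exp (G n)"
    proof -
      have "exp (G n) = exp (\<Lambda> (\<tau> * t n)) ^ (n div L)" unfolding G_def by (rule exp_of_nat_mult)
      then show ?thesis using I by (simp add: \<Lambda>_def I_def)
    qed
    ultimately show ?case using I by (simp add: block_mgf[OF elim(2)] ennreal_power)
  qed
  moreover have "(\<lambda>n. G n / (real n * (t n)\<^sup>2)) \<longlonglongrightarrow> \<tau>\<^sup>2 * (S / (2 * real L))"
  proof -
    have "filterlim (\<lambda>n. \<tau> * t n) (at 0) sequentially"
    proof (rule filterlim_atI[OF lt])
      show "\<forall>\<^sub>F n in sequentially. \<tau> * t n \<noteq> 0"
        using eventually_ge_at_top[of 1] by eventually_elim (use t(2) \<tau> in force)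
    qed
    from filterlim_compose[OF QF_cgf_at_zero[OF fV, of "Kmat l \<iota> c {0..<int p}"] this]
    have "(\<lambda>n. \<Lambda> (\<tau> * t n) / (\<tau> * t n)\<^sup>2) \<longlonglongrightarrow> S / 2"
      unfolding \<Lambda>_def S_def U_def .
    then have "(\<lambda>n. \<tau>\<^sup>2 * (real (n div L) / real n * (\<Lambda> (\<tau> * t n) / (\<tau> * t n)\<^sup>2))) \<longlonglongrightarrow> \<tau>\<^sup>2 * (1 / real L * (S / 2))"
      by (intro tendsto_mult tendsto_const div_over_n_tendsto L_pos)
    moreover have "\<forall>\<^sub>F n in sequentially. \<tau>\<^sup>2 * (real (n div L) / real n * (\<Lambda> (\<tau> * t n) / (\<tau> * t n)\<^sup>2)) = G n / (real n * (t n)\<^sup>2)"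
      using eventually_ge_at_top[of 1]
    proof eventually_elim
      case (elim n)
      then show ?case using t(2)[OF elim] \<tau> by (simp add: G_def power_mult_distrib field_simps)
    qed
    ultimately show ?thesis by (simp add: tendsto_cong mult.commute)
  qed
  ultimately show ?thesis unfolding S_def by blast
qed

end

lemma (in finite_filter) integrable_P4: "integrable torus (\<lambda>\<theta>. (cmod (P \<theta>)) ^ 4)"
proof (rule integrable_torus_bounded[of _ "((\<Sum>k\<in>{- int M..int M}. \<bar>c k\<bar>)\<^sup>2)\<^sup>2"])
  have [measurable]: "P \<in> borel_measurable torus" unfolding P_def by measurable
  show "(\<lambda>\<theta>. (cmod (P \<theta>)) ^ 4) \<in> borel_measurable torus" by measurable
  fix \<theta>
  have "((cmod (P \<theta>))\<^sup>2)\<^sup>2 \<le> ((\<Sum>k\<in>{- int M..int M}. \<bar>c k\<bar>)\<^sup>2)\<^sup>2" by (intro power_mono norm_P_bounded) simp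
  then show "norm ((cmod (P \<theta>)) ^ 4) \<le> ((\<Sum>k\<in>{- int M..int M}. \<bar>c k\<bar>)\<^sup>2)\<^sup>2" by simp
qed

context blocked_process
begin

text \<open>The bound of \<open>Kmat_diff_hs\<close> with x in the place of the number of all times
  and y in that of the times outside the blocks. It is linear in (x, y), so a factor n can be taken
  out.\<close>

definition HS :: "(real \<Rightarrow> complex) \<Rightarrow> real \<Rightarrow> real \<Rightarrow> real \<Rightarrow> real" where
  "HS g \<sigma> x y = 3 * (\<Sum>r\<in>UNIV. (l r)\<^sup>2) * real CARD('n) / (4 * pi) *
     (x * (2 * \<sigma> * (\<integral>\<theta>. (cmod (g \<theta> - P \<theta>)) ^ 4 \<partial>torus)
          + ((\<integral>\<theta>. (cmod (g \<theta>)) ^ 4 \<partial>torus) + (\<integral>\<theta>. (cmod (P \<theta>)) ^ 4 \<partial>torus)) / \<sigma>)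
      + y * (2 * (\<integral>\<theta>. (cmod (P \<theta>)) ^ 4 \<partial>torus)))"

lemma HS_nonneg: "0 < \<sigma> \<Longrightarrow> 0 \<le> x \<Longrightarrow> 0 \<le> y \<Longrightarrow> 0 \<le> HS g \<sigma> x y"
  unfolding HS_def by (intro mult_nonneg_nonneg add_nonneg_nonneg divide_nonneg_nonneg sum_nonneg integral_nonneg_AE) auto

lemma HS_scale: "HS g \<sigma> (z * x) (z * y) = z * HS g \<sigma> x y"
  unfolding HS_def by (simp add: algebra_simps)

context
  fixes g :: "real \<Rightarrow> complex" and t :: "nat \<Rightarrow> real" and c0 C C1 r \<sigma> :: real
  assumes hwC: "\<And>V A \<rho> u. finite V \<Longrightarrow> op_le V A \<rho> \<Longrightarrow> \<bar>u\<bar> * \<rho> \<le> c0 \<Longrightarrow>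
      (\<integral>\<^sup>+x. ennreal (exp (u * QF v V A x)) \<partial>PiM V (\<lambda>_. \<mu>)) \<le> ennreal (exp (C * u\<^sup>2 * (\<Sum>i\<in>V. \<Sum>j\<in>V. (A i j)\<^sup>2)))"
    and c0: "0 < c0" and C: "0 < C"
    and Fa: "fourier_series a g" and ig: "integrable torus (\<lambda>\<theta>. (cmod (g \<theta>)) ^ 4)"
    and ie: "integrable torus (\<lambda>\<theta>. (cmod (g \<theta> - P \<theta>)) ^ 4)"
    and op: "0 \<le> C1" "\<And>n K V y. 1 \<le> n \<Longrightarrow> finite K \<Longrightarrow> card K \<le> n \<Longrightarrow> finite V \<Longrightarrow>
        (\<Sum>i\<in>V. (\<Sum>k\<in>K. a (i - k) * y k)\<^sup>2) \<le> C1 * real n powr r * (\<Sum>k\<in>K. (y k)\<^sup>2)"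
    and t: "t \<longlonglongrightarrow> 0" "\<And>n. n \<ge> 1 \<Longrightarrow> t n > 0" and tr: "(\<lambda>n. t n * real n powr r) \<longlonglongrightarrow> 0"
    and \<sigma>: "0 < \<sigma>"
begin

text \<open>The proportion of the times in {1..n} that belong to no block; it tends to 1 - p/L,
  which is small when p is large compared with m and the filter order.\<close>

definition rest :: "nat \<Rightarrow> real" where "rest n = 1 - real (n div L) / real n * real p"

lemma rest_tendsto: "rest \<longlonglongrightarrow> 1 - real p / real L"
proof -
  have "(\<lambda>n. 1 - real (n div L) / real n * real p) \<longlonglongrightarrow> 1 - 1 / real L * real p"
    by (intro tendsto_diff tendsto_mult tendsto_const div_over_n_tendsto L_pos)
  then show ?thesis by (simp add: rest_def[abs_def])
qed

lemma deviation:
  "\<forall>\<^sub>F n in sequentially. (\<integral>\<^sup>+\<omega>. ennreal (exp (\<tau> * t n * (Q l \<iota> {1..int n} \<omega> - R n \<omega>))) \<partial>\<Omega>)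
     \<le> ennreal (exp (C * (\<tau> * t n)\<^sup>2 * (real n * HS g \<sigma> 1 (rest n))))"
proof -
  define B where "B = (\<Sum>k\<in>{- int H..int H}. \<bar>c k\<bar>)\<^sup>2"
  define D where "D = sqrt (2 * (\<Sum>r\<in>UNIV. (l r)\<^sup>2) * real CARD('n))"
  \<comment> \<open>The quantity that Hanson-Wright wants below c0: the parameter |\<tau>| t_n times
    the operator bound of \<open>Kmat_diff_op\<close>. The filter a contributes C1 n^r and the
    finite filter c the constant B.\<close>
  have "(\<lambda>n. \<bar>\<tau>\<bar> * (D * (C1 * (t n * real n powr r) + B * t n))) \<longlonglongrightarrow> \<bar>\<tau>\<bar> * (D * (C1 * 0 + B * 0))"
    by (intro tendsto_mult tendsto_const tendsto_add tr t(1))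
  then have "(\<lambda>n. \<bar>\<tau>\<bar> * (D * (C1 * (t n * real n powr r) + B * t n))) \<longlonglongrightarrow> 0" by simp
  from order_tendstoD(2)[OF this c0] eventually_ge_at_top[of 1]
  show ?thesis
  proof eventually_elim
    case (elim n)
    have fa: "filter_bound a {1..int n} (C1 * real n powr r)"
      unfolding filter_bound_def using op elim(2) by auto
    have fc: "filter_bound c (TT (n div L)) B" unfolding B_def by (rule filter_bound_P) simp
    have small: "\<bar>\<tau> * t n\<bar> * (D * (C1 * real n powr r + B)) \<le> c0"
      using elim t(2)[of n] by (simp add: abs_mult algebra_simps)
    have rest: "real (card ({1..int n} - TT (n div L))) = real n * rest n"
      unfolding card_rest rest_def using elim(2) by (simp add: right_diff_distrib)
    show ?case
      unfolding R_def
    proof (rule deviation_bound[OF finite_V(2)])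
      show "QF v W (Kmat l \<iota> c (TT (n div L))) x = QF v (VV (n div L)) (Kmat l \<iota> c (TT (n div L))) x"
        if "finite W" "VV (n div L) \<subseteq> W" for W x
        using that by (simp add: QF_TT[OF lag_le])
      fix W :: "int set" assume W: "finite W"
      have "(\<integral>\<^sup>+x. ennreal (exp (\<tau> * t n * QF v W (\<lambda>i j. Kmat l \<iota> a {1..int n} i j - Kmat l \<iota> c (TT (n div L)) i j) x)) \<partial>PiM W (\<lambda>_. \<mu>))
        \<le> ennreal (exp (C * (\<tau> * t n)\<^sup>2 * (\<Sum>i\<in>W. \<Sum>j\<in>W. (Kmat l \<iota> a {1..int n} i j - Kmat l \<iota> c (TT (n div L)) i j)\<^sup>2)))"
        by (rule hwC[OF W Kmat_diff_op[OF fa fc W] small[unfolded D_def]])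
      also have "\<dots> \<le> ennreal (exp (C * (\<tau> * t n)\<^sup>2 * (real n * HS g \<sigma> 1 (rest n))))"
      proof (rule ennreal_leI, unfold exp_le_cancel_iff, rule mult_left_mono)
        have "(\<Sum>i\<in>W. \<Sum>j\<in>W. (Kmat l \<iota> a {1..int n} i j - Kmat l \<iota> c (TT (n div L)) i j)\<^sup>2) \<le> HS g \<sigma> (real n) (real n * rest n)"
          using Kmat_diff_hs[OF Fa fourier_series_P fourier_series_diff[OF Fa] ig integrable_P4 ie _ TT_subset W \<sigma>, of n l \<iota>]
          unfolding HS_def rest by simp
        then show "(\<Sum>i\<in>W. \<Sum>j\<in>W. (Kmat l \<iota> a {1..int n} i j - Kmat l \<iota> c (TT (n div L)) i j)\<^sup>2) \<le> real n * HS g \<sigma> 1 (rest n)"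
          using HS_scale[of g \<sigma> "real n" 1 "rest n"] by simp
      qed (use C in simp)
      finally show "(\<integral>\<^sup>+x. ennreal (exp (\<tau> * t n * QF v W (\<lambda>i j. Kmat l \<iota> a {1..int n} i j - Kmat l \<iota> c (TT (n div L)) i j) x)) \<partial>PiM W (\<lambda>_. \<mu>))
        \<le> ennreal (exp (C * (\<tau> * t n)\<^sup>2 * (real n * HS g \<sigma> 1 (rest n))))" .
    qed
  qed
qed

lemma HS_tendsto: "(\<lambda>n. HS g \<sigma> 1 (rest n)) \<longlonglongrightarrow> HS g \<sigma> 1 (1 - real p / real L)"
  unfolding HS_def by (intro tendsto_intros rest_tendsto)

text \<open>For the upper bound, Hoelder with exponents \<alpha> = 1 + \<delta> and \<beta> = (1 +
  \<delta>)/\<delta> is applied to Q = R + (Q - R). For the lower bound the same exponents are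
  applied to R/\<alpha> = Q/\<alpha> - (Q - R)/\<alpha>. In both the factor of the error grows like
  1/\<delta>, so the error \<open>h\<close> has to be made small after \<delta> is fixed.\<close>

lemma cgf_sandwich:
  assumes \<delta>: "0 < \<delta>" and \<eta>: "0 < \<eta>"
  defines "w \<equiv> (\<integral>x. (U x)\<^sup>2 \<partial>PiM V0 (\<lambda>_. \<mu>)) / (2 * real L)" and "h \<equiv> HS g \<sigma> 1 (1 - real p / real L)"
  defines "A \<equiv> \<lambda>n. ln (\<integral>\<omega>. exp (t n * Q l \<iota> {1..int n} \<omega>) \<partial>\<Omega>) / (real n * (t n)\<^sup>2)"
  shows "\<forall>\<^sub>F n in sequentially. integrable \<Omega> (\<lambda>\<omega>. exp (t n * Q l \<iota> {1..int n} \<omega>)) \<and>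
      A n \<le> (1 + \<delta>) * w + C * ((1 + \<delta>) / \<delta>) * h + \<eta> \<and> w / (1 + \<delta>) - C * ((1 + \<delta>) / \<delta>) * h - \<eta> \<le> A n"
proof -
  define \<alpha> where "\<alpha> = 1 + \<delta>"
  define \<beta> where "\<beta> = (1 + \<delta>) / \<delta>"
  have ab: "\<alpha> > 1" "\<beta> > 0" "1 / \<alpha> + 1 / \<beta> = 1" using \<delta> by (auto simp: \<alpha>_def \<beta>_def field_simps)
  have hn: "0 \<le> h" unfolding h_def by (rule HS_nonneg[OF \<sigma>]) (simp_all add: L_def)
  define q where "q n = HS g \<sigma> 1 (rest n)" for n
  have lq: "q \<longlonglongrightarrow> h" unfolding q_def[abs_def] h_def by (rule HS_tendsto)
  obtain G1 where G1: "\<forall>\<^sub>F n in sequentially. (\<integral>\<^sup>+\<omega>. ennreal (exp (\<alpha> * t n * R n \<omega>)) \<partial>\<Omega>) = ennreal (exp (G1 n))"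
    and lG1: "(\<lambda>n. G1 n / (real n * (t n)\<^sup>2)) \<longlonglongrightarrow> \<alpha>\<^sup>2 * w"
    using main_term[OF t, of \<alpha>] ab unfolding w_def by auto
  obtain G2 where G2: "\<forall>\<^sub>F n in sequentially. (\<integral>\<^sup>+\<omega>. ennreal (exp (1 / \<alpha> * t n * R n \<omega>)) \<partial>\<Omega>) = ennreal (exp (G2 n))"
    and lG2: "(\<lambda>n. G2 n / (real n * (t n)\<^sup>2)) \<longlonglongrightarrow> (1 / \<alpha>)\<^sup>2 * w"
    using main_term[OF t, of "1 / \<alpha>"] ab unfolding w_def by auto
  have l1: "(\<lambda>n. G1 n / (real n * (t n)\<^sup>2) / \<alpha> + C * \<beta> * q n) \<longlonglongrightarrow> \<alpha>\<^sup>2 * w / \<alpha> + C * \<beta> * h"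
    using ab by (intro tendsto_intros lG1 lq) auto
  have l2: "(\<lambda>n. \<alpha> * (G2 n / (real n * (t n)\<^sup>2)) - C * \<beta> / \<alpha> * q n) \<longlonglongrightarrow> \<alpha> * ((1 / \<alpha>)\<^sup>2 * w) - C * \<beta> / \<alpha> * h"
    using ab by (intro tendsto_intros lG2 lq) auto
  have v1: "\<alpha>\<^sup>2 * w / \<alpha> = (1 + \<delta>) * w" using ab by (simp add: power2_eq_square \<alpha>_def)
  have v2: "\<alpha> * ((1 / \<alpha>)\<^sup>2 * w) = w / (1 + \<delta>)" using ab by (simp add: power2_eq_square \<alpha>_def)
  have v3: "C * \<beta> / \<alpha> * h \<le> C * \<beta> * h"
  proof -
    have "C * \<beta> / \<alpha> \<le> C * \<beta> / 1" using ab C by (intro divide_left_mono) auto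
    then show ?thesis using hn by (intro mult_right_mono) auto
  qed
  have e1: "\<forall>\<^sub>F n in sequentially. G1 n / (real n * (t n)\<^sup>2) / \<alpha> + C * \<beta> * q n < (1 + \<delta>) * w + C * \<beta> * h + \<eta>"
    using \<eta> by (intro order_tendstoD(2)[OF l1]) (simp add: v1)
  have e2: "\<forall>\<^sub>F n in sequentially. w / (1 + \<delta>) - C * \<beta> * h - \<eta> < \<alpha> * (G2 n / (real n * (t n)\<^sup>2)) - C * \<beta> / \<alpha> * q n"
    using \<eta> v3 by (intro order_tendstoD(1)[OF l2]) (simp add: v2)
  show ?thesis
    using G1 G2 deviation[of \<beta>] deviation[of "- (\<beta> / \<alpha>)"] e1 e2 eventually_ge_at_top[of 1]
  proof eventually_elim
    case (elim n)
    define T where "T = {1..int n}"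
    define N where "N = real n * (t n)\<^sup>2"
    have N: "N > 0" using elim(7) t(2)[of n] by (simp add: N_def)
    have "(\<integral>\<^sup>+\<omega>. ennreal (exp (t n * R n \<omega> + t n * (Q l \<iota> T \<omega> - R n \<omega>))) \<partial>\<Omega>)
        \<le> ennreal (exp (G1 n / \<alpha> + (C * (\<beta> * t n)\<^sup>2 * (real n * q n)) / \<beta>))"
    proof (rule M.exp_holder)
      show "(\<integral>\<^sup>+\<omega>. ennreal (exp (\<alpha> * (t n * R n \<omega>))) \<partial>\<Omega>) \<le> ennreal (exp (G1 n))" using elim(1) by (simp add: mult.assoc)
      show "(\<integral>\<^sup>+\<omega>. ennreal (exp (\<beta> * (t n * (Q l \<iota> T \<omega> - R n \<omega>)))) \<partial>\<Omega>) \<le> ennreal (exp (C * (\<beta> * t n)\<^sup>2 * (real n * q n)))"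
        using elim(3) by (simp add: mult.assoc q_def T_def)
    qed (use ab in auto)
    moreover have "C * (\<beta> * t n)\<^sup>2 * (real n * q n) / \<beta> = C * \<beta> * q n * N" using ab by (simp add: N_def power2_eq_square)
    ultimately have up: "(\<integral>\<^sup>+\<omega>. ennreal (exp (t n * Q l \<iota> T \<omega>)) \<partial>\<Omega>) \<le> ennreal (exp (G1 n / \<alpha> + C * \<beta> * q n * N))"
      by (simp add: right_diff_distrib)
    have int: "integrable \<Omega> (\<lambda>\<omega>. exp (t n * Q l \<iota> T \<omega>))"
    proof (rule integrableI_nonneg)
      show "(\<integral>\<^sup>+\<omega>. ennreal (exp (t n * Q l \<iota> T \<omega>)) \<partial>\<Omega>) < \<infinity>" using le_less_trans[OF up ennreal_less_top] by simp
    qed auto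
    define I where "I = (\<integral>\<omega>. exp (t n * Q l \<iota> T \<omega>) \<partial>\<Omega>)"
    have I: "I > 0" unfolding I_def by (rule M.expectation_exp_pos[OF int])
    have nnI: "(\<integral>\<^sup>+\<omega>. ennreal (exp (t n * Q l \<iota> T \<omega>)) \<partial>\<Omega>) = ennreal (exp (ln I))"
      using nn_integral_eq_integral[OF int] I by (simp add: I_def)
    have "I \<le> exp (G1 n / \<alpha> + C * \<beta> * q n * N)" using up I unfolding nnI by simp
    then have "ln I \<le> ln (exp (G1 n / \<alpha> + C * \<beta> * q n * N))" using I by (subst ln_le_cancel_iff) auto
    then have "ln I \<le> G1 n / \<alpha> + C * \<beta> * q n * N" by simp
    then have "ln I / N \<le> (G1 n / \<alpha> + C * \<beta> * q n * N) / N" using N by (intro divide_right_mono) auto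
    also have "\<dots> = G1 n / N / \<alpha> + C * \<beta> * q n" using N by (simp add: add_divide_distrib mult.commute)
    finally have A1: "ln I / N \<le> (1 + \<delta>) * w + C * \<beta> * h + \<eta>" using elim(5) unfolding N_def by linarith
    \<comment> \<open>The sum in the exponent is t n R/\<alpha>. Raising the second factor to the
      power \<beta> produces the parameter -\<beta>/\<alpha> in \<open>deviation\<close>.\<close>
    have H1: "(\<integral>\<^sup>+\<omega>. ennreal (exp (1 / \<alpha> * t n * Q l \<iota> T \<omega> + - (1 / \<alpha>) * t n * (Q l \<iota> T \<omega> - R n \<omega>))) \<partial>\<Omega>)
        \<le> ennreal (exp (ln I / \<alpha> + (C * (- (\<beta> / \<alpha>) * t n)\<^sup>2 * (real n * q n)) / \<beta>))"
    proof (rule M.exp_holder)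
      have "\<alpha> * (1 / \<alpha> * t n * x) = t n * x" for x using ab by simp
      then show "(\<integral>\<^sup>+\<omega>. ennreal (exp (\<alpha> * (1 / \<alpha> * t n * Q l \<iota> T \<omega>))) \<partial>\<Omega>) \<le> ennreal (exp (ln I))" using nnI by simp
      have eq: "\<beta> * (- (1 / \<alpha>) * t n * x) = - (\<beta> / \<alpha>) * t n * x" for x by simp
      show "(\<integral>\<^sup>+\<omega>. ennreal (exp (\<beta> * (- (1 / \<alpha>) * t n * (Q l \<iota> T \<omega> - R n \<omega>)))) \<partial>\<Omega>)
          \<le> ennreal (exp (C * (- (\<beta> / \<alpha>) * t n)\<^sup>2 * (real n * q n)))"
        using elim(4) unfolding q_def T_def by (simp only: eq)
    qed (use ab in auto)
    have eq1: "C * (- (\<beta> / \<alpha>) * t n)\<^sup>2 * (real n * q n) / \<beta> = C * \<beta> / \<alpha> * q n * N / \<alpha>"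
      using ab by (simp add: N_def power2_eq_square)
    have eq2: "z * t n * x + - z * t n * (x - y) = z * t n * y" for x y z by (simp add: algebra_simps)
    have "ennreal (exp (G2 n)) \<le> ennreal (exp (ln I / \<alpha> + C * \<beta> / \<alpha> * q n * N / \<alpha>))"
      using H1 unfolding eq1 eq2 elim(2) .
    then have "G2 n \<le> ln I / \<alpha> + C * \<beta> / \<alpha> * q n * N / \<alpha>" by simp
    then have "\<alpha> * G2 n \<le> \<alpha> * (ln I / \<alpha> + C * \<beta> / \<alpha> * q n * N / \<alpha>)" using ab by (intro mult_left_mono) auto
    also have "\<dots> = ln I + C * \<beta> / \<alpha> * q n * N" using ab by (simp add: distrib_left)
    finally have "\<alpha> * G2 n / N \<le> (ln I + C * \<beta> / \<alpha> * q n * N) / N" using N by (intro divide_right_mono) auto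
    also have "\<dots> = ln I / N + C * \<beta> / \<alpha> * q n" using N by (simp add: add_divide_distrib)
    finally have "\<alpha> * (G2 n / N) - C * \<beta> / \<alpha> * q n \<le> ln I / N" by simp
    then have A2: "w / (1 + \<delta>) - C * \<beta> * h - \<eta> \<le> ln I / N" using elim(6) unfolding N_def by linarith
    show ?case using int A1 A2 unfolding A_def I_def N_def T_def \<beta>_def by simp
  qed
qed

end

end

text \<open>The factor (1 + \<delta>)/\<delta> blows up as \<delta> tends to 0, so the quality
  \<epsilon> of the approximation is chosen after \<delta>. Then w and h may depend on both, and n
  comes last.\<close>

lemma sandwich_limit:
  fixes A :: "nat \<Rightarrow> real"
  assumes C: "0 \<le> C"
    and *: "\<And>\<delta> \<epsilon>. 0 < \<delta> \<Longrightarrow> 0 < \<epsilon> \<Longrightarrow> \<exists>w h. \<bar>w - S\<bar> \<le> \<epsilon> \<and> h \<le> \<epsilon> \<and>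
      (\<forall>\<eta>>0. \<forall>\<^sub>F n in sequentially. A n \<le> (1 + \<delta>) * w + C * ((1 + \<delta>) / \<delta>) * h + \<eta> \<and> w / (1 + \<delta>) - C * ((1 + \<delta>) / \<delta>) * h - \<eta> \<le> A n)"
  shows "A \<longlonglongrightarrow> S"
proof (rule tendstoI)
  fix e :: real assume e: "0 < e"
  \<comment> \<open>Four errors are kept below e/6 each: |w - S|, \<delta> |w|, \<beta> h and
    \<eta>. As \<epsilon> \<le> 1, |w| is at most |S| + 1.\<close>
  define \<delta> where "\<delta> = e / (6 * (\<bar>S\<bar> + 1))"
  have \<delta>: "\<delta> > 0" using e by (simp add: \<delta>_def add_nonneg_pos)
  have \<delta>S: "\<delta> * (\<bar>S\<bar> + 1) = e / 6"
  proof -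
    have "x \<noteq> 0 \<Longrightarrow> e / (6 * x) * x = e / 6" for x :: real by simp
    moreover have "\<bar>S\<bar> + 1 \<noteq> 0" using abs_ge_zero[of S] by linarith
    ultimately show ?thesis unfolding \<delta>_def by blast
  qed
  define \<beta> where "\<beta> = C * ((1 + \<delta>) / \<delta>)"
  have \<beta>: "\<beta> \<ge> 0" using C \<delta> by (simp add: \<beta>_def)
  define \<epsilon> where "\<epsilon> = min (min 1 (e / 6)) (e / 6 / (\<beta> + 1))"
  have "\<epsilon> \<le> min 1 (e / 6)" unfolding \<epsilon>_def by (rule min.cobounded1)
  moreover have "0 < \<epsilon>" unfolding \<epsilon>_def using e \<beta> by simp
  ultimately have \<epsilon>: "0 < \<epsilon>" "\<epsilon> \<le> 1" "\<epsilon> \<le> e / 6" by auto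
  have \<beta>\<epsilon>: "\<beta> * \<epsilon> \<le> e / 6"
  proof -
    have "\<beta> * \<epsilon> \<le> (\<beta> + 1) * \<epsilon>" using \<epsilon> by (intro mult_right_mono) auto
    also have "\<dots> \<le> (\<beta> + 1) * (e / 6 / (\<beta> + 1))" using \<beta> by (intro mult_left_mono) (auto simp: \<epsilon>_def)
    also have "\<dots> = e / 6"
    proof -
      have "x \<noteq> 0 \<Longrightarrow> x * (e / 6 / x) = e / 6" for x :: real by simp
      moreover have "\<beta> + 1 \<noteq> 0" using \<beta> by linarith
      ultimately show ?thesis by blast
    qed
    finally show ?thesis .
  qed
  obtain w h where w: "\<bar>w - S\<bar> \<le> \<epsilon>" and h: "h \<le> \<epsilon>"
    and ev: "\<forall>\<eta>>0. \<forall>\<^sub>F n in sequentially. A n \<le> (1 + \<delta>) * w + \<beta> * h + \<eta> \<and> w / (1 + \<delta>) - \<beta> * h - \<eta> \<le> A n"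
    using *[OF \<delta> \<epsilon>(1)] unfolding \<beta>_def by blast
  have bh: "\<beta> * h \<le> e / 6" using mult_left_mono[OF h \<beta>] \<beta>\<epsilon> by linarith
  have dw: "\<delta> * \<bar>w\<bar> \<le> e / 6"
  proof -
    have "\<delta> * \<bar>w\<bar> \<le> \<delta> * (\<bar>S\<bar> + 1)" using w \<epsilon>(2) \<delta> by (intro mult_left_mono) auto
    then show ?thesis using \<delta>S by simp
  qed
  have up: "(1 + \<delta>) * w \<le> w + \<delta> * \<bar>w\<bar>" using \<delta> by (simp add: distrib_right mult_left_mono)
  have lo: "w - \<delta> * \<bar>w\<bar> \<le> w / (1 + \<delta>)"
  proof -
    have "w / (1 + \<delta>) = w - \<delta> * w / (1 + \<delta>)" using \<delta> by (simp add: field_simps)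
    moreover have "\<delta> * w / (1 + \<delta>) \<le> \<delta> * \<bar>w\<bar> / (1 + \<delta>)" using \<delta> by (intro divide_right_mono mult_left_mono) auto
    moreover have "\<delta> * \<bar>w\<bar> / (1 + \<delta>) \<le> \<delta> * \<bar>w\<bar> / 1" using \<delta> by (intro divide_left_mono) auto
    ultimately show ?thesis by simp
  qed
  have "e / 6 > 0" using e by simp
  from ev[rule_format, OF this] show "\<forall>\<^sub>F n in sequentially. dist (A n) S < e"
  proof eventually_elim
    case (elim n)
    then have "A n \<le> S + 5 / 6 * e" "S - 5 / 6 * e \<le> A n" using w \<epsilon>(3) bh dw up lo by linarith+
    then show ?case using e by (simp add: dist_real_def abs_if)
  qed
qed

text \<open>The density is quadratic in |g|, so q > 2 yields a power of |g| strictly above 4, namely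
  2q, or 6 when q is infinite. The excess over 4 is what the interpolation for the Fejer means lives
  on.\<close>

lemma Lp_square_imp_power:
  assumes F: "fourier_series a g" and v: "v > 0" and q: "2 < q" and L: "in_Lp q torus (\<lambda>\<theta>. v * (cmod (g \<theta>))\<^sup>2)"
  shows "\<exists>w>4. integrable torus (\<lambda>\<theta>. cmod (g \<theta>) powr w)"
proof (cases "q = \<infinity>")
  case True
  note [measurable] = fourier_series_trig(1)[OF F]
  obtain B where B: "AE x in torus. (cmod (g x))\<^sup>2 \<le> B"
    using in_Lp_infinity_bound[OF v] L True by blast
  have "AE x in torus. cmod (g x) powr 6 \<le> B ^ 3"
    using B
  proof eventually_elim
    case (elim x)
    then have "((cmod (g x))\<^sup>2) ^ 3 \<le> B ^ 3" by (intro power_mono) auto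
    then show ?case by (simp flip: power_mult)
  qed
  then have "integrable torus (\<lambda>\<theta>. cmod (g \<theta>) powr 6)" by (intro torus.integrable_const_bound[of _ "B ^ 3"]) auto
  then show ?thesis by (intro exI[of _ 6]) simp
next
  case False
  obtain r where r: "q = ereal r" "r > 2" using q False by (cases q) auto
  have "integrable torus (\<lambda>\<theta>. \<bar>v * (cmod (g \<theta>))\<^sup>2\<bar> powr r)" using L False r by (simp add: in_Lp_def)
  moreover have "\<bar>v * (cmod (g \<theta>))\<^sup>2\<bar> powr r = v powr r * cmod (g \<theta>) powr (2 * r)" for \<theta>
  proof -
    have "(cmod (g \<theta>))\<^sup>2 powr r = cmod (g \<theta>) powr (2 * r)"
      using powr_powr[of "cmod (g \<theta>)" 2 r] by simp
    then show ?thesis using v by (simp add: powr_mult)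
  qed
  ultimately have "integrable torus (\<lambda>\<theta>. cmod (g \<theta>) powr (2 * r))" using v by simp
  then show ?thesis using r by (intro exI[of _ "2 * r"]) simp
qed

lemma powr_integrable_imp_4:
  assumes F: "fourier_series a g" and w: "4 < w" and iw: "integrable torus (\<lambda>\<theta>. cmod (g \<theta>) powr w)"
  shows "integrable torus (\<lambda>\<theta>. cmod (g \<theta>) ^ 4)"
proof (rule Bochner_Integration.integrable_bound)
  note [measurable] = fourier_series_trig(1)[OF F]
  show "integrable torus (\<lambda>\<theta>. 1 + cmod (g \<theta>) powr w)" using iw by auto
  have "x ^ 4 \<le> 1 + x powr w" if "x \<ge> 0" for x :: real
  proof (cases "x \<le> 1")
    case True
    then have "x ^ 4 \<le> 1" using that by (simp add: power_le_one)
    then show ?thesis using powr_ge_zero[of x w] by linarith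
  next
    case False
    then have "x powr 4 \<le> x powr w" using w by (intro powr_mono) auto
    then show ?thesis using False by simp
  qed
  then show "AE \<theta> in torus. norm (cmod (g \<theta>) ^ 4) \<le> norm (1 + cmod (g \<theta>) powr w)" by (intro AE_I2) (auto intro: order_trans[OF _ abs_ge_self])
  show "(\<lambda>\<theta>. cmod (g \<theta>) ^ 4) \<in> borel_measurable torus" by measurable
qed

lemma Sigma2_tendsto:
  fixes F :: "nat \<Rightarrow> real \<Rightarrow> real"
  assumes iF: "\<And>n. integrable torus (F n)" and iG: "integrable torus G"
    and iF2: "\<And>n. integrable torus (\<lambda>\<theta>. (F n \<theta>)\<^sup>2)" and iG2: "integrable torus (\<lambda>\<theta>. (G \<theta>)\<^sup>2)"
    and lim: "(\<lambda>n. \<integral>\<theta>. \<bar>F n \<theta> - G \<theta>\<bar> \<partial>torus) \<longlonglongrightarrow> 0"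
    and lim2: "(\<lambda>n. \<integral>\<theta>. \<bar>(F n \<theta>)\<^sup>2 - (G \<theta>)\<^sup>2\<bar> \<partial>torus) \<longlonglongrightarrow> 0"
  shows "(\<lambda>n. Sigma2 (F n) \<kappa> k l) \<longlonglongrightarrow> Sigma2 G \<kappa> k l"
proof -
  define e1 where "e1 \<theta> = exp (\<i> * complex_of_real ((real k - real l) * \<theta>)) + exp (\<i> * complex_of_real ((real k + real l) * \<theta>))" for \<theta>
  define e2 where "e2 j \<theta> = exp (\<i> * complex_of_real (real j * \<theta>))" for j :: nat and \<theta>
  have [measurable]: "e1 \<in> borel_measurable torus" "e2 j \<in> borel_measurable torus" for j
    unfolding e1_def[abs_def] e2_def[abs_def] by measurable
  have "cmod (e1 \<theta>) \<le> 1 + 1" for \<theta>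
    unfolding e1_def by (intro order_trans[OF norm_triangle_ineq] add_mono) simp_all
  then have 1: "(\<lambda>n. \<integral>\<theta>. e1 \<theta> * of_real ((F n \<theta>)\<^sup>2) \<partial>torus) \<longlonglongrightarrow> (\<integral>\<theta>. e1 \<theta> * of_real ((G \<theta>)\<^sup>2) \<partial>torus)"
    by (intro weighted_integral_tendsto[OF _ _ iF2 iG2 lim2]) auto
  have "cmod (e2 j \<theta>) \<le> 1" for j \<theta> unfolding e2_def by simp
  then have 2: "(\<lambda>n. \<integral>\<theta>. e2 j \<theta> * of_real (F n \<theta>) \<partial>torus) \<longlonglongrightarrow> (\<integral>\<theta>. e2 j \<theta> * of_real (G \<theta>) \<partial>torus)" for j
    by (intro weighted_integral_tendsto[OF _ _ iF iG lim]) auto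
  have eq: "Sigma2 f \<kappa> k l = 1 / (2 * complex_of_real pi) * (\<integral>\<theta>. e1 \<theta> * of_real ((f \<theta>)\<^sup>2) \<partial>torus)
     + complex_of_real \<kappa> * (1 / (2 * complex_of_real pi) * (\<integral>\<theta>. e2 k \<theta> * of_real (f \<theta>) \<partial>torus))
       * (1 / (2 * complex_of_real pi) * (\<integral>\<theta>. e2 l \<theta> * of_real (f \<theta>) \<partial>torus))" for f
    unfolding Sigma2_def e1_def e2_def by (simp only: mult.commute[of "complex_of_real (f _)"])
  show ?thesis unfolding eq by (intro tendsto_add tendsto_mult tendsto_const 1 2)
qed

text \<open>Exchanging k and l conjugates the first exponential, and the real part is a cosine,
  which is even. The kurtosis term is symmetric by commutativity.\<close>

lemma Re_Sigma2_commute: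
  assumes f: "integrable torus (\<lambda>\<theta>. (f \<theta>)\<^sup>2)"
  shows "Re (Sigma2 f \<kappa> k l) = Re (Sigma2 f \<kappa> l k)"
proof -
  define e where "e k l \<theta> = exp (\<i> * complex_of_real ((real k - real l) * \<theta>)) + exp (\<i> * complex_of_real ((real k + real l) * \<theta>))" for k l :: nat and \<theta>
  have [measurable]: "e k l \<in> borel_measurable torus" for k l unfolding e_def[abs_def] by measurable
  have e: "cmod (e k l \<theta>) \<le> 2" for k l \<theta>
    unfolding e_def by (rule order_trans[OF norm_triangle_ineq]) simp
  have i: "integrable torus (\<lambda>\<theta>. e k l \<theta> * complex_of_real ((f \<theta>)\<^sup>2))" for k l
  proof (rule Bochner_Integration.integrable_bound)
    show "integrable torus (\<lambda>\<theta>. 2 * (f \<theta>)\<^sup>2)" using f by auto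
    show "(\<lambda>\<theta>. e k l \<theta> * complex_of_real ((f \<theta>)\<^sup>2)) \<in> borel_measurable torus"
      using borel_measurable_integrable[OF f] by measurable
    show "AE \<theta> in torus. norm (e k l \<theta> * complex_of_real ((f \<theta>)\<^sup>2)) \<le> norm (2 * (f \<theta>)\<^sup>2)"
      unfolding norm_mult norm_of_real using mult_right_mono[OF e] by (intro AE_I2) simp
  qed
  have Re_e: "Re (e k l \<theta>) = cos ((real k - real l) * \<theta>) + cos ((real k + real l) * \<theta>)" for k l \<theta>
    unfolding e_def cis_conv_exp[symmetric] by simp
  have "Re (e k l \<theta>) = Re (e l k \<theta>)" for \<theta>
    unfolding Re_e using cos_minus[of "(real k - real l) * \<theta>"] by (simp add: minus_mult_left add.commute del: cos_minus)
  then have "(\<integral>\<theta>. Re (e k l \<theta> * complex_of_real ((f \<theta>)\<^sup>2)) \<partial>torus) = (\<integral>\<theta>. Re (e l k \<theta> * complex_of_real ((f \<theta>)\<^sup>2)) \<partial>torus)" by simp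
  then have "Re (\<integral>\<theta>. e k l \<theta> * complex_of_real ((f \<theta>)\<^sup>2) \<partial>torus) = Re (\<integral>\<theta>. e l k \<theta> * complex_of_real ((f \<theta>)\<^sup>2) \<partial>torus)"
    by (simp only: integral_Re[OF i])
  moreover have "1 / (2 * complex_of_real pi) = complex_of_real (1 / (2 * pi))" by simp
  ultimately show ?thesis
    unfolding Sigma2_def e_def[symmetric] by (simp only: plus_complex.simps Re_complex_of_real times_complex.simps Im_complex_of_real mult_zero_left diff_0_right mult_ac)
qed

lemma ratio_tendsto_1: "(\<lambda>p. real p / real (p + k)) \<longlonglongrightarrow> 1"
proof -
  have "(\<lambda>p. 1 - real k * inverse (real (p + k))) \<longlonglongrightarrow> 1 - real k * 0"
    using LIMSEQ_ignore_initial_segment[OF lim_inverse_n, of k] by (intro tendsto_intros)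
  moreover have "\<forall>\<^sub>F p in sequentially. 1 - real k * inverse (real (p + k)) = real p / real (p + k)"
    using eventually_gt_at_top[of 0] by eventually_elim (simp add: field_simps)
  ultimately show ?thesis by (simp add: tendsto_cong)
qed

context linear_process
begin

text \<open>The sandwich compares the cumulant function with the variance of a block per unit of
  time. With the Fejer order fixed and p large, this variance approaches half the form for the
  density v |P_H|^2, and for large H that form approaches the one for f.\<close>

theorem cgf_limit:
  fixes \<iota> :: "'n::finite \<Rightarrow> nat" and l :: "'n \<Rightarrow> real"
  assumes v: "v > 0" and F: "fourier_series a g" and q: "2 < q" and Lq: "in_Lp q torus (\<lambda>\<theta>. v * (cmod (g \<theta>))\<^sup>2)"
    and t: "t \<longlonglongrightarrow> 0" "\<And>n. n \<ge> 1 \<Longrightarrow> t n > 0" and tr: "(\<lambda>n. t n * real n powr real_of_ereal (1 / q)) \<longlonglongrightarrow> 0"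
    and lag: "\<And>r. \<iota> r \<le> m"
  shows "\<forall>\<^sub>F n in sequentially. integrable M (\<lambda>\<omega>. exp (t n * Q l \<iota> {1..int n} \<omega>))"
    "(\<lambda>n. ln (\<integral>\<omega>. exp (t n * Q l \<iota> {1..int n} \<omega>) \<partial>M) / (real n * (t n)\<^sup>2))
       \<longlonglongrightarrow> (\<Sum>r\<in>UNIV. \<Sum>s\<in>UNIV. l r * l s * Re (Sigma2 (\<lambda>\<theta>. v * (cmod (g \<theta>))\<^sup>2) ((m4 - 3 * v\<^sup>2) / v\<^sup>2) (\<iota> r) (\<iota> s))) / 2"
proof -
  define A where "A n = ln (\<integral>\<omega>. exp (t n * Q l \<iota> {1..int n} \<omega>) \<partial>M) / (real n * (t n)\<^sup>2)" for n
  define \<kappa> where "\<kappa> = (m4 - 3 * v\<^sup>2) / v\<^sup>2"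
  define form where "form f = (\<Sum>r\<in>UNIV. \<Sum>s\<in>UNIV. l r * l s * Re (Sigma2 f \<kappa> (\<iota> r) (\<iota> s)))" for f
  define S where "S = form (\<lambda>\<theta>. v * (cmod (g \<theta>))\<^sup>2) / 2"
  note [measurable] = fourier_series_trig(1)[OF F]
  obtain w where w: "4 < w" "integrable torus (\<lambda>\<theta>. cmod (g \<theta>) powr w)" using Lp_square_imp_power[OF F v q Lq] by blast
  have ig: "integrable torus (\<lambda>\<theta>. cmod (g \<theta>) ^ 4)" by (rule powr_integrable_imp_4[OF F w])
  define P where "P H = trig {- int H..int H} (\<lambda>j. complex_of_real (fejer_mean a H j))" for H
  have [measurable]: "P H \<in> borel_measurable torus" for H unfolding P_def by measurable
  note L4 = fejer_L4[OF F summable_squares w, folded P_def]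
  have mg: "g \<in> borel_measurable torus" "\<And>n. P n \<in> borel_measurable torus" by measurable
  note PL = L4_limits[OF mg ig L4(2) L4(1)]
  have lform: "(\<lambda>H. form (\<lambda>\<theta>. v * (cmod (P H \<theta>))\<^sup>2)) \<longlonglongrightarrow> form (\<lambda>\<theta>. v * (cmod (g \<theta>))\<^sup>2)"
    unfolding form_def
  proof (intro tendsto_sum tendsto_mult tendsto_const tendsto_Re Sigma2_tendsto)
    have sq: "(v * x\<^sup>2)\<^sup>2 = v\<^sup>2 * x ^ 4" for x :: real by (simp add: power_mult_distrib)
    show "integrable torus (\<lambda>\<theta>. (v * (cmod (P n \<theta>))\<^sup>2)\<^sup>2)" "integrable torus (\<lambda>\<theta>. (v * (cmod (g \<theta>))\<^sup>2)\<^sup>2)" for n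
      unfolding sq using PL(1) ig by auto
    show "integrable torus (\<lambda>\<theta>. v * (cmod (P n \<theta>))\<^sup>2)" "integrable torus (\<lambda>\<theta>. v * (cmod (g \<theta>))\<^sup>2)" for n
      using torus.L4_imp_L2[OF _ PL(1)] torus.L4_imp_L2[OF _ ig] by auto
    have "(\<lambda>n. v * (\<integral>\<theta>. \<bar>(cmod (P n \<theta>))\<^sup>2 - (cmod (g \<theta>))\<^sup>2\<bar> \<partial>torus)) \<longlonglongrightarrow> v * 0" by (intro tendsto_intros PL(3))
    then show "(\<lambda>n. \<integral>\<theta>. \<bar>v * (cmod (P n \<theta>))\<^sup>2 - v * (cmod (g \<theta>))\<^sup>2\<bar> \<partial>torus) \<longlonglongrightarrow> 0"
      using v by (simp add: right_diff_distrib[symmetric] abs_mult)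
    have "(\<lambda>n. v\<^sup>2 * (\<integral>\<theta>. \<bar>cmod (P n \<theta>) ^ 4 - cmod (g \<theta>) ^ 4\<bar> \<partial>torus)) \<longlonglongrightarrow> v\<^sup>2 * 0" by (intro tendsto_intros PL(2))
    then show "(\<lambda>n. \<integral>\<theta>. \<bar>(v * (cmod (P n \<theta>))\<^sup>2)\<^sup>2 - (v * (cmod (g \<theta>))\<^sup>2)\<^sup>2\<bar> \<partial>torus) \<longlonglongrightarrow> 0"
      unfolding sq by (simp add: right_diff_distrib[symmetric] abs_mult)
  qed
  define Ia where "Ia = (\<integral>\<theta>. cmod (g \<theta>) ^ 4 \<partial>torus)"
  define Ic where "Ic H = (\<integral>\<theta>. cmod (P H \<theta>) ^ 4 \<partial>torus)" for H
  define Ie where "Ie H = (\<integral>\<theta>. cmod (g \<theta> - P H \<theta>) ^ 4 \<partial>torus)" for H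
  have I0: "0 \<le> Ia" "0 \<le> Ic H" "0 \<le> Ie H" for H unfolding Ia_def Ic_def Ie_def by simp_all
  have lIe: "Ie \<longlonglongrightarrow> 0" unfolding Ie_def[abs_def] by (rule L4(1))
  have lIc: "Ic \<longlonglongrightarrow> Ia"
  proof (rule Lim_null_comparison[THEN LIM_zero_cancel, OF _ PL(2)])
    show "\<forall>\<^sub>F H in sequentially. norm (Ic H - Ia) \<le> (\<integral>\<theta>. \<bar>cmod (P H \<theta>) ^ 4 - cmod (g \<theta>) ^ 4\<bar> \<partial>torus)"
      unfolding Ic_def Ia_def Bochner_Integration.integral_diff[OF PL(1) ig, symmetric]
      by (intro always_eventually allI) (simp add: integral_abs_bound)
  qed
  obtain c0 C where c0: "0 < c0" and C: "0 < C" and hwC: "\<And>V A \<rho> u. finite V \<Longrightarrow> op_le V A \<rho> \<Longrightarrow> \<bar>u\<bar> * \<rho> \<le> c0 \<Longrightarrow>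
      (\<integral>\<^sup>+x. ennreal (exp (u * QF v V A x)) \<partial>PiM V (\<lambda>_. \<mu>)) \<le> ennreal (exp (C * u\<^sup>2 * (\<Sum>i\<in>V. \<Sum>j\<in>V. (A i j)\<^sup>2)))"
    using noise_hanson_wright by blast
  obtain C1 where C1: "0 \<le> C1" "\<And>n K V y. 1 \<le> n \<Longrightarrow> finite K \<Longrightarrow> card K \<le> n \<Longrightarrow> finite V \<Longrightarrow>
        (\<Sum>i\<in>V. (\<Sum>k\<in>K. a (i - k) * y k)\<^sup>2) \<le> C1 * real n powr real_of_ereal (1 / q) * (\<Sum>k\<in>K. (y k)\<^sup>2)"
    using op_bound[OF F v q Lq] by blast
  define k0 where "k0 = 3 * (\<Sum>r\<in>UNIV. (l r)\<^sup>2) * real CARD('n) / (4 * pi)"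
  have k0: "0 \<le> k0" unfolding k0_def by (intro divide_nonneg_nonneg mult_nonneg_nonneg sum_nonneg) auto
  define len where "len H p = p + (m + 2 * H + 1)" for H p
  define var where "var H p = (\<integral>x. (QF v {- int H..int p + int m + int H} (Kmat l \<iota> (fejer_mean a H) {0..<int p}) x)\<^sup>2 \<partial>PiM {- int H..int p + int m + int H} (\<lambda>_. \<mu>))" for H p
  define h where "h H p \<sigma> = k0 * (2 * \<sigma> * Ie H + (Ia + Ic H) / \<sigma> + (1 - real p / real (len H p)) * (2 * Ic H))" for H p \<sigma>
  have filt: "finite_filter (fejer_mean a H) H" for H by unfold_locales (simp add: fejer_mean_eq_0)
  have PH: "finite_filter.P (fejer_mean a H) H = P H" for H
    unfolding finite_filter.P_def[OF filt] P_def ..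
  have sand: "\<forall>\<^sub>F n in sequentially. integrable M (\<lambda>\<omega>. exp (t n * Q l \<iota> {1..int n} \<omega>)) \<and>
      A n \<le> (1 + \<delta>) * (var H p / (2 * real (len H p))) + C * ((1 + \<delta>) / \<delta>) * h H p \<sigma> + \<eta> \<and>
      var H p / (2 * real (len H p)) / (1 + \<delta>) - C * ((1 + \<delta>) / \<delta>) * h H p \<sigma> - \<eta> \<le> A n"
    if "0 < \<delta>" "0 < \<eta>" "0 < \<sigma>" for H p \<delta> \<eta> \<sigma>
  proof -
    interpret B: blocked_process \<mu> K v M a \<xi> X "fejer_mean a H" H m p l \<iota>
      by unfold_locales (simp_all add: fejer_mean_eq_0 lag)
    have ie: "integrable torus (\<lambda>\<theta>. (cmod (g \<theta> - B.P \<theta>)) ^ 4)" unfolding PH by (rule L4(2))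
    have "B.HS g \<sigma> 1 (1 - real p / real B.L) = h H p \<sigma>"
      unfolding B.HS_def h_def k0_def PH Ia_def Ic_def Ie_def B.L_def len_def by (simp add: add.assoc)
    moreover have "(\<integral>x. (B.U x)\<^sup>2 \<partial>PiM B.V0 (\<lambda>_. \<mu>)) / (2 * real B.L) = var H p / (2 * real (len H p))"
      unfolding B.U_def B.V0_def B.L_def var_def len_def by (simp add: add.assoc)
    ultimately show ?thesis
      using B.cgf_sandwich[OF hwC c0 C F ig ie C1 t tr that(3,1,2)] unfolding A_def by simp
  qed
  show "\<forall>\<^sub>F n in sequentially. integrable M (\<lambda>\<omega>. exp (t n * Q l \<iota> {1..int n} \<omega>))"
    \<comment> \<open>Integrability of the exponential is the same assertion for all parameters, so
      any choice serves here, even the empty block p = 0.\<close>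
    using sand[of 1 1 1 0 0] by (auto elim: eventually_mono)
  have "A \<longlonglongrightarrow> S"
  proof (rule sandwich_limit[of C])
    show "0 \<le> C" using C by simp
    fix \<delta> \<epsilon> :: real assume \<delta>: "0 < \<delta>" and \<epsilon>: "0 < \<epsilon>"
    \<comment> \<open>Makes the part of \<open>h\<close> divided by \<sigma> at most \<epsilon>/3
      once \<open>Ic H\<close> < Ia + 1. After that H is taken so large that \<sigma> times
      \<open>Ie H\<close> is small, and finally p so large that the gaps between blocks do not
      matter.\<close>
    define \<sigma> where "\<sigma> = 3 * (k0 * (2 * Ia + 1) + 1) / \<epsilon>"
    have pos: "0 < k0 * (2 * Ia + 1) + 1" using k0 I0(1) by (simp add: add_nonneg_pos)
    have \<sigma>: "\<sigma> > 0" unfolding \<sigma>_def using pos \<epsilon> by simp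
    have \<sigma>1: "k0 * ((2 * Ia + 1) / \<sigma>) \<le> \<epsilon> / 3"
    proof -
      have "k0 * (2 * Ia + 1) \<le> k0 * (2 * Ia + 1) + 1" by simp
      then have "k0 * (2 * Ia + 1) / \<sigma> \<le> (k0 * (2 * Ia + 1) + 1) / \<sigma>" using \<sigma> by (intro divide_right_mono) auto
      also have "\<dots> = \<epsilon> / 3"
      proof -
        have "x > 0 \<Longrightarrow> x / (3 * x / \<epsilon>) = \<epsilon> / 3" for x :: real by simp
        from this[OF pos] show ?thesis unfolding \<sigma>_def .
      qed
      finally show ?thesis by simp
    qed
    have "(\<lambda>H. k0 * (2 * \<sigma> * Ie H)) \<longlonglongrightarrow> k0 * (2 * \<sigma> * 0)" by (intro tendsto_intros lIe)
    then have "\<forall>\<^sub>F H in sequentially. k0 * (2 * \<sigma> * Ie H) < \<epsilon> / 3" using \<epsilon> by (intro order_tendstoD(2)) auto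
    moreover have "\<forall>\<^sub>F H in sequentially. Ic H < Ia + 1" by (intro order_tendstoD(2)[OF lIc]) simp
    moreover have "\<forall>\<^sub>F H in sequentially. dist (form (\<lambda>\<theta>. v * (cmod (P H \<theta>))\<^sup>2)) (form (\<lambda>\<theta>. v * (cmod (g \<theta>))\<^sup>2)) < \<epsilon>"
      using lform \<epsilon> by (rule tendstoD)
    ultimately have "\<forall>\<^sub>F H in sequentially. k0 * (2 * \<sigma> * Ie H) < \<epsilon> / 3 \<and> Ic H < Ia + 1 \<and> dist (form (\<lambda>\<theta>. v * (cmod (P H \<theta>))\<^sup>2)) (form (\<lambda>\<theta>. v * (cmod (g \<theta>))\<^sup>2)) < \<epsilon>"
      by eventually_elim auto
    then obtain H where H: "k0 * (2 * \<sigma> * Ie H) < \<epsilon> / 3" "Ic H < Ia + 1" "\<bar>form (\<lambda>\<theta>. v * (cmod (P H \<theta>))\<^sup>2) - form (\<lambda>\<theta>. v * (cmod (g \<theta>))\<^sup>2)\<bar> < \<epsilon>"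
      by (auto simp: eventually_sequentially dist_real_def)
    have lv: "(\<lambda>p. var H p / real p) \<longlonglongrightarrow> form (\<lambda>\<theta>. v * (cmod (P H \<theta>))\<^sup>2)"
      using finite_filter.variance_limit[OF filt noise_axioms v lag, of H l] unfolding PH var_def form_def \<kappa>_def .
    have lr: "(\<lambda>p. real p / real (len H p)) \<longlonglongrightarrow> 1" unfolding len_def by (rule ratio_tendsto_1)
    have "(\<lambda>p. var H p / real p * (real p / real (len H p)) / 2) \<longlonglongrightarrow> form (\<lambda>\<theta>. v * (cmod (P H \<theta>))\<^sup>2) * 1 / 2"
      by (intro tendsto_divide tendsto_mult tendsto_const lv lr) simp
    from tendstoD[OF this, of "\<epsilon> / 2"] \<epsilon>
    have 1: "\<forall>\<^sub>F p in sequentially. dist (var H p / real p * (real p / real (len H p)) / 2) (form (\<lambda>\<theta>. v * (cmod (P H \<theta>))\<^sup>2) / 2) < \<epsilon> / 2" by simp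
    have "(\<lambda>p. k0 * ((1 - real p / real (len H p)) * (2 * Ic H))) \<longlonglongrightarrow> k0 * ((1 - 1) * (2 * Ic H))"
      by (intro tendsto_mult tendsto_diff tendsto_const lr)
    then have 2: "\<forall>\<^sub>F p in sequentially. k0 * ((1 - real p / real (len H p)) * (2 * Ic H)) < \<epsilon> / 3"
      using \<epsilon> by (intro order_tendstoD(2)) auto
    have "\<forall>\<^sub>F p in sequentially. k0 * ((1 - real p / real (len H p)) * (2 * Ic H)) < \<epsilon> / 3 \<and> \<bar>var H p / (2 * real (len H p)) - form (\<lambda>\<theta>. v * (cmod (P H \<theta>))\<^sup>2) / 2\<bar> < \<epsilon> / 2"
      using 1 2 eventually_gt_at_top[of 0]
    proof eventually_elim
      case (elim p)
      have eq: "var H p / real p * (real p / real (len H p)) / 2 = var H p / (2 * real (len H p))" using elim(3) by simp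
      show ?case using elim(1,2) unfolding eq dist_real_def by blast
    qed
    then obtain p where p: "k0 * ((1 - real p / real (len H p)) * (2 * Ic H)) < \<epsilon> / 3" "\<bar>var H p / (2 * real (len H p)) - form (\<lambda>\<theta>. v * (cmod (P H \<theta>))\<^sup>2) / 2\<bar> < \<epsilon> / 2"
      by (auto simp: eventually_sequentially)
    have "k0 * ((Ia + Ic H) / \<sigma>) \<le> k0 * ((2 * Ia + 1) / \<sigma>)"
      using k0 \<sigma> H(2) by (intro mult_left_mono divide_right_mono) auto
    then have h: "h H p \<sigma> \<le> \<epsilon>" unfolding h_def distrib_left using \<sigma>1 H(1) p(1) by linarith
    have "\<bar>x - z / 2\<bar> \<le> e" if "\<bar>x - y / 2\<bar> < e / 2" "\<bar>y - z\<bar> < e" for x y z e :: real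
      using that by linarith
    from this[OF p(2) H(3)] have wS: "\<bar>var H p / (2 * real (len H p)) - S\<bar> \<le> \<epsilon>" unfolding S_def .
    show "\<exists>w h. \<bar>w - S\<bar> \<le> \<epsilon> \<and> h \<le> \<epsilon> \<and>
      (\<forall>\<eta>>0. \<forall>\<^sub>F n in sequentially. A n \<le> (1 + \<delta>) * w + C * ((1 + \<delta>) / \<delta>) * h + \<eta> \<and> w / (1 + \<delta>) - C * ((1 + \<delta>) / \<delta>) * h - \<eta> \<le> A n)"
    proof (intro exI conjI allI impI)
      show "\<bar>var H p / (2 * real (len H p)) - S\<bar> \<le> \<epsilon>" by (rule wS)
      show "h H p \<sigma> \<le> \<epsilon>" by (rule h)
      fix \<eta> :: real assume \<eta>: "\<eta> > 0"
      show "\<forall>\<^sub>F n in sequentially. A n \<le> (1 + \<delta>) * (var H p / (2 * real (len H p))) + C * ((1 + \<delta>) / \<delta>) * h H p \<sigma> + \<eta> \<and>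
        var H p / (2 * real (len H p)) / (1 + \<delta>) - C * ((1 + \<delta>) / \<delta>) * h H p \<sigma> - \<eta> \<le> A n"
        using sand[OF \<delta> \<eta> \<sigma>, of H p] by (rule eventually_mono) blast
    qed
  qed
  then show "(\<lambda>n. ln (\<integral>\<omega>. exp (t n * Q l \<iota> {1..int n} \<omega>) \<partial>M) / (real n * (t n)\<^sup>2))
       \<longlonglongrightarrow> (\<Sum>r\<in>UNIV. \<Sum>s\<in>UNIV. l r * l s * Re (Sigma2 (\<lambda>\<theta>. v * (cmod (g \<theta>))\<^sup>2) ((m4 - 3 * v\<^sup>2) / v\<^sup>2) (\<iota> r) (\<iota> s))) / 2"
    unfolding A_def S_def form_def \<kappa>_def .
qed

end

theorem theorem2p1:
  fixes M :: "'a measure"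
    and \<xi> X :: "int \<Rightarrow> 'a \<Rightarrow> real"
    and \<mu> :: "real measure"
    and a :: "int \<Rightarrow> real"
    and g :: "real \<Rightarrow> complex"
    and f :: "real \<Rightarrow> real"
    and b :: "nat \<Rightarrow> real"
    and q :: ereal
    and m :: nat
    and \<iota> :: "'n::finite \<Rightarrow> nat"
  assumes "prob_space M"
    and "prob_space.indep_vars M (\<lambda>_. borel) \<xi> UNIV"
    and "\<And>n. distr M borel (\<xi> n) = \<mu>"
    and "integrable M (\<lambda>\<omega>. (\<xi> 0 \<omega>)\<^sup>2)"
    and "prob_space.expectation M (\<xi> 0) = 0"
    and "prob_space.expectation M (\<lambda>\<omega>. (\<xi> 0 \<omega>)\<^sup>2) > 0"
    and "log_sobolev \<mu>"
    and "(\<lambda>n. \<bar>a n\<bar>\<^sup>2) summable_on UNIV"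
    and "moving_average M a \<xi> X"
    and "fourier_series a g"
    and "\<And>\<theta>. f \<theta> = prob_space.variance M (\<xi> 0) * (cmod (g \<theta>))\<^sup>2"
    and "2 < q"
    and "in_Lp q torus f"
    and "\<And>n. n \<ge> 1 \<Longrightarrow> b n > 0"
    and "filterlim b at_top sequentially"
    and "(\<lambda>n. b n / sqrt (real n)) \<longlonglongrightarrow> 0"
    and "(\<lambda>n. b n / sqrt (real n) * real n powr real_of_ereal (1 / q)) \<longlonglongrightarrow> 0"
    and "bij_betw \<iota> UNIV {0..m}"
  shows "LDP M
           (\<lambda>n \<omega>. \<chi> i. 1 / (b n * sqrt (real n)) *
              (\<Sum>k=1..n. X (int k) \<omega> * X (int k + int (\<iota> i)) \<omega>
                 - prob_space.expectation M (\<lambda>\<omega>'. X (int k) \<omega>' * X (int k + int (\<iota> i)) \<omega>')))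
           (\<lambda>n. (b n)\<^sup>2)
           (gaussian_rate (Sigma2_matrix f (kurtosis_excess M (\<xi> 0)) \<iota>))"
proof -
  interpret P: prob_space M by fact
  define v where "v = (\<integral>\<omega>. (\<xi> 0 \<omega>)\<^sup>2 \<partial>M)"
  have v: "v > 0" using assms(6) by (simp add: v_def)
  have [measurable]: "\<xi> i \<in> borel_measurable M" for i using assms(2) unfolding P.indep_vars_def by auto
  have \<mu>: "\<mu> = distr M borel (\<xi> 0)" using assms(3)[of 0] by simp
  have pm: "prob_space \<mu>" unfolding \<mu> by (rule P.prob_space_distr) simp
  have i\<xi>: "integrable M (\<xi> 0)" by (rule P.square_integrable_imp_integrable[OF _ assms(4)]) simp
  have im: "integrable \<mu> (\<lambda>x. x)" unfolding \<mu> using i\<xi> by (simp add: integrable_distr_eq)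
  have mean: "(\<integral>x. x \<partial>\<mu>) = 0" unfolding \<mu> using assms(5) by (simp add: integral_distr)
  obtain K where K: "subgaussian \<mu> K"
    using log_sobolev_imp_subgaussian[OF pm _ assms(7) im mean] unfolding \<mu> by auto
  interpret LP: linear_process \<mu> K v M a \<xi> X
  proof (unfold_locales)
    show "(\<integral>x. x\<^sup>2 \<partial>\<mu>) = v" unfolding \<mu> v_def by (simp add: integral_distr)
  qed (use assms K mean in auto)
  \<comment> \<open>The noise has mean 0, so its variance is its second moment v.\<close>
  have f: "f = (\<lambda>\<theta>. v * (cmod (g \<theta>))\<^sup>2)" using assms(11) assms(5) by (simp add: v_def fun_eq_iff)
  define \<kappa> where "\<kappa> = (LP.m4 - 3 * v\<^sup>2) / v\<^sup>2"
  have \<kappa>: "kurtosis_excess M (\<xi> 0) = \<kappa>"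
  proof -
    have "(\<integral>x. x ^ 4 \<partial>\<mu>) = (\<integral>\<omega>. (\<xi> 0 \<omega>) ^ 4 \<partial>M)" unfolding \<mu> by (simp add: integral_distr)
    then have "LP.m4 = (\<integral>\<omega>. (\<xi> 0 \<omega>) ^ 4 \<partial>M)" by (simp add: LP.m4_def)
    then show ?thesis by (simp add: kurtosis_excess_def \<kappa>_def v_def)
  qed
  have lag: "\<iota> r \<le> m" for r using bij_betwE[OF assms(18)] by auto
  have Lq: "in_Lp q torus (\<lambda>\<theta>. v * (cmod (g \<theta>))\<^sup>2)" using assms(13) unfolding f .
  define t where "t n = b n / sqrt (real n)" for n
  have t: "t \<longlonglongrightarrow> 0" "\<And>n. n \<ge> 1 \<Longrightarrow> t n > 0" "(\<lambda>n. t n * real n powr real_of_ereal (1 / q)) \<longlonglongrightarrow> 0"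
    unfolding t_def[abs_def] using assms(14,16,17) by auto
  have cgf: "\<forall>\<^sub>F n in sequentially. integrable M (\<lambda>\<omega>. exp (t n * LP.Q l \<iota> {1..int n} \<omega>))"
    "(\<lambda>n. ln (\<integral>\<omega>. exp (t n * LP.Q l \<iota> {1..int n} \<omega>) \<partial>M) / (real n * (t n)\<^sup>2))
       \<longlonglongrightarrow> (\<Sum>r\<in>UNIV. \<Sum>s\<in>UNIV. l r * l s * Re (Sigma2 f \<kappa> (\<iota> r) (\<iota> s))) / 2" for l
    unfolding f \<kappa>_def by (rule LP.cgf_limit[OF v assms(10) assms(12) Lq t(1) _ t(3) lag], erule t(2))+
  define Z where "Z n \<omega> = (\<chi> i. 1 / (b n * sqrt (real n)) *
              (\<Sum>k=1..n. X (int k) \<omega> * X (int k + int (\<iota> i)) \<omega>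
                 - (\<integral>\<omega>'. X (int k) \<omega>' * X (int k + int (\<iota> i)) \<omega>' \<partial>M)))" for n \<omega>
  define S where "S = Sigma2_matrix f \<kappa> \<iota>"
  \<comment> \<open>The normalisation 1/(b_n sqrt n) times the speed b_n^2 is t_n = b_n/sqrt n. At n
    = 0 the quotients take default values, so the identities are stated for n \<ge> 1, which is
    enough for limits.\<close>
  have Z: "(b n)\<^sup>2 * (u \<bullet> Z n \<omega>) = t n * LP.Q (($) u) \<iota> {1..int n} \<omega>" if n: "n \<ge> 1" for n u \<omega>
  proof -
    have r: "(\<Sum>k=1..n. F (int k)) = (\<Sum>k\<in>{1..int n}. F k)" for F :: "int \<Rightarrow> real"
      by (rule sum.reindex_bij_witness[of _ nat int]) auto
    define c where "c = 1 / (b n * sqrt (real n))"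
    define D where "D i = (\<Sum>k=1..n. X (int k) \<omega> * X (int k + int (\<iota> i)) \<omega>
      - (\<integral>\<omega>'. X (int k) \<omega>' * X (int k + int (\<iota> i)) \<omega>' \<partial>M))" for i
    have "u \<bullet> Z n \<omega> = (\<Sum>i\<in>UNIV. u $ i * (c * D i))"
      by (simp add: inner_vec_def Z_def c_def D_def)
    also have "\<dots> = c * (\<Sum>i\<in>UNIV. u $ i * D i)" by (simp add: sum_distrib_left mult_ac)
    also have "\<dots> = c * LP.Q (($) u) \<iota> {1..int n} \<omega>" unfolding LP.Q_def r[symmetric] D_def ..
    finally have "u \<bullet> Z n \<omega> = 1 / (b n * sqrt (real n)) * LP.Q (($) u) \<iota> {1..int n} \<omega>" unfolding c_def .
    then show ?thesis using assms(14)[OF n] n by (simp add: t_def power2_eq_square)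
  qed
  have N: "real n * (t n)\<^sup>2 = (b n)\<^sup>2" if "n \<ge> 1" for n using that by (simp add: t_def power_divide)
  have S: "u \<bullet> (S *v u) = (\<Sum>r\<in>UNIV. \<Sum>s\<in>UNIV. u $ r * u $ s * Re (Sigma2 f \<kappa> (\<iota> r) (\<iota> s)))" for u
    unfolding inner_vec_def matrix_vector_mult_def S_def Sigma2_matrix_def by (simp add: sum_distrib_left mult_ac)
  have ln_eq: "ln (\<integral>\<omega>. exp ((b n)\<^sup>2 * (u \<bullet> Z n \<omega>)) \<partial>M) / (b n)\<^sup>2
      = ln (\<integral>\<omega>. exp (t n * LP.Q (($) u) \<iota> {1..int n} \<omega>) \<partial>M) / (real n * (t n)\<^sup>2)" if "n \<ge> 1" for n u
    using that by (simp only: Z N)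
  have if2: "integrable torus (\<lambda>\<theta>. (f \<theta>)\<^sup>2)"
  proof -
    obtain w where w: "4 < w" "integrable torus (\<lambda>\<theta>. cmod (g \<theta>) powr w)"
      using Lp_square_imp_power[OF assms(10) v assms(12) Lq] by blast
    have "(f \<theta>)\<^sup>2 = v\<^sup>2 * cmod (g \<theta>) ^ 4" for \<theta> by (simp add: f power_mult_distrib)
    then show ?thesis using powr_integrable_imp_4[OF assms(10) w] by simp
  qed
  interpret quadratic_cgf M Z "\<lambda>n. (b n)\<^sup>2" S
  proof
    show "Z n \<in> borel_measurable M" for n
    proof (subst borel_measurable_euclidean_space, intro ballI)
      fix i :: "real ^ 'n" assume "i \<in> Basis"
      then obtain j where i: "i = axis j 1" by (auto simp: Basis_vec_def)
      show "(\<lambda>\<omega>. Z n \<omega> \<bullet> i) \<in> borel_measurable M" unfolding i inner_axis Z_def by simp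
    qed
    show "filterlim (\<lambda>n. (b n)\<^sup>2) at_top sequentially" by (rule filterlim_pow_at_top[OF _ assms(15)]) simp
    fix u w :: "real ^ 'n"
    show "\<forall>\<^sub>F n in sequentially. integrable M (\<lambda>\<omega>. exp ((b n)\<^sup>2 * (u \<bullet> Z n \<omega>)))"
      using cgf(1)[of "($) u"] eventually_ge_at_top[of 1] by eventually_elim (simp only: Z)
    have lim: "(\<lambda>n. ln (\<integral>\<omega>. exp (t n * LP.Q (($) u) \<iota> {1..int n} \<omega>) \<partial>M) / (real n * (t n)\<^sup>2)) \<longlonglongrightarrow> 1 / 2 * (u \<bullet> (S *v u))"
      using cgf(2)[of "($) u"] unfolding S by simp
    show "(\<lambda>n. ln (\<integral>\<omega>. exp ((b n)\<^sup>2 * (u \<bullet> Z n \<omega>)) \<partial>M) / (b n)\<^sup>2) \<longlonglongrightarrow> 1 / 2 * (u \<bullet> (S *v u))"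
      using lim by (rule Lim_transform_eventually) (use eventually_ge_at_top[of 1] in eventually_elim, simp only: ln_eq)
    show "u \<bullet> (S *v w) = w \<bullet> (S *v u)"
    proof -
      have "transpose S = S"
        unfolding S_def Sigma2_matrix_def transpose_def by (simp add: vec_eq_iff Re_Sigma2_commute[OF if2])
      then show ?thesis by (metis dot_lmul_matrix inner_commute transpose_matrix_vector)
    qed
    \<comment> \<open>Semidefiniteness comes from the limit itself: exp x \<ge> 1 + x and mean 0
      make the exponential moment at least 1, so each cumulant function is nonnegative.\<close>
    have "0 \<le> 1 / 2 * (u \<bullet> (S *v u))"
    proof (rule tendsto_lowerbound[OF lim])
      show "\<forall>\<^sub>F n in sequentially. 0 \<le> ln (\<integral>\<omega>. exp (t n * LP.Q (($) u) \<iota> {1..int n} \<omega>) \<partial>M) / (real n * (t n)\<^sup>2)"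
        using cgf(1)[of "($) u"]
      proof eventually_elim
        case (elim n)
        have "(\<integral>\<omega>. 1 + t n * LP.Q (($) u) \<iota> {1..int n} \<omega> \<partial>M) \<le> (\<integral>\<omega>. exp (t n * LP.Q (($) u) \<iota> {1..int n} \<omega>) \<partial>M)"
          by (rule integral_mono[OF _ elim exp_ge_add_one_self])
            (intro Bochner_Integration.integrable_add integrable_mult_right LP.Q_mean(1) P.integrable_const)
        moreover have "(\<integral>\<omega>. 1 + t n * LP.Q (($) u) \<iota> {1..int n} \<omega> \<partial>M) = 1"
          using LP.Q_mean(1)[of "($) u" \<iota>] LP.Q_mean(2)[of "($) u" \<iota>] by (subst Bochner_Integration.integral_add) (auto simp: P.prob_space)
        ultimately show ?case by simp
      qed
    qed simp
    then show "0 \<le> u \<bullet> (S *v u)" by simp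
  qed
  show ?thesis
    using LDP_gaussian_rate unfolding S_def \<kappa> Z_def[abs_def] .
qed

end
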